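(* Let $n\ge2$, and let $\sigma$ be a triangulation of $\Sigma_n$, the $(n+1)$-gon with one orbifold point of order three. For every arc $i$ on $\Sigma_n$ write $M(i)=M(i,\sigma)$ for the arc representation of $\Lambda(\sigma)$. Then for every triangulation $\tau=\{t_1,\dots,t_n\}$ of $\Sigma_n$ and every arc $j=t_k\in\tau$, if $j'$ is the arc that replaces $j$ when $j$ is flipped in $\tau$, the product of Caldero-Chapoton functions $\mathcal C_{\Lambda(\sigma)}(M(j))\,\mathcal C_{\Lambda(\sigma)}(M(j'))$ equals the Chekhov-Shapiro exchange polynomial $$\sum_{l=0}^{d_k}(v_k^+)^l(v_k^-)^{d_k-l},\qquad v_k^{+}=\prod_{b_{lk}>0}x_l^{b_{lk}/d_k},\quad v_k^-=\prod_{b_{lk}<0}x_l^{-b_{lk}/d_k},$$ evaluated at $x_l=\mathcal C_{\Lambda(\sigma)}(M(t_l))$, where $B(\tau)=(b_{ij})$ is the adjacency matrix of $\tau$ and $d_k=2$ if $t_k$ is pending, $d_k=1$ otherwise.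
   Context: Surface. $\Sigma_n$ is a closed disk with $n+1$ marked points $v_0,\dots,v_n$ on its boundary (in counterclockwise order), no punctures, and one orbifold point of order 3 in its interior. An arc on $\Sigma_n$ is a curve with endpoints at marked points, with no self-intersections except that its endpoints may coincide, which otherwise avoids the marked points and the orbifold point, is not isotopic to a boundary segment, and such that, if it cuts out a monogon, this monogon contains the orbifold point (the arc is then called pending). Arcs are considered up to isotopy relative to marked points and orbifold point, and up to orientation. Two arcs are compatible if they have representatives which do not intersect outside the marked points. A triangulation $\tau$ is a maximal collection of pairwise compatible arcs; it has $n$ arcs, exactly one of them pending. The flip of $j\in\tau$ is the unique arc $j'\neq j$ such that $(\tau\setminus\{j\})\cup\{j'\}$ is a triangulation. Cutting along $\tau$ yields the monogon enclosed by the pending arc and a number of three-sided triangles (each side is an arc of $\tau$ or a boundary segment); a triangle is internal if its three sides are arcs of $\tau$. Algebra. The quiver $Q(\tau)$ has the arcs of $\tau$ as vertices; for each three-sided triangle and each two of its sides $i,j\in\tau$ there is an arrow $j\to i$ if $i$ follows $j$ in the clockwise order in that triangle; finally there is a loop $\varepsilon$ at the pending arc. Each internal triangle $\Delta$ gives a 3-cycle $c_\Delta b_\Delta a_\Delta$. Let $S(\tau)=\sum_\Delta c_\Delta b_\Delta a_\Delta+\varepsilon^3$ and let $\Lambda(\tau)$ be the Jacobian algebra of $(Q(\tau),S(\tau))$, i.e. the completed complex path algebra of $Q(\tau)$ modulo the closed ideal generated by the cyclic derivatives of $S(\tau)$ (namely by $b_\Delta a_\Delta, c_\Delta b_\Delta,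 a_\Delta c_\Delta$ and $\varepsilon^2$). Let $c_{ij}=\#\{a:j\to i\}-\#\{a:i\to j\}$ for $Q(\tau)$; $C_{Q(\tau)}=(c_{ij})$, and $B(\tau)=(b_{ij})$ with $b_{ij}=d_jc_{ij}/\gcd(d_i,d_j)$. Caldero-Chapoton functions. A decorated representation of $\Lambda=\Lambda(\sigma)$ is $\mathcal M=(M,V)$ with $M$ a finite-dimensional representation of $\Lambda$ (maps $M_a:M_{t(a)}\to M_{h(a)}$ for arrows $a:t(a)\to h(a)$) and $V=(V_1,\dots,V_n)$ a tuple of finite-dimensional vector spaces. Put $g_i(\mathcal M)=-\dim\mathrm{Hom}_\Lambda(S_i,M)+\dim\mathrm{Ext}^1_\Lambda(S_i,M)+\dim V_i$ ($S_i$ simple at $i$), and $\mathcal C_\Lambda(\mathcal M)=\mathbf x^{g_\Lambda(\mathcal M)}\sum_{\mathbf e\in\mathbb N^n}\chi(\mathrm{Gr}_{\mathbf e}(M))\mathbf x^{C_Q\mathbf e}\in\mathbb Z[x_1^{\pm1},\dots,x_n^{\pm1}]$, $Q=Q(\sigma)$, with $\mathrm{Gr}_{\mathbf e}(M)$ the Grassmannian of subrepresentations of dimension vector $\mathbf e$ and $\chi$ the Euler characteristic. The negative simple is $\mathcal S_i^-=(0,S_i)$; thus $\mathcal C_\Lambda(\mathcal S_i^-)=x_i$. Arc representations. Let $\widetilde\Sigma_n$ be the regular $(3n+3)$-gon and $G=\mathbb Z_3$ generated by its rotation by $120^\circ$; $\Sigma_n$ is the orbit space $\widetilde\Sigma_n/G$,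 the orbifold point being the image of the center. Let $T$ be the $G$-invariant triangulation of $\widetilde\Sigma_n$ lifting $\sigma$, and $Q(T)$ its quiver (vertices the diagonals in $T$, arrows by the same clockwise rule, no loops); then $Q(\sigma)=Q(T)/G$, the loop $\varepsilon$ being the orbit of the arrows in the $G$-invariant triangle. For an arc $j\notin\sigma$, pick a lift $\alpha$ (a diagonal of $\widetilde\Sigma_n$), orient it, and let $s_0,\dots,s_r$ be the diagonals of $T$ crossed by $\alpha$, in order. For $1\le k\le r$ let $\gamma_k$ be the arrow of $Q(T)$ between $s_{k-1}$ and $s_k$ in the triangle of $T$ containing both; put $l_k=G\gamma_k$ if $\gamma_k:s_{k-1}\to s_k$ and $l_k=(G\gamma_k)^{-1}$ otherwise. Then $W_j=l_r\cdots l_1$ (trivial string at $Gs_0$ if $r=0$), and $M(j,\sigma)$ is the string module $N(W_j)$: it has basis $z_0,\dots,z_r$ with $z_k$ at vertex $Gs_k$; if $l_k=a$ is an arrow then $a z_{k-1}=z_k$, if $l_k=a^{-1}$ then $a z_k=z_{k-1}$, and all other actions of arrows on basis vectors are zero. For $j\in\sigma$, $M(j,\sigma)=\mathcal S_j^-$. *)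

theory Defs
  imports "HOL-Analysis.Analysis" "HOL-Homology.Homology"
    "HOL-Library.Poly_Mapping" "HOL-Library.Function_Algebras"
begin

section \<open>Euler characteristic\<close>

definition int_independent :: "('g, 'm) monoid_scheme \<Rightarrow> 'g set \<Rightarrow> bool" where
  "int_independent G S \<longleftrightarrow> finite S \<and> S \<subseteq> carrier G \<and>
     (\<forall>c :: 'g \<Rightarrow> int. finprod G (\<lambda>x. x [^]\<^bsub>G\<^esub> c x) S = \<one>\<^bsub>G\<^esub> \<longrightarrow> (\<forall>x\<in>S. c x = 0))"

definition group_rank :: "('g, 'm) monoid_scheme \<Rightarrow> nat" where
  "group_rank G = Max {card S | S. int_independent G S}"

text \<open>Meaningful for spaces whose total homology has finite rank (all Grassmannians below).\<close>
definition euler_char :: "'a topology \<Rightarrow> int" where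
  "euler_char X =
     (\<Sum>p | group_rank (homology_group (int p) X) \<noteq> 0.
        (- 1) ^ p * int (group_rank (homology_group (int p) X)))"

section \<open>Coordinate vector spaces over the complex numbers\<close>

definition cscale :: "complex \<Rightarrow> ('x \<Rightarrow> complex) \<Rightarrow> 'x \<Rightarrow> complex" where
  "cscale c f = (\<lambda>x. c * f x)"

lemma vector_space_cscale: "vector_space cscale"
  by unfold_locales
    (simp_all add: cscale_def plus_fun_def distrib_left distrib_right mult.assoc)

abbreviation csubspace :: "('x \<Rightarrow> complex) set \<Rightarrow> bool" where
  "csubspace \<equiv> module.subspace cscale"

abbreviation cspan :: "('x \<Rightarrow> complex) set \<Rightarrow> ('x \<Rightarrow> complex) set" where
  "cspan \<equiv> module.span cscale"

abbreviation cdim :: "('x \<Rightarrow> complex) set \<Rightarrow> nat" where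
  "cdim \<equiv> vector_space.dim cscale"

section \<open>Quivers with potential and their representations\<close>

text \<open>
  Paths are lists of arrows in the order in which they are traversed, so the composition
  \<open>c b a\<close> (first \<open>a\<close>) is the list \<open>[a, b, c]\<close>.
  The potential is the sum, with all coefficients 1, of a finite set of cyclic paths.
\<close>
record ('v, 'a) qp =
  verts :: "'v set"
  arrs :: "'a set"
  src :: "'a \<Rightarrow> 'v"
  tgt :: "'a \<Rightarrow> 'v"
  pot :: "'a list set"

text \<open>
  A finite-dimensional representation, given in a basis \<open>z\<^sub>0, \<dots>, z\<^sub>d\<^sub>-\<^sub>1\<close> (\<open>d = rdim M\<close>) adapted to the
  vertices: \<open>z\<^sub>k\<close> lies at the vertex \<open>vtx M k\<close>, and \<open>ent M a i k\<close> is the coefficient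
  of \<open>z\<^sub>i\<close> in \<open>a z\<^sub>k\<close>. The space of \<open>M\<close> at \<open>v\<close> is \<open>rspace M v\<close>.
\<close>
record ('v, 'a) rep =
  rdim :: nat
  vtx :: "nat \<Rightarrow> 'v"
  ent :: "'a \<Rightarrow> nat \<Rightarrow> nat \<Rightarrow> complex"

definition rspace :: "('v, 'a) rep \<Rightarrow> 'v \<Rightarrow> (nat \<Rightarrow> complex) set" where
  "rspace M v = {x. \<forall>k. x k \<noteq> 0 \<longrightarrow> k < rdim M \<and> vtx M k = v}"

definition act :: "('v, 'a) rep \<Rightarrow> 'a \<Rightarrow> (nat \<Rightarrow> complex) \<Rightarrow> nat \<Rightarrow> complex" where
  "act M a x = (\<lambda>i. \<Sum>k<rdim M. ent M a i k * x k)"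

definition dimv :: "('v, 'a) rep \<Rightarrow> 'v \<Rightarrow> nat" where
  "dimv M v = card {k. k < rdim M \<and> vtx M k = v}"

fun path_ent :: "('v, 'a) rep \<Rightarrow> 'a list \<Rightarrow> nat \<Rightarrow> nat \<Rightarrow> complex" where
  "path_ent M [] i k = (if i = k then 1 else 0)"
| "path_ent M (a # w) i k = (\<Sum>m<rdim M. path_ent M w i m * ent M a m k)"

text \<open>
  The cyclic derivative with respect to \<open>a\<close> is the sum, over all occurrences of \<open>a\<close> in the
  words of the potential, of the path that starts behind this occurrence and goes once around.
\<close>
definition cyclic_deriv_ent ::
    "('v, 'a) qp \<Rightarrow> ('v, 'a) rep \<Rightarrow> 'a \<Rightarrow> nat \<Rightarrow> nat \<Rightarrow> complex" where
  "cyclic_deriv_ent Q M a i k =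
     (\<Sum>(w, m) \<in> {(w, m). w \<in> pot Q \<and> m < length w \<and> w ! m = a}.
        path_ent M (drop (Suc m) w @ take m w) i k)"

text \<open>
  Representations of the Jacobian algebra of \<open>Q\<close>. Nilpotency is what makes a finite-dimensional
  representation of the quiver a module over the completed path algebra.
\<close>
definition is_rep :: "('v, 'a) qp \<Rightarrow> ('v, 'a) rep \<Rightarrow> bool" where
  "is_rep Q M \<longleftrightarrow>
     (\<forall>k < rdim M. vtx M k \<in> verts Q) \<and>
     (\<forall>a \<in> arrs Q. \<forall>i k. ent M a i k \<noteq> 0 \<longrightarrow>
        i < rdim M \<and> k < rdim M \<and> vtx M k = src Q a \<and> vtx M i = tgt Q a) \<and>
     (\<exists>L. \<forall>w. set w \<subseteq> arrs Q \<and> length w \<ge> L \<longrightarrow>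
        (\<forall>i < rdim M. \<forall>k < rdim M. path_ent M w i k = 0)) \<and>
     (\<forall>a \<in> arrs Q. \<forall>i < rdim M. \<forall>k < rdim M. cyclic_deriv_ent Q M a i k = 0)"

definition simple_rep :: "'v \<Rightarrow> ('v, 'a) rep" where
  "simple_rep v = \<lparr>rdim = 1, vtx = (\<lambda>_. v), ent = (\<lambda>_ _ _. 0)\<rparr>"

definition zero_rep :: "('v, 'a) rep" where
  "zero_rep = \<lparr>rdim = 0, vtx = (\<lambda>_. undefined), ent = (\<lambda>_ _ _. 0)\<rparr>"

subsection \<open>Homomorphisms and extensions\<close>

text \<open>Families of linear maps \<open>N\<^sub>v \<rightarrow> M\<^sub>v\<close>, as matrices.\<close>
definition graded_maps :: "('v, 'a) rep \<Rightarrow> ('v, 'a) rep \<Rightarrow> (nat \<times> nat \<Rightarrow> complex) set" where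
  "graded_maps N M =
     {h. \<forall>i k. h (i, k) \<noteq> 0 \<longrightarrow> i < rdim M \<and> k < rdim N \<and> vtx M i = vtx N k}"

text \<open>The map sending \<open>h\<close> to the family of defects \<open>M\<^sub>a h - h N\<^sub>a\<close>.\<close>
definition defect :: "('v, 'a) qp \<Rightarrow> ('v, 'a) rep \<Rightarrow> ('v, 'a) rep \<Rightarrow>
    (nat \<times> nat \<Rightarrow> complex) \<Rightarrow> 'a \<times> nat \<times> nat \<Rightarrow> complex" where
  "defect Q N M h = (\<lambda>(a, i, k). if a \<in> arrs Q
     then (\<Sum>m<rdim M. ent M a i m * h (m, k)) - (\<Sum>m<rdim N. h (i, m) * ent N a m k)
     else 0)"

definition hom_space :: "('v, 'a) qp \<Rightarrow> ('v, 'a) rep \<Rightarrow> ('v, 'a) rep \<Rightarrow>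
    (nat \<times> nat \<Rightarrow> complex) set" where
  "hom_space Q N M = {h \<in> graded_maps N M. defect Q N M h = 0}"

text \<open>
  \<open>Ext\<^sup>1\<close> is the space of equivalence classes of extensions \<open>0 \<rightarrow> M \<rightarrow> E \<rightarrow> N \<rightarrow> 0\<close> of modules over the
  Jacobian algebra. As a family of vector spaces \<open>E = M \<oplus> N\<close>, so that \<open>E\<close> is given by the family \<open>f\<close>
  of off-diagonal blocks \<open>f\<^sub>a : N\<^sub>s\<^sub>(\<^sub>a\<^sub>) \<rightarrow> M\<^sub>t\<^sub>(\<^sub>a\<^sub>)\<close>, and two extensions are equivalent
  iff their blocks differ by a defect (conjugation by a unitriangular block matrix).
\<close>
definition ext_rep :: "('v, 'a) rep \<Rightarrow> ('v, 'a) rep \<Rightarrow> ('a \<times> nat \<times> nat \<Rightarrow> complex) \<Rightarrow>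
    ('v, 'a) rep" where
  "ext_rep N M f =
     \<lparr>rdim = rdim M + rdim N,
      vtx = (\<lambda>k. if k < rdim M then vtx M k else vtx N (k - rdim M)),
      ent = (\<lambda>a i k.
        if k < rdim M then (if i < rdim M then ent M a i k else 0)
        else if i < rdim M then f (a, i, k - rdim M)
        else ent N a (i - rdim M) (k - rdim M))\<rparr>"

definition ext_blocks :: "('v, 'a) qp \<Rightarrow> ('v, 'a) rep \<Rightarrow> ('v, 'a) rep \<Rightarrow>
    ('a \<times> nat \<times> nat \<Rightarrow> complex) set" where
  "ext_blocks Q N M =
     {f. (\<forall>a i k. f (a, i, k) \<noteq> 0 \<longrightarrow> a \<in> arrs Q \<and> i < rdim M \<and> k < rdim N) \<and>
         is_rep Q (ext_rep N M f)}"

definition hom_dim :: "('v, 'a) qp \<Rightarrow> ('v, 'a) rep \<Rightarrow> ('v, 'a) rep \<Rightarrow> int" where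
  "hom_dim Q N M = int (cdim (hom_space Q N M))"

definition ext1_dim :: "('v, 'a) qp \<Rightarrow> ('v, 'a) rep \<Rightarrow> ('v, 'a) rep \<Rightarrow> int" where
  "ext1_dim Q N M =
     int (cdim (ext_blocks Q N M)) - int (cdim (defect Q N M ` graded_maps N M))"

subsection \<open>Quiver Grassmannians\<close>

definition Gr :: "('v, 'a) qp \<Rightarrow> ('v, 'a) rep \<Rightarrow> ('v \<Rightarrow> nat) \<Rightarrow>
    ('v \<Rightarrow> (nat \<Rightarrow> complex) set) set" where
  "Gr Q M e = {N \<in> extensional (verts Q).
     (\<forall>v \<in> verts Q. csubspace (N v) \<and> N v \<subseteq> rspace M v \<and> cdim (N v) = e v) \<and>
     (\<forall>a \<in> arrs Q. \<forall>x \<in> N (src Q a). act M a x \<in> N (tgt Q a))}"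

definition frame_span :: "('v, 'a) qp \<Rightarrow> ('v \<Rightarrow> nat) \<Rightarrow> ('v \<Rightarrow> nat \<Rightarrow> nat \<Rightarrow> complex) \<Rightarrow>
    'v \<Rightarrow> (nat \<Rightarrow> complex) set" where
  "frame_span Q e b = (\<lambda>v \<in> verts Q. cspan (b v ` {..<e v}))"

definition frames :: "('v, 'a) qp \<Rightarrow> ('v, 'a) rep \<Rightarrow> ('v \<Rightarrow> nat) \<Rightarrow>
    ('v \<Rightarrow> nat \<Rightarrow> nat \<Rightarrow> complex) set" where
  "frames Q M e = {b. frame_span Q e b \<in> Gr Q M e}"

text \<open>
  The classical topology of the Grassmannian, as the quotient of the space of frames; the latter
  carries the topology of coordinatewise convergence.
\<close>
definition Gr_topology :: "('v, 'a) qp \<Rightarrow> ('v, 'a) rep \<Rightarrow> ('v \<Rightarrow> nat) \<Rightarrow>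
    ('v \<Rightarrow> (nat \<Rightarrow> complex) set) topology" where
  "Gr_topology Q M e = topology (\<lambda>U. U \<subseteq> Gr Q M e \<and>
     openin (top_of_set (frames Q M e)) {b \<in> frames Q M e. frame_span Q e b \<in> U})"

lemma openin_Gr_topology:
  "openin (Gr_topology Q M e) U \<longleftrightarrow> U \<subseteq> Gr Q M e \<and>
     openin (top_of_set (frames Q M e)) {b \<in> frames Q M e. frame_span Q e b \<in> U}"
proof -
  have Int: "{b \<in> F. p b \<in> S \<inter> T} = {b \<in> F. p b \<in> S} \<inter> {b \<in> F. p b \<in> T}"
    and Union: "{b \<in> F. p b \<in> \<Union>K} = \<Union>((\<lambda>S. {b \<in> F. p b \<in> S}) ` K)"
    for F :: "('a \<Rightarrow> nat \<Rightarrow> nat \<Rightarrow> complex) set" and S T K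
      and p :: "_ \<Rightarrow> 'a \<Rightarrow> (nat \<Rightarrow> complex) set"
    by blast+
  have "istopology (\<lambda>U. U \<subseteq> G \<and> openin (top_of_set F) {b \<in> F. p b \<in> U})"
    for F :: "('a \<Rightarrow> nat \<Rightarrow> nat \<Rightarrow> complex) set" and G
      and p :: "_ \<Rightarrow> 'a \<Rightarrow> (nat \<Rightarrow> complex) set"
    unfolding istopology_def Int Union
    by (intro conjI allI impI openin_Int openin_Union) blast+
  then show ?thesis
    unfolding Gr_topology_def by (rule topology_inverse'[THEN fun_cong])
qed

subsection \<open>Caldero-Chapoton functions\<close>

text \<open>
  A decorated representation \<open>(M, V)\<close>; of the vector spaces \<open>V\<^sub>v\<close> only the dimensions are recorded.
\<close>
type_synonym ('v, 'a) drep = "('v, 'a) rep \<times> ('v \<Rightarrow> nat)"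

definition neg_simple :: "'v \<Rightarrow> ('v, 'a) drep" where
  "neg_simple v = (zero_rep, \<lambda>u. if u = v then 1 else 0)"

definition g_vec :: "('v, 'a) qp \<Rightarrow> ('v, 'a) drep \<Rightarrow> 'v \<Rightarrow> int" where
  "g_vec Q \<M> i = - hom_dim Q (simple_rep i) (fst \<M>) + ext1_dim Q (simple_rep i) (fst \<M>)
     + int (snd \<M> i)"

definition c_mat :: "('v, 'a) qp \<Rightarrow> 'v \<Rightarrow> 'v \<Rightarrow> int" where
  "c_mat Q i j = int (card {a \<in> arrs Q. src Q a = j \<and> tgt Q a = i})
     - int (card {a \<in> arrs Q. src Q a = i \<and> tgt Q a = j})"

text \<open>
  Integral Laurent polynomials in variables indexed by \<open>'v\<close>: the group ring over the integers of
  the free abelian group \<open>'v \<Rightarrow>\<^sub>0 int\<close> of exponent vectors.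
\<close>
type_synonym 'v laurent = "('v \<Rightarrow>\<^sub>0 int) \<Rightarrow>\<^sub>0 int"

definition lmonom :: "'v set \<Rightarrow> ('v \<Rightarrow> int) \<Rightarrow> 'v laurent" where
  "lmonom I u = Poly_Mapping.single (\<Sum>i\<in>I. Poly_Mapping.single i (u i)) 1"

text \<open>
  The sum runs over \<open>e \<le> dimv M\<close>; for all other dimension vectors the Grassmannian is empty.
\<close>
definition CC :: "('v, 'a) qp \<Rightarrow> ('v, 'a) drep \<Rightarrow> 'v laurent" where
  "CC Q \<M> = lmonom (verts Q) (g_vec Q \<M>) *
     (\<Sum>e \<in> (\<Pi>\<^sub>E v \<in> verts Q. {0..dimv (fst \<M>) v}).
        of_int (euler_char (Gr_topology Q (fst \<M>) e)) *
        lmonom (verts Q) (\<lambda>i. \<Sum>j \<in> verts Q. c_mat Q i j * int (e j)))"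

subsection \<open>String modules\<close>

datatype 'a letter = Direct 'a | Inverse 'a

text \<open>
  The string module with basis \<open>z\<^sub>0, \<dots>, z\<^sub>r\<close> at the vertices \<open>vs\<close>; the letter \<open>ls ! k\<close> connects
  \<open>z\<^sub>k\<close> and \<open>z\<^sub>k\<^sub>+\<^sub>1\<close>.
\<close>
definition string_rep :: "'v list \<Rightarrow> 'a letter list \<Rightarrow> ('v, 'a) rep" where
  "string_rep vs ls =
     \<lparr>rdim = length vs, vtx = (\<lambda>k. vs ! k),
      ent = (\<lambda>a i k.
        if (i = Suc k \<and> i < length vs \<and> ls ! k = Direct a) \<or>
           (k = Suc i \<and> k < length vs \<and> ls ! i = Inverse a) then 1 else 0)\<rparr>"

section \<open>The polygon with one orbifold point of order three\<close>

text \<open>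
  The surface \<open>\<Sigma>\<^sub>n\<close> is the orbit space of the regular \<open>(3n+3)\<close>-gon, with vertices
  \<open>0, \<dots>, 3n+2\<close> in counterclockwise order, under the rotations by multiples of \<open>n + 1\<close> steps.
  The marked points of \<open>\<Sigma>\<^sub>n\<close> are the residues of the vertices modulo \<open>n + 1\<close>.
\<close>

definition rot :: "nat \<Rightarrow> nat \<Rightarrow> nat \<Rightarrow> nat" where
  "rot n k x = (x + k * (n + 1)) mod (3 * n + 3)"

definition sides :: "nat \<Rightarrow> nat set set" where
  "sides n = {{a, (a + 1) mod (3 * n + 3)} | a. a < 3 * n + 3}"

definition diagonals :: "nat \<Rightarrow> nat set set" where
  "diagonals n = {d. d \<subseteq> {..<3 * n + 3} \<and> card d = 2} - sides n"

definition crosses :: "nat set \<Rightarrow> nat set \<Rightarrow> bool" where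
  "crosses d d' \<longleftrightarrow> (\<exists>a b c e. a < b \<and> b < c \<and> c < e \<and>
     (d = {a, c} \<and> d' = {b, e} \<or> d = {b, e} \<and> d' = {a, c}))"

definition orbit :: "nat \<Rightarrow> nat set \<Rightarrow> nat set set" where
  "orbit n d = {rot n k ` d | k. k < 3}"

text \<open>
  Every isotopy class of arcs on \<open>\<Sigma>\<^sub>n\<close> contains exactly one image of a diagonal, and the isotopy
  class is represented by the full preimage of that image, i.e. by an orbit of diagonals.
  The image of a diagonal is free of self-intersections (and avoids the orbifold point) iff no two
  diagonals in its orbit cross; it has coinciding endpoints iff those of the diagonal are
  congruent modulo \<open>n + 1\<close>, and it then encloses the image of the center.
\<close>
type_synonym arc = "nat set set"

definition arcs :: "nat \<Rightarrow> arc set" where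
  "arcs n = {orbit n d | d. d \<in> diagonals n \<and>
     (\<forall>s \<in> orbit n d. \<forall>t \<in> orbit n d. \<not> crosses s t)}"

definition pending :: "nat \<Rightarrow> arc \<Rightarrow> bool" where
  "pending n i \<longleftrightarrow> (\<forall>d \<in> i. \<forall>x \<in> d. \<forall>y \<in> d. x mod (n + 1) = y mod (n + 1))"

definition compatible :: "arc \<Rightarrow> arc \<Rightarrow> bool" where
  "compatible i j \<longleftrightarrow> (\<forall>s \<in> i. \<forall>t \<in> j. \<not> crosses s t)"

definition is_triangulation :: "nat \<Rightarrow> arc set \<Rightarrow> bool" where
  "is_triangulation n \<tau> \<longleftrightarrow> \<tau> \<subseteq> arcs n \<and> (\<forall>i \<in> \<tau>. \<forall>j \<in> \<tau>. compatible i j) \<and>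
     (\<forall>i \<in> arcs n. (\<forall>j \<in> \<tau>. compatible i j) \<longrightarrow> i \<in> \<tau>)"

definition flip :: "nat \<Rightarrow> arc set \<Rightarrow> arc \<Rightarrow> arc" where
  "flip n \<tau> j = (THE j'. j' \<noteq> j \<and> is_triangulation n ((\<tau> - {j}) \<union> {j'}))"

subsection \<open>The quiver with potential of a triangulation\<close>

text \<open>
  \<open>\<Union>\<tau>\<close> is the set of diagonals in the lift \<open>T\<close> of \<open>\<tau>\<close>. Since \<open>T\<close> triangulates a convex polygon,
  three vertices that are pairwise joined by sides or diagonals in \<open>T\<close> span a triangle of \<open>T\<close>.
\<close>
definition ccw_triangle :: "nat \<Rightarrow> arc set \<Rightarrow> nat \<Rightarrow> nat \<Rightarrow> nat \<Rightarrow> bool" where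
  "ccw_triangle n \<tau> a b c \<longleftrightarrow>
     (a < b \<and> b < c \<or> b < c \<and> c < a \<or> c < a \<and> a < b) \<and>
     {{a, b}, {b, c}, {c, a}} \<subseteq> \<Union>\<tau> \<union> sides n"

text \<open>
  The arrows of \<open>Q(T)\<close>. In the clockwise order of the sides of a triangle with counterclockwise
  vertices \<open>a\<close>, \<open>b\<close>, \<open>c\<close>, the side \<open>{a, b}\<close> follows \<open>{b, c}\<close>.
\<close>
definition lifted_arrows :: "nat \<Rightarrow> arc set \<Rightarrow> (nat set \<times> nat set) set" where
  "lifted_arrows n \<tau> = {({b, c}, {a, b}) | a b c.
     ccw_triangle n \<tau> a b c \<and> {b, c} \<in> \<Union>\<tau> \<and> {a, b} \<in> \<Union>\<tau>}"

type_synonym arrow = "(nat set \<times> nat set) set"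

definition arrow_orbit :: "nat \<Rightarrow> nat set \<Rightarrow> nat set \<Rightarrow> arrow" where
  "arrow_orbit n d d' = {(rot n k ` d, rot n k ` d') | k. k < 3}"

text \<open>
  The arrows of \<open>Q(\<tau>)\<close> are the orbits of the arrows of \<open>Q(T)\<close>: the three-sided triangles of \<open>\<tau>\<close> are
  the orbits of the triangles of \<open>T\<close> other than the central one, and the three arrows in the
  central triangle form one orbit, the loop \<open>\<epsilon>\<close> at the pending arc. The first (second) components
  of the pairs in an arrow form the orbit of diagonals which is its source (target).
\<close>
definition quiver_arrows :: "nat \<Rightarrow> arc set \<Rightarrow> arrow set" where
  "quiver_arrows n \<tau> = {arrow_orbit n d d' | d d'. (d, d') \<in> lifted_arrows n \<tau>}"

definition triangle_cycles :: "nat \<Rightarrow> arc set \<Rightarrow> arrow list set" where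
  "triangle_cycles n \<tau> =
     {[arrow_orbit n {b, c} {a, b}, arrow_orbit n {a, b} {c, a}, arrow_orbit n {c, a} {b, c}]
      | a b c. ccw_triangle n \<tau> a b c \<and> {{a, b}, {b, c}, {c, a}} \<subseteq> \<Union>\<tau> \<and>
          rot n 1 ` {a, b, c} \<noteq> {a, b, c}}"

text \<open>
  An internal triangle gives its 3-cycle only up to rotation; the potential contains one
  (arbitrary) rotation for each internal triangle, which does not affect cyclic derivatives.
\<close>
definition potential :: "nat \<Rightarrow> arc set \<Rightarrow> arrow list set" where
  "potential n \<tau> =
     (\<lambda>C. SOME w. w \<in> C) ` ((\<lambda>w. {rotate k w | k. True}) ` triangle_cycles n \<tau>) \<union>
     {[\<epsilon>, \<epsilon>, \<epsilon>] | \<epsilon>. \<epsilon> \<in> quiver_arrows n \<tau> \<and> fst ` \<epsilon> = snd ` \<epsilon>}"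

definition surface_qp :: "nat \<Rightarrow> arc set \<Rightarrow> (arc, arrow) qp" where
  "surface_qp n \<tau> =
     \<lparr>verts = \<tau>, arrs = quiver_arrows n \<tau>, src = (\<lambda>a. fst ` a), tgt = (\<lambda>a. snd ` a),
      pot = potential n \<tau>\<rparr>"

subsection \<open>Arc representations\<close>

definition offset :: "nat \<Rightarrow> nat \<Rightarrow> nat \<Rightarrow> nat" where
  "offset n u x = (x + (3 * n + 3) - u) mod (3 * n + 3)"

text \<open>For noncrossing \<open>s\<close> and \<open>s'\<close>: \<open>s'\<close> lies on the side of \<open>s\<close> that does not contain \<open>u\<close>.\<close>
definition beyond :: "nat \<Rightarrow> nat \<Rightarrow> nat set \<Rightarrow> nat set \<Rightarrow> bool" where
  "beyond n u s s' \<longleftrightarrow> offset n u ` s' \<subseteq> {Min (offset n u ` s)..Max (offset n u ` s)}"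

text \<open>
  The diagonals in the lift of \<open>\<sigma>\<close> that are crossed by the diagonal from \<open>u\<close> to \<open>w\<close>, in order.
\<close>
definition crossed :: "nat \<Rightarrow> arc set \<Rightarrow> nat \<Rightarrow> nat \<Rightarrow> nat set list" where
  "crossed n \<sigma> u w = (THE ss. distinct ss \<and> set ss = {s \<in> \<Union>\<sigma>. crosses s {u, w}} \<and>
     sorted_wrt (beyond n u) ss)"

definition arc_letter :: "nat \<Rightarrow> arc set \<Rightarrow> nat set \<Rightarrow> nat set \<Rightarrow> arrow letter" where
  "arc_letter n \<sigma> s s' = (if (s, s') \<in> lifted_arrows n \<sigma>
     then Direct (arrow_orbit n s s') else Inverse (arrow_orbit n s' s))"

text \<open>
  \<open>\<alpha> j = (u, w)\<close> is the chosen lift of \<open>j\<close>, as a diagonal oriented from \<open>u\<close> to \<open>w\<close>.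
\<close>
definition arc_rep :: "nat \<Rightarrow> arc set \<Rightarrow> (arc \<Rightarrow> nat \<times> nat) \<Rightarrow> arc \<Rightarrow> (arc, arrow) drep" where
  "arc_rep n \<sigma> \<alpha> j =
     (if j \<in> \<sigma> then neg_simple j
      else (let ss = crossed n \<sigma> (fst (\<alpha> j)) (snd (\<alpha> j))
            in (string_rep (map (orbit n) ss) (map2 (arc_letter n \<sigma>) ss (tl ss)), \<lambda>_. 0)))"

subsection \<open>Exchange polynomials\<close>

definition weight :: "nat \<Rightarrow> arc \<Rightarrow> nat" where
  "weight n i = (if pending n i then 2 else 1)"

definition b_mat :: "nat \<Rightarrow> arc set \<Rightarrow> arc \<Rightarrow> arc \<Rightarrow> int" where
  "b_mat n \<tau> i j = int (weight n j) * c_mat (surface_qp n \<tau>) i j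
     div gcd (int (weight n i)) (int (weight n j))"

definition v_plus :: "nat \<Rightarrow> arc set \<Rightarrow> (arc \<Rightarrow> 'r::comm_ring_1) \<Rightarrow> arc \<Rightarrow> 'r" where
  "v_plus n \<tau> x k = (\<Prod>l | l \<in> \<tau> \<and> b_mat n \<tau> l k > 0.
     x l ^ nat (b_mat n \<tau> l k div int (weight n k)))"

definition v_minus :: "nat \<Rightarrow> arc set \<Rightarrow> (arc \<Rightarrow> 'r::comm_ring_1) \<Rightarrow> arc \<Rightarrow> 'r" where
  "v_minus n \<tau> x k = (\<Prod>l | l \<in> \<tau> \<and> b_mat n \<tau> l k < 0.
     x l ^ nat (- b_mat n \<tau> l k div int (weight n k)))"

definition exchange_poly :: "nat \<Rightarrow> arc set \<Rightarrow> (arc \<Rightarrow> 'r::comm_ring_1) \<Rightarrow> arc \<Rightarrow> 'r" where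
  "exchange_poly n \<tau> x k =
     (\<Sum>l = 0..weight n k. v_plus n \<tau> x k ^ l * v_minus n \<tau> x k ^ (weight n k - l))"

end

theory Submission
  imports Defs
begin

text \<open>
  Arcs lift to pairs of integers modulo the shift by \<open>n + 1\<close>, and an arc module has dimension at most two
  at each vertex. Hence its quiver Grassmannians are spaces of tuples of points of the sphere cut out by
  equations that identify coordinates with each other or with a pole. Eliminating coordinates one at a
  time shows that the Euler characteristic of such a space is its number of solutions by poles, i.e. of
  coordinate subrepresentations. So the Caldero-Chapoton function of an arc is a sum over the closed
  subsets of its crossing sequence.

  On the other hand, there are vectors \<open>\<xi> x\<close>, one for each integer \<open>x\<close>, whose determinants are the variables
  at the edges of \<open>\<sigma>\<close>, and on which the shift acts by a matrix of determinant 1 and trace 1. By Pluecker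
  relations, \<open>det (\<xi> u, \<xi> w)\<close> has the same expansion over closed subsets. So the Caldero-Chapoton functions
  are values of this frieze, and the exchange relations are Pluecker relations, combined at a pending
  arc with the three-term recurrence \<open>\<xi> (x + 2m) = \<xi> (x + m) - \<xi> x\<close>, which gives \<open>a\<^sup>2 + a b + b\<^sup>2\<close>.
\<close>

section \<open>Ranks of abelian groups\<close>

text \<open>The two halves compute the same sum over closed subsets, one from subrepresentations and
  the other from determinants. The obstacle in the topological half is that a lift of an arc may
  cross two lifts of one arc of \<open>\<sigma>\<close>: the module then has planes, and not all
  subrepresentations are spanned by basis vectors. A projective line is realised as the unit sphere
  in \<open>complex \<times> real\<close> through the Hopf map, so that a line in a plane is a point
  and each arrow imposes one equation. A free point contributes a factor 2 to the Euler
  characteristic, and 2 is also the number of poles; this is why counting poles works. In the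
  algebraic half, trace 1 comes from order three: R^2 = R - 1 gives R^3 = -1, and this sign is what
  the antisymmetric determinant picks up when a chord (x, y) is rewritten as (y, x + 3m). Laurent
  polynomials admit no general division, so edge weights come with explicit inverses. The identities
  of the frieze do not refer to a triangulation. Hence a frieze built from \<open>\<sigma>\<close>
  yields the exchange relations in every \<open>\<tau>\<close>.\<close>

lemma int_linear_system:
  fixes d :: "'a => 'b => int"
  assumes "finite T" "finite S" "card T < card S"
  shows "\<exists>c. (\<exists>x\<in>S. c x ~= 0) \<and> (\<forall>t\<in>T. (\<Sum>x\<in>S. c x * d x t) = 0)"
  using assms
proof (induction T arbitrary: S d rule: finite_induct)
  case empty
  then obtain x where "x \<in> S" by fastforce
  thus ?case by (intro exI[of _ "\<lambda>_. 1"]) auto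
next
  case (insert t T)
  show ?case
  proof (cases "\<forall>x\<in>S. d x t = 0")
    case True
    from insert have "card T < card S" by simp
    with insert.IH[of S d] insert.prems obtain c where
      "\<exists>x\<in>S. c x ~= 0" "\<forall>t\<in>T. (\<Sum>x\<in>S. c x * d x t) = 0" by auto
    with True show ?thesis by (intro exI[of _ c]) auto
  next
    case False
    then obtain y where y: "y \<in> S" "d y t ~= 0" by auto
    define S' where "S' = S - {y}"
    have S': "finite S'" "S = insert y S'" "y \<notin> S'"
      using y insert.prems by (auto simp: S'_def)
    \<comment> \<open>Cross-multiplication eliminates the equation \<open>t\<close> without
      division. Below, \<open>c'\<close> is the back-substitution: the other coefficients are scaled
      by \<open>d y t\<close>, and that of \<open>y\<close> is chosen to satisfy
      \<open>t\<close>.\<close>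
    define d' where "d' x s = d y t * d x s - d x t * d y s" for x s
    have "card T < card S'" using insert S' by simp
    with insert.IH[of S' d'] S' obtain c where
      c: "\<exists>x\<in>S'. c x ~= 0" "\<And>s. s \<in> T ==> (\<Sum>x\<in>S'. c x * d' x s) = 0" by blast
    define c' where "c' x = (if x = y then - (\<Sum>x\<in>S'. c x * d x t) else d y t * c x)" for x
    have ne: "x ~= y" if "x \<in> S'" for x using that S' by auto
    have eq: "(\<Sum>x\<in>S. c' x * d x s) =
        (\<Sum>x\<in>S'. d y t * c x * d x s) - (\<Sum>x\<in>S'. c x * d x t) * d y s" for s
      using S' ne by (simp add: c'_def cong: sum.cong)
    also have "\<dots> s = (\<Sum>x\<in>S'. c x * d' x s)" for s
      by (simp add: d'_def sum_distrib_right sum_distrib_left algebra_simps sum_subtractf)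
    finally have eq: "(\<Sum>x\<in>S. c' x * d x s) = (\<Sum>x\<in>S'. c x * d' x s)" for s .
    have "(\<Sum>x\<in>S. c' x * d x s) = 0" if "s \<in> insert t T" for s
    proof (cases "s = t")
      case True
      thus ?thesis unfolding eq by (auto simp: d'_def intro: sum.neutral)
    qed (use that c eq in auto)
    moreover have "\<exists>x\<in>S. c' x ~= 0"
      using c(1) y ne S' by (auto simp: c'_def)
    ultimately show ?thesis by blast
  qed
qed

definition int_comb :: "('g, 'm) monoid_scheme => ('g => int) => 'g set => 'g" where
  "int_comb G c S = finprod G (\<lambda>x. x [^]\<^bsub>G\<^esub> c x) S"

lemma int_independent_alt:
  "int_independent G S \<longleftrightarrow> finite S \<and> S \<subseteq> carrier G \<and>
     (\<forall>c. int_comb G c S = \<one>\<^bsub>G\<^esub> --> (\<forall>x\<in>S. c x = 0))"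
  unfolding int_independent_def int_comb_def ..

context comm_group
begin

lemma int_comb_closed: "S \<subseteq> carrier G ==> int_comb G c S \<in> carrier G"
  unfolding int_comb_def by (rule finprod_closed) auto

lemma int_comb_cong:
  "S \<subseteq> carrier G ==> (\<And>x. x \<in> S ==> c x = d x) ==> int_comb G c S = int_comb G d S"
  unfolding int_comb_def by (intro finprod_cong') auto

lemma int_comb_add:
  assumes "S \<subseteq> carrier G"
  shows "int_comb G (\<lambda>x. c x + d x) S = int_comb G c S \<otimes> int_comb G d S"
proof -
  have "int_comb G (\<lambda>x. c x + d x) S = finprod G (\<lambda>x. x [^] c x \<otimes> x [^] d x) S"
    unfolding int_comb_def using assms by (intro finprod_cong') (auto simp: int_pow_mult)
  also have "\<dots> = int_comb G c S \<otimes> int_comb G d S"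
    unfolding int_comb_def using assms by (intro finprod_multf) auto
  finally show ?thesis .
qed

lemma int_comb_zero: "S \<subseteq> carrier G ==> int_comb G (\<lambda>x. 0) S = \<one>"
  unfolding int_comb_def by (simp add: finprod_one_eqI)

lemma int_comb_scale:
  assumes "S \<subseteq> carrier G"
  shows "int_comb G (\<lambda>x. k * c x) S = int_comb G c S [^] (k::int)"
proof (cases "finite S")
  case True
  thus ?thesis using assms
  proof (induction S rule: finite_induct)
    case empty
    thus ?case by (simp add: int_comb_def)
  next
    case (insert x S)
    have 1: "(\<lambda>x. x [^] c x) \<in> S \<rightarrow> carrier G" "(\<lambda>x. x [^] (k * c x)) \<in> S \<rightarrow> carrier G"
      using insert by auto
    hence "finprod G (\<lambda>x. x [^] c x) S \<in> carrier G" by simp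
    with insert 1 show ?case
      by (simp add: int_comb_def int_pow_distrib int_pow_pow mult.commute)
  qed
next
  case False
  thus ?thesis by (simp add: int_comb_def)
qed

lemma int_comb_sum:
  assumes "S \<subseteq> carrier G" "finite I"
  shows "finprod G (\<lambda>i. int_comb G (c i) S) I = int_comb G (\<lambda>x. \<Sum>i\<in>I. c i x) S"
  using assms(2)
proof (induction I rule: finite_induct)
  case empty
  thus ?case using assms by (simp add: int_comb_zero)
next
  case (insert i I)
  thus ?case using assms by (simp add: int_comb_add int_comb_closed Pi_def)
qed

lemma int_comb_insert:
  "finite S ==> x \<notin> S ==> insert x S \<subseteq> carrier G ==>
    int_comb G c (insert x S) = x [^] c x \<otimes> int_comb G c S"
  unfolding int_comb_def by (rule finprod_insert) auto

lemma int_comb_Un_disjoint: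
  "finite S ==> finite T ==> S \<inter> T = {} ==> S \<subseteq> carrier G ==> T \<subseteq> carrier G ==>
    int_comb G c (S \<union> T) = int_comb G c S \<otimes> int_comb G c T"
  unfolding int_comb_def by (rule finprod_Un_disjoint) auto

lemma int_comb_image:
  assumes "S \<subseteq> carrier G" "comm_group H" "f \<in> hom G H"
  shows "f (int_comb G c S) = finprod H (\<lambda>x. f x [^]\<^bsub>H\<^esub> c x) S"
proof -
  interpret H: comm_group H by fact
  have fc: "f x \<in> carrier H" if "x \<in> carrier G" for x
    using assms(3) that by (auto simp: hom_def)
  show ?thesis
  proof (cases "finite S")
    case True
    thus ?thesis using assms(1)
    proof (induction S rule: finite_induct)
      case empty
      thus ?case by (simp add: int_comb_def hom_one[OF assms(3)] )
    next
      case (insert x S)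
      have "f (x [^] c x) = f x [^]\<^bsub>H\<^esub> c x"
        using insert by (intro hom_int_pow assms) auto
      moreover have "f (x [^] c x \<otimes> int_comb G c S) = f (x [^] c x) \<otimes>\<^bsub>H\<^esub> f (int_comb G c S)"
        using insert by (intro hom_mult[OF assms(3)] int_comb_closed) auto
      moreover have "finprod H (\<lambda>x. f x [^]\<^bsub>H\<^esub> c x) (insert x S) =
          f x [^]\<^bsub>H\<^esub> c x \<otimes>\<^bsub>H\<^esub> finprod H (\<lambda>x. f x [^]\<^bsub>H\<^esub> c x) S"
        using insert fc by (intro H.finprod_insert) auto
      ultimately show ?case using insert by (simp add: int_comb_insert)
    qed
  next
    case False
    thus ?thesis by (simp add: int_comb_def hom_one[OF assms(3)])
  qed
qed

text \<open>This is the Steinitz bound over the rationals in integral form: passing to a nonzero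
  multiple of \<open>x\<close> clears denominators and absorbs torsion. If \<open>S\<close> were
  larger, the coefficient vectors would be dependent, and the dependence would give a relation in
  \<open>S\<close>.\<close>

lemma int_independent_card_le:
  assumes S: "int_independent G S" and T: "finite T" "T \<subseteq> carrier G"
    and span: "\<And>x. x \<in> S ==> \<exists>k d. k ~= 0 \<and> x [^] (k::int) = int_comb G d T"
  shows "card S <= card T"
proof (rule ccontr)
  assume "\<not> card S <= card T"
  moreover have finS: "finite S" and SC: "S \<subseteq> carrier G" using S by (auto simp: int_independent_def)
  obtain k d where kd: "\<And>x. x \<in> S ==> k x ~= 0 \<and> x [^] (k x::int) = int_comb G (d x) T"
    using span by metis
  ultimately obtain c where c: "\<exists>x\<in>S. c x ~= 0" "\<forall>t\<in>T. (\<Sum>x\<in>S. c x * d x t) = 0"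
    using int_linear_system[of T S d] T finS by auto
  have "int_comb G (\<lambda>x. k x * c x) S = finprod G (\<lambda>x. int_comb G (\<lambda>t. c x * d x t) T) S"
    unfolding int_comb_def[of G _ S]
  proof (rule finprod_cong')
    fix x assume x: "x \<in> S"
    hence "x [^] (k x * c x) = (x [^] k x) [^] c x"
      using SC by (simp add: int_pow_pow subset_iff)
    also have "\<dots> = int_comb G (\<lambda>t. c x * d x t) T"
      using kd x T by (simp add: int_comb_scale)
    finally show "x [^] (k x * c x) = int_comb G (\<lambda>t. c x * d x t) T" .
  qed (use T in \<open>auto simp: int_comb_closed\<close>)
  also have "\<dots> = int_comb G (\<lambda>t. \<Sum>x\<in>S. c x * d x t) T"
    using T finS by (simp add: int_comb_sum)
  also have "\<dots> = \<one>"
    using c(2) T by (subst int_comb_cong[where d = "\<lambda>_. 0"]) (auto simp: int_comb_zero)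
  finally have "\<forall>x\<in>S. k x * c x = 0"
    using S[unfolded int_independent_alt, THEN conjunct2, THEN conjunct2, rule_format, of "\<lambda>x. k x * c x"]
    by blast
  thus False using c(1) kd by auto
qed

end

text \<open>For an infinite rank, \<open>group_rank\<close> is the maximum of an infinite set; hence the relational form.\<close>
definition rank_on :: "('g, 'm) monoid_scheme => 'g set => nat => bool" where
  "rank_on G H k \<longleftrightarrow> (\<exists>S. int_independent G S \<and> S \<subseteq> H \<and> card S = k) \<and>
     (\<forall>S. int_independent G S \<and> S \<subseteq> H --> card S <= k)"

abbreviation has_rank :: "('g, 'm) monoid_scheme => nat => bool" where
  "has_rank G \<equiv> rank_on G (carrier G)"

lemma int_independent_empty: "int_independent G {}"
  by (simp add: int_independent_def)

lemma has_rank_imp_group_rank: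
  assumes "has_rank G k"
  shows "group_rank G = k"
proof -
  have "{card S | S. int_independent G S} \<subseteq> {..k}"
    using assms by (auto simp: rank_on_def int_independent_def)
  thus ?thesis
    unfolding group_rank_def using assms
    by (intro Max_eqI) (auto simp: rank_on_def finite_subset)
qed

lemma has_rank_bound: "has_rank G k ==> int_independent G S ==> card S <= k"
  by (simp add: rank_on_def int_independent_def)

lemma rank_on_exI:
  assumes "\<And>S. int_independent G S ==> S \<subseteq> H ==> card S <= k"
  shows "\<exists>r. rank_on G H r"
proof -
  define P where "P r \<longleftrightarrow> (\<exists>S. int_independent G S \<and> S \<subseteq> H \<and> card S = r)" for r
  have "P 0" unfolding P_def using int_independent_empty[of G] by force
  moreover have "\<forall>r. P r --> r <= k" using assms by (auto simp: P_def)
  ultimately have "P (Greatest P)" "\<forall>r. P r --> r <= Greatest P"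
    by (blast intro: GreatestI_nat Greatest_le_nat)+
  thus ?thesis by (intro exI[of _ "Greatest P"]) (auto simp: rank_on_def P_def)
qed

lemma rank_on_unique: "rank_on G H k ==> rank_on G H l ==> k = l"
  unfolding rank_on_def by (metis order_antisym)

context comm_group
begin

text \<open>By maximality, adding \<open>x\<close> creates a relation; independence of
  \<open>S\<close> forces the coefficient of \<open>x\<close> in it to be nonzero.\<close>

lemma rank_on_maximal_spans:
  assumes S: "int_independent G S" "S \<subseteq> H" "rank_on G H (card S)" and x: "x \<in> H" "H \<subseteq> carrier G"
  shows "\<exists>k d. k ~= 0 \<and> x [^] (k::int) = int_comb G d S"
proof (cases "x \<in> S")
  case True
  have finS: "finite S" "S \<subseteq> carrier G" using S by (auto simp: int_independent_def)
  have "int_comb G (\<lambda>y. if y = x then 1 else 0) S = finprod G (\<lambda>y. if x = y then y else \<one>) S"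
    unfolding int_comb_def using finS by (intro finprod_cong') auto
  also have "\<dots> = x" using finS True by (simp add: finprod_singleton subset_iff)
  finally show ?thesis using True finS
    by (intro exI[of _ 1] exI[of _ "\<lambda>y. if y = x then 1 else 0"]) (auto simp: subset_iff)
next
  case False
  have finS: "finite S" "S \<subseteq> carrier G" using S by (auto simp: int_independent_def)
  have xG: "x \<in> carrier G" using x by auto
  have "\<not> int_independent G (insert x S)"
    using S False x finS by (auto simp: rank_on_def)
  then obtain c where c: "int_comb G c (insert x S) = \<one>" "\<exists>y\<in>insert x S. c y ~= 0"
    using finS xG by (auto simp: int_independent_alt)
  have eq: "x [^] c x \<otimes> int_comb G c S = \<one>"
    using c(1) False finS xG by (simp add: int_comb_insert)
  have "c x ~= 0"
  proof
    assume "c x = 0"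
    with eq have "int_comb G c S = \<one>" using finS xG by (simp add: int_comb_closed)
    hence "\<forall>y\<in>S. c y = 0" using S by (auto simp: int_independent_alt)
    with \<open>c x = 0\<close> c(2) show False by auto
  qed
  moreover have "x [^] c x = inv (int_comb G c S)"
    using eq finS xG by (metis inv_equality int_comb_closed int_pow_closed)
  moreover have "inv (int_comb G c S) = int_comb G (\<lambda>x. -1 * c x) S"
    by (subst int_comb_scale) (use finS in \<open>auto simp: int_comb_closed int_pow_neg\<close>)
  ultimately show ?thesis by metis
qed

end

text \<open>A maximal independent set in the kernel, together with preimages of one in the image, is
  maximal independent in \<open>A\<close>.\<close>

lemma rank_on_nullity:
  assumes "comm_group A" "comm_group B" and f: "f \<in> hom A B"
    and K: "rank_on A (kernel A B f) k" and I: "rank_on B (f ` carrier A) i"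
  shows "has_rank A (k + i)"
proof -
  interpret A: comm_group A by fact
  interpret B: comm_group B by fact
  obtain S where S: "int_independent A S" "S \<subseteq> kernel A B f" "card S = k"
    using K by (auto simp: rank_on_def)
  obtain T where T: "int_independent B T" "T \<subseteq> f ` carrier A" "card T = i"
    using I by (auto simp: rank_on_def)
  have finS: "finite S" "S \<subseteq> carrier A" "finite T" "T \<subseteq> carrier B"
    using S T by (auto simp: int_independent_def)
  define g where "g = inv_into (carrier A) f"
  have g: "g t \<in> carrier A \<and> f (g t) = t" if "t \<in> T" for t
    using that T(2) inv_into_into[of t f "carrier A"] f_inv_into_f[of t f "carrier A"]
    unfolding g_def by (meson subsetD)
  have inj: "inj_on g T" using g by (metis inj_onI)
  have gT: "finite (g ` T)" "g ` T \<subseteq> carrier A" "card (g ` T) = i"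
    using finS g inj T(3) by (auto simp: card_image)
  have f0: "f x = \<one>\<^bsub>B\<^esub>" if "x \<in> S" for x using that S(2) by (auto simp: kernel_def)
  have T_ne: "t ~= \<one>\<^bsub>B\<^esub>" if "t \<in> T" for t
  proof
    assume t: "t = \<one>\<^bsub>B\<^esub>"
    have "int_comb B (\<lambda>y. if y = t then 1 else 0) T = \<one>\<^bsub>B\<^esub>"
      unfolding int_comb_def
      by (simp add: B.finprod_one_eqI t)
    hence "\<forall>y\<in>T. (if y = t then 1 else 0 :: int) = 0"
      using T(1) unfolding int_independent_alt by blast
    thus False using that by (metis zero_neq_one)
  qed
  have disj: "S \<inter> g ` T = {}"
    using f0 g T_ne by fastforce
  have fS: "f (int_comb A c S) = \<one>\<^bsub>B\<^esub>" for c
    using finS f0 by (simp add: A.int_comb_image[OF _ B.comm_group_axioms f] B.finprod_one_eqI)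
  have fT: "f (int_comb A c (g ` T)) = int_comb B (\<lambda>t. c (g t)) T" for c
  proof -
    have "f (int_comb A c (g ` T)) = finprod B (\<lambda>x. f x [^]\<^bsub>B\<^esub> c x) (g ` T)"
      using gT by (intro A.int_comb_image B.comm_group_axioms f)
    also have "\<dots> = finprod B (\<lambda>t. f (g t) [^]\<^bsub>B\<^esub> c (g t)) T"
      using inj g finS by (intro B.finprod_reindex) auto
    also have "\<dots> = int_comb B (\<lambda>t. c (g t)) T"
      unfolding int_comb_def using g finS by (intro B.finprod_cong') auto
    finally show ?thesis .
  qed
  have cc: "int_comb A c S \<in> carrier A" "int_comb A c (g ` T) \<in> carrier A" for c
    using finS gT by (auto intro: A.int_comb_closed)
  have Un: "int_comb A c (S \<union> g ` T) = int_comb A c S \<otimes>\<^bsub>A\<^esub> int_comb A c (g ` T)" for c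
    using finS gT disj by (intro A.int_comb_Un_disjoint) auto
  have "int_independent A (S \<union> g ` T)"
    unfolding int_independent_alt
  proof (intro conjI allI impI)
    fix c assume "int_comb A c (S \<union> g ` T) = \<one>\<^bsub>A\<^esub>"
    hence eq: "int_comb A c S \<otimes>\<^bsub>A\<^esub> int_comb A c (g ` T) = \<one>\<^bsub>A\<^esub>" by (simp add: Un)
    hence "f (int_comb A c S \<otimes>\<^bsub>A\<^esub> int_comb A c (g ` T)) = \<one>\<^bsub>B\<^esub>"
      using hom_one[OF f] by simp
    hence "int_comb B (\<lambda>t. c (g t)) T = \<one>\<^bsub>B\<^esub>"
      using hom_mult[OF f] cc fS fT finS by (simp add: B.int_comb_closed)
    hence c0: "\<forall>t\<in>T. c (g t) = 0" using T(1) by (auto simp: int_independent_alt)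
    hence "int_comb A c (g ` T) = \<one>\<^bsub>A\<^esub>"
      using gT by (subst A.int_comb_cong[where d = "\<lambda>_. 0"]) (auto simp: A.int_comb_zero)
    with eq have "int_comb A c S = \<one>\<^bsub>A\<^esub>" using cc by simp
    hence "\<forall>x\<in>S. c x = 0" using S(1) by (auto simp: int_independent_alt)
    with c0 show "\<forall>x\<in>S \<union> g ` T. c x = 0" by auto
  qed (use finS gT in auto)
  moreover have "card (S \<union> g ` T) = k + i"
    using finS gT disj S(3) by (simp add: card_Un_disjoint)
  moreover have "card U <= k + i" if U: "int_independent A U" for U
  proof -
    have "card U <= card (S \<union> g ` T)"
    proof (rule A.int_independent_card_le[OF U])
      fix x assume "x \<in> U"
      hence x: "x \<in> carrier A" using U by (auto simp: int_independent_def)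
      hence fx: "f x \<in> carrier B" using f by (auto simp: hom_def)
      obtain p d where p: "p ~= 0" "f x [^]\<^bsub>B\<^esub> (p::int) = int_comb B d T"
        using B.rank_on_maximal_spans[OF T(1,2), of "f x"] I T(3) x f
        by (auto simp: hom_def image_subset_iff Pi_iff)
      define d' where "d' y = d (f y)" for y
      \<comment> \<open>A multiple of \<open>x\<close> and the lifted combination have the same
        image, so their quotient \<open>z\<close> lies in the kernel. The multiplier finally used
        for \<open>x\<close> is the product of those found for \<open>f x\<close> and for
        \<open>z\<close>.\<close>
      define z where "z = x [^]\<^bsub>A\<^esub> p \<otimes>\<^bsub>A\<^esub> inv\<^bsub>A\<^esub> int_comb A d' (g ` T)"
      have zc: "z \<in> carrier A" using x cc by (simp add: z_def)
      have "int_comb B (\<lambda>t. d' (g t)) T = int_comb B d T"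
        using finS g by (intro B.int_comb_cong) (auto simp: d'_def)
      hence "f (int_comb A d' (g ` T)) = f x [^]\<^bsub>B\<^esub> p" using fT p by simp
      moreover have "f (x [^]\<^bsub>A\<^esub> p) = f x [^]\<^bsub>B\<^esub> p"
        using x by (intro hom_int_pow f) auto
      moreover have "f (inv\<^bsub>A\<^esub> int_comb A d' (g ` T)) = inv\<^bsub>B\<^esub> f (int_comb A d' (g ` T))"
        by (rule group_hom.hom_inv)
          (use f cc in \<open>auto intro!: group_hom.intro group_hom_axioms.intro\<close>)
      ultimately have "f z = \<one>\<^bsub>B\<^esub>"
        using hom_mult[OF f, of "x [^]\<^bsub>A\<^esub> p"] x cc fx by (simp add: z_def)
      hence "z \<in> kernel A B f" using zc by (auto simp: kernel_def)
      then obtain q e where q: "q ~= 0" "z [^]\<^bsub>A\<^esub> (q::int) = int_comb A e S"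
        using A.rank_on_maximal_spans[OF S(1,2), of z] K S(3) by (auto simp: kernel_def)
      define h where "h y = (if y \<in> S then e y else q * d' y)" for y
      have "x [^]\<^bsub>A\<^esub> p = z \<otimes>\<^bsub>A\<^esub> int_comb A d' (g ` T)"
        using x cc by (simp add: z_def A.m_assoc)
      hence "x [^]\<^bsub>A\<^esub> (p * q) = z [^]\<^bsub>A\<^esub> q \<otimes>\<^bsub>A\<^esub> int_comb A d' (g ` T) [^]\<^bsub>A\<^esub> q"
        using x zc cc by (metis A.int_pow_pow A.int_pow_distrib)
      also have "\<dots> = int_comb A e S \<otimes>\<^bsub>A\<^esub> int_comb A (\<lambda>y. q * d' y) (g ` T)"
        using q gT by (simp add: A.int_comb_scale)
      also have "int_comb A e S = int_comb A h S"
        using finS by (intro A.int_comb_cong) (auto simp: h_def)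
      also have "int_comb A (\<lambda>y. q * d' y) (g ` T) = int_comb A h (g ` T)"
        using gT disj by (intro A.int_comb_cong) (auto simp: h_def)
      also have "int_comb A h S \<otimes>\<^bsub>A\<^esub> int_comb A h (g ` T) = int_comb A h (S \<union> g ` T)"
        by (simp add: Un)
      finally show "\<exists>k d. k ~= 0 \<and> x [^]\<^bsub>A\<^esub> (k::int) = int_comb A d (S \<union> g ` T)"
        using p q by (intro exI[of _ "p * q"] exI[of _ h]) auto
    qed (use finS gT in auto)
    thus ?thesis using \<open>card (S \<union> g ` T) = k + i\<close> by simp
  qed
  ultimately show ?thesis
    using finS gT by (auto simp: rank_on_def intro!: exI[of _ "S \<union> g ` T"])
qed

text \<open>A relation among preimages maps to the same relation in \<open>T\<close>. Thus a bound
  on the rank of \<open>A\<close> bounds the rank of every image.\<close>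

lemma int_independent_hom_lift:
  assumes "comm_group A" "comm_group B" and f: "f \<in> hom A B"
    and T: "int_independent B T" "T \<subseteq> f ` carrier A"
  shows "\<exists>S. int_independent A S \<and> card S = card T"
proof -
  interpret A: comm_group A by fact
  interpret B: comm_group B by fact
  have finT: "finite T" "T \<subseteq> carrier B" using T by (auto simp: int_independent_def)
  define g where "g = inv_into (carrier A) f"
  have g: "g t \<in> carrier A \<and> f (g t) = t" if "t \<in> T" for t
    using that T(2) inv_into_into[of t f "carrier A"] f_inv_into_f[of t f "carrier A"]
    unfolding g_def by (meson subsetD)
  have inj: "inj_on g T" using g by (metis inj_onI)
  have "int_independent A (g ` T)"
    unfolding int_independent_alt
  proof (intro conjI allI impI)
    fix c assume "int_comb A c (g ` T) = \<one>\<^bsub>A\<^esub>"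
    hence "\<one>\<^bsub>B\<^esub> = f (int_comb A c (g ` T))" using hom_one[OF f] by simp
    also have "\<dots> = finprod B (\<lambda>x. f x [^]\<^bsub>B\<^esub> c x) (g ` T)"
      using g by (intro A.int_comb_image B.comm_group_axioms f) auto
    also have "\<dots> = finprod B (\<lambda>t. f (g t) [^]\<^bsub>B\<^esub> c (g t)) T"
      using inj g finT by (intro B.finprod_reindex) auto
    also have "\<dots> = int_comb B (\<lambda>t. c (g t)) T"
      unfolding int_comb_def using g finT by (intro B.finprod_cong') auto
    finally have "\<forall>t\<in>T. c (g t) = 0" using T(1) by (auto simp: int_independent_alt)
    thus "\<forall>x\<in>g ` T. c x = 0" by auto
  qed (use finT g in auto)
  thus ?thesis using inj by (auto simp: card_image)
qed

lemma has_rank_split: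
  assumes "comm_group A" "comm_group B" and f: "f \<in> hom A B" and a: "has_rank A a"
  obtains k i where "rank_on A (kernel A B f) k" "rank_on B (f ` carrier A) i" "a = k + i"
proof -
  have "\<exists>k. rank_on A (kernel A B f) k"
  proof (rule rank_on_exI)
    show "card S <= a" if "int_independent A S" for S using has_rank_bound[OF a that] .
  qed
  then obtain k where k: "rank_on A (kernel A B f) k" ..
  have "\<exists>i. rank_on B (f ` carrier A) i"
    by (metis rank_on_exI int_independent_hom_lift has_rank_bound assms)
  then obtain i where i: "rank_on B (f ` carrier A) i" ..
  have "a = k + i" using rank_on_unique[OF a rank_on_nullity[OF assms(1-3) k i]] .
  with k i that show ?thesis by metis
qed

lemma has_rank_trivial:
  fixes G (structure)
  assumes "trivial_group G"
  shows "has_rank G 0"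
proof -
  have "group G" and carr: "carrier G = {\<one>\<^bsub>G\<^esub>}" using assms by (auto simp: trivial_group_def)
  then interpret comm_group G
    by (intro group.group_comm_groupI) auto
  have "S = {}" if S: "int_independent G S" for S
  proof (rule ccontr)
    assume "S ~= {}"
    hence "S = {\<one>}" using S carr by (auto simp: int_independent_def)
    moreover have "int_comb G (\<lambda>_. 1) {\<one>} = \<one>"
      unfolding int_comb_def by (rule finprod_one_eqI) simp
    ultimately show False using S unfolding int_independent_alt
      by (metis insertI1 zero_neq_one)
  qed
  thus ?thesis using int_independent_empty[of G] by (force simp: rank_on_def)
qed

lemma has_rank_iso:
  assumes "comm_group A" "comm_group B" "A \<cong> B" "has_rank A a"
  shows "has_rank B a"
proof -
  obtain f where f: "f \<in> hom A B" "f ` carrier A = carrier B"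
    using assms(3) by (auto simp: is_iso_def iso_def bij_betw_def)
  obtain g where g: "g \<in> hom B A" "g ` carrier B = carrier A"
    using group.iso_sym[OF comm_group.axioms(2)[OF assms(1)] assms(3)]
    by (auto simp: is_iso_def iso_def bij_betw_def)
  obtain S where S: "int_independent A S" "card S = a" using assms(4) by (auto simp: rank_on_def)
  then obtain T where T: "int_independent B T" "card T = a"
    using int_independent_hom_lift[OF assms(2,1) g(1) S(1)] g(2)
    by (auto simp: int_independent_def)
  have "T \<subseteq> carrier B" using T(1) by (simp add: int_independent_def)
  have "card U <= a" if U: "int_independent B U" for U
  proof -
    have "U \<subseteq> f ` carrier A" using U f(2) by (simp add: int_independent_def)
    from int_independent_hom_lift[OF assms(1,2) f(1) U this]
    obtain V where "int_independent A V" "card V = card U" by auto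
    thus ?thesis using has_rank_bound[OF assms(4)] by metis
  qed
  thus ?thesis unfolding rank_on_def
    using T \<open>T \<subseteq> carrier B\<close> by (intro conjI exI[of _ T] allI impI) auto
qed

section \<open>Additivity of the Euler characteristic\<close>

text \<open>Finite ranks that vanish in high degrees are part of the assertion, because the maximum
  in \<open>group_rank\<close> and the sum in \<open>euler_char\<close> are meaningful only then.
  The relative form is what the exact sequence of a pair works with.\<close>

definition has_chi :: "'a topology => 'a set => int => bool" where
  "has_chi X S c \<longleftrightarrow> (\<exists>r K. (\<forall>p. has_rank (relative_homology_group (int p) X S) (r p)) \<and>
     (\<forall>p\<ge>K. r p = 0) \<and> c = (\<Sum>p<K. (-1) ^ p * int (r p)))"

lemma has_chiE:
  assumes "has_chi X S c"
  obtains r K where "\<And>p. has_rank (relative_homology_group (int p) X S) (r p)"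
    "\<And>p. p \<ge> K ==> r p = 0" "c = (\<Sum>p<K. (-1) ^ p * int (r p))"
proof -
  from assms obtain r K where "(\<forall>p. has_rank (relative_homology_group (int p) X S) (r p)) \<and>
     (\<forall>p\<ge>K. r p = 0) \<and> c = (\<Sum>p<K. (-1) ^ p * int (r p))"
    unfolding has_chi_def by (elim exE)
  thus ?thesis by (intro that[of r K]) auto
qed

lemma has_chi_I:
  assumes "\<And>p. has_rank (relative_homology_group (int p) X S) (r p)" "\<And>p. p \<ge> K ==> r p = 0"
    "c = (\<Sum>p<K. (-1) ^ p * int (r p))"
  shows "has_chi X S c"
  unfolding has_chi_def using assms by (intro exI[of _ r] exI[of _ K] conjI allI impI)

lemma sum_nonzero_eq:
  assumes K: "\<And>p. p \<ge> K ==> r p = (0::nat)"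
  shows "(\<Sum>p | r p ~= 0. (-1) ^ p * int (r p)) = (\<Sum>p<K. (-1) ^ p * int (r p))"
proof -
  have "{p. r p ~= 0} \<subseteq> {..<K}"
  proof
    fix p assume "p \<in> {p. r p ~= 0}"
    thus "p \<in> {..<K}" using K[of p] by (cases "p < K") auto
  qed
  thus ?thesis by (intro sum.mono_neutral_left) auto
qed

lemma has_chi_imp_euler_char:
  assumes "has_chi X {} c"
  shows "euler_char X = c"
proof -
  obtain r K where r: "\<And>p. has_rank (homology_group (int p) X) (r p)"
    and K: "\<And>p. p \<ge> K ==> r p = 0" and c: "c = (\<Sum>p<K. (-1) ^ p * int (r p))"
    using assms by (rule has_chiE) (rule that)
  have gr: "group_rank (homology_group (int p) X) = r p" for p
    by (rule has_rank_imp_group_rank[OF r])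
  have "euler_char X = (\<Sum>p | r p ~= 0. (-1) ^ p * int (r p))"
    unfolding euler_char_def gr ..
  also have "\<dots> = c"
    unfolding c by (rule sum_nonzero_eq[OF K])
  finally show ?thesis .
qed

lemma alternating_sum_extend:
  assumes "\<And>p. p \<ge> K ==> r p = 0" "L \<ge> K"
  shows "(\<Sum>p<L. (-1) ^ p * int (r p)) = (\<Sum>p<K. (-1) ^ p * int (r p))"
  by (rule sum.mono_neutral_right) (use assms in auto)

lemma has_chi_iso:
  assumes "\<And>p. relative_homology_group (int p) X S \<cong> relative_homology_group (int p) Y T" "has_chi X S c"
  shows "has_chi Y T c"
proof -
  obtain r K where r: "\<And>p. has_rank (relative_homology_group (int p) X S) (r p)"
    "\<And>p. p \<ge> K ==> r p = 0" "c = (\<Sum>p<K. (-1) ^ p * int (r p))"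
    using assms(2) by (rule has_chiE) (rule that)
  have "has_rank (relative_homology_group (int p) Y T) (r p)" for p
    by (rule has_rank_iso[OF _ _ assms(1) r(1)]) simp_all
  thus ?thesis using r(2,3) by (intro has_chi_I)
qed

lemma has_chi_homotopy_equivalent:
  "X homotopy_equivalent_space Y ==> has_chi X {} c ==> has_chi Y {} c"
  by (rule has_chi_iso[OF homotopy_equivalent_space_imp_isomorphic_homology_groups])

lemma has_chi_homeomorphic:
  "X homeomorphic_space Y ==> has_chi X {} c ==> has_chi Y {} c"
  by (rule has_chi_iso[OF homeomorphic_space_imp_isomorphic_homology_groups])

text \<open>The ranks of the groups in the long exact sequence of a pair, through the ranks
  \<open>d\<close>, \<open>i\<close>, \<open>j\<close> of its maps.\<close>
lemma exact_sequence_alternating_sum: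
  fixes a x r d i j :: "nat => nat"
  assumes a: "\<And>p. a p = d p + i p" and x: "\<And>p. x p = i p + j p"
    and r0: "r 0 = j 0" and r: "\<And>p. r (Suc p) = j (Suc p) + d p" and d: "d K = 0"
  shows "(\<Sum>p<Suc K. (-1) ^ p * int (x p)) =
    (\<Sum>p<Suc K. (-1) ^ p * int (a p)) + (\<Sum>p<Suc K. (-1) ^ p * int (r p))"
proof -
  have "(\<Sum>p<Suc L. (-1) ^ p * int (a p)) + (\<Sum>p<Suc L. (-1) ^ p * int (r p)) =
      (\<Sum>p<Suc L. (-1) ^ p * int (x p)) + (-1) ^ L * int (d L)" for L
    by (induction L) (simp_all add: a x r0 r algebra_simps)
  from this[of K] show ?thesis by (simp add: d)
qed

text \<open>Exactness splits the rank of each group of the long exact sequence into the ranks of its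
  incoming and outgoing maps. \<open>has_rank_split\<close> reads these off from the two known
  families of groups, and \<open>rank_on_nullity\<close> assembles the third.\<close>

lemma has_chi_pair:
  assumes A: "has_chi (subtopology X S) {} a"
  shows "has_chi X {} x ==> has_chi X S (x - a)"
    and "has_chi X S r ==> has_chi X {} (a + r)"
proof -
  define GA where "GA p = homology_group (int p) (subtopology X S)" for p
  define GX where "GX p = homology_group (int p) X" for p
  define GR where "GR p = relative_homology_group (int p) X S" for p
  define f where "f p = hom_induced (int p) (subtopology X S) {} X {} id" for p
  define g where "g p = hom_induced (int p) X {} X S id" for p
  define h where "h p = hom_boundary (int (Suc p)) X S" for p
  have ab: "comm_group (GA p)" "comm_group (GX p)" "comm_group (GR p)" for p
    by (simp_all add: GA_def GX_def GR_def)
  have f: "f p \<in> hom (GA p) (GX p)" and g: "g p \<in> hom (GX p) (GR p)" for p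
    by (simp_all add: f_def g_def GA_def GX_def GR_def hom_induced_hom)
  have h: "h p \<in> hom (GR (Suc p)) (GA p)" for p
    using hom_boundary_hom[of "int (Suc p)" X S] by (simp add: h_def GA_def GR_def)
  have kf: "kernel (GA p) (GX p) (f p) = h p ` carrier (GR (Suc p))" for p
    using homology_exactness_axiom_2[of "int (Suc p)" X S] by (simp add: h_def f_def GA_def GX_def GR_def)
  have kg: "kernel (GX p) (GR p) (g p) = f p ` carrier (GA p)" for p
    using homology_exactness_axiom_3[of "int p" X S] by (simp add: g_def f_def GA_def GX_def GR_def)
  have kh: "kernel (GR (Suc p)) (GA p) (h p) = g (Suc p) ` carrier (GX (Suc p))" for p
    using homology_exactness_axiom_1[of "int (Suc p)" X S] by (simp add: g_def h_def GA_def GX_def GR_def)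
  \<comment> \<open>The sequence ends in degree 0, as homology in degree -1 is trivial, so the map
    to the relative group is onto there.\<close>
  have g0: "g 0 ` carrier (GX 0) = carrier (GR 0)"
  proof -
    have triv: "trivial_group (homology_group (-1) (subtopology X S))" by simp
    have "kernel (relative_homology_group 0 X S) (homology_group (-1) (subtopology X S)) (hom_boundary 0 X S)
        = g 0 ` carrier (GX 0)"
      using homology_exactness_axiom_1[of "0" X S] by (simp add: g_def GX_def)
    moreover have "kernel (relative_homology_group 0 X S) (homology_group (-1) (subtopology X S)) (hom_boundary 0 X S)
        = carrier (relative_homology_group 0 X S)"
      using triv hom_boundary_carrier[of 0 X S] by (auto simp: kernel_def trivial_group_def)
    ultimately show ?thesis by (simp add: GR_def)
  qed
  obtain ra K where ra': "\<And>p. has_rank (homology_group (int p) (subtopology X S)) (ra p)" "\<And>p. p \<ge> K ==> ra p = 0"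
      "a = (\<Sum>p<K. (-1) ^ p * int (ra p))"
    using A by (rule has_chiE) (rule that)
  note ra = ra'[folded GA_def]
  have "\<exists>d i. rank_on (GA p) (h p ` carrier (GR (Suc p))) d \<and> rank_on (GX p) (f p ` carrier (GA p)) i
      \<and> ra p = d + i" for p
    using has_rank_split[OF ab(1,2) f ra(1), of p] by (metis kf)
  then obtain d i where d: "\<And>p. rank_on (GA p) (h p ` carrier (GR (Suc p))) (d p)"
    and i: "\<And>p. rank_on (GX p) (f p ` carrier (GA p)) (i p)" and adi: "\<And>p. ra p = d p + i p"
    by metis
  {
    assume "has_chi X {} x"
    then obtain rx L where rx': "\<And>p. has_rank (homology_group (int p) X) (rx p)" "\<And>p. p \<ge> L ==> rx p = 0"
        "x = (\<Sum>p<L. (-1) ^ p * int (rx p))"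
      by (rule has_chiE) (rule that)
    note rx = rx'[folded GX_def]
    have "\<exists>j. rank_on (GR p) (g p ` carrier (GX p)) j \<and> rx p = i p + j" for p
      using has_rank_split[OF ab(2,3) g rx(1), of p] rank_on_unique[OF i] by (metis kg)
    then obtain j where j: "\<And>p. rank_on (GR p) (g p ` carrier (GX p)) (j p)"
      and xij: "\<And>p. rx p = i p + j p" by metis
    define rr where "rr p = (case p of 0 => j 0 | Suc q => j (Suc q) + d q)" for p
    have rr: "has_rank (GR p) (rr p)" for p
    proof (cases p)
      case 0
      thus ?thesis using j[of 0] g0 by (simp add: rr_def)
    next
      case (Suc q)
      thus ?thesis using rank_on_nullity[OF ab(3,1) h, of q] j d by (simp add: rr_def kh)
    qed
    \<comment> \<open>The boundary map lowers the degree: \<open>d q\<close> enters the relative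
      rank in degree \<open>Suc q\<close>. Hence the one extra degree.\<close>
    define M where "M = Suc (K + L)"
    have z: "ra p = 0" "rx p = 0" if "p \<ge> K + L" for p using that ra(2) rx(2) by auto
    hence z': "rr p = 0" if "p \<ge> M" for p
      using that adi xij unfolding M_def by (cases p) (auto simp: rr_def)
    have "(\<Sum>p<M. (-1) ^ p * int (rx p)) =
       (\<Sum>p<M. (-1) ^ p * int (ra p)) + (\<Sum>p<M. (-1) ^ p * int (rr p))"
      unfolding M_def
      by (rule exact_sequence_alternating_sum[of ra d i rx j])
        (use adi xij z[of "K + L"] in \<open>auto simp: rr_def\<close>)
    moreover have "(\<Sum>p<M. (-1) ^ p * int (ra p)) = a" "(\<Sum>p<M. (-1) ^ p * int (rx p)) = x"
      unfolding ra(3) rx(3) by (rule alternating_sum_extend; use ra rx in \<open>simp add: M_def\<close>)+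
    ultimately have "x - a = (\<Sum>p<M. (-1) ^ p * int (rr p))" by simp
    with rr z' show "has_chi X S (x - a)" unfolding GR_def by (intro has_chi_I)
  next
    assume "has_chi X S r"
    then obtain rr L where rr': "\<And>p. has_rank (relative_homology_group (int p) X S) (rr p)" "\<And>p. p \<ge> L ==> rr p = 0"
        "r = (\<Sum>p<L. (-1) ^ p * int (rr p))"
      by (rule has_chiE) (rule that)
    note rr = rr'[folded GR_def]
    have "\<exists>j. rank_on (GR (Suc p)) (g (Suc p) ` carrier (GX (Suc p))) j \<and> rr (Suc p) = j + d p" for p
      using has_rank_split[OF ab(3,1) h rr(1), of p] rank_on_unique[OF d] by (metis kh)
    then obtain j' where j': "\<And>p. rank_on (GR (Suc p)) (g (Suc p) ` carrier (GX (Suc p))) (j' p)"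
      and rj: "\<And>p. rr (Suc p) = j' p + d p" by metis
    define j where "j p = (case p of 0 => rr 0 | Suc q => j' q)" for p
    have j: "rank_on (GR p) (g p ` carrier (GX p)) (j p)" for p
      using j' rr(1)[of 0] g0 by (cases p) (auto simp: j_def)
    have rx: "has_rank (GX p) (i p + j p)" for p
      using rank_on_nullity[OF ab(2,3) g] i j kg by simp
    define M where "M = Suc (K + L)"
    have z: "ra p = 0" "rr p = 0" if "p \<ge> K + L" for p using that ra(2) rr(2) by auto
    hence z': "i p + j p = 0" if "p \<ge> M" for p
      using that adi[of p] rj[of "p - 1"] unfolding M_def by (cases p) (auto simp: j_def)
    have "(\<Sum>p<M. (-1) ^ p * int (i p + j p)) =
       (\<Sum>p<M. (-1) ^ p * int (ra p)) + (\<Sum>p<M. (-1) ^ p * int (rr p))"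
      unfolding M_def
      by (rule exact_sequence_alternating_sum[of ra d i _ j])
        (use adi rj z[of "K + L"] in \<open>auto simp: j_def\<close>)
    moreover have "(\<Sum>p<M. (-1) ^ p * int (ra p)) = a" "(\<Sum>p<M. (-1) ^ p * int (rr p)) = r"
      unfolding ra(3) rr(3) by (rule alternating_sum_extend; use ra rr in \<open>simp add: M_def\<close>)+
    ultimately have "a + r = (\<Sum>p<M. (-1) ^ p * int (i p + j p))" by simp
    with rx z' show "has_chi X {} (a + r)" unfolding GX_def by (intro has_chi_I)
  }
qed

text \<open>Excising \<open>V - U\<close> identifies the pair (X, V) with (U, U \<inter> V).
  Comparing the two relative Euler characteristics gives inclusion-exclusion.\<close>

lemma has_chi_union:
  assumes U: "openin X U" "openin X V" "topspace X = U \<union> V"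
    and u: "has_chi (subtopology X U) {} u" and v: "has_chi (subtopology X V) {} v"
    and w: "has_chi (subtopology X (U \<inter> V)) {} w"
  shows "has_chi X {} (u + v - w)"
proof -
  have *: "subtopology (subtopology X U) (U \<inter> V) = subtopology X (U \<inter> V)"
    by (simp add: subtopology_subtopology Int_assoc[symmetric])
  have "has_chi (subtopology X U) (U \<inter> V) (u - w)"
    by (rule has_chi_pair(1)) (use u w * in simp_all)
  moreover have "relative_homology_group p (subtopology X U) (U \<inter> V) \<cong> relative_homology_group p X V" for p
  proof -
    \<comment> \<open>The closure stays in the closed complement of \<open>U\<close>, which lies in
      the open set \<open>V\<close>.\<close>
    have "(X closure_of (V - U)) \<subseteq> (X interior_of V)"
    proof -
      have "closedin X (topspace X - U)" using U(1) by blast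
      moreover have "V - U \<subseteq> topspace X - U" using U(3) by blast
      ultimately have "(X closure_of (V - U)) \<subseteq> topspace X - U" by (rule closure_of_minimal[rotated])
      also have "\<dots> \<subseteq> V" using U(3) by blast
      finally show ?thesis using U(2) by (simp add: interior_of_openin)
    qed
    from homology_excision_axiom[OF this, of "topspace X" p] have
      "hom_induced p (subtopology X (topspace X - (V - U))) (V - (V - U)) (subtopology X (topspace X)) V id
      \<in> iso (relative_homology_group p (subtopology X (topspace X - (V - U))) (V - (V - U)))
         (relative_homology_group p (subtopology X (topspace X)) V)"
      using U(3) by blast
    moreover have "topspace X - (V - U) = U" "V - (V - U) = U \<inter> V"
      using U(3) by auto
    ultimately show ?thesis unfolding is_iso_def by auto
  qed
  ultimately have "has_chi X V (u - w)" by (rule has_chi_iso[rotated])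
  from has_chi_pair(2)[OF v this] show ?thesis by (simp add: algebra_simps)
qed

lemma has_chi_empty: "topspace X = {} ==> has_chi X {} 0"
  by (rule has_chi_I[where r = "\<lambda>_. 0" and K = 0])
    (auto intro!: has_rank_trivial simp: trivial_homology_group_empty)

lemma has_rank_integer_group: "has_rank integer_group 1"
proof -
  interpret comm_group integer_group by (rule abelian_integer_group)
  have pw: "x [^]\<^bsub>integer_group\<^esub> (k::int) = k * x" for x k by simp
  have ind: "int_independent integer_group {1}"
    unfolding int_independent_def by simp
  have "card S <= card {1::int}" if S: "int_independent integer_group S" for S
  proof (rule int_independent_card_le[OF S])
    show "\<exists>k d. k ~= 0 \<and> x [^]\<^bsub>integer_group\<^esub> (k::int) = int_comb integer_group d {1}" for x :: int
      by (intro exI[of _ 1] exI[of _ "\<lambda>_. x"]) (simp add: int_comb_def)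
  qed auto
  with ind show ?thesis unfolding rank_on_def by (intro conjI exI[of _ "{1}"]) auto
qed

lemma has_chi_singleton:
  assumes "topspace X = {a}"
  shows "has_chi X {} 1"
proof (rule has_chi_I[where r = "\<lambda>p. if p = 0 then 1 else 0" and K = 1])
  fix p
  have "homology_group 0 X \<cong> integer_group" by (rule homology_coefficients[OF assms])
  hence "integer_group \<cong> homology_group 0 X" by (simp add: group.iso_sym)
  from has_rank_iso[OF abelian_integer_group _ this has_rank_integer_group]
  have "has_rank (homology_group 0 X) 1" by simp
  moreover have "has_rank (homology_group (int p) X) 0" if "p ~= 0"
    by (rule has_rank_trivial) (use homology_dimension_axiom[OF assms] that in simp)
  ultimately show "has_rank (homology_group (int p) X) (if p = 0 then 1 else 0)" by auto
qed auto

section \<open>Products with a sphere\<close>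

lemma has_chi_prod_contractible:
  assumes X: "has_chi X {} c" and Y: "contractible_space Y" "topspace Y ~= {}"
  shows "has_chi (prod_topology X Y) {} c"
proof -
  obtain a where a: "homotopic_with (\<lambda>x. True) Y Y id (\<lambda>x. a)" "a \<in> topspace Y"
    using Y unfolding contractible_space_alt by blast
  define f where "f x = (x, a)" for x :: 'a
  have f: "continuous_map X (prod_topology X Y) f"
    unfolding f_def using a(2) by (intro continuous_map_pairedI) simp_all
  have "homotopic_with (\<lambda>x. True) X X id id" by (simp add: homotopic_with_refl)
  from homotopic_with_prod_topology[OF this a(1), of "\<lambda>_. True"]
  have "homotopic_with (\<lambda>x. True) (prod_topology X Y) (prod_topology X Y) id (f \<circ> fst)"
    by (simp add: f_def comp_def id_def)
  hence "homotopic_with (\<lambda>x. True) (prod_topology X Y) (prod_topology X Y) (f \<circ> fst) id"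
    by (simp add: homotopic_with_symD)
  moreover have "homotopic_with (\<lambda>x. True) X X (fst \<circ> f) id"
    by (simp add: f_def comp_def id_def[symmetric] homotopic_with_refl)
  ultimately have "X homotopy_equivalent_space prod_topology X Y"
    unfolding homotopy_equivalent_space_def
    using f by (intro exI[of _ f] exI[of _ fst]) (simp add: continuous_map_fst)
  from has_chi_homotopy_equivalent[OF this X] show ?thesis .
qed

lemma has_chi_prod_union:
  assumes "openin Y U" "openin Y V" "topspace Y = U \<union> V"
    and "has_chi (prod_topology X (subtopology Y U)) {} u" "has_chi (prod_topology X (subtopology Y V)) {} v"
    and "has_chi (prod_topology X (subtopology Y (U \<inter> V))) {} w"
  shows "has_chi (prod_topology X Y) {} (u + v - w)"
proof -
  let ?c = "\<lambda>S. topspace X \<times> S"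
  have *: "subtopology (prod_topology X Y) (?c S) = prod_topology X (subtopology Y S)" for S
    using prod_topology_subtopology(2)[of X Y S] by (simp add: subtopology_restrict)
  show ?thesis
  proof (rule has_chi_union)
    show "openin (prod_topology X Y) (?c U)" "openin (prod_topology X Y) (?c V)"
      using assms by (auto simp: openin_prod_Times_iff)
    show "topspace (prod_topology X Y) = ?c U \<union> ?c V" using assms(3) by auto
    have "?c U \<inter> ?c V = ?c (U \<inter> V)" by auto
    thus "has_chi (subtopology (prod_topology X Y) (?c U \<inter> ?c V)) {} w"
      using assms(6) by (simp add: *)
  qed (use assms * in simp_all)
qed

lemma has_chi_prod_set_union:
  fixes U V :: "'b::topological_space set"
  assumes "openin (top_of_set (U \<union> V)) U" "openin (top_of_set (U \<union> V)) V"
    and "has_chi (prod_topology X (top_of_set U)) {} u" "has_chi (prod_topology X (top_of_set V)) {} v"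
    and "has_chi (prod_topology X (top_of_set (U \<inter> V))) {} w"
  shows "has_chi (prod_topology X (top_of_set (U \<union> V))) {} (u + v - w)"
  by (rule has_chi_prod_union[OF assms(1,2)])
    (use assms in \<open>simp_all add: subtopology_subtopology Int_absorb1 Int_Un_distrib2 inf.absorb2 le_infI1\<close>)

lemma has_chi_prod_homeomorphic:
  assumes "S homeomorphic T" "has_chi (prod_topology X (top_of_set S)) {} c"
  shows "has_chi (prod_topology X (top_of_set T)) {} c"
proof -
  have "prod_topology X (top_of_set S) homeomorphic_space prod_topology X (top_of_set T)"
    using assms(1) by (intro homeomorphic_space_prod_topology) simp_all
  from has_chi_homeomorphic[OF this assms(2)] show ?thesis .
qed

lemma has_chi_prod_contractible_set:
  "has_chi X {} c ==> contractible S ==> S ~= {} ==> has_chi (prod_topology X (top_of_set S)) {} c"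
  by (rule has_chi_prod_contractible) simp_all

lemma contractible_punctured_sphere:
  fixes a :: "'a::euclidean_space"
  assumes "a \<in> sphere 0 1" "2 <= DIM('a)"
  shows "contractible (sphere 0 1 - {a})" "sphere 0 1 - {a} ~= {}"
proof -
  have "a ~= 0" using assms by auto
  hence *: "(sphere 0 1 - {a}) homeomorphic {x. a \<bullet> x = 0}"
    by (intro homeomorphic_punctured_sphere_hyperplane) (use assms in auto)
  have "contractible {x. a \<bullet> x = 0}" by (rule convex_imp_contractible[OF convex_hyperplane])
  thus "contractible (sphere 0 1 - {a})" using homeomorphic_contractible_eq[OF *] by simp
  show "sphere 0 1 - {a} ~= {}"
  proof
    assume "sphere 0 1 - {a} = {}"
    with * have "{x. a \<bullet> x = 0} = {}" using homeomorphic_empty(2)[of "{x. a \<bullet> x = 0}"] by simp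
    moreover have "0 \<in> {x. a \<bullet> x = 0}" by simp
    ultimately show False by simp
  qed
qed

lemma homeomorphic_by_witness:
  assumes "continuous_on S f" "continuous_on T g"
    and "\<And>x. x \<in> S ==> f x \<in> T \<and> g (f x) = x" "\<And>y. y \<in> T ==> g y \<in> S \<and> f (g y) = y"
  shows "S homeomorphic T"
proof -
  have "homeomorphism S T f g" by (rule homeomorphismI[OF assms(1,2)]) (use assms(3,4) in auto)
  thus ?thesis unfolding homeomorphic_def by blast
qed

lemma prod_topology_assoc:
  "prod_topology (prod_topology X Y) Z homeomorphic_space prod_topology X (prod_topology Y Z)"
proof (rule homeomorphic_maps_imp_homeomorphic_space)
  let ?f = "\<lambda>p. (fst (fst p), (snd (fst p), snd p))" and ?g = "\<lambda>p. ((fst p, fst (snd p)), snd (snd p))"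
  have "continuous_map (prod_topology (prod_topology X Y) Z) X (\<lambda>p. fst (fst p))"
    "continuous_map (prod_topology (prod_topology X Y) Z) Y (\<lambda>p. snd (fst p))"
    using continuous_map_compose[OF continuous_map_fst continuous_map_fst]
      continuous_map_compose[OF continuous_map_fst continuous_map_snd] by (simp_all add: comp_def)
  hence f: "continuous_map (prod_topology (prod_topology X Y) Z) (prod_topology X (prod_topology Y Z)) ?f"
    by (intro continuous_map_pairedI continuous_map_snd)
  have "continuous_map (prod_topology X (prod_topology Y Z)) Y (\<lambda>p. fst (snd p))"
    "continuous_map (prod_topology X (prod_topology Y Z)) Z (\<lambda>p. snd (snd p))"
    using continuous_map_compose[OF continuous_map_snd continuous_map_fst]
      continuous_map_compose[OF continuous_map_snd continuous_map_snd] by (simp_all add: comp_def)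
  hence g: "continuous_map (prod_topology X (prod_topology Y Z)) (prod_topology (prod_topology X Y) Z) ?g"
    by (intro continuous_map_pairedI continuous_map_fst)
  show "homeomorphic_maps (prod_topology (prod_topology X Y) Z) (prod_topology X (prod_topology Y Z)) ?f ?g"
    unfolding homeomorphic_maps_def using f g by simp
qed

text \<open>Removing one point leaves a contractible set, so two such sets cover the sphere and
  everything is reduced to the sphere without two points.\<close>

lemma sphere_cover:
  fixes a b :: "'a::euclidean_space"
  assumes "a \<in> sphere 0 1" "b \<in> sphere 0 1" "a ~= b" "2 <= DIM('a)"
    and "has_chi X {} c" "has_chi (prod_topology X (top_of_set (sphere 0 1 - {a, b}))) {} w"
  shows "has_chi (prod_topology X (top_of_set (sphere 0 1 :: 'a set))) {} (2 * c - w)"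
proof -
  have 1: "(sphere 0 1 - {a}) \<union> (sphere 0 1 - {b}) = sphere 0 1"
    "(sphere 0 1 - {a}) \<inter> (sphere 0 1 - {b}) = sphere 0 1 - {a, b}" using assms by auto
  have o: "openin (top_of_set (sphere 0 1)) (sphere 0 1 - {d})" for d :: 'a
    unfolding Diff_eq by (intro openin_open_Int open_Compl closed_singleton)
  have "has_chi (prod_topology X (top_of_set ((sphere 0 1 - {a}) \<union> (sphere 0 1 - {b})))) {} (c + c - w)"
  proof (rule has_chi_prod_set_union)
    show "has_chi (prod_topology X (top_of_set (sphere 0 1 - {a}))) {} c"
      "has_chi (prod_topology X (top_of_set (sphere 0 1 - {b}))) {} c"
      by (intro has_chi_prod_contractible_set assms(5) contractible_punctured_sphere assms)+
  qed (use assms(6) o in \<open>simp_all only: 1\<close>)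
  thus ?thesis by (simp add: 1)
qed

text \<open>Without 1 and -1 the circle is two open arcs, each mapped homeomorphically to an
  interval by the real part; \<open>sphere_cover\<close> then gives 2c - 2c.\<close>

lemma has_chi_prod_circle:
  assumes "has_chi X {} c"
  shows "has_chi (prod_topology X (top_of_set (sphere 0 1 :: complex set))) {} 0"
proof -
  define U where "U = {z \<in> sphere 0 1. Im z > 0}"
  define V where "V = {z \<in> sphere 0 1. Im z < 0}"
  have UV: "U \<union> V = sphere 0 1 - {1, -1}"
  proof -
    have "z = 1 \<or> z = -1" if "norm z = 1" "Im z = 0" for z
      using that by (auto simp: complex_eq_iff cmod_def)
    thus ?thesis by (fastforce simp: U_def V_def)
  qed
  have sq: "sqrt (1 - (Re z)\<^sup>2) = \<bar>Im z\<bar>" "\<bar>Re z\<bar> < 1" if "norm z = 1" "Im z ~= 0" for z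
  proof -
    have *: "(Re z)\<^sup>2 + (Im z)\<^sup>2 = 1" using that(1) by (simp add: cmod_def)
    hence "1 - (Re z)\<^sup>2 = (Im z)\<^sup>2" by simp
    thus "sqrt (1 - (Re z)\<^sup>2) = \<bar>Im z\<bar>" by simp
    have "(Im z)\<^sup>2 > 0" using that(2) by simp
    with * have "(Re z)\<^sup>2 < 1" by linarith
    thus "\<bar>Re z\<bar> < 1" by (simp add: abs_square_less_1)
  qed
  have sq1: "x\<^sup>2 < 1" if "-1 < x" "x < 1" for x :: real
    using that by (simp add: abs_square_less_1)
  have half: "{z \<in> sphere 0 1. s * Im z > 0} homeomorphic {-1<..<1::real}" if "s = 1 \<or> s = -1" for s :: real
  proof (rule homeomorphic_by_witness)
    let ?g = "\<lambda>x. Complex x (s * sqrt (1 - x\<^sup>2))"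
    show "continuous_on {z \<in> sphere 0 1. 0 < s * Im z} Re" by (intro continuous_intros)
    show "continuous_on {-1<..<1} ?g" unfolding Complex_eq by (intro continuous_intros)
    show "Re z \<in> {-1<..<1} \<and> ?g (Re z) = z" if "z \<in> {z \<in> sphere 0 1. 0 < s * Im z}" for z
      using sq[of z] that \<open>s = 1 \<or> s = -1\<close> by (auto simp: complex_eq_iff)
    show "?g x \<in> {z \<in> sphere 0 1. 0 < s * Im z} \<and> Re (?g x) = x" if "x \<in> {-1<..<1}" for x
      using sq1[of x] that \<open>s = 1 \<or> s = -1\<close> by (auto simp: cmod_def)
  qed
  have I: "has_chi (prod_topology X (top_of_set {-1<..<1::real})) {} c"
    by (rule has_chi_prod_contractible_set[OF assms]) (auto intro: convex_imp_contractible)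
  have "U homeomorphic {-1<..<1::real}" "V homeomorphic {-1<..<1::real}"
    using half[of 1] half[of "-1"] by (simp_all add: U_def V_def)
  hence u: "has_chi (prod_topology X (top_of_set U)) {} c" and v: "has_chi (prod_topology X (top_of_set V)) {} c"
    using has_chi_prod_homeomorphic[OF _ I] homeomorphic_sym by blast+
  have "has_chi (prod_topology X (top_of_set (U \<union> V))) {} (c + c - 0)"
  proof (rule has_chi_prod_set_union[OF _ _ u v])
    have "openin (top_of_set (U \<union> V)) ((U \<union> V) \<inter> {z. Im z > 0})"
      "openin (top_of_set (U \<union> V)) ((U \<union> V) \<inter> {z. Im z < 0})"
      by (intro openin_open_Int open_halfspace_Im_gt open_halfspace_Im_lt)+
    moreover have "(U \<union> V) \<inter> {z. Im z > 0} = U" "(U \<union> V) \<inter> {z. Im z < 0} = V"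
      by (auto simp: U_def V_def)
    ultimately show "openin (top_of_set (U \<union> V)) U" "openin (top_of_set (U \<union> V)) V" by simp_all
    have "U \<inter> V = {}" by (auto simp: U_def V_def)
    thus "has_chi (prod_topology X (top_of_set (U \<inter> V))) {} 0"
      by (intro has_chi_empty) simp
  qed
  hence "has_chi (prod_topology X (top_of_set (sphere 0 1 - {1, -1 :: complex}))) {} (2 * c)"
    by (simp add: UV)
  from sphere_cover[OF _ _ _ _ assms this] show ?thesis by simp
qed

text \<open>A complex coordinate and a height: the model of the complex projective line in which the
  two coordinate lines are the poles.\<close>

abbreviation S2 :: "(complex \<times> real) set" where "S2 \<equiv> sphere 0 1"

lemma S2_iff: "(z, t) \<in> S2 \<longleftrightarrow> (cmod z)\<^sup>2 + t\<^sup>2 = 1"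
  by (simp add: norm_Pair)

text \<open>Without its poles the sphere is a circle times an interval, which contributes 0, so
  \<open>sphere_cover\<close> gives 2c.\<close>

lemma has_chi_prod_S2:
  assumes "has_chi X {} c"
  shows "has_chi (prod_topology X (top_of_set S2)) {} (2 * c)"
proof -
  let ?N = "(0, 1) :: complex \<times> real" and ?S = "(0, -1) :: complex \<times> real"
  let ?C = "sphere 0 1 :: complex set" and ?I = "{-1<..<1::real}"
  have *: "cmod z > 0" "t\<^sup>2 < 1" "-1 < t" "t < 1" "sqrt (1 - t\<^sup>2) = cmod z"
    if "(z, t) \<in> S2 - {?N, ?S}" for z t
  proof -
    have 1: "(cmod z)\<^sup>2 + t\<^sup>2 = 1" using that S2_iff[of z t] by blast
    have "z ~= 0" using that 1 by (auto simp: power2_eq_1_iff)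
    thus "cmod z > 0" by simp
    hence "(cmod z)\<^sup>2 > 0" by simp
    with 1 show t: "t\<^sup>2 < 1" by linarith
    hence "\<bar>t\<bar> < 1" by (simp add: abs_square_less_1)
    thus "-1 < t" "t < 1" by linarith+
    have "1 - t\<^sup>2 = (cmod z)\<^sup>2" using 1 by simp
    thus "sqrt (1 - t\<^sup>2) = cmod z" by simp
  qed
  have "(?C \<times> ?I) homeomorphic (S2 - {?N, ?S})"
  proof (rule homeomorphic_by_witness)
    let ?f = "\<lambda>p :: complex \<times> real. (of_real (sqrt (1 - (snd p)\<^sup>2)) * fst p, snd p)"
    let ?g = "\<lambda>p :: complex \<times> real. (fst p / of_real (cmod (fst p)), snd p)"
    show "continuous_on (?C \<times> ?I) ?f" by (intro continuous_intros)
    show "continuous_on (S2 - {?N, ?S}) ?g"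
      by (intro continuous_intros) (use *(1) in fastforce)
    show "?f p \<in> S2 - {?N, ?S} \<and> ?g (?f p) = p" if pCI: "p \<in> ?C \<times> ?I" for p
    proof -
      obtain z t where p: "p = (z, t)" "cmod z = 1" "-1 < t" "t < 1" using pCI by auto
      hence t: "t\<^sup>2 < 1" by (simp add: abs_square_less_1)
      have "(cmod (of_real (sqrt (1 - t\<^sup>2)) * z))\<^sup>2 + t\<^sup>2 = 1" using p t by (simp add: norm_mult power_mult_distrib)
      hence "?f p \<in> S2" using p S2_iff by simp
      moreover have "z ~= 0" using p by auto
      ultimately show ?thesis using p t by (auto simp: norm_mult)
    qed
    show "?g p \<in> ?C \<times> ?I \<and> ?f (?g p) = p" if "p \<in> S2 - {?N, ?S}" for p
    proof -
      obtain z t where p: "p = (z, t)" by (cases p)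
      show ?thesis using *[of z t] that unfolding p by (auto simp: norm_divide)
    qed
  qed
  moreover have "has_chi (prod_topology X (top_of_set (?C \<times> ?I))) {} 0"
  proof -
    have "has_chi (prod_topology (prod_topology X (top_of_set ?C)) (top_of_set ?I)) {} 0"
      by (rule has_chi_prod_contractible_set[OF has_chi_prod_circle[OF assms]])
        (auto intro: convex_imp_contractible)
    moreover have "prod_topology (prod_topology X (top_of_set ?C)) (top_of_set ?I) homeomorphic_space
        prod_topology X (top_of_set (?C \<times> ?I))"
      using prod_topology_assoc[of X "top_of_set ?C" "top_of_set ?I"] by simp
    ultimately show ?thesis by (rule has_chi_homeomorphic[rotated])
  qed
  ultimately have "has_chi (prod_topology X (top_of_set (S2 - {?N, ?S}))) {} 0"
    by (rule has_chi_prod_homeomorphic)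
  from sphere_cover[OF _ _ _ _ assms this] show ?thesis by (simp add: norm_Pair)
qed

section \<open>Systems of equations between points of a sphere\<close>

definition pole :: "bool => complex \<times> real" where "pole b = (0, if b then 1 else -1)"

lemma norm_pole [simp]: "norm (pole b) = 1" by (simp add: pole_def norm_Pair)

lemma pole_in_S2: "pole b \<in> S2" by simp

lemma pole_inj [simp]: "pole b = pole b' \<longleftrightarrow> b = b'" by (simp add: pole_def)

primrec eval_term :: "('v => complex \<times> real) => 'v + bool => complex \<times> real" where
  "eval_term l (Inl v) = l v"
| "eval_term l (Inr b) = pole b"

definition sols :: "'v set => (('v + bool) \<times> ('v + bool)) set => ('v => complex \<times> real) set" where
  "sols V E = {l \<in> V \<rightarrow>\<^sub>E S2. \<forall>(s, t) \<in> E. eval_term l s = eval_term l t}"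

text \<open>For the systems that come from Grassmannians, these solutions are the coordinate
  subrepresentations.\<close>

definition pole_sols :: "'v set => (('v + bool) \<times> ('v + bool)) set => ('v => complex \<times> real) set" where
  "pole_sols V E = {l \<in> sols V E. \<forall>v\<in>V. \<exists>b. l v = pole b}"

definition sol_space :: "'v set => (('v + bool) \<times> ('v + bool)) set => ('v => complex \<times> real) topology" where
  "sol_space V E = subtopology (product_topology (\<lambda>_. top_of_set S2) V) (sols V E)"

lemma topspace_sol_space [simp]: "topspace (sol_space V E) = sols V E"
  by (auto simp: sol_space_def sols_def)

lemma continuous_map_into_sol_space:
  "continuous_map X (sol_space V E) f \<longleftrightarrow>
     f \<in> topspace X \<rightarrow> sols V E \<and> (\<forall>v\<in>V. continuous_map X (top_of_set S2) (\<lambda>x. f x v))"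
  by (auto simp: sols_def PiE_def sol_space_def continuous_map_in_subtopology continuous_map_componentwise)

lemma continuous_map_sol_space_component:
  "v \<in> V ==> continuous_map (sol_space V E) (top_of_set S2) (\<lambda>l. l v)"
  unfolding sol_space_def
  by (rule continuous_map_from_subtopology) (rule continuous_map_product_projection)

lemma has_chi_bij_pole_sols:
  assumes "homeomorphic_maps (sol_space V E) (sol_space V' E') f g"
    and "\<And>l. l \<in> pole_sols V E ==> f l \<in> pole_sols V' E'"
    and "\<And>l. l \<in> pole_sols V' E' ==> g l \<in> pole_sols V E"
    and "has_chi (sol_space V' E') {} (int (card (pole_sols V' E')))"
  shows "has_chi (sol_space V E) {} (int (card (pole_sols V E)))"
proof -
  have "bij_betw f (pole_sols V E) (pole_sols V' E')"
    by (rule bij_betw_byWitness[where f' = g])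
      (use assms(1-3) in \<open>auto simp: homeomorphic_maps_def pole_sols_def\<close>)
  hence "card (pole_sols V E) = card (pole_sols V' E')" by (rule bij_betw_same_card)
  moreover have "sol_space V' E' homeomorphic_space sol_space V E"
    using assms(1) homeomorphic_maps_imp_homeomorphic_space homeomorphic_space_sym by blast
  ultimately show ?thesis using has_chi_homeomorphic assms(4) by metis
qed

abbreviation terms :: "'v set => ('v + bool) set" where
  "terms V \<equiv> {s. \<forall>v. s = Inl v --> v \<in> V}"

definition over :: "'v set => (('v + bool) \<times> ('v + bool)) set => bool" where
  "over V E \<longleftrightarrow> (\<forall>(s, t) \<in> E. s \<in> terms V \<and> t \<in> terms V)"

text \<open>Induction on the unknowns. If an equation expresses \<open>v\<close> by another term,
  substituting it is a homeomorphism that preserves solutions by poles. Otherwise the point at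
  \<open>v\<close> is free, and both the Euler characteristic and the number of solutions by poles
  are doubled.\<close>

theorem has_chi_sol_space:
  assumes "finite V" "over V E"
  shows "has_chi (sol_space V E) {} (int (card (pole_sols V E)))"
  using assms
proof (induction V arbitrary: E rule: finite_induct)
  case empty
  have 1: "sols {} E \<subseteq> {\<lambda>_. undefined}" by (auto simp: sols_def)
  have 2: "pole_sols {} E = sols {} E" by (auto simp: pole_sols_def)
  show ?case
  proof (cases "sols {} E = {}")
    case True
    thus ?thesis by (simp add: 2 has_chi_empty)
  next
    case False
    with 1 have "sols {} E = {\<lambda>_. undefined}" by auto
    thus ?thesis by (simp add: 2 has_chi_singleton)
  qed
next
  case (insert v V)
  have ext: "l \<in> extensional (insert v V)" if "l \<in> sols (insert v V) E" for l
    using that by (auto simp: sols_def PiE_def)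
  show ?case
  \<comment> \<open>An equation of a term with itself carries no information, so only equations
    relating \<open>v\<close> to a different term count here.\<close>
  proof (cases "\<exists>(s, t) \<in> E. s ~= t \<and> (s = Inl v \<or> t = Inl v)")
    case True
    then obtain u where u: "(Inl v, u) \<in> E \<or> (u, Inl v) \<in> E" "u ~= Inl v" by auto
    hence uV: "u \<in> terms V" using insert.prems by (auto simp: over_def)
    define sub where "sub s = (if s = Inl v then u else s)" for s
    define E' where "E' = (\<lambda>(s, t). (sub s, sub t)) ` E"
    have sV: "sub s \<in> terms V" if "(s, t) \<in> E \<or> (t, s) \<in> E" for s t
    proof -
      have "s \<in> terms (insert v V)" using that insert.prems unfolding over_def by blast
      thus ?thesis using uV by (cases "s = Inl v") (auto simp: sub_def)
    qed
    have oE': "over V E'" unfolding over_def using E'_def sV by auto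
    define f where "f l = restrict l V" for l :: "'a => complex \<times> real"
    define g where "g l = l(v := eval_term l u)" for l
    have ev_g: "eval_term (g l) s = eval_term l (sub s)" for l s
      using u(2) by (cases s) (auto simp: g_def sub_def)
    have ev_f: "eval_term (f l) s = eval_term l s" if "s \<in> terms V" for l s
      using that by (cases s) (auto simp: f_def)
    have lv: "l v = eval_term l u" if "l \<in> sols (insert v V) E" for l
      using that u(1) by (auto simp: sols_def split: prod.splits)
    have ev_sub: "eval_term l (sub s) = eval_term l s" if "l \<in> sols (insert v V) E" for l s
      using lv[OF that] by (auto simp: sub_def)
    have f: "f l \<in> sols V E'" if l: "l \<in> sols (insert v V) E" for l
    proof -
      have "eval_term (f l) s = eval_term (f l) t" if "(s, t) \<in> E'" for s t
      proof -
        obtain s' t' where st: "(s', t') \<in> E" "s = sub s'" "t = sub t'" using \<open>(s, t) \<in> E'\<close> by (auto simp: E'_def)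
        hence "eval_term (f l) s = eval_term l s'" "eval_term (f l) t = eval_term l t'"
          using ev_f sV[of s' t'] sV[of t' s'] ev_sub[OF l] by auto
        thus ?thesis using st(1) l by (auto simp: sols_def)
      qed
      thus ?thesis using l by (auto simp: sols_def f_def)
    qed
    have uS: "eval_term l u \<in> S2" if "l \<in> sols V E'" for l
      using that uV by (cases u) (auto simp: sols_def PiE_iff)
    have g: "g l \<in> sols (insert v V) E" if l: "l \<in> sols V E'" for l
    proof -
      have "eval_term (g l) s = eval_term (g l) t" if "(s, t) \<in> E" for s t
        using l that by (auto simp: ev_g sols_def E'_def)
      moreover have "g l \<in> insert v V \<rightarrow>\<^sub>E S2"
        using l uS[OF l] by (auto simp: g_def sols_def PiE_iff extensional_def simp del: mem_sphere_0)
      ultimately show ?thesis by (auto simp: sols_def)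
    qed
    have gf: "g (f l) = l" if "l \<in> sols (insert v V) E" for l
      using ev_f[OF uV, of l] lv[OF that] ext[OF that]
      by (auto simp: g_def f_def extensional_def fun_eq_iff)
    have fg: "f (g l) = l" if "l \<in> sols V E'" for l
      using that insert.hyps by (auto simp: g_def f_def sols_def fun_eq_iff PiE_iff extensional_def)
    show ?thesis
    proof (rule has_chi_bij_pole_sols[of _ _ V E' f g, OF _ _ _ insert.IH[OF oE']])
      have "continuous_map (sol_space V E') (top_of_set S2) (\<lambda>l. eval_term l u)"
        using uV by (cases u) (auto intro: continuous_map_sol_space_component)
      hence "continuous_map (sol_space V E') (sol_space (insert v V) E) g"
        unfolding continuous_map_into_sol_space
        using g insert.hyps by (auto simp: g_def intro: continuous_map_sol_space_component)
      moreover have "continuous_map (sol_space (insert v V) E) (sol_space V E') f"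
        unfolding continuous_map_into_sol_space
        using f by (auto simp: f_def intro: continuous_map_sol_space_component)
      ultimately show "homeomorphic_maps (sol_space (insert v V) E) (sol_space V E') f g"
        using fg gf by (simp add: homeomorphic_maps_def)
      show "f l \<in> pole_sols V E'" if "l \<in> pole_sols (insert v V) E" for l
        using that f by (auto simp: pole_sols_def f_def)
      show "g l \<in> pole_sols (insert v V) E" if l: "l \<in> pole_sols V E'" for l
      proof -
        have "\<exists>b. eval_term l u = pole b" using l uV by (cases u) (auto simp: pole_sols_def)
        thus ?thesis using l g by (auto simp: pole_sols_def g_def)
      qed
    qed
  next
    case False
    \<comment> \<open>At this point only trivial equations mention \<open>v\<close>; dropping them
      does not change the solutions.\<close>
    define E' where "E' = {(s, t) \<in> E. s ~= Inl v \<and> t ~= Inl v}"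
    have oE': "over V E'" using insert.prems by (fastforce simp: over_def E'_def)
    have E': "(s, t) \<in> E \<longleftrightarrow> (s, t) \<in> E' \<or> s = Inl v \<and> t = Inl v \<and> (Inl v, Inl v) \<in> E" for s t
      using False by (auto simp: E'_def)
    have sV: "s \<in> terms V" "t \<in> terms V" if "(s, t) \<in> E'" for s t
      using oE' that unfolding over_def by blast+
    define f where "f l = (restrict l V, l v)" for l :: "'a => complex \<times> real"
    define g where "g p = (fst p)(v := snd p)" for p :: "('a => complex \<times> real) \<times> complex \<times> real"
    have ev: "eval_term (restrict l V) s = eval_term l s" if "s \<in> terms V" for l s
      using that by (cases s) auto
    have ev': "eval_term (l(v := x)) s = eval_term l s" if "s \<in> terms V" for l s x
      using that insert.hyps by (cases s) auto
    have f: "restrict l V \<in> sols V E' \<and> l v \<in> S2" if l: "l \<in> sols (insert v V) E" for l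
    proof -
      have "eval_term (restrict l V) s = eval_term (restrict l V) t" if st: "(s, t) \<in> E'" for s t
      proof -
        have "(s, t) \<in> E" using st E' by blast
        hence "eval_term l s = eval_term l t" using l by (auto simp: sols_def)
        thus ?thesis using ev[OF sV(1)[OF st]] ev[OF sV(2)[OF st]] by simp
      qed
      thus ?thesis using l by (auto simp: sols_def PiE_iff)
    qed
    have g: "l(v := x) \<in> sols (insert v V) E" if l: "l \<in> sols V E'" "x \<in> S2" for l x
    proof -
      have "eval_term (l(v := x)) s = eval_term (l(v := x)) t" if "(s, t) \<in> E" for s t
      proof (cases "(s, t) \<in> E'")
        case True
        hence "eval_term l s = eval_term l t" using l(1) by (auto simp: sols_def)
        thus ?thesis using ev'[OF sV(1)[OF True]] ev'[OF sV(2)[OF True]] by simp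
      next
        case False
        thus ?thesis using E'[of s t] that by auto
      qed
      moreover have "l(v := x) \<in> insert v V \<rightarrow>\<^sub>E S2"
        using l by (auto simp: sols_def PiE_iff extensional_def)
      ultimately show ?thesis unfolding sols_def by blast
    qed
    have gf: "g (f l) = l" if "l \<in> sols (insert v V) E" for l
      using ext[OF that] by (auto simp: g_def f_def extensional_def fun_eq_iff)
    have fg: "f (g p) = p" if "fst p \<in> sols V E'" for p
      using that insert.hyps by (cases p) (auto simp: g_def f_def sols_def fun_eq_iff PiE_iff extensional_def)
    have fS: "f l \<in> sols V E' \<times> S2" if "l \<in> sols (insert v V) E" for l
      using f[OF that] by (simp add: f_def)
    have gS: "g p \<in> sols (insert v V) E" if "p \<in> sols V E' \<times> S2" for p
      using g that by (cases p) (simp add: g_def)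
    have "continuous_map (sol_space (insert v V) E) (sol_space V E') (\<lambda>l. restrict l V)"
      unfolding continuous_map_into_sol_space
      using f by (auto simp del: mem_sphere_0 intro: continuous_map_sol_space_component)
    hence "continuous_map (sol_space (insert v V) E) (prod_topology (sol_space V E') (top_of_set S2)) f"
      unfolding f_def
      by (intro continuous_map_pairedI) (auto intro: continuous_map_sol_space_component)
    moreover have "continuous_map (prod_topology (sol_space V E') (top_of_set S2)) (sol_space (insert v V) E) g"
    proof -
      have "continuous_map (prod_topology (sol_space V E') (top_of_set S2)) (top_of_set S2) (\<lambda>p. g p w)"
        if "w \<in> insert v V" for w
      proof (cases "w = v")
        case True
        thus ?thesis by (simp add: g_def continuous_map_snd)
      next
        case False
        hence "continuous_map (sol_space V E') (top_of_set S2) (\<lambda>l. l w)"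
          using that by (intro continuous_map_sol_space_component) auto
        from continuous_map_compose[OF continuous_map_fst this]
        show ?thesis using False by (simp add: g_def comp_def)
      qed
      thus ?thesis unfolding continuous_map_into_sol_space
        using gS by (auto simp del: mem_sphere_0)
    qed
    ultimately have "homeomorphic_maps (prod_topology (sol_space V E') (top_of_set S2)) (sol_space (insert v V) E) g f"
      using fg gf by (auto simp: homeomorphic_maps_def simp del: mem_sphere_0)
    hence h: "prod_topology (sol_space V E') (top_of_set S2) homeomorphic_space sol_space (insert v V) E"
      by (rule homeomorphic_maps_imp_homeomorphic_space)
    have "bij_betw f (pole_sols (insert v V) E) (pole_sols V E' \<times> range pole)"
    proof (rule bij_betw_byWitness[where f' = g])
      show "f ` pole_sols (insert v V) E \<subseteq> pole_sols V E' \<times> range pole"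
        using fS by (fastforce simp: pole_sols_def f_def simp del: mem_sphere_0)
      show "g ` (pole_sols V E' \<times> range pole) \<subseteq> pole_sols (insert v V) E"
        using g[OF _ pole_in_S2] by (auto simp: pole_sols_def g_def simp del: mem_sphere_0)
      show "\<forall>l\<in>pole_sols (insert v V) E. g (f l) = l" using gf by (auto simp: pole_sols_def)
      show "\<forall>p\<in>pole_sols V E' \<times> range pole. f (g p) = p" using fg by (auto simp: pole_sols_def)
    qed
    hence "card (pole_sols (insert v V) E) = card (pole_sols V E' \<times> range pole)"
      by (rule bij_betw_same_card)
    also have "\<dots> = 2 * card (pole_sols V E')"
      by (simp add: UNIV_bool card_cartesian_product)
    finally have "int (card (pole_sols (insert v V) E)) = 2 * int (card (pole_sols V E'))" by simp
    with has_chi_homeomorphic[OF h has_chi_prod_S2[OF insert.IH[OF oE']]] show ?thesis by simp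
  qed
qed

section \<open>Coordinate subspaces\<close>

interpretation cvs: vector_space cscale by (rule vector_space_cscale)

definition unit_vec :: "'x => 'x => complex" where
  "unit_vec k = (\<lambda>i. if i = k then 1 else 0)"

definition coord_space :: "'x set => ('x => complex) set" where
  "coord_space A = {x. \<forall>k. x k ~= 0 --> k \<in> A}"

lemma sum_fun_apply: "(\<Sum>a\<in>A. f a) x = (\<Sum>a\<in>A. f a x :: 'b::comm_monoid_add)"
  by (induction A rule: infinite_finite_induct) (auto simp: zero_fun_def plus_fun_def)

lemma cscale_apply [simp]: "cscale c f x = c * f x" by (simp add: cscale_def)

lemma csubspace_coord_space: "csubspace (coord_space A)"
proof (rule cvs.subspaceI)
  show "x + y \<in> coord_space A" if "x \<in> coord_space A" "y \<in> coord_space A" for x y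
  proof -
    have "k \<in> A" if "x k + y k ~= 0" for k
      using that \<open>x \<in> coord_space A\<close> \<open>y \<in> coord_space A\<close>
      by (cases "x k = 0") (auto simp: coord_space_def)
    thus ?thesis by (auto simp: coord_space_def plus_fun_def)
  qed
qed (auto simp: coord_space_def zero_fun_def)

lemma inj_unit_vec: "inj (unit_vec :: 'x => _)"
proof (rule injI)
  fix x y :: 'x assume "unit_vec x = unit_vec y"
  hence "unit_vec x x = unit_vec y x" by simp
  thus "x = y" by (simp add: unit_vec_def split: if_splits)
qed

lemma coord_space_expand:
  assumes "finite A" "x \<in> coord_space A"
  shows "x = (\<Sum>k\<in>A. cscale (x k) (unit_vec k))"
proof
  fix i
  have "(\<Sum>k\<in>A. x k * (if i = k then 1 else 0)) = x i"
    using assms by (auto simp: coord_space_def if_distrib[of "\<lambda>c. _ * c"] sum.delta cong: if_cong)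
  thus "x i = (\<Sum>k\<in>A. cscale (x k) (unit_vec k)) i"
    by (simp add: sum_fun_apply unit_vec_def)
qed

lemma span_unit_vecs: "finite A ==> cspan (unit_vec ` A) = coord_space A"
proof
  assume A: "finite A"
  have "unit_vec ` A \<subseteq> coord_space A" by (auto simp: coord_space_def unit_vec_def split: if_splits)
  thus "cspan (unit_vec ` A) \<subseteq> coord_space A"
    by (rule cvs.span_minimal[OF _ csubspace_coord_space])
  show "coord_space A \<subseteq> cspan (unit_vec ` A)"
  proof
    fix x assume "x \<in> coord_space A"
    hence "x = (\<Sum>k\<in>A. cscale (x k) (unit_vec k))" by (rule coord_space_expand[OF A])
    also have "\<dots> \<in> cspan (unit_vec ` A)"
      by (intro cvs.span_sum cvs.span_scale cvs.span_base) auto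
    finally show "x \<in> cspan (unit_vec ` A)" .
  qed
qed

lemma independent_unit_vecs: "finite A ==> cvs.independent (unit_vec ` A)"
proof (rule cvs.independent_if_scalars_zero)
  assume A: "finite A"
  fix f v assume f: "(\<Sum>x\<in>unit_vec ` A. cscale (f x) x) = 0" and "v \<in> unit_vec ` A"
  then obtain k where k: "k \<in> A" "v = unit_vec k" by auto
  have "0 = (\<Sum>x\<in>unit_vec ` A. cscale (f x) x) k" using f by simp
  also have "\<dots> = (\<Sum>i\<in>A. f (unit_vec i) * unit_vec i k)"
    by (simp add: sum_fun_apply sum.reindex[OF inj_on_subset[OF inj_unit_vec subset_UNIV]])
  also have "\<dots> = f (unit_vec k)"
    using A k(1) by (auto simp: unit_vec_def if_distrib[of "\<lambda>c. _ * c"] sum.delta cong: if_cong)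
  finally show "f v = 0" using k(2) by simp
qed simp

lemma cdim_coord_space: "finite A ==> cdim (coord_space A) = card A"
  using cvs.dim_span_eq_card_independent[OF independent_unit_vecs] span_unit_vecs
  by (metis card_image inj_on_subset inj_unit_vec subset_UNIV)

lemma subspace_coord_basis:
  assumes "finite A" "csubspace N" "N \<subseteq> coord_space A"
  obtains B where "finite B" "cvs.independent B" "cspan B = N" "card B = cdim N" "card B <= card A" "B \<subseteq> N"
proof -
  obtain B where B: "B \<subseteq> N" "cvs.independent B" "N \<subseteq> cspan B" "card B = cdim N"
    using cvs.basis_exists by metis
  have "B \<subseteq> cspan (unit_vec ` A)" using B(1) assms span_unit_vecs by blast
  from cvs.independent_span_bound[OF _ B(2) this] assms(1)
  have "finite B" "card B <= card (unit_vec ` A)" by auto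
  moreover have "card (unit_vec ` A) = card A"
    by (rule card_image) (rule inj_on_subset[OF inj_unit_vec subset_UNIV])
  moreover have "cspan B = N"
    using cvs.span_minimal[OF B(1) assms(2)] B(3) by blast
  ultimately show ?thesis using B by (intro that[of B]) auto
qed

lemma subspace_dim_0:
  assumes "finite A" "csubspace N" "N \<subseteq> coord_space A" "cdim N = 0"
  shows "N = {0}"
proof -
  obtain B where B: "finite B" "cspan B = N" "card B = cdim N"
    using subspace_coord_basis[OF assms(1-3)] by metis
  hence "B = {}" using assms(4) by simp
  thus ?thesis using B(2) cvs.span_empty by simp
qed

lemma subspace_dim_1:
  assumes "finite A" "csubspace N" "N \<subseteq> coord_space A" "cdim N = 1"
  obtains x where "x ~= 0" "N = cspan {x}"
proof -
  obtain B where B: "cvs.independent B" "cspan B = N" "card B = cdim N"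
    using subspace_coord_basis[OF assms(1-3)] by metis
  then obtain x where x: "B = {x}" using assms(4) card_1_singletonE by metis
  hence "x ~= 0" using B(1) cvs.dependent_zero by blast
  with x B that show ?thesis by blast
qed

lemma subspace_dim_full:
  assumes "finite A" "csubspace N" "N \<subseteq> coord_space A" "cdim N = card A"
  shows "N = coord_space A"
proof -
  obtain B where B: "finite B" "cvs.independent B" "cspan B = N" "card B = cdim N" "B \<subseteq> N"
    using subspace_coord_basis[OF assms(1-3)] by metis
  have "B \<subseteq> cspan (unit_vec ` A)" using B(5) assms span_unit_vecs by blast
  have fin: "finite (unit_vec ` A)" using assms(1) by simp
  have "x \<in> N" if x: "x \<in> coord_space A" for x
  proof (rule ccontr)
    assume "x \<notin> N"
    hence "x \<notin> cspan B" "x \<notin> B" using B(3,5) by auto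
    hence "cvs.independent (insert x B)" using B(2) by (simp add: cvs.independent_insert)
    moreover have "insert x B \<subseteq> cspan (unit_vec ` A)"
      using x \<open>B \<subseteq> cspan (unit_vec ` A)\<close> span_unit_vecs[OF assms(1)] by simp
    ultimately have "card (insert x B) <= card (unit_vec ` A)"
      using cvs.independent_span_bound[OF fin] by blast
    thus False
      using card_image_le[OF assms(1), of unit_vec] B(1,4) assms(4) \<open>x \<notin> B\<close> by simp
  qed
  thus ?thesis using assms(3) by blast
qed

lemma cspan_singleton: "cspan {x} = range (\<lambda>c. cscale c x)"
  by (rule cvs.span_singleton)

lemma cdim_span_singleton: "x ~= 0 ==> cdim (cspan {x}) = 1"
  using cvs.dim_span_eq_card_independent[of "{x}"] cvs.independent_insert[of x "{}"] cvs.independent_empty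
  by (simp add: cvs.span_empty)

section \<open>Lines in a plane as points of a sphere\<close>

text \<open>For y = (z, t) the vector (a, b) is fixed by the Hermitian matrix with rows (t, z) and
  (cnj z, -t). Each of the two equations degenerates at one pole, where the other determines the
  line.\<close>

definition on_line :: "complex \<times> real => complex => complex => bool" where
  "on_line y a b \<longleftrightarrow> (1 - of_real (snd y)) * a = fst y * b \<and> cnj (fst y) * a = (1 + of_real (snd y)) * b"

text \<open>The Hopf map, sending a nonzero vector to the point of the sphere that represents its
  line.\<close>

definition line_pt :: "complex => complex => complex \<times> real" where
  "line_pt a b = (2 * a * cnj b / of_real ((cmod a)\<^sup>2 + (cmod b)\<^sup>2),
     ((cmod a)\<^sup>2 - (cmod b)\<^sup>2) / ((cmod a)\<^sup>2 + (cmod b)\<^sup>2))"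

lemma norm_sq_pos: "a ~= 0 \<or> b ~= 0 ==> (cmod a)\<^sup>2 + (cmod b)\<^sup>2 > 0"
  by (metis add_cancel_left_right add_nonneg_pos add_pos_nonneg norm_ge_zero zero_le_power2 zero_less_norm_iff zero_less_power)

lemma line_pt_in_S2:
  assumes "a ~= 0 \<or> b ~= 0"
  shows "line_pt a b \<in> S2"
proof -
  let ?s = "(cmod a)\<^sup>2 + (cmod b)\<^sup>2"
  have s: "?s > 0" by (rule norm_sq_pos[OF assms])
  have "cmod (2 * a * cnj b / of_real ?s) = 2 * cmod a * cmod b / ?s"
    unfolding norm_divide norm_of_real using s by (simp add: norm_mult)
  moreover have "(2 * cmod a * cmod b / ?s)\<^sup>2 + (((cmod a)\<^sup>2 - (cmod b)\<^sup>2) / ?s)\<^sup>2 = 1"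
  proof -
    have "(2 * cmod a * cmod b)\<^sup>2 + ((cmod a)\<^sup>2 - (cmod b)\<^sup>2)\<^sup>2 = ?s\<^sup>2"
      by (simp add: power2_eq_square algebra_simps)
    moreover have "?s\<^sup>2 ~= 0" using s by (metis less_irrefl power_not_zero)
    ultimately show ?thesis unfolding power_divide add_divide_distrib[symmetric] by (metis divide_self)
  qed
  ultimately show ?thesis unfolding line_pt_def S2_iff by simp
qed

lemma on_line_iff:
  assumes ab: "a ~= 0 \<or> b ~= 0"
  shows "on_line y a b \<longleftrightarrow> y = line_pt a b"
proof -
  let ?s = "(cmod a)\<^sup>2 + (cmod b)\<^sup>2"
  have s: "?s > 0" by (rule norm_sq_pos[OF assms])
  have A: "a * cnj a = of_real ((cmod a)\<^sup>2)" and B: "b * cnj b = of_real ((cmod b)\<^sup>2)"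
    by (rule complex_norm_square[symmetric])+
  obtain z t where y: "y = (z, t)" by (cases y)
  have sn: "?s ~= 0" using s by linarith
  hence sc: "(of_real ?s :: complex) ~= 0" using of_real_eq_0_iff by blast
  show ?thesis
  proof
    assume "on_line y a b"
    hence 1: "(1 - of_real t) * a = z * b" and 2: "cnj z * a = (1 + of_real t) * b"
      by (auto simp: on_line_def y)
    \<comment> \<open>Conjugating the second equation makes it comparable with the first one
      multiplied by \<open>cnj a\<close>. This expresses the height by the norms of a and b, and
      then z.\<close>
    have 3: "z * cnj a = (1 + of_real t) * cnj b"
      using arg_cong[OF 2, of cnj] by simp
    have "(1 - of_real t) * (a * cnj a) = ((1 - of_real t) * a) * cnj a" by (simp only: mult.assoc)
    also have "\<dots> = (z * cnj a) * b" unfolding 1 by (simp only: mult_ac)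
    also have "\<dots> = (1 + of_real t) * (b * cnj b)" unfolding 3 by (simp only: mult_ac)
    finally have "of_real ((1 - t) * (cmod a)\<^sup>2) = (of_real ((1 + t) * (cmod b)\<^sup>2) :: complex)"
      unfolding A B by simp
    hence "(1 - t) * (cmod a)\<^sup>2 = (1 + t) * (cmod b)\<^sup>2" using of_real_eq_iff by blast
    hence "t * ?s = (cmod a)\<^sup>2 - (cmod b)\<^sup>2" by (simp add: algebra_simps)
    hence t: "t = ((cmod a)\<^sup>2 - (cmod b)\<^sup>2) / ?s" by (rule eq_divide_imp[OF sn])
    have "z * of_real ?s = (z * cnj a) * a + (z * b) * cnj b"
      unfolding of_real_add A[symmetric] B[symmetric] by (simp add: algebra_simps)
    also have "\<dots> = (1 + of_real t) * cnj b * a + (1 - of_real t) * a * cnj b"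
      unfolding 3 1[symmetric] ..
    also have "\<dots> = 2 * a * cnj b" by (simp add: algebra_simps)
    finally have "z = 2 * a * cnj b / of_real ?s" by (rule eq_divide_imp[OF sc])
    with t show "y = line_pt a b" by (simp add: y line_pt_def)
  next
    assume "y = line_pt a b"
    hence z: "z = 2 * a * cnj b / of_real ?s" and t: "t = ((cmod a)\<^sup>2 - (cmod b)\<^sup>2) / ?s"
      by (auto simp: y line_pt_def)
    have "1 - t = 2 * (cmod b)\<^sup>2 / ?s" "1 + t = 2 * (cmod a)\<^sup>2 / ?s"
    proof -
      have ts: "t * ?s = (cmod a)\<^sup>2 - (cmod b)\<^sup>2" unfolding t by (rule nonzero_eq_divide_eq[OF sn, THEN iffD1]) (rule refl)
      show "1 - t = 2 * (cmod b)\<^sup>2 / ?s"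
        by (rule eq_divide_imp[OF sn]) (use ts in \<open>simp add: left_diff_distrib\<close>)
      show "1 + t = 2 * (cmod a)\<^sup>2 / ?s"
        by (rule eq_divide_imp[OF sn]) (use ts in \<open>simp add: distrib_right\<close>)
    qed
    hence tt: "1 - of_real t = 2 * (b * cnj b) / (of_real ?s :: complex)"
        "1 + of_real t = 2 * (a * cnj a) / (of_real ?s :: complex)"
      unfolding A B by (metis (no_types, lifting) of_real_1 of_real_diff of_real_divide of_real_mult of_real_numeral,
        metis (no_types, lifting) of_real_1 of_real_add of_real_divide of_real_mult of_real_numeral)
    show "on_line y a b" unfolding on_line_def y fst_conv snd_conv tt z by (simp add: algebra_simps)
  qed
qed

lemma on_line_add: "on_line y a b ==> on_line y a' b' ==> on_line y (a + a') (b + b')"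
  unfolding on_line_def by (simp add: distrib_left)

lemma on_line_scale: "on_line y a b ==> on_line y (c * a) (c * b)"
  unfolding on_line_def by (metis mult.left_commute)

lemma on_line_0: "on_line y 0 0" by (simp add: on_line_def)

lemma on_line_proportional:
  assumes "on_line y a b" "on_line y a' b'"
  shows "a * b' = a' * b"
proof -
  let ?t = "complex_of_real (snd y)" and ?z = "fst y"
  have 1: "(1 - ?t) * a = ?z * b" "(1 - ?t) * a' = ?z * b'"
    and 2: "cnj ?z * a = (1 + ?t) * b" "cnj ?z * a' = (1 + ?t) * b'"
    using assms by (auto simp: on_line_def)
  have "(1 - ?t) * (a * b') = ((1 - ?t) * a) * b'" by (simp add: algebra_simps)
  also have "\<dots> = ((1 - ?t) * a') * b" unfolding 1 by simp
  finally have 3: "(1 - ?t) * (a * b' - a' * b) = 0" by (simp add: algebra_simps)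
  have "(1 + ?t) * (a * b') = ((1 + ?t) * b') * a" by (simp add: algebra_simps)
  also have "\<dots> = ((1 + ?t) * b) * a'" unfolding 2[symmetric] by simp
  finally have 4: "(1 + ?t) * (a * b' - a' * b) = 0" by (simp add: algebra_simps)
  \<comment> \<open>The factors add up to 2, which treats both poles at once.\<close>
  from 3 4 have "((1 - ?t) + (1 + ?t)) * (a * b' - a' * b) = 0" by (simp only: distrib_right) simp
  thus ?thesis by simp
qed

text \<open>Two vectors spanning the line of \<open>y\<close>; the first is nonzero away from the south pole, the
  second away from the north pole.\<close>
definition line_vec :: "bool => complex \<times> real => complex \<times> complex" where
  "line_vec s y = (if s then (1 + of_real (snd y), cnj (fst y)) else (fst y, 1 - of_real (snd y)))"

lemma on_line_vec:
  assumes "y \<in> S2"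
  shows "on_line y (fst (line_vec s y)) (snd (line_vec s y))"
proof -
  obtain z t where y: "y = (z, t)" by (cases y)
  have "(cmod z)\<^sup>2 + t\<^sup>2 = 1" using assms S2_iff y by blast
  hence "(cmod z)\<^sup>2 = 1 - t\<^sup>2" by simp
  hence "z * cnj z = 1 - (of_real t)\<^sup>2"
    by (metis complex_norm_square of_real_1 of_real_diff of_real_power)
  thus ?thesis by (auto simp: on_line_def y line_vec_def power2_eq_square algebra_simps)
qed

lemma on_line_pole: "on_line (pole s) a b \<longleftrightarrow> (if s then b = 0 else a = 0)"
  by (auto simp: on_line_def pole_def)

section \<open>Grassmannians of thin string-like representations\<close>

lemma rspace_coord_space: "rspace M v = coord_space {k. k < rdim M \<and> vtx M k = v}"
  by (simp add: rspace_def coord_space_def)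

lemma unit_vec_nonzero: "unit_vec k ~= 0"
proof
  assume "unit_vec k = 0"
  hence "unit_vec k k = 0" by simp
  thus False by (simp add: unit_vec_def)
qed

text \<open>
  Every vertex carries at most two basis vectors, told apart by \<open>\<delta>\<close>. Arrows act by partial
  injections on the basis; between two planes they are zero or respect \<open>\<delta>\<close>, except for loops,
  which have a single off-diagonal entry.
\<close>
locale thin_rep =
  fixes Q :: "('v, 'a) qp" and M :: "('v, 'a) rep" and \<delta> :: "nat => bool"
  assumes finite_verts: "finite (verts Q)"
    and vtx_verts: "k < rdim M ==> vtx M k \<in> verts Q"
    and arrow_verts: "a \<in> arrs Q ==> src Q a \<in> verts Q \<and> tgt Q a \<in> verts Q"
    and ent_01: "a \<in> arrs Q ==> ent M a i k = 0 \<or> ent M a i k = 1"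
    and ent_graded: "a \<in> arrs Q ==> ent M a i k = 1 ==>
        i < rdim M \<and> k < rdim M \<and> vtx M k = src Q a \<and> vtx M i = tgt Q a"
    and ent_inj1: "a \<in> arrs Q ==> ent M a i k = 1 ==> ent M a i' k = 1 ==> i = i'"
    and ent_inj2: "a \<in> arrs Q ==> ent M a i k = 1 ==> ent M a i k' = 1 ==> k = k'"
    and label_inj: "k < rdim M ==> k' < rdim M ==> vtx M k = vtx M k' ==> \<delta> k = \<delta> k' ==> k = k'"
    and ent_planes: "a \<in> arrs Q ==> src Q a ~= tgt Q a ==> ent M a i k = 1 ==>
        dimv M (src Q a) = 2 ==> dimv M (tgt Q a) = 2 ==>
        k' < rdim M ==> i' < rdim M ==> vtx M k' = src Q a ==> vtx M i' = tgt Q a ==>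
        ent M a i' k' = 1 \<longleftrightarrow> \<delta> i' = \<delta> k'"
    and ent_loop: "a \<in> arrs Q ==> src Q a = tgt Q a ==> ent M a i k = 1 ==> i ~= k \<and>
        (\<forall>i' k'. ent M a i' k' = 1 --> i' = i \<and> k' = k)"
begin

definition pos :: "'v => nat set" where "pos v = {k. k < rdim M \<and> vtx M k = v}"

lemma finite_pos [simp]: "finite (pos v)" by (simp add: pos_def)

lemma dimv_pos: "dimv M v = card (pos v)" by (simp add: dimv_def pos_def)

lemma rspace_pos: "rspace M v = coord_space (pos v)" by (simp add: rspace_coord_space pos_def)

lemma pos_label_inj: "k \<in> pos v ==> l \<in> pos v ==> \<delta> k = \<delta> l ==> k = l"
  using label_inj[of k l] by (simp add: pos_def)

definition ord :: "bool => 'v => nat" where "ord b v = (THE k. k \<in> pos v \<and> \<delta> k = b)"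

lemma ord_eq: "k \<in> pos v ==> ord (\<delta> k) v = k"
  unfolding ord_def by (rule the_equality) (auto simp: pos_def label_inj)

lemma plane_pos:
  assumes "card (pos v) = 2"
  shows "ord b v \<in> pos v" "\<delta> (ord b v) = b" "pos v = {ord True v, ord False v}"
proof -
  have "\<exists>k l. pos v = {k, l} \<and> k ~= l" using assms by (simp only: card_2_iff)
  then obtain k l where kl: "pos v = {k, l}" "k ~= l" by (elim exE conjE) (rule that)
  hence kl': "k \<in> pos v" "l \<in> pos v" by simp_all
  hence d: "\<delta> k ~= \<delta> l" using pos_label_inj kl(2) by blast
  have ex: "\<exists>k\<in>pos v. \<delta> k = b" for b
    using d kl' by auto
  have 1: "ord b v \<in> pos v \<and> \<delta> (ord b v) = b" for b
  proof -
    obtain k where "k \<in> pos v" "\<delta> k = b" using ex by blast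
    thus ?thesis using ord_eq[of k v] by simp
  qed
  thus "ord b v \<in> pos v" "\<delta> (ord b v) = b" by simp_all
  have "ord True v ~= ord False v"
  proof
    assume "ord True v = ord False v"
    thus False using 1[of True] 1[of False] by simp
  qed
  thus "pos v = {ord True v, ord False v}" using 1[of True] 1[of False] kl by auto
qed

lemma ord_neq: assumes "card (pos v) = 2" shows "ord True v ~= ord False v"
  using plane_pos assms by fastforce

lemma act_eq:
  assumes "a \<in> arrs Q"
  shows "ent M a i k = 1 ==> act M a x i = x k"
    and "(\<And>k. ent M a i k ~= 1) ==> act M a x i = 0"
proof -
  assume 1: "ent M a i k = 1"
  have "act M a x i = (\<Sum>k'<rdim M. if k' = k then x k else 0)"
    unfolding act_def
  proof (rule sum.cong)
    fix k' assume "k' \<in> {..<rdim M}"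
    show "ent M a i k' * x k' = (if k' = k then x k else 0)"
    proof (cases "k' = k")
      case False
      hence "ent M a i k' ~= 1" using ent_inj2[OF assms 1] by blast
      thus ?thesis using ent_01[OF assms, of i k'] False by simp
    qed (simp add: 1)
  qed simp
  also have "\<dots> = x k" using ent_graded[OF assms 1] by simp
  finally show "act M a x i = x k" .
next
  assume "\<And>k. ent M a i k ~= 1"
  hence "ent M a i k = 0" for k using ent_01[OF assms] by blast
  thus "act M a x i = 0" by (simp add: act_def)
qed

lemma act_0 [simp]: "act M a 0 = 0" by (rule ext) (simp add: act_def)

lemma act_in_rspace: "a \<in> arrs Q ==> act M a x \<in> coord_space (pos (tgt Q a))"
  using act_eq(2) ent_graded by (fastforce simp: coord_space_def pos_def)

lemma act_unit_vec: "a \<in> arrs Q ==> ent M a i k = 1 ==> act M a (unit_vec k) = unit_vec i"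
proof
  fix j assume a: "a \<in> arrs Q" "ent M a i k = 1"
  show "act M a (unit_vec k) j = unit_vec i j"
    by (metis act_eq a ent_inj1 unit_vec_def)
qed

text \<open>The sets of basis vectors that span subrepresentations.\<close>

definition closed_set :: "nat set => bool" where
  "closed_set S \<longleftrightarrow> S \<subseteq> {..<rdim M} \<and> (\<forall>a \<in> arrs Q. \<forall>i k. ent M a i k = 1 --> k \<in> S --> i \<in> S)"

end

locale thin_rep_dim = thin_rep Q M \<delta>
  for Q :: "('v, 'a) qp" and M :: "('v, 'a) rep" and \<delta> +
  fixes e :: "'v => nat"
  assumes e_le: "v \<in> verts Q ==> e v <= dimv M v"
begin

text \<open>At any other vertex a subspace of dimension \<open>e v\<close> is zero or everything, so
  only these vertices carry an unknown point.\<close>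

definition lines :: "'v set" where "lines = {v \<in> verts Q. card (pos v) = 2 \<and> e v = 1}"

lemma finite_lines [simp]: "finite lines" by (simp add: lines_def finite_verts)

lemma linesD: "v \<in> lines ==> v \<in> verts Q" "v \<in> lines ==> card (pos v) = 2" "v \<in> lines ==> e v = 1"
  by (auto simp: lines_def)

lemma not_line: "v \<in> verts Q ==> v \<notin> lines ==> e v = 0 \<or> e v = card (pos v)"
proof -
  assume v: "v \<in> verts Q" "v \<notin> lines"
  have "card (pos v) <= 2"
  proof (rule ccontr)
    assume "\<not> card (pos v) <= 2"
    moreover have "card (\<delta> ` pos v) = card (pos v)"
      by (rule card_image) (auto simp: inj_on_def pos_def label_inj)
    moreover have "card (\<delta> ` pos v) <= card (UNIV :: bool set)" by (rule card_mono) auto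
    ultimately show False by (simp add: card_UNIV_bool)
  qed
  thus ?thesis using e_le[OF v(1)] v by (auto simp: lines_def dimv_pos)
qed

definition line_space :: "'v => complex \<times> real => (nat => complex) set" where
  "line_space v y = {x \<in> coord_space (pos v). on_line y (x (ord True v)) (x (ord False v))}"

definition full_pos :: "'v => nat set" where "full_pos v = (if e v = 0 then {} else pos v)"

lemma finite_full_pos [simp]: "finite (full_pos v)" by (simp add: full_pos_def)

lemma card_full_pos: "v \<in> verts Q ==> v \<notin> lines ==> card (full_pos v) = e v"
  using not_line[of v] by (auto simp: full_pos_def)

definition fibre :: "('v => complex \<times> real) => 'v => (nat => complex) set" where
  "fibre l v = (if v \<in> lines then line_space v (l v) else coord_space (full_pos v))"

lemma line_space_nonzero:
  assumes "v \<in> lines" "x \<in> coord_space (pos v)" "x ~= 0"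
  shows "x (ord True v) ~= 0 \<or> x (ord False v) ~= 0"
proof (rule ccontr)
  assume "\<not> ?thesis"
  hence "x k = 0" for k
    using assms(2) plane_pos(3)[OF linesD(2)[OF assms(1)]] by (auto simp: coord_space_def)
  thus False using assms(3) by (auto simp: fun_eq_iff)
qed

lemma subspace_line_space: "csubspace (line_space v y)"
proof (rule cvs.subspaceI)
  show "x + x' \<in> line_space v y" if "x \<in> line_space v y" "x' \<in> line_space v y" for x x'
    using that cvs.subspace_add[OF csubspace_coord_space] on_line_add by (auto simp: line_space_def plus_fun_def)
  show "cscale c x \<in> line_space v y" if "x \<in> line_space v y" for c x
    using that cvs.subspace_scale[OF csubspace_coord_space] on_line_scale by (auto simp: line_space_def)
  show "0 \<in> line_space v y"
    using cvs.subspace_0[OF csubspace_coord_space] by (auto simp: line_space_def on_line_0 zero_fun_def)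
qed

lemma line_space_eq_span:
  assumes v: "v \<in> lines" and x: "x \<in> line_space v y" "x ~= 0"
  shows "line_space v y = cspan {x}"
proof
  show "cspan {x} \<subseteq> line_space v y"
    by (rule cvs.span_minimal[OF _ subspace_line_space]) (use x in auto)
  show "line_space v y \<subseteq> cspan {x}"
  proof
    fix x' assume x': "x' \<in> line_space v y"
    let ?t = "ord True v" and ?f = "ord False v"
    have P: "pos v = {?t, ?f}" "?t ~= ?f"
      using plane_pos(3)[OF linesD(2)[OF v]] ord_neq[OF linesD(2)[OF v]] .
    have z: "x k = 0 \<and> x' k = 0" if "k \<notin> {?t, ?f}" for k
      using x x' that P by (auto simp: line_space_def coord_space_def)
    have pr: "x ?t * x' ?f = x' ?t * x ?f"
      using x x' by (intro on_line_proportional[of y]) (auto simp: line_space_def)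
    have "x ?t ~= 0 \<or> x ?f ~= 0" using x by (intro line_space_nonzero[OF v]) (auto simp: line_space_def)
    then obtain c where c: "x' ?t = c * x ?t" "x' ?f = c * x ?f"
    proof
      assume "x ?t ~= 0"
      thus ?thesis using pr by (intro that[of "x' ?t / x ?t"]) (auto simp: field_simps)
    next
      assume "x ?f ~= 0"
      thus ?thesis using pr by (intro that[of "x' ?f / x ?f"]) (auto simp: field_simps)
    qed
    have "x' = cscale c x"
    proof
      fix k show "x' k = cscale c x k" using z[of k] c by (cases "k \<in> {?t, ?f}") auto
    qed
    thus "x' \<in> cspan {x}" unfolding cspan_singleton by blast
  qed
qed

definition plane_vec :: "'v => complex \<times> complex => nat => complex" where
  "plane_vec v p k = (if k = ord True v then fst p else if k = ord False v then snd p else 0)"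

lemma plane_vec_in:
  assumes "v \<in> lines"
  shows "plane_vec v p \<in> coord_space (pos v)" "plane_vec v p (ord True v) = fst p"
    "plane_vec v p (ord False v) = snd p"
  using plane_pos(3)[OF linesD(2)[OF assms]] ord_neq[OF linesD(2)[OF assms]]
  by (auto simp: coord_space_def plane_vec_def split: if_splits)

lemma plane_vec_nonzero: "v \<in> lines ==> p ~= 0 ==> plane_vec v p ~= 0"
proof
  assume v: "v \<in> lines" and p: "p ~= 0" "plane_vec v p = 0"
  hence "fst p = 0" "snd p = 0" using plane_vec_in(2,3)[OF v, of p] by auto
  thus False using p(1) by (simp add: prod_eq_iff)
qed

lemma line_space_span_vec:
  assumes "v \<in> lines" "y \<in> S2" "line_vec s y ~= 0"
  shows "line_space v y = cspan {plane_vec v (line_vec s y)}"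
  using line_space_eq_span plane_vec_in on_line_vec line_space_def plane_vec_nonzero assms by simp

lemma line_vec_nonzero: "(if s then snd y > -1 else snd y < 1) ==> line_vec s y ~= 0"
proof
  assume 1: "if s then snd y > -1 else snd y < 1" and "line_vec s y = 0"
  hence "if s then 1 + complex_of_real (snd y) = 0 else 1 - complex_of_real (snd y) = 0"
    by (auto simp: line_vec_def zero_prod_def split: if_splits)
  hence "if s then Re (1 + complex_of_real (snd y)) = 0 else Re (1 - complex_of_real (snd y)) = 0"
    by auto
  thus False using 1 by (auto split: if_splits)
qed

lemma line_vec_nonzero_ex: "\<exists>s. line_vec s y ~= 0"
proof (cases "snd y > -1")
  case True
  thus ?thesis using line_vec_nonzero[of True y] by auto
next
  case False
  thus ?thesis using line_vec_nonzero[of False y] by auto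
qed

lemma cdim_line_space:
  assumes "v \<in> lines" "y \<in> S2"
  shows "cdim (line_space v y) = 1"
  by (metis line_vec_nonzero_ex plane_vec_nonzero line_space_span_vec cdim_span_singleton assms)

lemma mem_line_space_iff:
  assumes "v \<in> lines" "x \<in> coord_space (pos v)" "x ~= 0"
  shows "x \<in> line_space v y \<longleftrightarrow> y = line_pt (x (ord True v)) (x (ord False v))"
  using on_line_iff[OF line_space_nonzero[OF assms]] assms by (simp add: line_space_def)

lemma line_space_inj:
  assumes "v \<in> lines" "y \<in> S2" "line_space v y = line_space v y'"
  shows "y = y'"
proof -
  obtain s where s: "line_vec s y ~= 0" using line_vec_nonzero_ex by blast
  let ?x = "plane_vec v (line_vec s y)"
  have "?x ~= 0"
    using plane_vec_nonzero[OF assms(1) s] .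
  moreover have "?x \<in> line_space v y" using line_space_span_vec[OF assms(1,2) s] cvs.span_base by blast
  ultimately show ?thesis
    using mem_line_space_iff[OF assms(1) plane_vec_in(1)[OF assms(1)]] assms(3) by metis
qed

lemma one_dim_is_line:
  assumes "v \<in> lines" "csubspace N" "N \<subseteq> coord_space (pos v)" "cdim N = 1"
  shows "\<exists>y\<in>S2. N = line_space v y"
proof -
  obtain x where x: "x ~= 0" "N = cspan {x}"
    using subspace_dim_1[OF finite_pos assms(2-4)] by metis
  hence xc: "x \<in> coord_space (pos v)" using assms(3) cvs.span_base by blast
  let ?y = "line_pt (x (ord True v)) (x (ord False v))"
  have "?y \<in> S2" using line_pt_in_S2[OF line_space_nonzero[OF assms(1) xc x(1)]] .
  moreover have "x \<in> line_space v ?y" using mem_line_space_iff[OF assms(1) xc x(1)] by blast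
  ultimately show ?thesis using line_space_eq_span[OF assms(1) _ x(1)] x(2) by metis
qed

lemma unit_vec_line_space:
  assumes "v \<in> lines" "k \<in> pos v"
  shows "unit_vec k \<in> line_space v y \<longleftrightarrow> y = pole (\<delta> k)"
proof -
  have k: "k = ord (\<delta> k) v" using ord_eq[OF assms(2)] by simp
  have "unit_vec k \<in> coord_space (pos v)" using assms(2) by (auto simp: coord_space_def unit_vec_def split: if_splits)
  moreover have "pole (\<delta> k) = line_pt (unit_vec k (ord True v)) (unit_vec k (ord False v))"
  proof -
    let ?a = "unit_vec k (ord True v)" and ?b = "unit_vec k (ord False v)"
    have "on_line (pole (\<delta> k)) ?a ?b" "?a ~= 0 \<or> ?b ~= 0"
      using k ord_neq[OF linesD(2)[OF assms(1)]]
      by (cases "\<delta> k"; auto simp: on_line_pole unit_vec_def)+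
    thus ?thesis using on_line_iff by metis
  qed
  ultimately show ?thesis using mem_line_space_iff[OF assms(1) _ unit_vec_nonzero] by auto
qed

lemma line_space_pole:
  assumes "v \<in> lines" "k \<in> pos v"
  shows "line_space v (pole (\<delta> k)) = coord_space {k}"
proof -
  have "line_space v (pole (\<delta> k)) = cspan {unit_vec k}"
    using line_space_eq_span[OF assms(1) _ unit_vec_nonzero] unit_vec_line_space[OF assms] by auto
  thus ?thesis using span_unit_vecs[of "{k}"] by simp
qed

end

section \<open>Stability under an arrow as an equation between points\<close>

lemma ex_term_eqI:
  "s \<in> terms V ==> t \<in> terms V ==> (\<And>l. l \<in> L ==> P l \<longleftrightarrow> eval_term l s = eval_term l t) ==>
    \<exists>s t. s \<in> terms V \<and> t \<in> terms V \<and> (\<forall>l\<in>L. P l \<longleftrightarrow> eval_term l s = eval_term l t)"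
  by blast

context thin_rep_dim
begin

definition arrow_ok :: "('v => complex \<times> real) => 'a => bool" where
  "arrow_ok l a \<longleftrightarrow> (\<forall>x \<in> fibre l (src Q a). act M a x \<in> fibre l (tgt Q a))"

lemma subspace_fibre: "csubspace (fibre l v)"
  by (simp add: fibre_def subspace_line_space csubspace_coord_space)

lemma fibre_subset: "fibre l v \<subseteq> coord_space (pos v)"
  by (auto simp: fibre_def line_space_def full_pos_def coord_space_def)

lemma zero_in_fibre [simp]: "0 \<in> fibre l v" "(\<lambda>_. 0) \<in> fibre l v"
  using cvs.subspace_0[OF subspace_fibre] by (simp_all add: zero_fun_def)

lemma line_space_ex_nonzero:
  assumes "v \<in> lines" "y \<in> S2"
  obtains x where "x \<in> line_space v y" "x ~= 0"
proof -
  obtain s where s: "line_vec s y ~= 0" using line_vec_nonzero_ex by blast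
  have "plane_vec v (line_vec s y) \<in> line_space v y"
    using line_space_span_vec[OF assms s] cvs.span_base[of "plane_vec v (line_vec s y)"] by simp
  thus ?thesis using that plane_vec_nonzero[OF assms(1) s] by simp
qed

lemma unit_vec_if_line:
  assumes "v \<in> lines" "k \<in> pos v" "x \<in> line_space v y" "x ~= 0" "\<And>j. j ~= k ==> x j = 0"
  shows "y = pole (\<delta> k)"
proof -
  have "x k ~= 0" using assms(4,5) by (metis ext zero_fun_def)
  hence "unit_vec k = cscale (1 / x k) x"
    using assms(5) by (auto simp: unit_vec_def fun_eq_iff)
  hence "unit_vec k \<in> line_space v y"
    using cvs.subspace_scale[OF subspace_line_space assms(3)] by simp
  thus ?thesis using unit_vec_line_space[OF assms(1,2)] by simp
qed

lemma act_zeroI: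
  assumes "a \<in> arrs Q" "\<And>i k. ent M a i k = 1 ==> x k = 0"
  shows "act M a x = 0"
proof
  fix j
  show "act M a x j = 0 j"
  proof (cases "\<exists>k. ent M a j k = 1")
    case True
    then obtain k where k: "ent M a j k = 1" ..
    thus ?thesis using act_eq(1)[OF assms(1) k, of x] assms(2)[OF k] by simp
  next
    case False
    thus ?thesis using act_eq(2)[OF assms(1), of j x] by simp
  qed
qed

text \<open>If the source or the target carries no unknown, stability holds always, never, or
  exactly when the other point is a certain pole, namely the kernel or the image of the arrow. A
  loop on a plane also fixes a pole. Between two different planes the arrow respects labels, so it
  identifies their coordinates and the condition says that the two points agree.\<close>

lemma arrow_equation:
  assumes a: "a \<in> arrs Q"
  shows "\<exists>s t. s \<in> terms lines \<and> t \<in> terms lines \<and>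
    (\<forall>l \<in> lines \<rightarrow>\<^sub>E S2. arrow_ok l a \<longleftrightarrow> eval_term l s = eval_term l t)"
proof -
  let ?v = "src Q a" and ?w = "tgt Q a"
  have vw: "?v \<in> verts Q" "?w \<in> verts Q" using arrow_verts[OF a] by auto
  \<comment> \<open>Conditions that hold always or never are also written as equations, between
    equal or distinct poles.\<close>
  have T: ?thesis if "\<And>l. l \<in> lines \<rightarrow>\<^sub>E S2 ==> arrow_ok l a"
    by (rule ex_term_eqI[of "Inr True" _ "Inr True"]) (use that in auto)
  have F: ?thesis if "\<And>l. l \<in> lines \<rightarrow>\<^sub>E S2 ==> \<not> arrow_ok l a"
    by (rule ex_term_eqI[of "Inr True" _ "Inr False"]) (use that in auto)
  show ?thesis
  proof (cases "\<exists>i k. ent M a i k = 1")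
    case False
    have "act M a x = 0" for x by (rule act_zeroI[OF a]) (use False in blast)
    thus ?thesis by (intro T) (simp add: arrow_ok_def)
  next
    case True
    then obtain i k where ik: "ent M a i k = 1" by blast
    have ipos: "i \<in> pos ?w" and kpos: "k \<in> pos ?v" using ent_graded[OF a ik] by (auto simp: pos_def)
    consider "?v \<notin> lines" "e ?v = 0" | "?v \<notin> lines" "e ?v ~= 0" | "?v \<in> lines" by blast
    thus ?thesis
    proof cases
      case 1
      hence "x = 0" if "x \<in> fibre l ?v" for l x
        using that by (auto simp: fibre_def full_pos_def coord_space_def fun_eq_iff)
      hence "arrow_ok l a" for l unfolding arrow_ok_def by force
      thus ?thesis by (rule T)
    next
      case 2
      hence full: "fibre l ?v = coord_space (pos ?v)" for l by (simp add: fibre_def full_pos_def)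
      have uk: "unit_vec k' \<in> fibre l ?v" if "k' \<in> pos ?v" for l k'
        unfolding full using that by (auto simp: coord_space_def unit_vec_def split: if_splits)
      show ?thesis
      proof (cases "?w \<in> lines")
        case False
        show ?thesis
        proof (cases "e ?w = 0")
          case True
          have "\<not> arrow_ok l a" for l
          proof
            assume "arrow_ok l a"
            hence "act M a (unit_vec k) \<in> fibre l ?w" using uk[OF kpos] by (auto simp: arrow_ok_def)
            hence "unit_vec i \<in> fibre l ?w" using act_unit_vec[OF a ik] by simp
            hence "\<forall>k. unit_vec i k = 0" using False True by (simp add: fibre_def full_pos_def coord_space_def)
            hence "unit_vec i i = (0 :: complex)" by blast
            thus False by (simp add: unit_vec_def)
          qed
          thus ?thesis by (rule F)
        next
          case nz: False
          show ?thesis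
            by (rule T) (use act_in_rspace[OF a] False nz in \<open>simp add: arrow_ok_def fibre_def full_pos_def\<close>)
        qed
      next
        case wl: True
        show ?thesis
        proof (cases "\<exists>i' k'. ent M a i' k' = 1 \<and> k' ~= k")
          case True
          then obtain i' k' where ik': "ent M a i' k' = 1" "k' ~= k" by blast
          have "k' \<in> pos ?v" "i' \<in> pos ?w" using ent_graded[OF a ik'(1)] by (auto simp: pos_def)
          have ne: "i' ~= i" using ent_inj2[OF a ik] ik' by blast
          \<comment> \<open>Two different basis vectors are hit, and they cannot both lie on one
            line.\<close>
          have "\<not> arrow_ok l a" for l
          proof
            assume ok: "arrow_ok l a"
            have "unit_vec i \<in> fibre l ?w" "unit_vec i' \<in> fibre l ?w"
              using ok uk[OF kpos, of l] uk[OF \<open>k' \<in> pos ?v\<close>, of l] act_unit_vec[OF a ik] act_unit_vec[OF a ik'(1)]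
              unfolding arrow_ok_def by metis+
            hence "l ?w = pole (\<delta> i)" "l ?w = pole (\<delta> i')"
              using unit_vec_line_space[OF wl ipos] unit_vec_line_space[OF wl \<open>i' \<in> pos ?w\<close>] wl
              by (simp_all add: fibre_def)
            hence "\<delta> i = \<delta> i'" by simp
            thus False using pos_label_inj[OF ipos \<open>i' \<in> pos ?w\<close>] ne by simp
          qed
          thus ?thesis by (rule F)
        next
          case False
          hence single: "ent M a j k' = 1 ==> j = i" for j k' using ent_inj1[OF a ik] by blast
          have img: "act M a x \<in> coord_space {i}" for x
            using act_eq(2)[OF a] single by (fastforce simp: coord_space_def)
          have "arrow_ok l a \<longleftrightarrow> l ?w = pole (\<delta> i)" for l
            by (metis uk kpos act_unit_vec a ik arrow_ok_def unit_vec_line_space wl ipos fibre_def line_space_pole img assms)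
          thus ?thesis
            by (intro ex_term_eqI[of "Inl ?w" _ "Inr (\<delta> i)"]) (use wl in simp_all)
        qed
      qed
    next
      case vl: 3
      have fv: "fibre l ?v = line_space ?v (l ?v)" for l using vl by (simp add: fibre_def)
      have lS: "l ?v \<in> S2" if "l \<in> lines \<rightarrow>\<^sub>E S2" for l using that vl by (auto simp del: mem_sphere_0)
      have lc: "line_space ?v y \<subseteq> coord_space (pos ?v)" for y by (auto simp: line_space_def)
      have lcs: "x j = 0" if "x \<in> line_space ?v y" "j \<notin> pos ?v" for x y j
        using that by (auto simp: line_space_def coord_space_def)
      show ?thesis
      proof (cases "?w \<in> lines")
        case False
        show ?thesis
        proof (cases "e ?w = 0")
          case nz: False
          show ?thesis
            by (rule T) (use act_in_rspace[OF a] False nz in \<open>simp add: arrow_ok_def fibre_def full_pos_def\<close>)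
        next
          case True
          have fw: "x \<in> fibre l ?w \<longleftrightarrow> x = 0" for l x
            using False True by (auto simp: fibre_def full_pos_def coord_space_def fun_eq_iff)
          \<comment> \<open>The other basis vector of the source plane. It spans the kernel on this
            plane when \<open>k\<close> is the only vector on which the arrow is nonzero.\<close>
          define k2 where "k2 = ord (\<not> \<delta> k) ?v"
          have k2: "k2 \<in> pos ?v" "\<delta> k2 = (\<not> \<delta> k)" "pos ?v = {k, k2}"
            using plane_pos(1,2)[OF linesD(2)[OF vl], of "\<not> \<delta> k"] plane_pos(3)[OF linesD(2)[OF vl]] ord_eq[OF kpos]
            by (cases "\<delta> k"; auto simp: k2_def)+
          show ?thesis
          proof (cases "\<exists>i' k'. ent M a i' k' = 1 \<and> k' ~= k")
            case True
            then obtain i' k' where ik': "ent M a i' k' = 1" "k' ~= k" by blast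
            have "k' \<in> pos ?v" using ent_graded[OF a ik'(1)] by (auto simp: pos_def)
            hence "k' = k2" using k2(3) ik'(2) by blast
            have "\<not> arrow_ok l a" if l: "l \<in> lines \<rightarrow>\<^sub>E S2" for l
            proof
              assume ok: "arrow_ok l a"
              obtain x where x: "x \<in> line_space ?v (l ?v)" "x ~= 0"
                using line_space_ex_nonzero[OF vl lS[OF l]] .
              have "act M a x = 0" using ok x fw by (auto simp: arrow_ok_def fv)
              hence "x k = 0" "x k2 = 0"
                using act_eq(1)[OF a ik, of x] act_eq(1)[OF a ik'(1), of x] \<open>k' = k2\<close> by simp_all
              hence "x j = 0" for j using lcs[OF x(1), of j] k2(3) by auto
              thus False using x(2) by (auto simp: fun_eq_iff)
            qed
            thus ?thesis by (rule F)
          next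
            case single: False
            have "arrow_ok l a \<longleftrightarrow> l ?v = pole (\<delta> k2)" if l: "l \<in> lines \<rightarrow>\<^sub>E S2" for l
            proof
              assume ok: "arrow_ok l a"
              obtain x where x: "x \<in> line_space ?v (l ?v)" "x ~= 0"
                using line_space_ex_nonzero[OF vl lS[OF l]] .
              have "act M a x = 0" using ok x fw by (auto simp: arrow_ok_def fv)
              hence "x k = 0" using act_eq(1)[OF a ik, of x] by simp
              hence "x j = 0" if "j ~= k2" for j using lcs[OF x(1), of j] k2(3) that by auto
              thus "l ?v = pole (\<delta> k2)" using unit_vec_if_line[OF vl k2(1) x] by blast
            next
              assume "l ?v = pole (\<delta> k2)"
              hence f: "fibre l ?v = coord_space {k2}" using line_space_pole[OF vl k2(1)] fv by simp
              have "k ~= k2" using k2(2) by auto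
              have "act M a x = 0" if "x \<in> fibre l ?v" for x
              proof (rule act_zeroI[OF a])
                fix j k' assume "ent M a j k' = 1"
                hence "k' = k" using single by blast
                thus "x k' = 0" using that \<open>k ~= k2\<close> unfolding f coord_space_def by blast
              qed
              thus "arrow_ok l a" using fw by (simp add: arrow_ok_def)
            qed
            thus ?thesis
              by (intro ex_term_eqI[of "Inl ?v" _ "Inr (\<delta> k2)"]) (use vl in simp_all)
          qed
        qed
      next
        case wl: True
        show ?thesis
        proof (cases "?v = ?w")
          case True
          have single: "ent M a j k' = 1 ==> j = i \<and> k' = k" for j k'
            using ent_loop[OF a True ik] by blast
          have "i ~= k" using ent_loop[OF a True ik] by blast
          have iv: "i \<in> pos ?v" using ipos True by simp
          have P: "pos ?v = {k, i}"
          proof -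
            have "card {k, i} = card (pos ?v)" using \<open>i ~= k\<close> linesD(2)[OF vl] by simp
            thus ?thesis using card_subset_eq[OF finite_pos, of "{k, i}" ?v] iv kpos by simp
          qed
          \<comment> \<open>The loop has square zero on the plane, with image and kernel both
            spanned by \<open>i\<close>; this is its only invariant line.\<close>
          have "arrow_ok l a \<longleftrightarrow> l ?v = pole (\<delta> i)" if l: "l \<in> lines \<rightarrow>\<^sub>E S2" for l
          proof
            assume ok: "arrow_ok l a"
            obtain x where x: "x \<in> line_space ?v (l ?v)" "x ~= 0"
              using line_space_ex_nonzero[OF vl lS[OF l]] .
            show "l ?v = pole (\<delta> i)"
            proof (cases "x k = 0")
              case True
              hence "x j = 0" if "j ~= i" for j using lcs[OF x(1), of j] P that by auto
              thus ?thesis using unit_vec_if_line[OF vl iv x] by blast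
            next
              case False
              have "fibre l ?w = line_space ?v (l ?v)" using fv[of l] \<open>?v = ?w\<close> by metis
              hence ax: "act M a x \<in> line_space ?v (l ?v)"
                using ok x(1) fv[of l] unfolding arrow_ok_def by blast
              have "act M a x i = x k" by (rule act_eq(1)[OF a ik])
              hence "act M a x ~= 0" using False by auto
              moreover have "act M a x j = 0" if "j ~= i" for j
                using act_eq(2)[OF a, of j x] single that by blast
              ultimately show ?thesis using unit_vec_if_line[OF vl iv ax] by blast
            qed
          next
            assume "l ?v = pole (\<delta> i)"
            hence f: "fibre l ?v = coord_space {i}" using line_space_pole[OF vl iv] fv by simp
            have "act M a x = 0" if "x \<in> fibre l ?v" for x
            proof (rule act_zeroI[OF a])
              fix j k' assume "ent M a j k' = 1"
              hence "k' = k" using single by blast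
              thus "x k' = 0" using that \<open>i ~= k\<close> unfolding f coord_space_def by blast
            qed
            thus "arrow_ok l a" by (simp add: arrow_ok_def)
          qed
          thus ?thesis
            by (intro ex_term_eqI[of "Inl ?v" _ "Inr (\<delta> i)"]) (use vl in simp_all)
        next
          case False
          have par: "ent M a (ord b ?w) (ord b ?v) = 1" for b
          proof -
            have "ord b ?v \<in> pos ?v" "ord b ?w \<in> pos ?w" "\<delta> (ord b ?w) = \<delta> (ord b ?v)"
              using plane_pos(1,2)[OF linesD(2)[OF vl], of b] plane_pos(1,2)[OF linesD(2)[OF wl], of b] by auto
            thus ?thesis
              using ent_planes[OF a False ik, of "ord b ?v" "ord b ?w"] linesD(2)[OF vl] linesD(2)[OF wl]
              unfolding dimv_pos by (simp add: pos_def)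
          qed
          have ax: "act M a x (ord b ?w) = x (ord b ?v)" for x b by (rule act_eq(1)[OF a par])
          have "arrow_ok l a \<longleftrightarrow> l ?v = l ?w" if l: "l \<in> lines \<rightarrow>\<^sub>E S2" for l
          proof
            assume ok: "arrow_ok l a"
            obtain x where x: "x \<in> line_space ?v (l ?v)" "x ~= 0"
              using line_space_ex_nonzero[OF vl lS[OF l]] .
            have xc: "x \<in> coord_space (pos ?v)" using x lc by blast
            have "act M a x \<in> line_space ?w (l ?w)" using ok x(1) wl by (simp add: arrow_ok_def fv fibre_def[of l ?w])
            moreover have "act M a x ~= 0"
            proof
              assume "act M a x = 0"
              hence "x (ord b ?v) = 0" for b using ax[of x b] by simp
              thus False using line_space_nonzero[OF vl xc x(2)] by blast
            qed
            ultimately have "l ?w = line_pt (x (ord True ?v)) (x (ord False ?v))"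
              using mem_line_space_iff[OF wl act_in_rspace[OF a]] ax by simp
            thus "l ?v = l ?w" using mem_line_space_iff[OF vl xc x(2)] x(1) by simp
          next
            assume "l ?v = l ?w"
            thus "arrow_ok l a"
              using act_in_rspace[OF a] vl wl by (simp add: arrow_ok_def fibre_def line_space_def ax)
          qed
          thus ?thesis
            by (intro ex_term_eqI[of "Inl ?v" _ "Inl ?w"]) (use vl wl in simp_all)
        qed
      qed
    qed
  qed
qed

definition valid :: "('v => complex \<times> real) => bool" where
  "valid l \<longleftrightarrow> (\<forall>a\<in>arrs Q. arrow_ok l a)"

lemma ex_equations: "\<exists>E. over lines E \<and> sols lines E = {l \<in> lines \<rightarrow>\<^sub>E S2. valid l}"
proof -
  have "\<forall>a\<in>arrs Q. \<exists>p. fst p \<in> terms lines \<and> snd p \<in> terms lines \<and>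
      (\<forall>l \<in> lines \<rightarrow>\<^sub>E S2. arrow_ok l a \<longleftrightarrow> eval_term l (fst p) = eval_term l (snd p))"
    using arrow_equation by simp
  from bchoice[OF this] obtain p where p: "\<forall>a\<in>arrs Q. fst (p a) \<in> terms lines \<and> snd (p a) \<in> terms lines \<and>
      (\<forall>l \<in> lines \<rightarrow>\<^sub>E S2. arrow_ok l a \<longleftrightarrow> eval_term l (fst (p a)) = eval_term l (snd (p a)))" ..
  define E where "E = p ` arrs Q"
  have "over lines E" unfolding over_def E_def using p by (auto simp: case_prod_beta)
  moreover have "l \<in> sols lines E \<longleftrightarrow> l \<in> lines \<rightarrow>\<^sub>E S2 \<and> valid l" for l
    by (auto simp: E_def valid_def p sols_def)
  ultimately show ?thesis by (intro exI[of _ E]) blast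
qed

end

section \<open>The Grassmannian as a space of solutions\<close>

lemma continuous_map_into_functions:
  "continuous_map X euclidean f \<longleftrightarrow> (\<forall>i. continuous_map X euclidean (\<lambda>x. f x i))"
  for f :: "'a => 'i => 'b::topological_space"
  unfolding euclidean_product_topology[symmetric] continuous_map_componentwise_UNIV ..

lemma topspace_Gr_topology [simp]: "topspace (Gr_topology Q M e) = Gr Q M e"
proof
  show "topspace (Gr_topology Q M e) \<subseteq> Gr Q M e"
    using openin_topspace[of "Gr_topology Q M e"] unfolding openin_Gr_topology by (rule conjunct1)
  have "{b \<in> frames Q M e. frame_span Q e b \<in> Gr Q M e} = frames Q M e" by (auto simp: frames_def)
  hence "openin (Gr_topology Q M e) (Gr Q M e)" unfolding openin_Gr_topology by simp
  thus "Gr Q M e \<subseteq> topspace (Gr_topology Q M e)" by (rule openin_subset)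
qed

context thin_rep_dim
begin

definition to_Gr :: "('v => complex \<times> real) => 'v => (nat => complex) set" where
  "to_Gr l = restrict (fibre l) (verts Q)"

lemma cdim_fibre: "l \<in> lines \<rightarrow>\<^sub>E S2 ==> v \<in> verts Q ==> cdim (fibre l v) = e v"
proof (cases "v \<in> lines")
  case True
  assume l: "l \<in> lines \<rightarrow>\<^sub>E S2"
  hence "l v \<in> S2" using True by (rule PiE_mem)
  thus ?thesis using cdim_line_space[OF True] linesD(3)[OF True] True by (simp add: fibre_def)
next
  case False
  assume "v \<in> verts Q"
  thus ?thesis using card_full_pos[OF _ False] False by (simp add: fibre_def cdim_coord_space)
qed

lemma to_Gr_in_Gr: "l \<in> lines \<rightarrow>\<^sub>E S2 ==> to_Gr l \<in> Gr Q M e \<longleftrightarrow> valid l"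
  by (simp add: subspace_fibre fibre_subset cdim_fibre to_Gr_def rspace_pos arrow_verts arrow_ok_def Gr_def valid_def)

definition from_Gr :: "('v => (nat => complex) set) => 'v => complex \<times> real" where
  "from_Gr N = (\<lambda>v\<in>lines. SOME y. y \<in> S2 \<and> N v = line_space v y)"

lemma GrD:
  assumes "N \<in> Gr Q M e"
  shows "N \<in> extensional (verts Q)"
    and "v \<in> verts Q ==> csubspace (N v) \<and> N v \<subseteq> coord_space (pos v) \<and> cdim (N v) = e v"
  using assms by (simp_all add: Gr_def rspace_pos)

lemma from_Gr:
  assumes "N \<in> Gr Q M e"
  shows "from_Gr N \<in> lines \<rightarrow>\<^sub>E S2" "to_Gr (from_Gr N) = N"
proof -
  have y: "from_Gr N v \<in> S2 \<and> N v = line_space v (from_Gr N v)" if v: "v \<in> lines" for v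
  proof -
    have "\<exists>y\<in>S2. N v = line_space v y"
      using one_dim_is_line[OF v] GrD(2)[OF assms linesD(1)[OF v]] linesD(3)[OF v] by simp
    hence "\<exists>y. y \<in> S2 \<and> N v = line_space v y" by blast
    from someI_ex[OF this] show ?thesis using v by (simp add: from_Gr_def del: mem_sphere_0)
  qed
  thus "from_Gr N \<in> lines \<rightarrow>\<^sub>E S2" by (intro PiE_I) (auto simp: from_Gr_def simp del: mem_sphere_0)
  show "to_Gr (from_Gr N) = N"
  proof (rule extensionalityI[of _ "verts Q"])
    show "to_Gr (from_Gr N) \<in> extensional (verts Q)" by (simp add: to_Gr_def)
    show "N \<in> extensional (verts Q)" using GrD(1)[OF assms] .
    fix v assume v: "v \<in> verts Q"
    show "to_Gr (from_Gr N) v = N v"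
    proof (cases "v \<in> lines")
      case True
      thus ?thesis using y v by (simp add: to_Gr_def fibre_def)
    next
      case False
      have N: "csubspace (N v)" "N v \<subseteq> coord_space (pos v)" "cdim (N v) = e v"
        using GrD(2)[OF assms v] by auto
      have "N v = coord_space (full_pos v)"
      proof (cases "e v = 0")
        case True
        hence "N v = {0}" using subspace_dim_0[OF finite_pos N(1,2)] N(3) by simp
        moreover have "coord_space {} = {0 :: nat => complex}" by (auto simp: coord_space_def fun_eq_iff)
        ultimately show ?thesis using True by (simp add: full_pos_def)
      next
        case nz: False
        hence "e v = card (pos v)" using not_line[OF v False] by simp
        thus ?thesis using subspace_dim_full[OF finite_pos N(1,2)] N(3) nz by (simp add: full_pos_def)
      qed
      thus ?thesis using False v by (simp add: to_Gr_def fibre_def)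
    qed
  qed
qed

lemma from_Gr_to_Gr:
  assumes l: "l \<in> lines \<rightarrow>\<^sub>E S2" "valid l"
  shows "from_Gr (to_Gr l) = l"
proof (rule extensionalityI[of _ lines])
  have N: "to_Gr l \<in> Gr Q M e" using to_Gr_in_Gr[OF l(1)] l(2) by simp
  show "from_Gr (to_Gr l) \<in> extensional lines" by (simp add: from_Gr_def)
  show "l \<in> extensional lines" using l(1) by (simp add: PiE_def)
  fix v assume v: "v \<in> lines"
  have "to_Gr (from_Gr (to_Gr l)) v = to_Gr l v" using from_Gr(2)[OF N] by simp
  hence "line_space v (from_Gr (to_Gr l) v) = line_space v (l v)"
    using v linesD(1)[OF v] by (simp add: to_Gr_def fibre_def)
  moreover have "from_Gr (to_Gr l) v \<in> S2" using from_Gr(1)[OF N] v by (rule PiE_mem)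
  ultimately show "from_Gr (to_Gr l) v = l v" using line_space_inj[OF v] by blast
qed

lemma continuous_line_vec: "continuous_on UNIV (\<lambda>y. plane_vec v (line_vec s y) k)"
proof -
  have 1: "continuous_on UNIV (\<lambda>y. fst (line_vec s y))" "continuous_on UNIV (\<lambda>y. snd (line_vec s y))"
    unfolding line_vec_def by (cases s; simp; intro continuous_intros)+
  show ?thesis
  proof (cases "k = ord True v")
    case True
    thus ?thesis using 1(1) by (simp add: plane_vec_def)
  next
    case False
    thus ?thesis using 1(2) by (cases "k = ord False v") (simp_all add: plane_vec_def)
  qed
qed

text \<open>The Grassmannian has the quotient topology of the frames, so continuity into it is shown
  by lifting to frames locally. \<open>line_vec\<close> gives a nonzero vector depending
  continuously on the point away from one pole; choosing at every vertex which pole to avoid gives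
  the open cover by the sets \<open>W s\<close>. At the other vertices any fixed basis serves as a
  frame.\<close>

lemma continuous_map_to_Gr:
  assumes E: "sols lines E = {l \<in> lines \<rightarrow>\<^sub>E S2. valid l}"
  shows "continuous_map (sol_space lines E) (Gr_topology Q M e) to_Gr"
proof -
  have inGr: "to_Gr l \<in> Gr Q M e" if "l \<in> sols lines E" for l
    using that to_Gr_in_Gr[of l] unfolding E by blast
  have "\<forall>v. \<exists>h. bij_betw h {0..<card (full_pos v)} (full_pos v)"
    using ex_bij_betw_nat_finite[OF finite_full_pos] by blast
  from choice[OF this] obtain enum where
    enum: "\<And>v. bij_betw (enum v) {0..<card (full_pos v)} (full_pos v)" by blast
  define fr where "fr s l v i = (if v \<in> lines then plane_vec v (line_vec (s v) (l v))
      else if v \<in> verts Q then unit_vec (enum v i) else 0)"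
    for s :: "'v => bool" and l :: "'v => complex \<times> real" and v and i :: nat
  define W where "W s = {l \<in> sols lines E. \<forall>v\<in>lines. if s v then snd (l v) > -1 else snd (l v) < 1}"
    for s :: "'v => bool"
  have comp: "continuous_map (sol_space lines E) euclidean (\<lambda>l. g (l v))"
    if "v \<in> lines" "continuous_on UNIV g" for v and g :: "complex \<times> real => 'z::topological_space"
  proof -
    have "continuous_map (top_of_set S2) euclidean g"
      using that(2) continuous_on_subset by (auto simp: continuous_map_iff_continuous)
    from continuous_map_compose[OF continuous_map_sol_space_component[OF that(1), of E] this]
    show ?thesis by (simp add: comp_def)
  qed
  have openW: "openin (sol_space lines E) (W s)" for s
  proof -
    have "openin (sol_space lines E) {l \<in> sols lines E. if s v then snd (l v) > -1 else snd (l v) < 1}"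
      if v: "v \<in> lines" for v
    proof -
      have 1: "continuous_map (sol_space lines E) euclidean (\<lambda>l. snd (l v))"
        by (rule comp[OF v]) (intro continuous_intros)
      have "openin (sol_space lines E) {l \<in> topspace (sol_space lines E). snd (l v) \<in> (if s v then {-1<..} else {..<1})}"
        by (rule openin_continuous_map_preimage[OF 1]) simp
      thus ?thesis by (cases "s v") simp_all
    qed
    hence "openin (sol_space lines E)
        ((\<Inter>v\<in>lines. {l \<in> sols lines E. if s v then snd (l v) > -1 else snd (l v) < 1}) \<inter> topspace (sol_space lines E))"
      by (intro openin_INT finite_lines) auto
    moreover have "(\<Inter>v\<in>lines. {l \<in> sols lines E. if s v then snd (l v) > -1 else snd (l v) < 1}) \<inter> topspace (sol_space lines E) = W s"
      unfolding W_def by auto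
    ultimately show ?thesis by simp
  qed
  have span: "frame_span Q e (fr s l) = to_Gr l" if l: "l \<in> W s" for s l
  proof
    fix v
    have lS: "l \<in> lines \<rightarrow>\<^sub>E S2" using l E unfolding W_def by blast
    show "frame_span Q e (fr s l) v = to_Gr l v"
    proof (cases "v \<in> verts Q")
      case v: True
      show ?thesis
      proof (cases "v \<in> lines")
        case True
        have "if s v then snd (l v) > -1 else snd (l v) < 1" using l True unfolding W_def by blast
        hence "line_vec (s v) (l v) ~= 0" by (rule line_vec_nonzero)
        hence "line_space v (l v) = cspan {plane_vec v (line_vec (s v) (l v))}"
          using line_space_span_vec[OF True PiE_mem[OF lS True]] by blast
        moreover have "fr s l v ` {..<e v} = {plane_vec v (line_vec (s v) (l v))}"
          using True linesD(3)[OF True] by (auto simp: fr_def)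
        ultimately show ?thesis using v True by (simp add: frame_span_def to_Gr_def fibre_def)
      next
        case False
        have "fr s l v ` {..<e v} = unit_vec ` (enum v ` {0..<card (full_pos v)})"
          using v False card_full_pos[OF v False] by (simp add: fr_def image_image lessThan_atLeast0)
        also have "enum v ` {0..<card (full_pos v)} = full_pos v" using enum[of v] by (simp add: bij_betw_def)
        finally show ?thesis using v False
          by (simp add: frame_span_def to_Gr_def fibre_def span_unit_vecs)
      qed
    qed (simp add: frame_span_def to_Gr_def)
  qed
  have frcont: "continuous_map (sol_space lines E) euclidean (fr s)" for s
  proof -
    have "continuous_map (sol_space lines E) euclidean (\<lambda>l. fr s l v i k)" for v i k
    proof (cases "v \<in> lines")
      case True
      thus ?thesis using comp[OF True continuous_line_vec[of v "s v" k]] by (simp add: fr_def)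
    next
      case False
      thus ?thesis by (simp add: fr_def)
    qed
    thus ?thesis by (subst continuous_map_into_functions, intro allI)+ blast
  qed
  show ?thesis
    unfolding continuous_map_def topspace_sol_space topspace_Gr_topology
  proof (intro conjI allI impI)
    show "to_Gr \<in> sols lines E \<rightarrow> Gr Q M e" using inGr by blast
    fix U assume U: "openin (Gr_topology Q M e) U"
    then obtain B where B: "open B" "{b \<in> frames Q M e. frame_span Q e b \<in> U} = frames Q M e \<inter> B"
      unfolding openin_Gr_topology openin_open by blast
    show "openin (sol_space lines E) {l \<in> sols lines E. to_Gr l \<in> U}"
    proof (subst openin_subopen, intro ballI)
      fix l assume "l \<in> {l \<in> sols lines E. to_Gr l \<in> U}"
      hence l: "l \<in> sols lines E" "to_Gr l \<in> U" by auto
      define s where "s v \<longleftrightarrow> snd (l v) > -1" for v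
      have lW: "l \<in> W s" unfolding W_def s_def using l(1) by auto
      let ?T = "W s \<inter> {l \<in> topspace (sol_space lines E). fr s l \<in> B}"
      have eq: "fr s l \<in> B \<longleftrightarrow> to_Gr l \<in> U" if "l \<in> W s" for l
      proof -
        have "fr s l \<in> frames Q M e"
          using span[OF that] inGr that unfolding frames_def W_def by simp
        moreover have "fr s l \<in> {b \<in> frames Q M e. frame_span Q e b \<in> U} \<longleftrightarrow> fr s l \<in> frames Q M e \<inter> B"
          using B(2) by simp
        ultimately show ?thesis using span[OF that] by simp
      qed
      have "openin (sol_space lines E) ?T"
        by (intro openin_Int openW openin_continuous_map_preimage[OF frcont]) (use B(1) in simp)
      moreover have "l \<in> ?T" using lW l eq[OF lW] by simp
      moreover have "?T \<subseteq> {l \<in> sols lines E. to_Gr l \<in> U}" using eq by auto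
      ultimately show "\<exists>T. openin (sol_space lines E) T \<and> l \<in> T \<and> T \<subseteq> {l \<in> sols lines E. to_Gr l \<in> U}"
        by blast
    qed
  qed
qed

text \<open>Continuity out of a quotient is tested on frames, where the point at \<open>v\<close> is
  the Hopf image of the single frame vector at \<open>v\<close>.\<close>

lemma continuous_map_from_Gr:
  assumes E: "sols lines E = {l \<in> lines \<rightarrow>\<^sub>E S2. valid l}"
  shows "continuous_map (Gr_topology Q M e) (sol_space lines E) from_Gr"
  unfolding continuous_map_into_sol_space topspace_Gr_topology
proof (intro conjI ballI)
  show "from_Gr \<in> Gr Q M e \<rightarrow> sols lines E"
    using from_Gr to_Gr_in_Gr assms by fastforce
  fix v assume v: "v \<in> lines"
  let ?F = "frames Q M e"
  define h where "h b = line_pt (b v 0 (ord True v)) (b v 0 (ord False v))" for b :: "'v => nat => nat => complex"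
  have nz: "(b v 0 (ord True v) ~= 0 \<or> b v 0 (ord False v) ~= 0) \<and> from_Gr (frame_span Q e b) v = h b" if b: "b \<in> ?F" for b
  proof -
    let ?N = "frame_span Q e b"
    have N: "?N \<in> Gr Q M e" using b by (simp add: frames_def)
    have "?N v = cspan {b v 0}"
      using linesD(1,3)[OF v] by (simp add: frame_span_def lessThan_Suc)
    hence bN: "b v 0 \<in> ?N v" and "cdim (cspan {b v 0}) = 1"
      using cvs.span_base[of "b v 0" "{b v 0}"] GrD(2)[OF N linesD(1)[OF v]] linesD(3)[OF v] by auto
    moreover have "cdim (cspan {0 :: nat => complex}) = 0"
      using cvs.dim_span_eq_card_independent[OF cvs.independent_empty] by (simp add: cvs.span_insert_0)
    ultimately have nz: "b v 0 ~= 0" by auto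
    have c: "b v 0 \<in> coord_space (pos v)" using bN GrD(2)[OF N linesD(1)[OF v]] by blast
    have "?N v = line_space v (from_Gr ?N v)"
      using from_Gr(2)[OF N] v linesD(1)[OF v] by (metis to_Gr_def fibre_def restrict_apply')
    hence "b v 0 \<in> line_space v (from_Gr ?N v)" using bN by simp
    thus ?thesis using mem_line_space_iff[OF v c nz] line_space_nonzero[OF v c nz] by (simp add: h_def)
  qed
  have hS: "h b \<in> S2" if "b \<in> ?F" for b unfolding h_def by (rule line_pt_in_S2) (use nz[OF that] in blast)
  have coord: "continuous_on ?F (\<lambda>b. b v 0 k)" for k
  proof -
    have 1: "continuous_on ?F (\<lambda>b. b v)" by (rule continuous_on_product_then_coordinatewise[OF continuous_on_id])
    have 2: "continuous_on ?F (\<lambda>b. b v 0)" by (rule continuous_on_product_then_coordinatewise[OF 1])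
    show ?thesis by (rule continuous_on_product_then_coordinatewise[OF 2])
  qed
  have hc: "continuous_on ?F h"
    unfolding h_def line_pt_def
  proof (intro continuous_intros coord ballI)
    fix b assume "b \<in> ?F"
    hence "(cmod (b v 0 (ord True v)))\<^sup>2 + (cmod (b v 0 (ord False v)))\<^sup>2 > 0"
      using nz norm_sq_pos by blast
    thus "(cmod (b v 0 (ord True v)))\<^sup>2 + (cmod (b v 0 (ord False v)))\<^sup>2 ~= 0" by linarith
    thus "complex_of_real ((cmod (b v 0 (ord True v)))\<^sup>2 + (cmod (b v 0 (ord False v)))\<^sup>2) ~= 0"
      using of_real_eq_0_iff by blast
  qed
  show "continuous_map (Gr_topology Q M e) (top_of_set S2) (\<lambda>N. from_Gr N v)"
    unfolding continuous_map_def topspace_Gr_topology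
  proof (intro conjI allI impI)
    show "(\<lambda>N. from_Gr N v) \<in> Gr Q M e \<rightarrow> topspace (top_of_set S2)"
      using from_Gr(1) v by (auto simp del: mem_sphere_0)
    fix U assume U: "openin (top_of_set S2) U"
    have "{b \<in> ?F. frame_span Q e b \<in> {N \<in> Gr Q M e. from_Gr N v \<in> U}} = ?F \<inter> h -` U"
      using frames_def nz by auto
    moreover have "openin (top_of_set ?F) (?F \<inter> h -` U)"
      by (rule continuous_openin_preimage[OF hc _ U]) (use hS in blast)
    ultimately show "openin (Gr_topology Q M e) {N \<in> Gr Q M e. from_Gr N v \<in> U}"
      unfolding openin_Gr_topology by auto
  qed
qed

text \<open>A line at a pole is spanned by a basis vector, and a coordinate subspace is stable under
  the arrows exactly when its index set is closed. The solution is recovered from the set by asking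
  at each vertex whether the vector labelled \<open>True\<close> belongs to it.\<close>

lemma pole_sols_closed_sets:
  assumes E: "sols lines E = {l \<in> lines \<rightarrow>\<^sub>E S2. valid l}"
  shows "card (pole_sols lines E) = card {S. closed_set S \<and> (\<forall>v\<in>verts Q. card (S \<inter> pos v) = e v)}"
proof -
  define f where "f l = {k. k < rdim M \<and> unit_vec k \<in> fibre l (vtx M k)}" for l
  define g where "g S = (\<lambda>v\<in>lines. pole (ord True v \<in> S))" for S
  let ?C = "{S. closed_set S \<and> (\<forall>v\<in>verts Q. card (S \<inter> pos v) = e v)}"
  have ucs: "unit_vec k \<in> coord_space A \<longleftrightarrow> k \<in> A" for k :: nat and A
    by (auto simp: coord_space_def unit_vec_def split: if_splits)
  have Int: "f l \<inter> pos v = (if v \<in> lines then {k\<in>pos v. l v = pole (\<delta> k)} else full_pos v)" for l v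
  proof -
    have 1: "f l \<inter> pos v = {k \<in> pos v. unit_vec k \<in> fibre l v}" by (auto simp: f_def pos_def)
    show ?thesis
    proof (cases "v \<in> lines")
      case True
      have "unit_vec k \<in> fibre l v \<longleftrightarrow> l v = pole (\<delta> k)" if "k \<in> pos v" for k
        using unit_vec_line_space[OF True that, of "l v"] True by (simp add: fibre_def)
      thus ?thesis unfolding 1 using True by auto
    next
      case False
      thus ?thesis unfolding 1 by (auto simp: fibre_def ucs full_pos_def)
    qed
  qed
  have f: "f l \<in> ?C" if l: "l \<in> pole_sols lines E" for l
  proof -
    have lS: "l \<in> lines \<rightarrow>\<^sub>E S2" "valid l" and lp: "\<And>v. v \<in> lines ==> \<exists>b. l v = pole b"
      using l E unfolding pole_sols_def by blast+
    have "closed_set (f l)"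
      unfolding closed_set_def
      using f_def lS ent_graded valid_def arrow_ok_def act_unit_vec by fastforce
    moreover have "card (f l \<inter> pos v) = e v" if v: "v \<in> verts Q" for v
    proof (cases "v \<in> lines")
      case True
      obtain b where b: "l v = pole b" using lp[OF True] by blast
      have "{k \<in> pos v. l v = pole (\<delta> k)} = {ord b v}"
        using plane_pos(1,2)[OF linesD(2)[OF True], of b] pos_label_inj[of _ v] b by auto
      thus ?thesis using Int[of l v] True linesD(3)[OF True] by simp
    next
      case False
      thus ?thesis using Int[of l v] card_full_pos[OF v False] by simp
    qed
    ultimately show ?thesis by blast
  qed
  have fibre_g: "fibre (g S) v = coord_space (S \<inter> pos v)"
    if S: "S \<in> ?C" and v: "v \<in> verts Q" for S v
  proof -
    have c: "card (S \<inter> pos v) = e v" using S v by blast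
    show ?thesis
    proof (cases "v \<in> lines")
      case True
      have "card (S \<inter> pos v) = 1" using c linesD(3)[OF True] by simp
      then obtain k where k: "S \<inter> pos v = {k}" by (rule card_1_singletonE)
      hence kp: "k \<in> pos v" "k \<in> S" by auto
      have "ord True v \<in> S \<longleftrightarrow> \<delta> k"
        using k plane_pos linesD True ord_eq kp by fastforce
      thus ?thesis using True line_space_pole[OF True kp(1)] k by (simp add: fibre_def g_def)
    next
      case False
      have "S \<inter> pos v = full_pos v"
      proof (cases "e v = 0")
        case True
        hence "S \<inter> pos v = {}" using c finite_pos[of v] by auto
        thus ?thesis using True by (simp add: full_pos_def)
      next
        case nz: False
        hence "card (S \<inter> pos v) = card (pos v)" using c not_line[OF v False] by simp
        hence "S \<inter> pos v = pos v" by (intro card_subset_eq finite_pos) auto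
        thus ?thesis using nz by (simp add: full_pos_def)
      qed
      thus ?thesis using False by (simp add: fibre_def)
    qed
  qed
  have gP: "g S \<in> lines \<rightarrow>\<^sub>E S2" for S by (auto simp: g_def)
  have g: "g S \<in> pole_sols lines E" if S: "S \<in> ?C" for S
  proof -
    have cl: "closed_set S" using S by blast
    have "valid (g S)"
      unfolding valid_def arrow_ok_def
    proof (intro ballI)
      fix a x assume a: "a \<in> arrs Q" and x: "x \<in> fibre (g S) (src Q a)"
      have xs: "x k = 0" if "k \<notin> S" for k
        using x that arrow_verts[OF a] fibre_g[OF S] by (auto simp: coord_space_def)
      have "i \<in> S" if ai: "act M a x i ~= 0" for i
      proof -
        obtain k where k: "ent M a i k = 1" using act_eq(2)[OF a, of i x] ai by blast
        hence "x k ~= 0" using act_eq(1)[OF a k, of x] ai by simp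
        hence "k \<in> S" using xs by blast
        thus ?thesis using cl a k unfolding closed_set_def by blast
      qed
      hence "act M a x \<in> coord_space (S \<inter> pos (tgt Q a))"
        using act_in_rspace[OF a, of x] by (auto simp: coord_space_def)
      thus "act M a x \<in> fibre (g S) (tgt Q a)" using fibre_g[OF S] arrow_verts[OF a] by simp
    qed
    thus ?thesis using gP E unfolding pole_sols_def by (auto simp: g_def)
  qed
  have "bij_betw f (pole_sols lines E) ?C"
  proof (rule bij_betw_byWitness[where f' = g])
    show "\<forall>l\<in>pole_sols lines E. g (f l) = l"
    proof
      fix l assume l: "l \<in> pole_sols lines E"
      have lS: "l \<in> lines \<rightarrow>\<^sub>E S2" and lp: "\<And>v. v \<in> lines ==> \<exists>b. l v = pole b"
        using l E unfolding pole_sols_def by blast+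
      show "g (f l) = l"
      proof (rule extensionalityI[of _ lines])
        show "g (f l) \<in> extensional lines" by (simp add: g_def)
        show "l \<in> extensional lines" using lS by (simp add: PiE_def)
        fix v assume v: "v \<in> lines"
        obtain b where b: "l v = pole b" using lp[OF v] by blast
        have "ord True v \<in> f l \<longleftrightarrow> ord True v \<in> f l \<inter> pos v" using plane_pos(1)[OF linesD(2)[OF v], of True] by blast
        also have "\<dots> \<longleftrightarrow> b" unfolding Int using v b plane_pos(1,2)[OF linesD(2)[OF v], of True] by simp
        finally show "g (f l) v = l v" using v b by (simp add: g_def)
      qed
    qed
    show "\<forall>S\<in>?C. f (g S) = S"
    proof
      fix S assume S: "S \<in> ?C"
      hence SM: "S \<subseteq> {..<rdim M}" by (simp add: closed_set_def)
      have "k \<in> f (g S) \<longleftrightarrow> k \<in> S" if "k < rdim M" for k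
        using that fibre_g[OF S vtx_verts[OF that]] by (simp add: f_def ucs pos_def)
      moreover have "f (g S) \<subseteq> {..<rdim M}" by (auto simp: f_def)
      ultimately show "f (g S) = S" using SM by blast
    qed
  qed (use f g in blast)+
  thus ?thesis by (rule bij_betw_same_card)
qed

theorem euler_char_Gr:
  "euler_char (Gr_topology Q M e) = int (card {S. closed_set S \<and> (\<forall>v\<in>verts Q. card (S \<inter> pos v) = e v)})"
proof -
  obtain E where oE: "over lines E" and E: "sols lines E = {l \<in> lines \<rightarrow>\<^sub>E S2. valid l}"
    using ex_equations by blast
  have "homeomorphic_maps (sol_space lines E) (Gr_topology Q M e) to_Gr from_Gr"
    unfolding homeomorphic_maps_def topspace_sol_space topspace_Gr_topology
    using from_Gr_to_Gr E from_Gr continuous_map_to_Gr continuous_map_from_Gr by simp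
  hence "sol_space lines E homeomorphic_space Gr_topology Q M e"
    by (rule homeomorphic_maps_imp_homeomorphic_space)
  from has_chi_imp_euler_char[OF has_chi_homeomorphic[OF this has_chi_sol_space[OF finite_lines oE]]]
  show ?thesis unfolding pole_sols_closed_sets[OF E] .
qed

end

section \<open>The g-vector\<close>

text \<open>Every unit vector that is not killed has an output coordinate in which it alone is
  nonzero. So the nonzero images are independent, and the kernel is spanned by the killed unit
  vectors.\<close>

lemma cdim_image_coord:
  fixes f :: "('x => complex) => 'y => complex"
  assumes "finite A" and add: "\<And>x y. f (x + y) = f x + f y" and scale: "\<And>c x. f (cscale c x) = cscale c (f x)"
    and inj: "inj_on (\<lambda>k. f (unit_vec k)) {k\<in>A. f (unit_vec k) ~= 0}"
    and ind: "\<And>k. k \<in> A ==> f (unit_vec k) = 0 \<or> (\<exists>r. f (unit_vec k) r ~= 0 \<and>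
        (\<forall>k'\<in>A. k' ~= k --> f (unit_vec k') r = 0))"
  shows "cdim (f ` coord_space A) = card {k\<in>A. f (unit_vec k) ~= 0}"
    and "{x \<in> coord_space A. f x = 0} = coord_space {k\<in>A. f (unit_vec k) = 0}"
proof -
  let ?B = "{k\<in>A. f (unit_vec k) ~= 0}"
  have f0: "f 0 = 0" using scale[of 0 0] by (simp add: cvs.scale_zero_left)
  have fsum: "f (\<Sum>i\<in>I. g i) = (\<Sum>i\<in>I. f (g i))" for I :: "'i set" and g
    by (induction I rule: infinite_finite_induct) (simp_all only: sum.infinite sum.empty sum.insert f0 add simp_thms)
  have fx: "f x = (\<Sum>k\<in>A. cscale (x k) (f (unit_vec k)))" if "x \<in> coord_space A" for x
    by (subst coord_space_expand[OF assms(1) that]) (simp add: fsum scale)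
  have val: "f x r = x k * f (unit_vec k) r"
    if "x \<in> coord_space A" "k \<in> A" "\<forall>k'\<in>A. k' ~= k --> f (unit_vec k') r = 0" for x k r
  proof -
    have "f x r = (\<Sum>k'\<in>A. x k' * f (unit_vec k') r)" by (simp add: fx[OF that(1)] sum_fun_apply)
    also have "\<dots> = (\<Sum>k'\<in>A. if k' = k then x k * f (unit_vec k) r else 0)"
      by (rule sum.cong) (use that(3) in auto)
    also have "\<dots> = x k * f (unit_vec k) r" using assms(1) that(2) by simp
    finally show ?thesis .
  qed
  show "{x \<in> coord_space A. f x = 0} = coord_space {k\<in>A. f (unit_vec k) = 0}"
  proof (intro equalityI subsetI)
    fix x assume x: "x \<in> {x \<in> coord_space A. f x = 0}"
    have "x k = 0" if kn: "k \<notin> {k\<in>A. f (unit_vec k) = 0}" for k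
    proof (cases "k \<in> A")
      case True
      hence "f (unit_vec k) ~= 0" using kn by blast
      then obtain r where r: "f (unit_vec k) r ~= 0" "\<forall>k'\<in>A. k' ~= k --> f (unit_vec k') r = 0"
        using ind[OF True] by blast
      have "f x r = 0" using x by simp
      thus ?thesis using val[OF _ True r(2), of x] x r(1) by simp
    next
      case False
      thus ?thesis using x by (auto simp: coord_space_def)
    qed
    thus "x \<in> coord_space {k\<in>A. f (unit_vec k) = 0}" unfolding coord_space_def by blast
  next
    fix x assume x: "x \<in> coord_space {k\<in>A. f (unit_vec k) = 0}"
    hence xA: "x \<in> coord_space A" by (auto simp: coord_space_def)
    have z: "cscale (x k) (f (unit_vec k)) = 0" if "k \<in> A" for k
    proof (cases "f (unit_vec k) = 0")
      case False
      hence "x k = 0" using x by (auto simp: coord_space_def)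
      thus ?thesis by (simp add: cvs.scale_zero_left)
    qed (simp add: cvs.scale_zero_right)
    have "f x = 0" unfolding fx[OF xA] by (rule sum.neutral) (use z in blast)
    thus "x \<in> {x \<in> coord_space A. f x = 0}" using xA by simp
  qed
  have finB: "finite ?B" using assms(1) by simp
  have "f ` coord_space A = cspan ((\<lambda>k. f (unit_vec k)) ` ?B)"
  proof (intro equalityI subsetI)
    fix y assume "y \<in> f ` coord_space A"
    then obtain x where x: "x \<in> coord_space A" "y = f x" by blast
    have "cscale (x k) (f (unit_vec k)) \<in> cspan ((\<lambda>k. f (unit_vec k)) ` ?B)" if "k \<in> A" for k
    proof (cases "f (unit_vec k) = 0")
      case True
      thus ?thesis by (simp add: cvs.scale_zero_right cvs.span_zero)
    next
      case False
      thus ?thesis using that by (intro cvs.span_scale cvs.span_base) blast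
    qed
    thus "y \<in> cspan ((\<lambda>k. f (unit_vec k)) ` ?B)" using x fx by (simp add: cvs.span_sum)
  next
    fix y assume y: "y \<in> cspan ((\<lambda>k. f (unit_vec k)) ` ?B)"
    have "csubspace (f ` coord_space A)"
    proof (rule cvs.subspaceI)
      show "0 \<in> f ` coord_space A" 
        by (rule image_eqI[where x = 0]) (simp_all only: f0 cvs.subspace_0[OF csubspace_coord_space])
      show "a + b \<in> f ` coord_space A" if "a \<in> f ` coord_space A" "b \<in> f ` coord_space A" for a b
        using that cvs.subspace_add[OF csubspace_coord_space] add[symmetric] by blast
      show "cscale c a \<in> f ` coord_space A" if "a \<in> f ` coord_space A" for c a
        using that cvs.subspace_scale[OF csubspace_coord_space] scale[symmetric] by blast
    qed
    moreover have "(\<lambda>k. f (unit_vec k)) ` ?B \<subseteq> f ` coord_space A"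
      by (auto simp: coord_space_def unit_vec_def intro!: imageI split: if_splits)
    ultimately show "y \<in> f ` coord_space A" using y cvs.span_minimal by blast
  qed
  moreover have "cvs.independent ((\<lambda>k. f (unit_vec k)) ` ?B)"
  proof (rule cvs.independent_if_scalars_zero)
    show "finite ((\<lambda>k. f (unit_vec k)) ` ?B)" using finB by simp
    fix c v assume s: "(\<Sum>x\<in>(\<lambda>k. f (unit_vec k)) ` ?B. cscale (c x) x) = 0"
      and "v \<in> (\<lambda>k. f (unit_vec k)) ` ?B"
    then obtain k where k: "k \<in> ?B" "v = f (unit_vec k)" by blast
    then obtain r where r: "f (unit_vec k) r ~= 0" "\<forall>k'\<in>A. k' ~= k --> f (unit_vec k') r = 0"
      using ind[of k] by auto
    have "0 = (\<Sum>k\<in>?B. cscale (c (f (unit_vec k))) (f (unit_vec k)))"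
      using s by (simp add: sum.reindex[OF inj])
    hence "0 = (\<Sum>k\<in>?B. cscale (c (f (unit_vec k))) (f (unit_vec k))) r" by simp
    also have "\<dots> = (\<Sum>k'\<in>?B. c (f (unit_vec k')) * f (unit_vec k') r)" by (simp add: sum_fun_apply)
    also have "\<dots> = (\<Sum>k'\<in>?B. if k' = k then c (f (unit_vec k)) * f (unit_vec k) r else 0)"
      by (rule sum.cong) (use r(2) in auto)
    also have "\<dots> = c v * f (unit_vec k) r" using finB k by simp
    finally show "c v = 0" using r(1) by simp
  qed
  ultimately show "cdim (f ` coord_space A) = card ?B"
    using cvs.dim_span_eq_card_independent[of "(\<lambda>k. f (unit_vec k)) ` ?B"] card_image[OF inj] by simp
qed


section \<open>Hom and Ext from a simple module\<close>

lemma sum_mult_unit_row: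
  fixes c :: "nat => complex"
  assumes "\<And>m. c m = 0 \<or> c m = 1" "\<And>m m'. c m = 1 ==> c m' = 1 ==> m = m'" "c k = 1" "k < d"
  shows "(\<Sum>m<d. c m * x m) = x k"
proof -
  have "(\<Sum>m<d. c m * x m) = (\<Sum>m<d. if m = k then x k else 0)"
  proof (rule sum.cong)
    fix m
    show "c m * x m = (if m = k then x k else 0)"
      using assms by auto
  qed simp
  thus ?thesis using assms(4) by simp
qed

text \<open>\<open>nxt a\<close> is the arrow whose composite after \<open>a\<close> is a defining
  relation. The assumption \<open>relations\<close> ranges over all representations because
  extensions of \<open>M\<close> have to be tested as well as \<open>M\<close> itself.\<close>

locale thin_module = thin_rep +
  fixes nxt :: "'b => 'b option"
  assumes finite_arrs: "finite (arrs Q)"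
    and nxt_arr: "a \<in> arrs Q ==> nxt a = Some b ==> b \<in> arrs Q \<and> src Q b = tgt Q a"
    and relations: "\<And>N :: ('a, 'b) rep.
        (\<forall>c \<in> arrs Q. \<forall>i < rdim N. \<forall>k < rdim N. cyclic_deriv_ent Q N c i k = 0) \<longleftrightarrow>
        (\<forall>a \<in> arrs Q. \<forall>b. nxt a = Some b --> (\<forall>i < rdim N. \<forall>k < rdim N.
           (\<Sum>m<rdim N. ent N b i m * ent N a m k) = 0))"
    and nilpotent: "\<exists>L. \<forall>w. set w \<subseteq> arrs Q \<and> length w \<ge> L -->
        (\<forall>i < rdim M. \<forall>k < rdim M. path_ent M w i k = 0)"
    and M_relations: "a \<in> arrs Q ==> nxt a = Some b ==> ent M a m k = 1 ==> ent M b i m ~= 1"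
begin

text \<open>The condition under which an extension may send its top vector to
  \<open>z\<^sub>p\<close> along \<open>a\<close> without violating the relation that begins with
  \<open>a\<close>.\<close>

definition kills :: "'b => nat => bool" where
  "kills a p \<longleftrightarrow> (\<forall>b. nxt a = Some b --> (\<forall>j. ent M b j p ~= 1))"

context
  fixes i assumes i: "i \<in> verts Q"
begin

lemma graded_maps_simple: "graded_maps (simple_rep i) M = coord_space ((\<lambda>p. (p, 0)) ` pos i)"
  by (auto simp: graded_maps_def simple_rep_def coord_space_def pos_def image_iff)

lemma defect_simple:
  "defect Q (simple_rep i) M h (a, p, k) =
     (if a \<in> arrs Q then (\<Sum>m<rdim M. ent M a p m * h (m, k)) else 0)"
  by (simp add: defect_def simple_rep_def)

lemma defect_unit:
  assumes "q \<in> pos i"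
  shows "defect Q (simple_rep i) M (unit_vec (q, 0)) (a, p, k) =
     (if a \<in> arrs Q \<and> k = 0 \<and> ent M a p q = 1 then 1 else 0)"
proof (cases "a \<in> arrs Q")
  case True
  have "(\<Sum>m<rdim M. ent M a p m * unit_vec (q, 0) (m, k)) =
      (\<Sum>m<rdim M. if m = q then (if k = 0 then ent M a p q else 0) else 0)"
    by (rule sum.cong) (auto simp: unit_vec_def)
  also have "\<dots> = (if k = 0 then ent M a p q else 0)" using assms by (simp add: pos_def)
  finally show ?thesis using True ent_01[OF True, of p q] by (auto simp: defect_simple)
qed (simp add: defect_simple)

text \<open>Rank-nullity for \<open>defect\<close>. In the g-vector only this sum of dimensions
  occurs, besides the dimension of the space of admissible blocks.\<close>

lemma hom_and_image:
  "cdim (hom_space Q (simple_rep i) M) + cdim (defect Q (simple_rep i) M ` graded_maps (simple_rep i) M)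
     = card (pos i)"
proof -
  let ?A = "(\<lambda>p. (p, 0 :: nat)) ` pos i" and ?f = "defect Q (simple_rep i) M"
  have finA: "finite ?A" by simp
  have add: "?f (x + y) = ?f x + ?f y" for x y
    by (rule ext) (auto simp: defect_def simple_rep_def plus_fun_def distrib_left sum.distrib split: prod.splits)
  have scale: "?f (cscale c x) = cscale c (?f x)" for c x
    by (rule ext) (auto simp: defect_def simple_rep_def sum_distrib_left mult.left_commute split: prod.splits)
  have nz: "\<exists>a p. a \<in> arrs Q \<and> ent M a p q = 1" if "q \<in> pos i" "?f (unit_vec (q, 0)) ~= 0" for q
  proof (rule ccontr)
    assume no: "\<not> ?thesis"
    have "?f (unit_vec (q, 0)) r = 0" for r
    proof -
      obtain a p k where r: "r = (a, p, k)" by (cases r) auto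
      show ?thesis unfolding r defect_unit[OF that(1)] using no by auto
    qed
    thus False using that(2) by (auto simp: fun_eq_iff)
  qed
  have inj: "inj_on (\<lambda>k. ?f (unit_vec k)) {k\<in>?A. ?f (unit_vec k) ~= 0}"
  proof (rule inj_onI)
    fix x y assume x: "x \<in> {k\<in>?A. ?f (unit_vec k) ~= 0}" and y: "y \<in> {k\<in>?A. ?f (unit_vec k) ~= 0}"
      and eq: "?f (unit_vec x) = ?f (unit_vec y)"
    obtain q q' where q: "x = (q, 0)" "q \<in> pos i" "y = (q', 0)" "q' \<in> pos i" using x y by auto
    obtain a p where a: "a \<in> arrs Q" "ent M a p q = 1" using nz[OF q(2)] x q(1) by auto
    have "?f (unit_vec (q', 0)) (a, p, 0) = 1" using eq defect_unit[OF q(2), of a p 0] a q by simp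
    hence "ent M a p q' = 1" using defect_unit[OF q(4), of a p 0] by (auto split: if_splits)
    thus "x = y" using ent_inj2[OF a] q by simp
  qed
  have ind: "?f (unit_vec k) = 0 \<or> (\<exists>r. ?f (unit_vec k) r ~= 0 \<and>
        (\<forall>k'\<in>?A. k' ~= k --> ?f (unit_vec k') r = 0))" if kA: "k \<in> ?A" for k
  proof (cases "?f (unit_vec k) = 0")
    case False
    obtain q where q: "k = (q, 0)" "q \<in> pos i" using kA by auto
    obtain a p where a: "a \<in> arrs Q" "ent M a p q = 1" using nz[OF q(2)] False q(1) by auto
    have "?f (unit_vec k) (a, p, 0) ~= 0" using defect_unit[OF q(2), of a p 0] a q by simp
    moreover have "?f (unit_vec k') (a, p, 0) = 0" if k': "k' \<in> ?A" "k' ~= k" for k'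
    proof -
      obtain q' where q': "k' = (q', 0)" "q' \<in> pos i" using k'(1) by auto
      hence "q' ~= q" using q(1) k'(2) by blast
      hence "ent M a p q' ~= 1" using ent_inj2[OF a] by blast
      thus ?thesis using defect_unit[OF q'(2), of a p 0] q'(1) by simp
    qed
    ultimately show ?thesis by blast
  qed simp
  let ?B = "{k\<in>?A. ?f (unit_vec k) ~= 0}" and ?C = "{k\<in>?A. ?f (unit_vec k) = 0}"
  have "cdim (?f ` graded_maps (simple_rep i) M) = card ?B"
    unfolding graded_maps_simple by (rule cdim_image_coord(1)[OF finA add scale inj ind])
  moreover have "cdim (hom_space Q (simple_rep i) M) = card ?C"
  proof -
    have "hom_space Q (simple_rep i) M = coord_space ?C"
      unfolding hom_space_def graded_maps_simple by (rule cdim_image_coord(2)[OF finA add scale inj ind])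
    thus ?thesis by (simp add: cdim_coord_space)
  qed
  moreover have "card ?C + card ?B = card ?A"
  proof -
    have "?A = ?C \<union> ?B" "?C \<inter> ?B = {}" by blast+
    thus ?thesis using card_Un_disjoint[of ?C ?B] by simp
  qed
  moreover have "card ?A = card (pos i)" by (rule card_image) (simp add: inj_on_def)
  ultimately show ?thesis by simp
qed

definition ext_index :: "('b \<times> nat \<times> nat) set" where
  "ext_index = {(a, p, k). a \<in> arrs Q \<and> src Q a = i \<and> p \<in> pos (tgt Q a) \<and> kills a p \<and> k = 0}"

text \<open>\<open>M\<close> is a subrepresentation of the extension, so a path that starts in
  \<open>M\<close> never meets the added basis vector, whose index is \<open>rdim M\<close>.\<close>

lemma path_ent_ext:
  "k < rdim M ==> p <= rdim M ==> path_ent (ext_rep (simple_rep i) M f) w p k =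
     (if p < rdim M then path_ent M w p k else 0)"
proof (induction w arbitrary: k)
  case Nil
  thus ?case by auto
next
  case (Cons a w)
  let ?E = "ext_rep (simple_rep i) M f"
  have "path_ent ?E (a # w) p k = (\<Sum>m<Suc (rdim M). path_ent ?E w p m * ent ?E a m k)"
    by (simp add: ext_rep_def simple_rep_def)
  also have "\<dots> = (\<Sum>m<rdim M. path_ent ?E w p m * ent M a m k)"
    using Cons.prems(1) by (simp add: ext_rep_def)
  also have "\<dots> = (\<Sum>m<rdim M. (if p < rdim M then path_ent M w p m else 0) * ent M a m k)"
    by (rule sum.cong) (use Cons.IH Cons.prems(2) in auto)
  finally show ?case by (simp del: path_ent.simps) (simp add: path_ent.simps)
qed

text \<open>Arrows vanish on the simple module, so the relation starting with \<open>a\<close>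
  constrains only the block of \<open>a\<close>. Rows of \<open>M\<close> have at most one nonzero
  entry, so this linear condition says that certain coordinates vanish, and the admissible blocks
  form a coordinate space.\<close>

lemma ext_blocks_simple: "ext_blocks Q (simple_rep i) M = coord_space ext_index"
proof -
  let ?d = "rdim M"
  have "f \<in> ext_blocks Q (simple_rep i) M \<longleftrightarrow> f \<in> coord_space ext_index" for f
  proof -
    let ?E = "ext_rep (simple_rep i) M f"
    have rE: "rdim ?E = Suc ?d" by (simp add: ext_rep_def simple_rep_def)
    have vE: "vtx ?E k = (if k < ?d then vtx M k else i)" for k by (simp add: ext_rep_def simple_rep_def)
    have eE: "ent ?E a p k = (if k < ?d then (if p < ?d then ent M a p k else 0)
        else if p < ?d then f (a, p, k - ?d) else 0)" for a p k
      by (simp add: ext_rep_def simple_rep_def)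
    let ?supp = "\<forall>a p k. f (a, p, k) ~= 0 --> a \<in> arrs Q \<and> p < ?d \<and> k < (1::nat)"
    let ?grad = "\<forall>a\<in>arrs Q. \<forall>p k. ent ?E a p k ~= 0 -->
        p < rdim ?E \<and> k < rdim ?E \<and> vtx ?E k = src Q a \<and> vtx ?E p = tgt Q a"
    let ?rel = "\<forall>a \<in> arrs Q. \<forall>b. nxt a = Some b --> (\<forall>p < rdim ?E. \<forall>k < rdim ?E.
           (\<Sum>m<rdim ?E. ent ?E b p m * ent ?E a m k) = 0)"
    have 1: "\<forall>k < rdim ?E. vtx ?E k \<in> verts Q" using vtx_verts i by (simp add: vE)
    obtain L where L: "\<And>w p k. set w \<subseteq> arrs Q ==> length w \<ge> L ==> p < ?d ==> k < ?d ==> path_ent M w p k = 0"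
      using nilpotent by blast
    have 2: "\<exists>L. \<forall>w. set w \<subseteq> arrs Q \<and> length w \<ge> L -->
        (\<forall>p < rdim ?E. \<forall>k < rdim ?E. path_ent ?E w p k = 0)"
    \<comment> \<open>The first arrow moves the top vector into \<open>M\<close>; afterwards the
      bound for \<open>M\<close> applies.\<close>
    proof (intro exI[of _ "Suc L"] allI impI)
      fix w p k assume w: "set w \<subseteq> arrs Q \<and> length w \<ge> Suc L" and p: "p < rdim ?E" and k: "k < rdim ?E"
      then obtain a w' where aw: "w = a # w'" "set w' \<subseteq> arrs Q" "length w' \<ge> L" by (cases w) auto
      have z: "path_ent ?E w' p m = 0" if "m < ?d" for m
        using path_ent_ext[OF that, of p f w'] L[OF aw(2,3), of p m] p that by (simp add: rE)
      have "path_ent ?E w p k = (\<Sum>m<Suc ?d. path_ent ?E w' p m * ent ?E a m k)"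
        using aw(1) rE by simp
      also have "\<dots> = 0" using z by (simp add: eE)
      finally show "path_ent ?E w p k = 0" .
    qed
    have mem: "f \<in> ext_blocks Q (simple_rep i) M \<longleftrightarrow> ?supp \<and> ?grad \<and> ?rel"
      using 1 2 relations[of ?E] unfolding ext_blocks_def is_rep_def
      by (simp add: simple_rep_def)
    have gradM: "p < ?d \<and> k < ?d \<and> vtx M k = src Q a \<and> vtx M p = tgt Q a"
      if "a \<in> arrs Q" "ent M a p k ~= 0" for a p k
      using ent_graded[OF that(1), of p k] ent_01[OF that(1), of p k] that(2) by auto
    have sumE: "(\<Sum>m<rdim ?E. ent ?E b p m * ent ?E a m k) =
        (if p < ?d then (if k < ?d then \<Sum>m<?d. ent M b p m * ent M a m k
           else \<Sum>m<?d. ent M b p m * f (a, m, k - ?d)) else 0)" for a b p k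
      by (simp add: rE eE)
    have relM: "(\<Sum>m<?d. ent M b p m * ent M a m k) = 0" if "a \<in> arrs Q" "nxt a = Some b" for a b p k
    proof (rule sum.neutral, intro ballI)
      fix m
      show "ent M b p m * ent M a m k = 0"
        using M_relations[OF that, of m k p] ent_01[OF that(1), of m k]
          ent_01[OF conjunct1[OF nxt_arr[OF that]], of p m] by auto
    qed
    have row: "(\<Sum>m<?d. ent M b p m * f (a, m, 0)) = 0 \<longleftrightarrow> (\<forall>m<?d. ent M b p m = 1 --> f (a, m, 0) = 0)"
      if b: "b \<in> arrs Q" for a b p
    proof (cases "\<exists>m. ent M b p m = 1")
      case True
      then obtain m where m: "ent M b p m = 1" by blast
      hence "m < ?d" using ent_graded[OF b] by blast
      have "(\<Sum>m<?d. ent M b p m * f (a, m, 0)) = f (a, m, 0)"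
        by (rule sum_mult_unit_row[where c = "ent M b p" and x = "\<lambda>m. f (a, m, 0)", OF _ _ m \<open>m < ?d\<close>])
          (use ent_01[OF b] ent_inj2[OF b] in blast)+
      moreover have "m' = m" if "ent M b p m' = 1" for m' using ent_inj2[OF b m that] by simp
      ultimately show ?thesis using m \<open>m < ?d\<close> by metis
    next
      case False
      hence "ent M b p m = 0" for m using ent_01[OF b, of p m] by blast
      thus ?thesis using False by simp
    qed
    show ?thesis
    proof
      assume "f \<in> ext_blocks Q (simple_rep i) M"
      hence f: ?supp ?grad ?rel using mem by auto
      have "(a, p, k) \<in> ext_index" if nz: "f (a, p, k) ~= 0" for a p k
      proof -
        have s: "a \<in> arrs Q" "p < ?d" "k = 0" using f(1) nz by auto
        have "ent ?E a p ?d ~= 0" using nz s by (simp add: eE)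
        hence "vtx ?E ?d = src Q a \<and> vtx ?E p = tgt Q a" using f(2) s(1) by blast
        hence g: "src Q a = i" "vtx M p = tgt Q a" using s(2) by (simp_all add: vE)
        have "kills a p"
          unfolding kills_def
        proof (intro allI impI)
          fix b j assume b: "nxt a = Some b"
          show "ent M b j p ~= 1"
          proof
            assume e1: "ent M b j p = 1"
            have bQ: "b \<in> arrs Q" using nxt_arr[OF s(1) b] by blast
            have "j < ?d" using ent_graded[OF bQ e1] by blast
            hence "(\<Sum>m<rdim ?E. ent ?E b j m * ent ?E a m ?d) = 0" using f(3) s(1) b rE by auto
            hence "(\<Sum>m<?d. ent M b j m * f (a, m, 0)) = 0" unfolding sumE using \<open>j < ?d\<close> by simp
            thus False using row[OF bQ] e1 s(2,3) nz by blast
          qed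
        qed
        thus ?thesis using s g by (simp add: ext_index_def pos_def)
      qed
      thus "f \<in> coord_space ext_index" by (auto simp: coord_space_def)
    next
      assume f: "f \<in> coord_space ext_index"
      hence fd: "a \<in> arrs Q \<and> src Q a = i \<and> p \<in> pos (tgt Q a) \<and> kills a p \<and> k = 0" if "f (a, p, k) ~= 0" for a p k
        using that unfolding coord_space_def ext_index_def by blast
      have ?supp using fd by (auto simp: pos_def)
      moreover have ?grad
      proof (intro ballI allI impI)
        fix a p k assume a: "a \<in> arrs Q" and nz: "ent ?E a p k ~= 0"
        show "p < rdim ?E \<and> k < rdim ?E \<and> vtx ?E k = src Q a \<and> vtx ?E p = tgt Q a"
        proof (cases "k < ?d")
          case True
          hence "p < ?d" "ent M a p k ~= 0" using nz by (auto simp: eE split: if_splits)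
          thus ?thesis using gradM[OF a, of p k] True by (simp add: rE vE)
        next
          case False
          hence "p < ?d" "f (a, p, k - ?d) ~= 0" using nz by (auto simp: eE split: if_splits)
          thus ?thesis using fd[of a p "k - ?d"] False by (auto simp: rE vE pos_def)
        qed
      qed
      moreover have ?rel
      proof (intro ballI allI impI)
        fix a b p k assume a: "a \<in> arrs Q" and b: "nxt a = Some b" and p: "p < rdim ?E" and k: "k < rdim ?E"
        have bQ: "b \<in> arrs Q" using nxt_arr[OF a b] by blast
        have "f (a, m, 0) = 0" if "ent M b p m = 1" for m
        proof (rule ccontr)
          assume "f (a, m, 0) ~= 0"
          hence "kills a m" using fd by blast
          thus False using b that unfolding kills_def by blast
        qed
        hence "(\<Sum>m<?d. ent M b p m * f (a, m, 0)) = 0" using row[OF bQ] by blast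
        moreover have "k < ?d \<or> k - ?d = 0" using k rE by auto
        ultimately show "(\<Sum>m<rdim ?E. ent ?E b p m * ent ?E a m k) = 0"
          unfolding sumE using relM[OF a b] by auto
      qed
      ultimately show "f \<in> ext_blocks Q (simple_rep i) M" using mem by blast
    qed
  qed
  thus ?thesis by blast
qed

lemma card_ext_index:
  "card ext_index = (\<Sum>a | a \<in> arrs Q \<and> src Q a = i. card {p \<in> pos (tgt Q a). kills a p})"
proof -
  let ?S = "SIGMA a:{a \<in> arrs Q. src Q a = i}. {p \<in> pos (tgt Q a). kills a p}"
  let ?h = "\<lambda>(a, p). (a, p, 0 :: nat)"
  have "ext_index = ?h ` ?S"
    by (auto simp: ext_index_def image_iff)
  moreover have "inj_on ?h ?S" by (auto simp: inj_on_def)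
  ultimately have "card ext_index = card ?S" using card_image[of ?h ?S] by simp
  thus ?thesis using finite_arrs by (simp add: card_SigmaI)
qed

lemma finite_ext_index: "finite ext_index"
proof -
  have "ext_index \<subseteq> arrs Q \<times> {..<rdim M} \<times> {0}" by (auto simp: ext_index_def pos_def)
  thus ?thesis by (rule finite_subset) (simp add: finite_arrs)
qed

theorem g_vec_eq:
  "g_vec Q (M, V) i = int (V i) - int (card (pos i)) +
     (\<Sum>a | a \<in> arrs Q \<and> src Q a = i. int (card {p \<in> pos (tgt Q a). kills a p}))"
proof -
  have "cdim (ext_blocks Q (simple_rep i) M) =
      (\<Sum>a | a \<in> arrs Q \<and> src Q a = i. card {p \<in> pos (tgt Q a). kills a p})"
    unfolding ext_blocks_simple by (simp add: cdim_coord_space finite_ext_index card_ext_index)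
  thus ?thesis
    using hom_and_image unfolding g_vec_def hom_dim_def ext1_dim_def by simp
qed

end

end

section \<open>Laurent monomials\<close>

definition xpow :: "'v => int => 'v laurent" where
  "xpow v k = Poly_Mapping.single (Poly_Mapping.single v k) 1"

abbreviation xvar :: "'v => 'v laurent" where "xvar v \<equiv> xpow v 1"
abbreviation xinv :: "'v => 'v laurent" where "xinv v \<equiv> xpow v (-1)"

lemma xpow_add: "xpow v (k + l) = xpow v k * xpow v l"
  by (simp add: xpow_def mult_single single_add)

lemma xpow_0 [simp]: "xpow v 0 = 1" by (simp add: xpow_def)

lemma xpow_inverse: "xpow v k * xpow v (-k) = 1" "xpow v (-k) * xpow v k = 1"
  using xpow_add[of v k "-k"] xpow_add[of v "-k" k] by simp_all

lemma xpow_sum: "xpow v (\<Sum>i\<in>I. f i) = (\<Prod>i\<in>I. xpow v (f i))"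
  by (induction I rule: infinite_finite_induct) (simp_all add: xpow_add)

lemma lmonom_prod: "finite I ==> lmonom I u = (\<Prod>i\<in>I. xpow i (u i))"
proof (induction I rule: finite_induct)
  case empty
  thus ?case by (simp add: lmonom_def)
next
  case (insert i I)
  have "lmonom (insert i I) u = xpow i (u i) * lmonom I u"
    using insert.hyps by (simp add: lmonom_def xpow_def mult_single)
  with insert show ?case by simp
qed

lemma lmonom_add: "finite I ==> lmonom I (\<lambda>i. u i + w i) = lmonom I u * lmonom I w"
  by (simp add: lmonom_prod xpow_add prod.distrib)

lemma lmonom_sum: "finite I ==> lmonom I (\<lambda>i. \<Sum>k\<in>K. u k i) = (\<Prod>k\<in>K. lmonom I (u k))"
  by (simp add: lmonom_prod xpow_sum) (rule prod.swap)

lemma lmonom_single: "finite I ==> v \<in> I ==> lmonom I (\<lambda>i. if i = v then k else 0) = xpow v k"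
proof -
  assume "finite I" "v \<in> I"
  have "(\<Prod>i\<in>I. xpow i (if i = v then k else 0)) = (\<Prod>i\<in>I. if i = v then xpow v k else 1)"
    by (rule prod.cong) auto
  also have "\<dots> = xpow v k" using \<open>finite I\<close> \<open>v \<in> I\<close> by simp
  finally show ?thesis using \<open>finite I\<close> by (simp add: lmonom_prod)
qed

section \<open>Caldero-Chapoton functions of thin modules\<close>

text \<open>The monomial whose exponent vector is column \<open>v\<close> of \<open>c_mat\<close>,
  i.e. the factor contributed by one basis vector at \<open>v\<close>. A loop contributes a variable
  and its inverse, which cancel.\<close>

definition y_monom :: "('v, 'a) qp => 'v => 'v laurent" where
  "y_monom Q v = (\<Prod>a | a \<in> arrs Q \<and> src Q a = v. xvar (tgt Q a)) *
     (\<Prod>a | a \<in> arrs Q \<and> tgt Q a = v. xinv (src Q a))"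

lemma lmonom_count:
  assumes "finite I" "finite A" "f ` A \<subseteq> I"
  shows "lmonom I (\<lambda>i. k * int (card {a \<in> A. f a = i})) = (\<Prod>a\<in>A. xpow (f a) k)"
proof -
  have "k * int (card {a \<in> A. f a = i}) = (\<Sum>a\<in>A. if i = f a then k else 0)" for i
  proof -
    have "(\<Sum>a\<in>A. if i = f a then k else 0) = (\<Sum>a\<in>{a \<in> A. f a = i}. k)"
      by (rule sum.mono_neutral_cong_right) (use assms(2) in auto)
    thus ?thesis by simp
  qed
  hence "lmonom I (\<lambda>i. k * int (card {a \<in> A. f a = i})) = (\<Prod>a\<in>A. lmonom I (\<lambda>i. if i = f a then k else 0))"
    using lmonom_sum[OF assms(1), of "\<lambda>a i. if i = f a then k else 0" A] by simp
  also have "\<dots> = (\<Prod>a\<in>A. xpow (f a) k)"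
  proof (rule prod.cong)
    fix a assume "a \<in> A"
    hence "f a \<in> I" using assms(3) by blast
    thus "lmonom I (\<lambda>i. if i = f a then k else 0) = xpow (f a) k" by (rule lmonom_single[OF assms(1)])
  qed simp
  finally show ?thesis .
qed

lemma lmonom_c_mat:
  assumes "finite (verts Q)" "finite (arrs Q)" "\<And>a. a \<in> arrs Q ==> src Q a \<in> verts Q \<and> tgt Q a \<in> verts Q"
  shows "lmonom (verts Q) (\<lambda>i. c_mat Q i v) = y_monom Q v"
proof -
  let ?A = "{a \<in> arrs Q. src Q a = v}" and ?B = "{a \<in> arrs Q. tgt Q a = v}"
  have c: "c_mat Q i v = 1 * int (card {a \<in> ?A. tgt Q a = i}) + (-1) * int (card {a \<in> ?B. src Q a = i})" for i
    unfolding c_mat_def by (simp add: conj_ac Collect_conj_eq Int_ac)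
  have "lmonom (verts Q) (\<lambda>i. 1 * int (card {a \<in> ?A. tgt Q a = i})) = (\<Prod>a\<in>?A. xvar (tgt Q a))"
    by (rule lmonom_count) (use assms in auto)
  moreover have "lmonom (verts Q) (\<lambda>i. (-1) * int (card {a \<in> ?B. src Q a = i})) = (\<Prod>a\<in>?B. xinv (src Q a))"
    by (rule lmonom_count) (use assms in auto)
  ultimately show ?thesis unfolding c lmonom_add[OF assms(1)] y_monom_def by simp
qed

context thin_module
begin

lemma lmonom_dimension:
  assumes "finite S" "S \<subseteq> {..<rdim M}"
  shows "lmonom (verts Q) (\<lambda>i. \<Sum>j\<in>verts Q. c_mat Q i j * int (card (S \<inter> pos j))) =
    (\<Prod>p\<in>S. y_monom Q (vtx M p))"
proof -
  have "(\<Sum>j\<in>verts Q. c_mat Q i j * int (card (S \<inter> pos j))) = (\<Sum>p\<in>S. c_mat Q i (vtx M p))" for i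
  proof -
    have "(\<Sum>j\<in>verts Q. c_mat Q i j * int (card (S \<inter> pos j))) = (\<Sum>j\<in>verts Q. \<Sum>p\<in>{p \<in> S. vtx M p = j}. c_mat Q i (vtx M p))"
    proof (rule sum.cong)
      fix j
      have "S \<inter> pos j = {p \<in> S. vtx M p = j}" using assms(2) by (auto simp: pos_def)
      thus "c_mat Q i j * int (card (S \<inter> pos j)) = (\<Sum>p\<in>{p \<in> S. vtx M p = j}. c_mat Q i (vtx M p))"
        by simp
    qed simp
    also have "\<dots> = (\<Sum>p\<in>S. c_mat Q i (vtx M p))"
      by (rule sum.group) (use assms finite_verts vtx_verts in auto)
    finally show ?thesis .
  qed
  thus ?thesis
    using lmonom_sum[OF finite_verts, of "\<lambda>p i. c_mat Q i (vtx M p)" S]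
      lmonom_c_mat[OF finite_verts finite_arrs arrow_verts] by simp
qed

text \<open>Exchanging the sums over arrows and basis vectors groups the exponents by basis vectors;
  each factor can then be compared with the geometry at a single crossing.\<close>

lemma lmonom_g_vec:
  "lmonom (verts Q) (g_vec Q (M, \<lambda>_. 0)) =
     (\<Prod>p<rdim M. xinv (vtx M p) * (\<Prod>a | a \<in> arrs Q \<and> tgt Q a = vtx M p \<and> kills a p. xvar (src Q a)))"
proof -
  let ?K = "SIGMA p:{..<rdim M}. {a. a \<in> arrs Q \<and> tgt Q a = vtx M p \<and> kills a p}"
  have finK: "finite ?K" using finite_arrs by auto
  have g: "g_vec Q (M, \<lambda>_. 0) i = (-1) * int (card {p \<in> {..<rdim M}. vtx M p = i}) +
      1 * int (card {q \<in> ?K. src Q (snd q) = i})" if i: "i \<in> verts Q" for i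
  proof -
    have "{q \<in> ?K. src Q (snd q) = i} =
        (\<lambda>(a, p). (p, a)) ` (SIGMA a:{a \<in> arrs Q. src Q a = i}. {p \<in> pos (tgt Q a). kills a p})"
      by (auto simp: pos_def image_iff)
    moreover have "inj_on (\<lambda>(a, p). (p, a)) (SIGMA a:{a \<in> arrs Q. src Q a = i}. {p \<in> pos (tgt Q a). kills a p})"
      by (auto simp: inj_on_def)
    ultimately have "card {q \<in> ?K. src Q (snd q) = i} =
        card (SIGMA a:{a \<in> arrs Q. src Q a = i}. {p \<in> pos (tgt Q a). kills a p})"
      using card_image[of "\<lambda>(a, p). (p, a)"] by simp
    also have "\<dots> = (\<Sum>a | a \<in> arrs Q \<and> src Q a = i. card {p \<in> pos (tgt Q a). kills a p})"
      using finite_arrs by (simp add: card_SigmaI)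
    finally have "int (card {q \<in> ?K. src Q (snd q) = i}) =
        (\<Sum>a | a \<in> arrs Q \<and> src Q a = i. int (card {p \<in> pos (tgt Q a). kills a p}))" by simp
    thus ?thesis unfolding g_vec_eq[OF i] by (simp add: pos_def)
  qed
  have "lmonom (verts Q) (g_vec Q (M, \<lambda>_. 0)) =
      lmonom (verts Q) (\<lambda>i. (-1) * int (card {p \<in> {..<rdim M}. vtx M p = i}) +
      1 * int (card {q \<in> ?K. src Q (snd q) = i}))"
    unfolding lmonom_prod[OF finite_verts] by (rule prod.cong) (simp_all only: g)
  also have "\<dots> = (\<Prod>p<rdim M. xinv (vtx M p)) * (\<Prod>q\<in>?K. xvar (src Q (snd q)))"
    unfolding lmonom_add[OF finite_verts]
    by (rule arg_cong2[where f = "(*)"]; rule lmonom_count[OF finite_verts])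
      (use finK vtx_verts arrow_verts in auto)
  also have "(\<Prod>q\<in>?K. xvar (src Q (snd q))) =
      (\<Prod>p<rdim M. \<Prod>a | a \<in> arrs Q \<and> tgt Q a = vtx M p \<and> kills a p. xvar (src Q a))"
    using finite_arrs by (subst prod.Sigma) (auto simp: case_prod_beta)
  finally show ?thesis by (simp add: prod.distrib)
qed

text \<open>By \<open>euler_char_Gr\<close> the coefficient of a dimension vector counts the closed
  sets of that dimension. Summing over all dimension vectors leaves one term for each closed
  set.\<close>

theorem CC_thin:
  "CC Q (M, \<lambda>_. 0) =
     (\<Prod>p<rdim M. xinv (vtx M p) * (\<Prod>a | a \<in> arrs Q \<and> tgt Q a = vtx M p \<and> kills a p. xvar (src Q a))) *
     (\<Sum>S | closed_set S. \<Prod>p\<in>S. y_monom Q (vtx M p))"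
proof -
  let ?E = "\<Pi>\<^sub>E v \<in> verts Q. {0..dimv M v}"
  let ?W = "\<lambda>e. lmonom (verts Q) (\<lambda>i. \<Sum>j \<in> verts Q. c_mat Q i j * int (e j))"
  let ?d = "\<lambda>S. \<lambda>v\<in>verts Q. card (S \<inter> pos v)"
  have finC: "finite {S. closed_set S}"
    by (rule finite_subset[of _ "Pow {..<rdim M}"]) (auto simp: closed_set_def)
  have "(\<Sum>e\<in>?E. of_int (euler_char (Gr_topology Q M e)) * ?W e) =
      (\<Sum>e\<in>?E. \<Sum>S\<in>{S \<in> {S. closed_set S}. ?d S = e}. \<Prod>p\<in>S. y_monom Q (vtx M p))"
  proof (rule sum.cong)
    fix e assume e: "e \<in> ?E"
    interpret thin_rep_dim Q M \<delta> e
      by unfold_locales (use e in auto)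
    have eq: "{S. closed_set S \<and> (\<forall>v\<in>verts Q. card (S \<inter> pos v) = e v)} = {S \<in> {S. closed_set S}. ?d S = e}"
      using e by (auto simp: fun_eq_iff restrict_def PiE_iff extensional_def)
    have "(\<Prod>p\<in>S. y_monom Q (vtx M p)) = ?W e" if S: "S \<in> {S \<in> {S. closed_set S}. ?d S = e}" for S
    proof -
      have Sr: "S \<subseteq> {..<rdim M}" using S by (auto simp: closed_set_def)
      have "e = ?d S" using S by simp
      hence "?W e = lmonom (verts Q) (\<lambda>i. \<Sum>j\<in>verts Q. c_mat Q i j * int (card (S \<inter> pos j)))" by simp
      thus ?thesis using lmonom_dimension[OF finite_subset[OF Sr finite_lessThan] Sr] by simp
    qed
    thus "of_int (euler_char (Gr_topology Q M e)) * ?W e =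
        (\<Sum>S\<in>{S \<in> {S. closed_set S}. ?d S = e}. \<Prod>p\<in>S. y_monom Q (vtx M p))"
      unfolding euler_char_Gr eq by simp
  qed simp
  also have "\<dots> = (\<Sum>S | closed_set S. \<Prod>p\<in>S. y_monom Q (vtx M p))"
  proof (rule sum.group[OF finC])
    show "finite ?E" using finite_verts by (intro finite_PiE) auto
    show "?d ` {S. closed_set S} \<subseteq> ?E"
      by (auto simp: dimv_pos intro!: card_mono)
  qed
  finally show ?thesis unfolding CC_def lmonom_g_vec fst_conv by simp
qed

end

section \<open>Triangulations of a periodic polygon\<close>

text \<open>
  The universal cover of the once-punctured disk: marked points are the integers, the deck
  transformation is the shift by \<open>m\<close>, and an edge \<open>E x y\<close> joins \<open>x\<close> and \<open>y\<close> below height \<open>m\<close>.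
\<close>
locale periodic_triangulation =
  fixes m :: int and E :: "int => int => bool"
  assumes m3: "m \<ge> 3"
    and E_len: "E x y ==> x < y \<and> y <= x + m"
    and E_side: "E x (x + 1)"
    and E_shift: "E x y ==> E (x + k * m) (y + k * m)"
    and noncross: "E x y ==> E x' y' ==> \<not> (x < x' \<and> x' < y \<and> y < y')"
    and maximal: "x + 2 <= y ==> y <= x + m ==>
        (\<And>c d. E c d ==> \<not> (x < c \<and> c < y \<and> y < d) \<and> \<not> (c < x \<and> x < d \<and> d < y)) ==> E x y"
begin

lemma E_shift_iff: "E (x + k * m) (y + k * m) \<longleftrightarrow> E x y"
  using E_shift[of "x + k * m" "y + k * m" "-k"] E_shift[of x y k] by auto

lemma E_shift1: "E (x + m) (y + m) \<longleftrightarrow> E x y" "E (x - m) (y - m) \<longleftrightarrow> E x y"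
  using E_shift_iff[of x 1 y] E_shift_iff[of x "-1" y] by simp_all

text \<open>Take the farthest neighbour \<open>c\<close> of \<open>a\<close> before
  \<open>b\<close>. An edge crossing the pair (c, b) would cross one of the edges at
  \<open>a\<close>, or start at \<open>a\<close> and contradict the choice of
  \<open>c\<close>.\<close>

lemma apex:
  assumes "E a b" "a + 2 <= b"
  shows "\<exists>c. a < c \<and> c < b \<and> E a c \<and> E c b"
proof -
  let ?S = "{c. a < c \<and> c < b \<and> E a c}"
  have fin: "finite ?S" by (rule finite_subset[of _ "{a..b}"]) auto
  have "a + 1 \<in> ?S" using assms E_side by simp
  hence ne: "?S ~= {}" by blast
  define c where "c = Max ?S"
  have c: "a < c" "c < b" "E a c" and mx: "\<And>d. a < d ==> d < b ==> E a d ==> d <= c"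
    using Max_in[OF fin ne] Max_ge[OF fin] unfolding c_def by auto
  have "E c b"
  proof (cases "b = c + 1")
    case True
    thus ?thesis using E_side by simp
  next
    case False
    show ?thesis
    proof (rule maximal)
      fix x y assume xy: "E x y"
      show "\<not> (c < x \<and> x < b \<and> b < y) \<and> \<not> (x < c \<and> c < y \<and> y < b)"
      proof (intro conjI notI)
        assume "c < x \<and> x < b \<and> b < y"
        thus False using noncross[OF assms(1) xy] c by linarith
      next
        assume *: "x < c \<and> c < y \<and> y < b"
        have "\<not> x < a" using noncross[OF xy assms(1)] * c by linarith
        moreover have "x ~= a" using mx[of y] xy * c by auto
        moreover have "\<not> a < x" using noncross[OF c(3) xy] * c by linarith
        ultimately show False by linarith
      qed
    qed (use c False E_len[OF assms(1)] in linarith)+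
  qed
  with c show ?thesis by blast
qed

text \<open>Take a longest edge from a to b. If it is shorter than \<open>m\<close>, let c be the
  farthest neighbour of b to the right: nothing crosses the pair (a, c), so maximality produces a
  longer edge.\<close>

lemma ex_pending: "\<exists>v. E v (v + m)"
proof -
  define len where "len l \<longleftrightarrow> (\<exists>x. E x (x + l))" for l
  let ?S = "{l. len l}"
  have fin: "finite ?S" by (rule finite_subset[of _ "{0..m}"]) (use E_len len_def in force)+
  have ne: "?S ~= {}" using E_side len_def by auto
  define L where "L = Max ?S"
  have "len L" using Max_in[OF fin ne] unfolding L_def by simp
  have mx: "y - x <= L" if "E x y" for x y
  proof -
    have "E x (x + (y - x))" using that by simp
    hence "y - x \<in> ?S" unfolding len_def by blast
    thus ?thesis using Max_ge[OF fin] unfolding L_def by blast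
  qed
  obtain a where a: "E a (a + L)" using \<open>len L\<close> unfolding len_def by blast
  \<comment> \<open>An edge passing over a translate of the left end would have to pass over the
    whole translated edge, and would be longer.\<close>
  have notunder: "\<not> (c < a + k * m \<and> a + k * m < d)" if "E c d" for c d k
  proof
    assume 1: "c < a + k * m \<and> a + k * m < d"
    have 2: "E (a + k * m) (a + L + k * m)" using E_shift[OF a] by simp
    show False using noncross[OF that 2] 1 mx[OF that] by linarith
  qed
  have "L = m"
  proof (rule ccontr)
    assume "L ~= m"
    hence Lm: "L < m" "0 < L" using E_len[OF a] by auto
    define b where "b = a + L"
    let ?T = "{d. E b d}"
    have finT: "finite ?T" by (rule finite_subset[of _ "{b..b + m}"]) (use E_len in force)+
    have neT: "?T ~= {}" using E_side by blast
    define c where "c = Max ?T"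
    have c: "E b c" and cmx: "\<And>d. E b d ==> d <= c"
      using Max_in[OF finT neT] Max_ge[OF finT] unfolding c_def by auto
    have "c <= a + m"
    proof (rule ccontr)
      assume "\<not> c <= a + m"
      thus False using notunder[OF c, of 1] Lm by (simp add: b_def)
    qed
    have bc: "b < c" using E_len[OF c] by simp
    have ab: "a < b" using Lm by (simp add: b_def)
    have "E a c"
    proof (rule maximal)
      fix x y assume xy: "E x y"
      show "\<not> (a < x \<and> x < c \<and> c < y) \<and> \<not> (x < a \<and> a < y \<and> y < c)"
      proof (intro conjI notI)
        assume "x < a \<and> a < y \<and> y < c"
        thus False using notunder[OF xy, of 0] by simp
      next
        assume *: "a < x \<and> x < c \<and> c < y"
        have "\<not> b < x" using noncross[OF c xy] * by linarith
        moreover have "x ~= b" using cmx[of y] xy * by auto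
        moreover have "\<not> x < b" using noncross[OF a xy] * bc unfolding b_def by linarith
        ultimately show False by linarith
      qed
    qed (use ab bc \<open>c <= a + m\<close> in linarith)+
    thus False using mx[of a c] bc by (simp add: b_def)
  qed
  thus ?thesis using a by blast
qed

text \<open>A shortest edge lying strictly over (a, b) exists because a translate of the pending
  edge covers it. The apex of that edge does not lie between a and b, and by minimality one of its
  two lower sides is (a, b) itself.\<close>

lemma parent:
  assumes "E a b" "b < a + m"
  shows "\<exists>c. b < c \<and> E a c \<and> E b c \<or> c < a \<and> E c a \<and> E c b"
proof -
  obtain v where v: "E v (v + m)" using ex_pending by blast
  define P where "P l \<longleftrightarrow> (\<exists>c d. E c d \<and> c <= a \<and> b <= d \<and> (c, d) ~= (a, b) \<and> d - c = int l)" for l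
  define k where "k = (a - v) div m"
  have "v + k * m <= a" "a < v + k * m + m"
    using m3 pos_mod_bound[of m "a - v"] pos_mod_sign[of m "a - v"] div_mult_mod_eq[of "a - v" m]
    unfolding k_def by linarith+
  moreover have vk: "E (v + k * m) (v + k * m + m)" using E_shift[OF v, of k] by (simp add: add_ac)
  ultimately have vb: "v + k * m <= a" "b <= v + k * m + m"
  proof -
    assume 1: "v + k * m <= a" "a < v + k * m + m"
    show "v + k * m <= a" by (rule 1)
    show "b <= v + k * m + m"
    proof (rule ccontr)
      assume "\<not> b <= v + k * m + m"
      moreover from this have "v + k * m < a" using assms(2) by linarith
      ultimately show False using noncross[OF vk assms(1)] 1 by linarith
    qed
  qed
  have "P (nat m)" unfolding P_def
    using vk vb assms(2) m3 by (intro exI[of _ "v + k * m"] exI[of _ "v + k * m + m"]) auto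
  hence PL: "P (LEAST l. P l)" by (rule LeastI)
  have least: "\<And>l. P l ==> (LEAST l. P l) <= l" by (rule Least_le)
  from PL obtain c d where cd: "E c d" "c <= a" "b <= d" "(c, d) ~= (a, b)" "d - c = int (LEAST l. P l)"
    unfolding P_def by blast
  have mn: "d - c <= y - x" if "E x y" "x <= a" "b <= y" "(x, y) ~= (a, b)" for x y
  proof -
    have "P (nat (y - x))" unfolding P_def using that E_len[OF that(1)] by (intro exI[of _ x] exI[of _ y]) auto
    from least[OF this] show ?thesis using cd(5) E_len[OF that(1)] by linarith
  qed
  have "a < b" using E_len[OF assms(1)] by simp
  hence "c + 2 <= d" using cd by auto
  then obtain e where e: "c < e" "e < d" "E c e" "E e d" using apex[OF cd(1)] by blast
  have "e <= a \<or> b <= e"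
    using noncross e cd assms by fastforce
  thus ?thesis
  proof
    assume "e <= a"
    hence "(e, d) = (a, b)" using mn[OF e(4)] cd(3) e by fastforce
    thus ?thesis using e cd by blast
  next
    assume "b <= e"
    hence "(c, e) = (a, b)" using mn[OF e(3)] cd(2) e by fastforce
    thus ?thesis using e cd by blast
  qed
qed

text \<open>The chords and sides of the \<open>3 m\<close>-gon, as pairs of integers modulo simultaneous shifts by
  \<open>3 m\<close>; both orientations of a chord are recorded.\<close>
definition D :: "int => int => bool" where "D x y \<longleftrightarrow> E x y \<or> E y (x + 3 * m)"

lemma D_len: "D x y ==> x < y \<and> y < x + 3 * m"
  using E_len[of x y] E_len[of y "x + 3 * m"] m3 by (auto simp: D_def)

lemma D_flip: "D y (x + 3 * m) \<longleftrightarrow> D x y"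
  using E_shift_iff[of x 3 y] by (auto simp: D_def algebra_simps)

lemma D_shift: "D (x + k * m) (y + k * m) \<longleftrightarrow> D x y"
  using E_shift_iff[of x k y] E_shift_iff[of y k "x + 3 * m"] by (simp add: D_def algebra_simps)

lemma D_side: "D x (x + 1)" by (simp add: D_def E_side)

lemma D_noncross:
  assumes "D x y" "D x' y'"
  shows "\<not> (x < x' \<and> x' < y \<and> y < y' \<and> y' < x + 3 * m)"
proof
  assume *: "x < x' \<and> x' < y \<and> y < y' \<and> y' < x + 3 * m"
  have s: "E (u - 3 * m) (v - 3 * m) \<longleftrightarrow> E u v" for u v
    using E_shift_iff[of u "-3" v] by simp
  from assms show False unfolding D_def
  proof (elim disjE)
    assume "E x y" "E x' y'"
    thus False using noncross[of x y x' y'] * by blast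
  next
    assume "E x y" "E y' (x' + 3 * m)"
    hence "E (y' - 3 * m) x'" using s[of y' "x' + 3 * m"] by simp
    thus False using noncross[of "y' - 3 * m" x' x y] \<open>E x y\<close> * by linarith
  next
    assume "E y (x + 3 * m)" "E x' y'"
    thus False using noncross[of x' y' y "x + 3 * m"] * by linarith
  next
    assume "E y (x + 3 * m)" "E y' (x' + 3 * m)"
    thus False using noncross[of y "x + 3 * m" y' "x' + 3 * m"] * by linarith
  qed
qed

text \<open>If the pair itself is an edge, the triangle on this side lies below it. If its
  complement is an edge, the triangle is the one shared with the parent edge, unless the complement
  has length \<open>m\<close>: then the triangle is the central one, b, b + m, b + 2m.\<close>

lemma D_apex:
  assumes "D b a" "b + 2 <= a"
  shows "\<exists>z. b < z \<and> z < a \<and> D b z \<and> D z a"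
  using assms(1) unfolding D_def
proof
  assume "E b a"
  from apex[OF this assms(2)] show "\<exists>z. b < z \<and> z < a \<and> (E b z \<or> E z (b + 3 * m)) \<and> (E z a \<or> E a (z + 3 * m))"
    by blast
next
  assume e: "E a (b + 3 * m)"
  have l: "a < b + 3 * m" "b + 3 * m <= a + m" using E_len[OF e] by auto
  show "\<exists>z. b < z \<and> z < a \<and> (E b z \<or> E z (b + 3 * m)) \<and> (E z a \<or> E a (z + 3 * m))"
  proof (cases "b + 3 * m = a + m")
    case True
    have "E a (a + m)" using e unfolding True .
    hence "E (a - m) a" using E_shift1(2)[of a "a + m"] by simp
    moreover from this have "E (a - m - m) (a - m)" using E_shift1(2)[of "a - m" a] by simp
    moreover have "a - m - m = b" using True by simp
    ultimately show ?thesis using m3 by (intro exI[of _ "a - m"]) auto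
  next
    case False
    then obtain c where c: "b + 3 * m < c \<and> E a c \<and> E (b + 3 * m) c \<or> c < a \<and> E c a \<and> E c (b + 3 * m)"
      using parent[OF e] l by auto
    thus ?thesis
    proof
      assume *: "b + 3 * m < c \<and> E a c \<and> E (b + 3 * m) c"
      hence "E b (c - 3 * m)" using E_shift_iff[of b 3 "c - 3 * m"] by simp
      thus ?thesis using * E_len[of a c] m3 by (intro exI[of _ "c - 3 * m"]) auto
    next
      assume *: "c < a \<and> E c a \<and> E c (b + 3 * m)"
      thus ?thesis using E_len[of c "b + 3 * m"] m3 by (intro exI[of _ c]) auto
    qed
  qed
qed

lemma D_apex_unique:
  assumes "a < b + 3 * m" "b < z" "z < a" "D b z" "D z a" "b < z'" "z' < a" "D b z'" "D z' a"
  shows "z = z'"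
  using D_noncross[of b z z' a] D_noncross[of b z' z a] assms by linarith

lemma ex_crossing:
  assumes "u < w" "w < u + 3 * m" "\<not> D u w" "w <= u + m \<or> u + 2 * m <= w"
  shows "\<exists>b a. u < b \<and> b < w \<and> w < a \<and> a < u + 3 * m \<and> D b a"
proof -
  have short: "\<exists>b a. u < b \<and> b < w \<and> w < a \<and> a < u + 3 * m \<and> D b a"
    if "u < w" "w <= u + m" "\<not> E u w" for u w
  proof -
    have "w ~= u + 1" using that(3) E_side by auto
    hence "u + 2 <= w" using that(1) by linarith
    have "\<exists>c d. E c d \<and> (u < c \<and> c < w \<and> w < d \<or> c < u \<and> u < d \<and> d < w)"
    proof (rule ccontr)
      assume no: "\<not> ?thesis"
      have "E u w" by (rule maximal[OF \<open>u + 2 <= w\<close> that(2)]) (use no in blast)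
      thus False using that(3) by simp
    qed
    then obtain c d where cd: "E c d" "u < c \<and> c < w \<and> w < d \<or> c < u \<and> u < d \<and> d < w" by blast
    from cd(2) show ?thesis
    proof
      assume "u < c \<and> c < w \<and> w < d"
      thus ?thesis using cd(1) E_len[OF cd(1)] that(2) m3 by (intro exI[of _ c] exI[of _ d]) (auto simp: D_def)
    next
      assume "c < u \<and> u < d \<and> d < w"
      thus ?thesis using cd(1) E_len[OF cd(1)] that(2) m3 E_shift_iff[of c 3 d]
        by (intro exI[of _ d] exI[of _ "c + 3 * m"]) (auto simp: D_def)
    qed
  qed
  show ?thesis
  proof (cases "w <= u + m")
    case True
    thus ?thesis using short[OF assms(1)] assms(3) by (auto simp: D_def)
  next
    case False
    then obtain b a where "w < b" "b < u + 3 * m" "u + 3 * m < a" "a < w + 3 * m" "D b a"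
      using short[of w "u + 3 * m"] assms by (auto simp: D_def)
    moreover from this have "D (a - 3 * m) b" using D_flip[of b "a - 3 * m"] by simp
    ultimately show ?thesis by (intro exI[of _ "a - 3 * m"] exI[of _ b]) auto
  qed
qed

end

section \<open>The frieze of a periodic triangulation\<close>

definition det2 :: "'r::comm_ring_1 \<times> 'r => 'r \<times> 'r => 'r" where
  "det2 p q = fst p * snd q - snd p * fst q"

lemma det2_self [simp]: "det2 p p = 0" by (simp add: det2_def)

lemma det2_swap: "det2 q p = - det2 p q" by (simp add: det2_def)

lemma plucker: "det2 a c * det2 b d = det2 a b * det2 c d + det2 b c * det2 a d"
  by (simp add: det2_def algebra_simps)

text \<open>
  A frieze is given by vectors \<open>\<xi> x\<close> whose determinants are the edge weights. The deck transformation
  acts through a matrix of determinant 1 and trace \<open>1 = 2 cos (\<pi>/3)\<close>, whence the three-term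
  recurrence \<open>\<xi> (x + 2m) = \<xi> (x + m) - \<xi> x\<close>: this encodes the orbifold point of order three.
\<close>
locale weighted_triangulation = periodic_triangulation m E
  for m E +
  fixes wt wi :: "int => int => 'r::comm_ring_1"
  assumes wt_side: "wt x (x + 1) = 1"
    and wt_inv: "D x y ==> wt x y * wi x y = 1"
    and wt_shift: "wt (x + k * m) (y + k * m) = wt x y"
    and wi_shift: "wi (x + k * m) (y + k * m) = wi x y"
    and wt_flip: "wt y (x + 3 * m) = wt x y"
    and wi_flip: "wi y (x + 3 * m) = wi x y"
begin

text \<open>The vector at the apex is forced by its determinants with the two given vectors.
  Recursion into the two smaller edges then fills in the rest, and no edge joins the interiors of
  the two halves.\<close>

lemma vectors_below:
  assumes "E a b" "det2 p q = wt a b"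
  shows "\<exists>\<xi>. \<xi> a = p \<and> \<xi> b = q \<and> (\<forall>c d. a <= c --> d <= b --> E c d --> det2 (\<xi> c) (\<xi> d) = wt c d)"
  using assms
proof (induction "nat (b - a)" arbitrary: a b p q rule: less_induct)
  case less
  have ab: "a < b" using E_len[OF less.prems(1)] by simp
  show ?case
  proof (cases "b = a + 1")
    case True
    show ?thesis
    proof (intro exI[of _ "\<lambda>x. if x = a then p else q"] conjI allI impI)
      fix c d assume "a <= c" "d <= b" "E c d"
      hence "c = a" "d = b" using E_len[of c d] True by auto
      thus "det2 (if c = a then p else q) (if d = a then p else q) = wt c d"
        using less.prems(2) ab by simp
    qed (use ab in auto)
  next
    case False
    then obtain z where z: "a < z" "z < b" "E a z" "E z b" using apex[OF less.prems(1)] ab by force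
    \<comment> \<open>Cramer's rule for the conditions that \<open>p\<close> and \<open>r\<close>
      have determinant \<open>wt a z\<close>, and \<open>r\<close> and \<open>q\<close> have
      determinant \<open>wt z b\<close>.\<close>
    let ?r = "(wi a b * (wt z b * fst p + wt a z * fst q), wi a b * (wt z b * snd p + wt a z * snd q))"
    have i: "wt a b * wi a b = 1" using wt_inv less.prems(1) by (simp add: D_def)
    have 1: "det2 p ?r = wt a z"
    proof -
      have "det2 p ?r = wi a b * wt a z * det2 p q" by (simp add: det2_def algebra_simps)
      also have "\<dots> = wt a z * (wt a b * wi a b)" using less.prems(2) by (simp add: algebra_simps)
      finally show ?thesis using i by simp
    qed
    have 2: "det2 ?r q = wt z b"
    proof -
      have "det2 ?r q = wi a b * wt z b * det2 p q" by (simp add: det2_def algebra_simps)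
      also have "\<dots> = wt z b * (wt a b * wi a b)" using less.prems(2) by (simp add: algebra_simps)
      finally show ?thesis using i by simp
    qed
    obtain \<xi> where \<xi>: "\<xi> a = p" "\<xi> z = ?r" "\<And>c d. a <= c ==> d <= z ==> E c d ==> det2 (\<xi> c) (\<xi> d) = wt c d"
      using less.hyps[OF _ z(3) 1] z by auto
    obtain \<eta> where \<eta>: "\<eta> z = ?r" "\<eta> b = q" "\<And>c d. z <= c ==> d <= b ==> E c d ==> det2 (\<eta> c) (\<eta> d) = wt c d"
      using less.hyps[OF _ z(4) 2] z by auto
    show ?thesis
    proof (intro exI[of _ "\<lambda>x. if x <= z then \<xi> x else \<eta> x"] conjI allI impI)
      fix c d assume cd: "a <= c" "d <= b" "E c d"
      have "c < d" using E_len[OF cd(3)] by simp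
      consider "d <= z" | "z <= c" | "c < z" "z < d" by linarith
      thus "det2 (if c <= z then \<xi> c else \<eta> c) (if d <= z then \<xi> d else \<eta> d) = wt c d"
      proof cases
        case 1
        thus ?thesis using \<xi>(3)[OF cd(1) 1 cd(3)] \<open>c < d\<close> by simp
      next
        case 2
        hence "(if c <= z then \<xi> c else \<eta> c) = \<eta> c" using \<xi>(2) \<eta>(1) by auto
        thus ?thesis using \<eta>(3)[OF 2 cd(2,3)] \<open>c < d\<close> 2 by simp
      next
        case 3
        have "\<not> a < c" using noncross[OF z(3) cd(3)] 3 by linarith
        moreover have "\<not> d < b" using noncross[OF cd(3) z(4)] 3 by linarith
        ultimately have "c = a" "d = b" using cd by auto
        thus ?thesis using \<xi>(1) \<eta>(2) less.prems(2) 3 by simp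
      qed
    qed (use \<xi> \<eta> z in auto)
  qed
qed

definition is_frieze :: "(int => int => 'r) => bool" where
  "is_frieze f \<longleftrightarrow> (\<forall>x. f x x = 0) \<and> (\<forall>x y. f y x = - f x y) \<and>
     (\<forall>a b c d. f a c * f b d = f a b * f c d + f b c * f a d) \<and>
     (\<forall>x y k. f (x + k * m) (y + k * m) = f x y) \<and> (\<forall>x y. f y (x + 3 * m) = f x y) \<and>
     (\<forall>x y. f x (y + 2 * m) = f x (y + m) - f x y) \<and>
     (\<forall>x y. D x y --> f x y = wt x y)"

lemma friezeD:
  assumes "is_frieze f"
  shows "f x x = 0" "f y x = - f x y" "f a c * f b d = f a b * f c d + f b c * f a d"
    "f (x + k * m) (y + k * m) = f x y" "f y (x + 3 * m) = f x y"
    "f x (y + 2 * m) = f x (y + m) - f x y" "D x y ==> f x y = wt x y"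
  using assms unfolding is_frieze_def by blast+

text \<open>The vectors are fixed on one fundamental domain, below the pending edge at
  \<open>v\<close>, and continued by the matrix \<open>R\<close> of the deck transformation.\<close>

theorem ex_frieze: "\<exists>f :: int => int => 'r. is_frieze f"
proof -
  obtain v where v: "E v (v + m)" using ex_pending by blast
  let ?p = "wt v (v + m)" and ?i = "wi v (v + m)"
  have pi: "?p * ?i = 1" using wt_inv v by (simp add: D_def)
  \<comment> \<open>The unique matrix of determinant 1 and trace 1 that sends (1, 0), the vector at
    \<open>v\<close>, to (0, p), the vector at \<open>v + m\<close>.\<close>
  define R where "R s = (- ?i * snd s, ?p * fst s + snd s)" for s :: "'r \<times> 'r"
  have detR: "det2 (R s) (R t) = det2 s t" for s t
  proof -
    have "det2 (R s) (R t) = (?p * ?i) * (fst s * snd t - snd s * fst t)"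
      by (simp add: det2_def R_def algebra_simps)
    thus ?thesis using pi by (simp add: det2_def)
  qed
  have RR: "R (R s) = (fst (R s) - fst s, snd (R s) - snd s)" for s
  proof -
    have "- ?i * (?p * fst s + snd s) = - ?i * snd s - (?p * ?i) * fst s" by (simp add: algebra_simps)
    moreover have "?p * (- ?i * snd s) = - (?p * ?i) * snd s" by (simp add: algebra_simps)
    ultimately show ?thesis using pi by (simp add: R_def)
  qed
  have R6: "(R ^^ 6) s = s" for s
  proof -
    have "R (R (R s)) = (- fst s, - snd s)" for s
      unfolding RR[of "R s"] by (simp add: RR)
    moreover have "(R ^^ 6) s = R (R (R (R (R (R s)))))" by (simp add: eval_nat_numeral)
    ultimately show ?thesis by simp
  qed
  obtain \<xi>0 where \<xi>0: "\<xi>0 v = (1, 0)" "\<xi>0 (v + m) = (0, ?p)"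
    "\<And>c d. v <= c ==> d <= v + m ==> E c d ==> det2 (\<xi>0 c) (\<xi>0 d) = wt c d"
    using vectors_below[OF v, of "(1, 0)" "(0, ?p)"] by (auto simp: det2_def)
  define q where "q x = (x - v) div m" for x
  define r where "r x = v + (x - v) mod m" for x
  \<comment> \<open>Since \<open>R\<close> has order dividing 6, reducing the exponent modulo 6
    allows negative \<open>q x\<close> with natural iterates.\<close>
  define \<xi> where "\<xi> x = (R ^^ nat (q x mod 6)) (\<xi>0 (r x))" for x
  have qr: "x = r x + q x * m" "v <= r x" "r x < v + m" for x
    using m3 div_mult_mod_eq[of "x - v" m] pos_mod_bound[of m "x - v"] pos_mod_sign[of m "x - v"]
    unfolding q_def r_def by linarith+
  have qm: "q (x + m) = q x + 1" "r (x + m) = r x" for x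
  proof -
    have eq: "x + m - v = (x - v) + m" by simp
    show "q (x + m) = q x + 1" unfolding q_def eq by (rule div_add_self2) (use m3 in simp)
    show "r (x + m) = r x" unfolding r_def eq by (simp only: mod_add_self2)
  qed
  have \<xi>m: "\<xi> (x + m) = R (\<xi> x)" for x
  proof -
    define c where "c = q x mod 6"
    have c: "0 <= c" "c < 6" by (simp_all add: c_def)
    have c1: "(q x + 1) mod 6 = (if c = 5 then 0 else c + 1)"
    proof -
      have "(q x + 1) mod 6 = (c + 1) mod 6" unfolding c_def by (simp only: mod_add_left_eq)
      also have "\<dots> = (if c = 5 then 0 else c + 1)" using c by (auto simp: mod_pos_pos_trivial)
      finally show ?thesis .
    qed
    show ?thesis
    proof (cases "c = 5")
      case True
      hence "\<xi> (x + m) = \<xi>0 (r x)" using c1 by (simp add: \<xi>_def qm)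
      moreover have "R (\<xi> x) = (R ^^ 6) (\<xi>0 (r x))" using True by (simp add: \<xi>_def c_def[symmetric] eval_nat_numeral)
      ultimately show ?thesis using R6 by simp
    next
      case False
      hence "nat ((q x + 1) mod 6) = Suc (nat c)" using c1 c by simp
      thus ?thesis by (simp add: \<xi>_def qm c_def)
    qed
  qed
  define f where "f x y = det2 (\<xi> x) (\<xi> y)" for x y
  have fm: "f (x + m) (y + m) = f x y" for x y by (simp add: f_def \<xi>m detR)
  have fkm: "f (x + k * m) (y + k * m) = f x y" for x y k
  proof (induction k rule: int_induct[where k = 0])
    case base
    thus ?case by simp
  next
    case (step1 i)
    thus ?case using fm[of "x + i * m" "y + i * m"] by (simp add: algebra_simps)
  next
    case (step2 i)
    thus ?case using fm[of "x + (i - 1) * m" "y + (i - 1) * m"] by (simp add: algebra_simps)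
  qed
  have f2: "f x (y + 2 * m) = f x (y + m) - f x y" for x y
  proof -
    have "\<xi> (y + 2 * m) = R (R (\<xi> y))" using \<xi>m[of "y + m"] \<xi>m[of y] by (simp add: algebra_simps)
    thus ?thesis unfolding f_def \<xi>m RR by (simp add: det2_def algebra_simps)
  qed
  have f3: "f x (y + 3 * m) = - f x y" for x y
  proof -
    have e: "y + m + 2 * m = y + 3 * m" "y + m + m = y + 2 * m" by simp_all
    have "f x (y + 3 * m) = f x (y + 2 * m) - f x (y + m)" using f2[of x "y + m"] by (simp only: e)
    thus ?thesis unfolding f2[of x y] by simp
  qed
  have sw: "f y x = - f x y" for x y unfolding f_def by (rule det2_swap)
  have flip: "f y (x + 3 * m) = f x y" for x y by (rule trans[OF f3 sw[symmetric]])
  have \<xi>\<xi>0: "\<xi> c = \<xi>0 c" if c: "v <= c" "c <= v + m" for c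
  proof (cases "c = v + m")
    case True
    have "q v = 0" "r v = v" by (simp_all add: q_def r_def)
    hence "\<xi> v = (1, 0)" using \<xi>0(1) by (simp add: \<xi>_def)
    thus ?thesis using True \<xi>m[of v] \<xi>0(2) by (simp add: R_def)
  next
    case False
    hence "q c = 0" "r c = c" using c by (simp_all add: q_def r_def)
    thus ?thesis by (simp add: \<xi>_def)
  qed
  have fE: "f c d = wt c d" if cd: "E c d" for c d
  proof -
    let ?k = "q c"
    let ?c = "c - ?k * m" and ?d = "d - ?k * m"
    have e: "E ?c ?d" using E_shift[OF cd, of "- ?k"] by simp
    have vc: "v <= ?c" "?c < v + m" using qr[of c] by linarith+
    \<comment> \<open>An edge starting in the fundamental domain and ending beyond it would cross
      the pending edge, or be longer than \<open>m\<close>.\<close>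
    have "?d <= v + m"
      using E_len e noncross v vc by fastforce
    hence "f ?c ?d = wt ?c ?d"
      using \<xi>0(3)[OF vc(1) _ e] \<xi>\<xi>0 vc E_len[OF e] by (simp add: f_def)
    thus ?thesis using fkm[of c "- ?k" d] wt_shift[of c "- ?k" d] by simp
  qed
  have "f x y = wt x y" if "D x y" for x y
  proof (cases "E x y")
    case False
    hence "E y (x + 3 * m)" using that by (simp add: D_def)
    hence "f y (x + 3 * m) = wt y (x + 3 * m)" by (rule fE)
    thus ?thesis using wt_flip[of y x] flip by simp
  qed (rule fE)
  moreover have "f x x = 0" for x by (simp add: f_def)
  moreover have "f a c * f b d = f a b * f c d + f b c * f a d" for a b c d unfolding f_def by (rule plucker)
  ultimately have "is_frieze f"
    unfolding is_frieze_def using fkm flip f2 sw by (intro conjI allI impI)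
  thus ?thesis by (intro exI[of _ f])
qed

end

section \<open>Expansion of a frieze along a crossing sequence\<close>

lemma sum_prod_split:
  fixes y :: "'e => 'r::comm_ring_1"
  assumes "finite P" "Z \<subseteq> Pow P"
  shows "(\<Sum>S\<in>Z. prod y S) = (\<Sum>S | S \<in> Z \<and> p \<notin> S. prod y S) + y p * (\<Sum>S | S \<in> Z \<and> p \<in> S. prod y (S - {p}))"
proof -
  have fin: "finite Z" and fS: "S \<in> Z ==> finite S" for S using assms finite_subset by blast+
  have "(\<Sum>S\<in>Z. prod y S) = (\<Sum>S\<in>{S. S \<in> Z \<and> p \<notin> S} \<union> {S. S \<in> Z \<and> p \<in> S}. prod y S)"
    by (rule arg_cong[where f = "sum (prod y)"]) blast
  also have "\<dots> = (\<Sum>S | S \<in> Z \<and> p \<notin> S. prod y S) + (\<Sum>S | S \<in> Z \<and> p \<in> S. prod y S)"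
    by (rule sum.union_disjoint) (use fin in auto)
  also have "(\<Sum>S | S \<in> Z \<and> p \<in> S. prod y S) = y p * (\<Sum>S | S \<in> Z \<and> p \<in> S. prod y (S - {p}))"
    unfolding sum_distrib_left by (rule sum.cong) (use fS in \<open>simp_all add: prod.remove\<close>)
  finally show ?thesis .
qed

text \<open>How the generating function over closed sets grows when one element \<open>s\<close> is appended to a
  fence after \<open>p\<close>.\<close>
lemma closed_sum_extend:
  fixes y :: "'e => 'r::comm_ring_1"
  assumes fin: "finite P" and p: "p \<in> P" and s: "s \<notin> P" and Z0: "Z0 \<subseteq> Pow P"
    and Z: "\<And>S. S \<in> Z \<longleftrightarrow> S \<subseteq> insert s P \<and> S - {s} \<in> Z0 \<and> (if left then p \<in> S --> s \<in> S else s \<in> S --> p \<in> S)"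
  defines "A0 \<equiv> (\<Sum>S | S \<in> Z0 \<and> p \<notin> S. prod y S)"
    and "B0 \<equiv> (\<Sum>S | S \<in> Z0 \<and> p \<in> S. prod y (S - {p}))"
  shows "(\<Sum>S | S \<in> Z \<and> s \<notin> S. prod y S) = (if left then A0 else A0 + y p * B0)"
    and "(\<Sum>S | S \<in> Z \<and> s \<in> S. prod y (S - {s})) = (if left then A0 + y p * B0 else y p * B0)"
proof -
  have sS: "s \<notin> S" if "S \<in> Z0" for S using that Z0 s by blast
  have all: "(\<Sum>S\<in>Z0. prod y S) = A0 + y p * B0" unfolding A0_def B0_def by (rule sum_prod_split[OF fin Z0])
  have B0: "(\<Sum>S | S \<in> Z0 \<and> p \<in> S. prod y S) = y p * B0"
    unfolding B0_def sum_distrib_left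
    by (rule sum.cong) (use finite_subset[OF _ fin] Z0 in \<open>auto simp: prod.remove\<close>)
  have without: "{S. S \<in> Z \<and> s \<notin> S} = (if left then {S. S \<in> Z0 \<and> p \<notin> S} else Z0)"
  proof -
    have "S \<in> Z \<and> s \<notin> S \<longleftrightarrow> S \<in> Z0 \<and> (left --> p \<notin> S)" for S
      using sS Z Z0 by auto
    thus ?thesis by auto
  qed
  show "(\<Sum>S | S \<in> Z \<and> s \<notin> S. prod y S) = (if left then A0 else A0 + y p * B0)"
    unfolding without using all by (simp add: A0_def)
  have ins: "{S. S \<in> Z \<and> s \<in> S} = insert s ` (if left then Z0 else {S. S \<in> Z0 \<and> p \<in> S})"
  proof -
    have ps: "p ~= s" using p s by blast
    have 1: "S \<in> Z \<and> s \<in> S \<longleftrightarrow> S - {s} \<in> Z0 \<and> (\<not> left --> p \<in> S - {s}) \<and> s \<in> S" for S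
      using Z[of S] Z0 ps by auto
    show ?thesis
    proof (intro equalityI subsetI)
      fix S assume "S \<in> {S. S \<in> Z \<and> s \<in> S}"
      hence "S - {s} \<in> (if left then Z0 else {S. S \<in> Z0 \<and> p \<in> S})" "S = insert s (S - {s})"
        using 1[of S] by auto
      thus "S \<in> insert s ` (if left then Z0 else {S. S \<in> Z0 \<and> p \<in> S})" by (rule rev_image_eqI)
    next
      fix S assume "S \<in> insert s ` (if left then Z0 else {S. S \<in> Z0 \<and> p \<in> S})"
      then obtain T where T: "S = insert s T" "T \<in> Z0" "\<not> left --> p \<in> T" by (auto split: if_splits)
      hence "S - {s} = T" using sS by auto
      thus "S \<in> {S. S \<in> Z \<and> s \<in> S}" using 1[of S] T by auto
    qed
  qed
  have "inj_on (insert s) Z0"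
  proof (rule inj_onI)
    fix S T assume "S \<in> Z0" "T \<in> Z0" "insert s S = insert s T"
    thus "S = T" using sS by (metis Diff_insert_absorb)
  qed
  hence inj: "inj_on (insert s) (if left then Z0 else {S. S \<in> Z0 \<and> p \<in> S})"
    by (rule inj_on_subset) auto
  have "(\<Sum>S | S \<in> Z \<and> s \<in> S. prod y (S - {s})) =
      (\<Sum>S\<in>(if left then Z0 else {S. S \<in> Z0 \<and> p \<in> S}). prod y (insert s S - {s}))"
    unfolding ins by (simp only: sum.reindex[OF inj] comp_def)
  also have "\<dots> = (\<Sum>S\<in>(if left then Z0 else {S. S \<in> Z0 \<and> p \<in> S}). prod y S)"
    using sS by simp
  finally show "(\<Sum>S | S \<in> Z \<and> s \<in> S. prod y (S - {s})) = (if left then A0 + y p * B0 else y p * B0)"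
    using all B0 by simp
qed

section \<open>Crossing sequences\<close>

context periodic_triangulation
begin

definition apx :: "int => int => int" where
  "apx b a = (THE z. b < z \<and> z < a \<and> D b z \<and> D z a)"

lemma apx_eq: "D b a ==> b < z ==> z < a ==> D b z ==> D z a ==> apx b a = z"
  unfolding apx_def by (rule the_equality) (use D_apex_unique[of a b] D_len[of b a] in blast)+

lemma apx:
  assumes "D b a" "b + 2 <= a"
  shows "b < apx b a" "apx b a < a" "D b (apx b a)" "D (apx b a) a"
  using D_apex apx_eq assms by blast+

lemma apx_shift: 
  assumes "D b a" "b + 2 <= a"
  shows "apx (b + k * m) (a + k * m) = apx b a + k * m"
  by (rule apx_eq) (use apx[OF assms] assms D_shift in simp_all)

text \<open>The window of length 3m after \<open>u\<close> selects one orientation of each crossed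
  chord. In this orientation the crossings are nested around \<open>w\<close>.\<close>

definition Cr :: "int => int => (int \<times> int) set" where
  "Cr u w = {(b, a). u < b \<and> b < w \<and> w < a \<and> a < u + 3 * m \<and> D b a}"

lemma CrD: "(b, a) \<in> Cr u w ==> u < b \<and> b < w \<and> w < a \<and> a < u + 3 * m \<and> D b a"
  by (simp add: Cr_def)

lemma finite_Cr: "finite (Cr u w)"
  by (rule finite_subset[of _ "{u..w} \<times> {w..u + 3 * m}"]) (auto simp: Cr_def)

text \<open>\<open>inn\<close> and \<open>out\<close> are the third vertices of the triangles on either side of a chord.\<close>
abbreviation inn :: "int \<times> int => int" where "inn s \<equiv> apx (fst s) (snd s)"
abbreviation out :: "int \<times> int => int" where "out s \<equiv> apx (snd s) (fst s + 3 * m)"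

lemma inn:
  assumes "(b, a) \<in> Cr u w"
  shows "b < apx b a" "apx b a < a" "D b (apx b a)" "D (apx b a) a"
  using apx[of b a] CrD[OF assms] by auto

lemma out:
  assumes "(b, a) \<in> Cr u w"
  shows "a < apx a (b + 3 * m)" "apx a (b + 3 * m) < b + 3 * m" "D a (apx a (b + 3 * m))"
    "D (apx a (b + 3 * m)) (b + 3 * m)"
  using apx[of a "b + 3 * m"] CrD[OF assms] D_flip[of a b] by auto

text \<open>Beyond \<open>s\<close>, the diagonal towards \<open>w\<close> traverses the triangle
  with third vertex \<open>inn s\<close> and leaves it through the side separating that vertex's
  position from \<open>w\<close>. If \<open>inn s\<close> is \<open>w\<close>, the value is not a
  crossing, and the sequence ends.\<close>

definition nx :: "int => int \<times> int => int \<times> int" where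
  "nx w s = (if inn s < w then (inn s, snd s) else (fst s, inn s))"

text \<open>Consecutive crossings share an endpoint. The arrow between them points forward if this
  is \<open>snd s\<close> and backward if it is \<open>fst s\<close>; the closed sets are those
  stable under these arrows.\<close>

definition closedOn :: "int => (int \<times> int) set => (int \<times> int) set => bool" where
  "closedOn w P S \<longleftrightarrow> S \<subseteq> P \<and> (\<forall>s\<in>P. nx w s \<in> P -->
     (if inn s < w then s \<in> S --> nx w s \<in> S else nx w s \<in> S --> s \<in> S))"

text \<open>The initial segment of the crossing sequence ending in \<open>s\<close>, since an
  earlier crossing encloses a later one.\<close>

definition Pre :: "int => int => int \<times> int => (int \<times> int) set" where
  "Pre u w s = {t \<in> Cr u w. fst t <= fst s \<and> snd s <= snd t}"

lemma Pre_sub: "Pre u w s \<subseteq> Cr u w" by (auto simp: Pre_def)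

lemma finite_Pre: "finite (Pre u w s)" using finite_subset[OF Pre_sub finite_Cr] .

lemma self_in_Pre: "s \<in> Cr u w ==> s \<in> Pre u w s" by (simp add: Pre_def)

lemma Cr_nested:
  assumes "(b, a) \<in> Cr u w" "(b', a') \<in> Cr u w"
  shows "b < b' ==> a' <= a" "a' < a ==> b <= b'"
  using D_noncross[of b a b' a'] D_noncross[of b' a' b a] CrD[OF assms(1)] CrD[OF assms(2)] by linarith+

text \<open>The chord crossed before \<open>(b, a)\<close>.\<close>
lemma pred_cases:
  assumes s: "(b, a) \<in> Cr u w"
  defines "z \<equiv> apx a (b + 3 * m)"
  obtains "z = u + 3 * m" "Pre u w (b, a) = {(b, a)}"
  | "z > u + 3 * m" "(z - 3 * m, a) \<in> Cr u w" "z - 3 * m < b" "D (z - 3 * m) b" "apx (z - 3 * m) a = b"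
      "nx w (z - 3 * m, a) = (b, a)"
      "Pre u w (b, a) = insert (b, a) (Pre u w (z - 3 * m, a))" "(b, a) \<notin> Pre u w (z - 3 * m, a)"
  | "z < u + 3 * m" "(b, z) \<in> Cr u w" "a < z" "D a z" "apx b z = a"
      "nx w (b, z) = (b, a)"
      "Pre u w (b, a) = insert (b, a) (Pre u w (b, z))" "(b, a) \<notin> Pre u w (b, z)"
proof -
  have c: "u < b" "b < w" "w < a" "a < u + 3 * m" "D b a" using CrD[OF s] by auto
  have z: "a < z" "z < b + 3 * m" "D a z" "D z (b + 3 * m)" unfolding z_def using out[OF s] by auto
  have z': "D (z - 3 * m) a" using D_flip[of a "z - 3 * m"] z(3) by simp
  have z'': "D (z - 3 * m) b" using D_shift[of "z - 3 * m" 3 b] z(4) by (simp add: algebra_simps)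
  have zb: "D b z" using D_flip[of z b] z(4) by simp
  \<comment> \<open>The outer apex is the starting point of the diagonal, or it lies on one side of
    it. The side decides which endpoint is shared with the preceding crossing.\<close>
  consider "z = u + 3 * m" | "z > u + 3 * m" | "z < u + 3 * m" by linarith
  thus ?thesis
  proof cases
    case 1
    have "t = (b, a)" if t: "t \<in> Pre u w (b, a)" for t
    proof -
      obtain b' a' where t': "t = (b', a')" "(b', a') \<in> Cr u w" "b' <= b" "a <= a'"
        using t by (cases t) (auto simp: Pre_def)
      have c': "u < b'" "a' < u + 3 * m" "D b' a'" "w < a'" using CrD[OF t'(2)] by auto
      have "\<not> a < a'"
      proof
        assume "a < a'"
        thus False using D_noncross[OF c'(3), of a z] z(3) D_noncross[of b' a' a z] c' c 1 z t' by auto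
      qed
      moreover have "\<not> b' < b"
      proof
        assume "b' < b"
        thus False using D_noncross[OF z'' c'(3)] c' c 1 z t' by auto
      qed
      ultimately show ?thesis using t' by simp
    qed
    hence "Pre u w (b, a) = {(b, a)}" using self_in_Pre[OF s] by blast
    with 1 that(1) show ?thesis by blast
  next
    case 2
    have zC: "(z - 3 * m, a) \<in> Cr u w" using 2 z c z' by (simp add: Cr_def)
    have ap: "apx (z - 3 * m) a = b" by (rule apx_eq) (use z' z'' z c in auto)
    have "Pre u w (b, a) = insert (b, a) (Pre u w (z - 3 * m, a))"
    proof (intro equalityI subsetI)
      fix t assume t: "t \<in> Pre u w (b, a)"
      obtain b' a' where t': "t = (b', a')" "(b', a') \<in> Cr u w" "b' <= b" "a <= a'"
        using t by (cases t) (auto simp: Pre_def)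
      have c': "u < b'" "a' < u + 3 * m" "D b' a'" "w < a'" using CrD[OF t'(2)] by auto
      have 3: "\<not> (z - 3 * m < b' \<and> b' < b)"
        using D_noncross[OF z'' c'(3)] c' c 2 z t' by auto
      have 4: "\<not> (b' = b \<and> a < a')"
        using D_noncross[OF z' c'(3)] c' c 2 z t' by auto
      show "t \<in> insert (b, a) (Pre u w (z - 3 * m, a))"
        using 3 4 t' by (auto simp: Pre_def)
    next
      fix t assume "t \<in> insert (b, a) (Pre u w (z - 3 * m, a))"
      thus "t \<in> Pre u w (b, a)" using self_in_Pre[OF s] z by (auto simp: Pre_def)
    qed
    moreover have "(b, a) \<notin> Pre u w (z - 3 * m, a)" using z by (simp add: Pre_def)
    moreover have "nx w (z - 3 * m, a) = (b, a)" using ap c by (simp add: nx_def)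
    ultimately show ?thesis using that(2) 2 zC ap z'' z by auto
  next
    case 3
    have zC: "(b, z) \<in> Cr u w" using 3 z c zb by (simp add: Cr_def)
    have ap: "apx b z = a" by (rule apx_eq) (use zb z c in auto)
    have "Pre u w (b, a) = insert (b, a) (Pre u w (b, z))"
    proof (intro equalityI subsetI)
      fix t assume t: "t \<in> Pre u w (b, a)"
      obtain b' a' where t': "t = (b', a')" "(b', a') \<in> Cr u w" "b' <= b" "a <= a'"
        using t by (cases t) (auto simp: Pre_def)
      have c': "u < b'" "a' < u + 3 * m" "D b' a'" "w < a'" using CrD[OF t'(2)] by auto
      have 4: "\<not> (a < a' \<and> a' < z)"
        using D_noncross[OF c'(3) z(3)] c' c 3 z t' by auto
      have 5: "\<not> (a = a' \<and> b' < b)"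
        using D_noncross[OF c'(3) zb] c' c 3 z t' by auto
      show "t \<in> insert (b, a) (Pre u w (b, z))"
        using 4 5 t' by (auto simp: Pre_def)
    next
      fix t assume "t \<in> insert (b, a) (Pre u w (b, z))"
      thus "t \<in> Pre u w (b, a)" using self_in_Pre[OF s] z by (auto simp: Pre_def)
    qed
    moreover have "(b, a) \<notin> Pre u w (b, z)" using z by (simp add: Pre_def)
    moreover have "nx w (b, z) = (b, a)" using ap c by (simp add: nx_def)
    ultimately show ?thesis using that(3) 3 zC ap z by auto
  qed
qed

lemma nx_nested:
  assumes "(b, a) \<in> Cr u w"
  shows "b <= fst (nx w (b, a))" "snd (nx w (b, a)) <= a" "nx w (b, a) ~= (b, a)"
  using inn[OF assms] by (auto simp: nx_def)

lemma nx_not_in_Pre: "s \<in> Cr u w ==> nx w s \<notin> Pre u w s"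
  using nx_nested[of "fst s" "snd s" u w] by (cases s) (auto simp: Pre_def nx_def split: if_splits)

text \<open>So \<open>nx w e\<close> is the immediate successor: a later crossing not enclosed by it
  would cross a side of the inner triangle at \<open>e\<close>.\<close>

lemma nx_contains:
  assumes e: "e \<in> Cr u w" and t: "t \<in> Cr u w" and n: "fst e <= fst t" "snd t <= snd e" "t ~= e"
  shows "fst (nx w e) <= fst t" "snd t <= snd (nx w e)"
proof -
  obtain c d b a where ed: "e = (c, d)" and ta: "t = (b, a)" by (cases e, cases t)
  have ce: "u < c" "c < w" "w < d" "d < u + 3 * m" "D c d" using CrD[OF e[unfolded ed]] by auto
  have ct: "u < b" "b < w" "w < a" "a < u + 3 * m" "D b a" using CrD[OF t[unfolded ta]] by auto
  define z where "z = apx c d"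
  have z: "c < z" "z < d" "D c z" "D z d" using inn[OF e[unfolded ed]] by (simp_all add: z_def)
  have n': "c <= b" "a <= d" "(b, a) ~= (c, d)" using n ed ta by auto
  have "fst (nx w e) <= fst t \<and> snd t <= snd (nx w e)"
  proof (cases "z < w")
    case True
    have "z <= b"
    proof (rule ccontr)
      assume "\<not> z <= b"
      hence "b < z" by simp
      show False
      proof (cases "c = b")
        case True
        hence "a < d" using n' by auto
        thus False using D_noncross[OF ct(5) z(4)] True z \<open>z < w\<close> ct ce by auto
      next
        case False
        thus False using D_noncross[OF z(3) ct(5)] n' \<open>b < z\<close> \<open>z < w\<close> ct ce by auto
      qed
    qed
    thus ?thesis using True n' by (simp add: nx_def ed ta z_def[symmetric])
  next
    case False
    have "a <= z"
    proof (rule ccontr)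
      assume "\<not> a <= z"
      hence "z < a" by simp
      show False
      proof (cases "a = d")
        case True
        hence "c < b" using n' by auto
        thus False using D_noncross[OF z(3) ct(5)] True z False ct ce by auto
      next
        case ad: False
        thus False using D_noncross[OF ct(5) z(4)] n' \<open>z < a\<close> False ct ce by auto
      qed
    qed
    thus ?thesis using False n' by (simp add: nx_def ed ta z_def[symmetric])
  qed
  thus "fst (nx w e) <= fst t" "snd t <= snd (nx w e)" by auto
qed

text \<open>The last element \<open>s\<close> is tied only to its predecessor \<open>p\<close>: by
  \<open>nx_contains\<close>, the successor of any other element, if it is in the segment, is
  already in the old one, and the successor of \<open>s\<close> lies outside.\<close>

lemma closedOn_insert:
  assumes p: "p \<in> Cr u w" and s: "s \<in> Cr u w" "nx w p = s" and P: "Pre u w s = insert s (Pre u w p)"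
    and sp: "s \<notin> Pre u w p"
  shows "closedOn w (Pre u w s) S \<longleftrightarrow> S \<subseteq> insert s (Pre u w p) \<and> closedOn w (Pre u w p) (S - {s}) \<and>
    (if inn p < w then p \<in> S --> s \<in> S else s \<in> S --> p \<in> S)"
proof -
  let ?P = "Pre u w p"
  define C where "C T e \<longleftrightarrow> (if inn e < w then e \<in> T --> nx w e \<in> T else nx w e \<in> T --> e \<in> T)" for T e
  have nxs: "nx w s \<notin> insert s ?P" using nx_not_in_Pre[OF s(1)] P by simp
  have nxe: "nx w e \<in> ?P \<and> nx w e ~= s" if e: "e \<in> ?P" "e ~= p" "nx w e \<in> insert s ?P" for e
  proof -
    have eC: "e \<in> Cr u w" "fst e <= fst p" "snd p <= snd e" using e(1) by (auto simp: Pre_def)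
    have "nx w e \<in> Cr u w" using e(3) s(1) Pre_sub by blast
    hence "nx w e \<in> ?P" using nx_contains[OF eC(1) p eC(2,3)] e(2) by (simp add: Pre_def)
    thus ?thesis using sp by blast
  qed
  have C_cong: "C S e \<longleftrightarrow> C (S - {s}) e" if "e \<in> ?P" "nx w e \<in> ?P" for e
    using that sp unfolding C_def by auto
  have pP: "p \<in> ?P" by (rule self_in_Pre[OF p])
  have np: "nx w p \<notin> ?P" by (rule nx_not_in_Pre[OF p])
  have "closedOn w (Pre u w s) S \<longleftrightarrow> S \<subseteq> insert s ?P \<and> (\<forall>e\<in>insert s ?P. nx w e \<in> insert s ?P --> C S e)"
    unfolding closedOn_def C_def P ..
  also have "(\<forall>e\<in>insert s ?P. nx w e \<in> insert s ?P --> C S e) \<longleftrightarrow>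
      C S p \<and> (\<forall>e\<in>?P. nx w e \<in> ?P --> C S e)"
  proof (intro iffI conjI ballI impI)
    assume A: "\<forall>e\<in>insert s ?P. nx w e \<in> insert s ?P --> C S e"
    have "nx w p \<in> insert s ?P" using s(2) by simp
    thus "C S p" using A pP by blast
    show "C S e" if "e \<in> ?P" "nx w e \<in> ?P" for e using A that by blast
  next
    fix e assume A: "C S p \<and> (\<forall>e\<in>?P. nx w e \<in> ?P --> C S e)"
      and e: "e \<in> insert s ?P" "nx w e \<in> insert s ?P"
    show "C S e"
      using e nxs A nxe by blast
  qed
  also have "(\<forall>e\<in>?P. nx w e \<in> ?P --> C S e) \<longleftrightarrow> (\<forall>e\<in>?P. nx w e \<in> ?P --> C (S - {s}) e)"
    using C_cong by blast
  finally have "closedOn w (Pre u w s) S \<longleftrightarrow> S \<subseteq> insert s ?P \<and> C S p \<and>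
      (\<forall>e\<in>?P. nx w e \<in> ?P --> C (S - {s}) e)" .
  moreover have "closedOn w ?P (S - {s}) \<longleftrightarrow> S - {s} \<subseteq> ?P \<and> (\<forall>e\<in>?P. nx w e \<in> ?P --> C (S - {s}) e)"
    unfolding closedOn_def C_def ..
  moreover have "S \<subseteq> insert s ?P \<longleftrightarrow> S - {s} \<subseteq> ?P" by blast
  ultimately show ?thesis unfolding C_def s(2) by blast
qed

text \<open>The narrowest crossing is the last one: if its inner apex were not \<open>w\<close>, its
  successor would be a narrower crossing. The two inner sides then end at \<open>w\<close> and force
  all other crossings to enclose it.\<close>

lemma ex_last_crossing:
  assumes "Cr u w ~= {}"
  obtains s where "s \<in> Cr u w" "inn s = w" "Pre u w s = Cr u w"
proof -
  obtain s where s: "s \<in> Cr u w" and mn: "\<And>t. t \<in> Cr u w ==> snd s - fst s <= snd t - fst t"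
  proof -
    let ?g = "\<lambda>t :: int \<times> int. snd t - fst t"
    have "Min (?g ` Cr u w) \<in> ?g ` Cr u w" using assms finite_Cr by (intro Min_in) auto
    then obtain s where "s \<in> Cr u w" "Min (?g ` Cr u w) = ?g s" by (rule imageE) simp
    moreover have "Min (?g ` Cr u w) <= ?g t" if "t \<in> Cr u w" for t using that finite_Cr by simp
    ultimately show ?thesis using that by metis
  qed
  obtain b a where ba: "s = (b, a)" by (cases s)
  have c: "u < b" "b < w" "w < a" "a < u + 3 * m" "D b a" using CrD[OF s[unfolded ba]] by auto
  define z where "z = apx b a"
  have z: "b < z" "z < a" "D b z" "D z a" using inn[OF s[unfolded ba]] by (simp_all add: z_def)
  have "z = w"
  proof (rule ccontr)
    assume "z ~= w"
    hence "nx w s \<in> Cr u w" using z c by (auto simp: nx_def ba z_def[symmetric] Cr_def)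
    from mn[OF this] show False using z by (auto simp: nx_def ba z_def[symmetric] split: if_splits)
  qed
  moreover have "Pre u w s = Cr u w"
  proof -
    have "b' <= b \<and> a <= a'" if t: "(b', a') \<in> Cr u w" for b' a'
    proof -
      have c': "u < b'" "b' < w" "w < a'" "a' < u + 3 * m" "D b' a'" using CrD[OF t] by auto
      show ?thesis using D_noncross[OF z(3) c'(5)] D_noncross[OF c'(5) z(4)] \<open>z = w\<close> c c' by auto
    qed
    thus ?thesis by (auto simp: Pre_def ba)
  qed
  ultimately show ?thesis using that[OF s] by (simp add: ba z_def)
qed

end

context weighted_triangulation
begin

text \<open>The cross-ratio of the quadrilateral with diagonal \<open>s\<close>, in terms of the
  weights of its four sides.\<close>

definition y_wt :: "int \<times> int => 'r" where
  "y_wt s = (wt (inn s) (snd s) * wi (fst s) (inn s)) * (wt (out s) (fst s + 3 * m) * wi (snd s) (out s))"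

definition in_wt :: "int => int \<times> int => 'r" where
  "in_wt w s = (if inn s < w then 1 else wt (fst s) (inn s))"

definition out_wt :: "int => int \<times> int => 'r" where
  "out_wt u s = (if out s < u + 3 * m then 1 else wt (snd s) (out s))"

text \<open>The contribution of one crossing to the monomial of the g-vector. The diagonal stands in
  the denominator. Each adjacent triangle contributes one side, unless the arrow inside that
  triangle leads from \<open>s\<close> to a neighbouring crossing.\<close>

definition g_wt :: "int => int => int \<times> int => 'r" where
  "g_wt u w s = wi (fst s) (snd s) * in_wt w s * out_wt u s"

text \<open>The induction along the crossing sequence needs both ends of the current chord: the
  value at \<open>snd s\<close> collects the closed sets avoiding \<open>s\<close>, the value at
  \<open>fst s\<close> those containing it. One endpoint changes at each step, and its new value
  comes from one Pluecker relation.\<close>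

lemma prefix_expansion:
  assumes f: "is_frieze f" and u: "u < w" "w < u + 3 * m" and s: "s \<in> Cr u w"
  defines "G \<equiv> \<lambda>s. (\<Prod>t\<in>Pre u w s - {s}. g_wt u w t) * out_wt u s"
    and "A \<equiv> \<lambda>s. \<Sum>S | S \<in> {S. closedOn w (Pre u w s) S} \<and> s \<notin> S. prod y_wt S"
    and "B \<equiv> \<lambda>s. \<Sum>S | S \<in> {S. closedOn w (Pre u w s) S} \<and> s \<in> S. prod y_wt (S - {s})"
  shows "f u (snd s) = G s * A s \<and>
    f u (fst s) = G s * (wt (out s) (fst s + 3 * m) * wi (snd s) (out s)) * B s"
  using s
\<comment> \<open>The preceding crossing is a wider chord, so this measure decreases towards the
  start.\<close>
proof (induction "nat (3 * m - (snd s - fst s))" arbitrary: s rule: less_induct)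
  case less
  obtain b a where ba: "s = (b, a)" by (cases s)
  have sC: "(b, a) \<in> Cr u w" using less.prems ba by simp
  have c: "u < b" "b < w" "w < a" "a < u + 3 * m" "D b a" using CrD[OF sC] by auto
  define z where "z = apx a (b + 3 * m)"
  have z: "a < z" "z < b + 3 * m" "D a z" "D z (b + 3 * m)" using out[OF sC] by (simp_all add: z_def)
  note plu = friezeD(3)[OF f] and fD = friezeD(7)[OF f]
  have ext: "A s = (if inn p < w then A p else A p + y_wt p * B p) \<and>
      B s = (if inn p < w then A p + y_wt p * B p else y_wt p * B p) \<and>
      (\<Prod>t\<in>Pre u w s - {s}. g_wt u w t) = (\<Prod>t\<in>Pre u w p - {p}. g_wt u w t) * g_wt u w p"
    if p: "p \<in> Cr u w" "nx w p = s" "Pre u w s = insert s (Pre u w p)" "s \<notin> Pre u w p" for p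
  proof (intro conjI)
    have Z0: "{S. closedOn w (Pre u w p) S} \<subseteq> Pow (Pre u w p)" by (auto simp: closedOn_def)
    have Z: "S \<in> {S. closedOn w (Pre u w s) S} \<longleftrightarrow> S \<subseteq> insert s (Pre u w p) \<and>
        S - {s} \<in> {S. closedOn w (Pre u w p) S} \<and>
        (if inn p < w then p \<in> S --> s \<in> S else s \<in> S --> p \<in> S)" for S
      using closedOn_insert[OF p(1) less.prems p(2-4)] by simp
    show "A s = (if inn p < w then A p else A p + y_wt p * B p)"
      unfolding A_def B_def
      by (rule closed_sum_extend(1)[OF finite_Pre self_in_Pre[OF p(1)] p(4) Z0 Z])
    show "B s = (if inn p < w then A p + y_wt p * B p else y_wt p * B p)"
      unfolding A_def B_def
      by (rule closed_sum_extend(2)[OF finite_Pre self_in_Pre[OF p(1)] p(4) Z0 Z])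
    have "Pre u w s - {s} = Pre u w p" using p(3,4) by auto
    thus "(\<Prod>t\<in>Pre u w s - {s}. g_wt u w t) = (\<Prod>t\<in>Pre u w p - {p}. g_wt u w t) * g_wt u w p"
      using prod.remove[OF finite_Pre self_in_Pre[OF p(1)], of "g_wt u w"] by (simp add: mult.commute)
  qed
  show ?case
  proof (cases rule: pred_cases[OF sC])
    case 1
    have z1: "z = u + 3 * m" using 1(1) by (simp add: z_def)
    have P: "Pre u w s = {s}" using 1(2) ba by simp
    have np: "nx w s \<notin> {s}" using nx_not_in_Pre[OF less.prems] P by simp
    have "closedOn w (Pre u w s) S \<longleftrightarrow> S = {} \<or> S = {s}" for S
      unfolding closedOn_def P using np by auto
    hence Z: "{S. S \<in> {S. closedOn w (Pre u w s) S} \<and> s \<notin> S} = {{}}"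
        "{S. S \<in> {S. closedOn w (Pre u w s) S} \<and> s \<in> S} = {{s}}" by auto
    have AB: "A s = 1" "B s = 1" unfolding A_def B_def Z by simp_all
    have Du: "D u a" using z(3) D_flip[of a u] z1 by simp
    have Gs: "G s = wt u a" unfolding G_def P using wt_flip[of a u] by (simp add: out_wt_def ba z_def[symmetric] z1)
    have Db: "D u b" using z(4) D_shift[of u 3 b] z1 by simp
    have ws: "wt z (b + 3 * m) = wt u b" using wt_shift[of u 3 b] z1 by simp
    have "wi a z = wi u a" using wi_flip[of a u] z1 by simp
    hence "G s * (wt z (b + 3 * m) * wi a z) = wt u b * (wt u a * wi u a)"
      using Gs ws by (simp add: algebra_simps)
    hence "G s * (wt z (b + 3 * m) * wi a z) = wt u b" using wt_inv[OF Du] by simp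
    thus ?thesis using AB Gs fD[OF Du] fD[OF Db] by (simp add: ba z_def[symmetric])
  next
    case 2
    define b0 where "b0 = z - 3 * m"
    let ?p = "(b0, a)"
    have p: "?p \<in> Cr u w" "b0 < b" "D b0 b" "apx b0 a = b" "nx w ?p = s"
        "Pre u w s = insert s (Pre u w ?p)" "s \<notin> Pre u w ?p" and zu: "z > u + 3 * m"
      using 2 by (simp_all add: b0_def z_def ba)
    have zb: "z = b0 + 3 * m" by (simp add: b0_def)
    have D0: "D b0 a" using CrD[OF p(1)] by simp
    have IH: "f u a = G ?p * A ?p" "f u b0 = G ?p * (wt (out ?p) (b0 + 3 * m) * wi a (out ?p)) * B ?p"
      using less.hyps[OF _ p(1)] p(2) ba c CrD[OF p(1)] by auto
    have E: "A s = A ?p" "B s = A ?p + y_wt ?p * B ?p"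
      "(\<Prod>t\<in>Pre u w s - {s}. g_wt u w t) = (\<Prod>t\<in>Pre u w ?p - {?p}. g_wt u w t) * g_wt u w ?p"
      using ext[OF p(1,5-7)] p(4) c by simp_all
    have w0: "wt a z = wt b0 a" "wi a z = wi b0 a" unfolding zb by (rule wt_flip wi_flip)+
    have w1: "wt z (b + 3 * m) = wt b0 b" using wt_shift[of b0 3 b] by (simp add: zb)
    have gp: "g_wt u w ?p = wi b0 a * out_wt u ?p" using c by (simp add: g_wt_def in_wt_def p(4))
    have os: "out_wt u s = wt b0 a" using zu by (simp add: out_wt_def ba z_def[symmetric] w0)
    have "G s = G ?p * (wt b0 a * wi b0 a)"
      unfolding G_def E(3) gp os by (simp only: mult_ac)
    hence Gs: "G s = G ?p" using wt_inv[OF D0] by simp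
    have 1: "f u (snd s) = G s * A s" using IH(1) E(1) Gs by (simp add: ba)
    \<comment> \<open>The new endpoint is \<open>b\<close>. In the quadrilateral u, b0, b, a, with
      b0 the replaced endpoint, every other value is already known.\<close>
    have pl: "f u b * wt b0 a = f u b0 * wt b a + wt b0 b * f u a"
      using plu[of u b b0 a] fD[OF D0] fD[OF c(5)] fD[OF p(3)] by simp
    have "(wt b0 a * wi b0 a) * f u b = wi b0 a * (f u b * wt b0 a)" by (simp only: mult_ac)
    hence "(wt b0 a * wi b0 a) * f u b = wi b0 a * (f u b0 * wt b a + wt b0 b * f u a)"
      unfolding pl .
    hence fb: "f u b = wi b0 a * (f u b0 * wt b a + wt b0 b * f u a)" using wt_inv[OF D0] by simp
    have y: "y_wt ?p = wt b a * wi b0 b * (wt (out ?p) (b0 + 3 * m) * wi a (out ?p))"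
      by (simp add: y_wt_def p(4))
    have "G s * (wt z (b + 3 * m) * wi a z) * B s =
      G ?p * wt b0 b * wi b0 a * A ?p + wi b0 a * wt b a * (wt b0 b * wi b0 b) *
        (G ?p * (wt (out ?p) (b0 + 3 * m) * wi a (out ?p)) * B ?p)"
      unfolding Gs w0 w1 E(2) y by (simp add: algebra_simps)
    also have "\<dots> = f u b" unfolding fb IH wt_inv[OF p(3)] by (simp add: algebra_simps)
    finally show ?thesis using 1 by (simp add: ba z_def[symmetric])
  next
    case 3
    let ?p = "(b, z)"
    have p: "?p \<in> Cr u w" "a < z" "D a z" "apx b z = a" "nx w ?p = s"
        "Pre u w s = insert s (Pre u w ?p)" "s \<notin> Pre u w ?p" and zu: "z < u + 3 * m"
      using 3 by (simp_all add: z_def ba)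
    have D0: "D b z" using CrD[OF p(1)] by simp
    have IH: "f u z = G ?p * A ?p" "f u b = G ?p * (wt (out ?p) (b + 3 * m) * wi z (out ?p)) * B ?p"
      using less.hyps[OF _ p(1)] p(2) ba c CrD[OF p(1)] by auto
    have E: "A s = A ?p + y_wt ?p * B ?p" "B s = y_wt ?p * B ?p"
      "(\<Prod>t\<in>Pre u w s - {s}. g_wt u w t) = (\<Prod>t\<in>Pre u w ?p - {?p}. g_wt u w t) * g_wt u w ?p"
      using ext[OF p(1,5-7)] p(4) c by simp_all
    have w1: "wt z (b + 3 * m) = wt b z" by (rule wt_flip)
    have gp: "g_wt u w ?p = wi b z * wt b a * out_wt u ?p" using c by (simp add: g_wt_def in_wt_def p(4))
    have os: "out_wt u s = 1" using zu by (simp add: out_wt_def ba z_def[symmetric])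
    have Gs: "G s = G ?p * wi b z * wt b a"
      unfolding G_def E(3) gp os by (simp only: mult_ac mult_1_right mult_1_left)
    have y: "y_wt ?p = wt a z * wi b a * (wt (out ?p) (b + 3 * m) * wi z (out ?p))"
      by (simp add: y_wt_def p(4))
    have "G s * A s = wi b z * (wt b a * (G ?p * A ?p) + wt a z * (wt b a * wi b a) *
        (G ?p * (wt (out ?p) (b + 3 * m) * wi z (out ?p)) * B ?p))"
      unfolding Gs E(1) y by (simp add: algebra_simps)
    also have "\<dots> = wi b z * (wt b a * f u z + wt a z * f u b)"
      unfolding IH wt_inv[OF c(5)] by (simp add: algebra_simps)
    also have "wt b a * f u z + wt a z * f u b = f u a * wt b z"
      using plu[of u a b z] fD[OF D0] fD[OF c(5)] fD[OF p(3)] by (simp add: algebra_simps)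
    also have "wi b z * (f u a * wt b z) = (wt b z * wi b z) * f u a" by (simp add: algebra_simps)
    finally have 1: "f u a = G s * A s" using wt_inv[OF D0] by simp
    have "G s * (wt z (b + 3 * m) * wi a z) * B s =
      (wt b z * wi b z) * (wt b a * wi b a) * (wt a z * wi a z) *
        (G ?p * (wt (out ?p) (b + 3 * m) * wi z (out ?p)) * B ?p)"
      unfolding Gs w1 E(2) y by (simp add: algebra_simps)
    also have "\<dots> = f u b" unfolding IH wt_inv[OF D0] wt_inv[OF c(5)] wt_inv[OF p(3)] by simp
    finally show ?thesis using 1 by (simp add: ba z_def[symmetric])
  qed
qed

text \<open>The last crossing has inner apex \<open>w\<close>, so the Pluecker relation in the
  quadrilateral u, b, w, a joins the two partial sums.\<close>

theorem frieze_expansion: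
  assumes f: "is_frieze f" and u: "u < w" "w < u + 3 * m" and ne: "Cr u w ~= {}"
  shows "f u w = (\<Prod>s\<in>Cr u w. g_wt u w s) * (\<Sum>S | closedOn w (Cr u w) S. prod y_wt S)"
proof -
  obtain s where s: "s \<in> Cr u w" "inn s = w" "Pre u w s = Cr u w" using ex_last_crossing[OF ne] by blast
  obtain b a where ba: "s = (b, a)" by (cases s)
  have sC: "(b, a) \<in> Cr u w" using s ba by simp
  have c: "u < b" "b < w" "w < a" "a < u + 3 * m" "D b a" using CrD[OF sC] by auto
  have z: "apx b a = w" "D b w" "D w a" using inn[OF sC] s(2) by (simp_all add: ba)
  note plu = friezeD(3)[OF f] and fD = friezeD(7)[OF f]
  let ?A = "\<Sum>S | S \<in> {S. closedOn w (Cr u w) S} \<and> s \<notin> S. prod y_wt S"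
  let ?B = "\<Sum>S | S \<in> {S. closedOn w (Cr u w) S} \<and> s \<in> S. prod y_wt (S - {s})"
  let ?G = "(\<Prod>t\<in>Cr u w - {s}. g_wt u w t) * out_wt u s"
  let ?be = "wt (out s) (b + 3 * m) * wi a (out s)"
  have X: "f u a = ?G * ?A" "f u b = ?G * ?be * ?B"
    using prefix_expansion[OF f u s(1)] unfolding s(3) by (simp_all add: ba)
  have "{S. closedOn w (Cr u w) S} \<subseteq> Pow (Cr u w)" by (auto simp: closedOn_def)
  note sm = sum_prod_split[OF finite_Cr this, of y_wt s]
  have y: "y_wt s = wt w a * wi b w * ?be" by (simp add: y_wt_def ba z(1))
  have "(\<Prod>s\<in>Cr u w. g_wt u w s) = g_wt u w s * (\<Prod>t\<in>Cr u w - {s}. g_wt u w t)"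
    by (rule prod.remove[OF finite_Cr s(1)])
  also have "\<dots> = ?G * wi b a * wt b w" by (simp add: g_wt_def in_wt_def s(2) ba algebra_simps z(1))
  finally have "(\<Prod>s\<in>Cr u w. g_wt u w s) * (\<Sum>S | closedOn w (Cr u w) S. prod y_wt S) =
      wi b a * (wt b w * (?G * ?A) + (wt b w * wi b w) * wt w a * (?G * ?be * ?B))"
    unfolding sm y by (simp add: algebra_simps)
  also have "\<dots> = wi b a * (wt b w * f u a + wt w a * f u b)"
    unfolding X wt_inv[OF z(2)] by (simp add: algebra_simps)
  also have "wt b w * f u a + wt w a * f u b = f u w * wt b a"
    using plu[of u w b a] fD[OF c(5)] fD[OF z(2)] fD[OF z(3)] by (simp add: algebra_simps)
  also have "wi b a * (f u w * wt b a) = (wt b a * wi b a) * f u w" by (simp add: algebra_simps)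
  finally show ?thesis using wt_inv[OF c(5)] by simp
qed

end

section \<open>Arcs as pairs of integers\<close>

definition cyc :: "nat => nat => nat => bool" where
  "cyc a b c \<longleftrightarrow> a < b \<and> b < c \<or> b < c \<and> c < a \<or> c < a \<and> a < b"

locale orbifold =
  fixes n :: nat
  assumes n2: "2 <= n"
begin

definition M :: int where "M = int n + 1"

lemma M3: "M \<ge> 3" using n2 by (simp add: M_def)

lemma n_M: "int (3 * n + 3) = 3 * M" "int (n + 1) = M" by (simp_all add: M_def)

definition pt :: "int => nat" where "pt x = nat (x mod (3 * M))"

lemma int_pt: "int (pt x) = x mod (3 * M)" using M3 by (simp add: pt_def)

lemma pt_lt: "pt x < 3 * n + 3"
proof -
  have "int (pt x) < int (3 * n + 3)" unfolding int_pt n_M using M3 by simp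
  thus ?thesis by linarith
qed

lemma pt_of_nat: "a < 3 * n + 3 ==> pt (int a) = a"
  using n_M pt_def by simp

lemma pt_shift: "pt (x + k * (3 * M)) = pt x" by (simp add: pt_def)

lemma pt_eq: "pt x = a \<longleftrightarrow> a < 3 * n + 3 \<and> (\<exists>j. x = int a + j * (3 * M))"
  by (metis mod_div_mult_eq pt_lt int_pt pt_shift pt_of_nat)

lemma pt_eq_iff: "pt x = pt y \<longleftrightarrow> (\<exists>k. y = x + k * (3 * M))"
proof
  assume "pt x = pt y"
  then obtain j where "y = int (pt x) + j * (3 * M)" using pt_eq[of y "pt x"] by auto
  moreover obtain i where "x = int (pt x) + i * (3 * M)" using pt_eq[of x "pt x"] by auto
  ultimately have "y = x + (j - i) * (3 * M)" by (simp add: algebra_simps)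
  thus "\<exists>k. y = x + k * (3 * M)" ..
next
  assume "\<exists>k. y = x + k * (3 * M)"
  thus "pt x = pt y" using pt_shift by auto
qed

lemma multiple_window:
  fixes j N :: int
  assumes "N > 0"
  shows "- N < j * N ==> j \<ge> 0" "j * N < N ==> j <= 0" "j * N < 2 * N ==> j <= 1" "0 < j * N ==> j \<ge> 1"
proof -
  show "j \<ge> 0" if "- N < j * N"
  proof -
    have "(-1) * N < j * N" using that by simp
    thus ?thesis using assms mult_less_cancel_right_pos[of N "-1" j] by linarith
  qed
  show "j <= 0" if "j * N < N"
  proof -
    have "j * N < 1 * N" using that by simp
    thus ?thesis using assms mult_less_cancel_right_pos[of N j 1] by linarith
  qed
  show "j <= 1" if "j * N < 2 * N"
    using that assms mult_less_cancel_right_pos[of N j 2] by linarith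
  show "j \<ge> 1" if "0 < j * N"
    using that assms zero_less_mult_iff[of j N] by linarith
qed

lemma pt_window:
  assumes "x < y" "y < x + 3 * M"
  shows "(pt x < pt y \<and> y - x = int (pt y) - int (pt x)) \<or> (pt y < pt x \<and> y - x = int (pt y) - int (pt x) + 3 * M)"
proof -
  obtain i j where ij: "x = int (pt x) + i * (3 * M)" "y = int (pt y) + j * (3 * M)"
    using pt_eq[of x "pt x"] pt_eq[of y "pt y"] by auto
  have l: "int (pt x) < 3 * M" "int (pt y) < 3 * M" using pt_lt[of x] pt_lt[of y] n_M(1) by linarith+
  have N: "3 * M > 0" using M3 by simp
  have e: "y - x = int (pt y) - int (pt x) + (j - i) * (3 * M)" using ij by (simp add: algebra_simps)
  have "(j - i) * (3 * M) < 2 * (3 * M)" using e assms l by linarith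
  hence "j - i <= 1" by (rule multiple_window(3)[OF N])
  moreover have "- (3 * M) < (j - i) * (3 * M)" using e assms l by linarith
  hence "0 <= j - i" by (rule multiple_window(1)[OF N])
  ultimately consider "j - i = 0" | "j - i = 1" by linarith
  thus ?thesis
    using e assms by fastforce
qed

lemma ex_lift:
  assumes "a < 3 * n + 3" "a ~= pt x"
  shows "\<exists>y. x < y \<and> y < x + 3 * M \<and> pt y = a"
proof -
  obtain i where i: "x = int (pt x) + i * (3 * M)" using pt_eq[of x "pt x"] by auto
  have l: "int (pt x) < 3 * M" "int a < 3 * M" using pt_lt[of x] assms(1) n_M(1) by linarith+
  have p: "pt (int a + j * (3 * M)) = a" for j unfolding pt_shift by (rule pt_of_nat[OF assms(1)])
  show ?thesis
  proof (cases "pt x < a")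
    case True
    hence "x < int a + i * (3 * M)" "int a + i * (3 * M) < x + 3 * M" using l i by linarith+
    thus ?thesis using p by blast
  next
    case False
    hence "int a < int (pt x)" using assms(2) by simp
    moreover have "(i + 1) * (3 * M) = i * (3 * M) + 3 * M" by (simp add: distrib_right)
    ultimately have "x < int a + (i + 1) * (3 * M)" "int a + (i + 1) * (3 * M) < x + 3 * M" using l i by linarith+
    thus ?thesis using p by blast
  qed
qed

text \<open>Once a lift of the first point is fixed, cyclic order becomes linear order in a window
  of one full turn. Through this, crossings and triangles of the polygon become statements about
  integers.\<close>

lemma cyc_lift:
  "cyc (pt x) b c \<and> b < 3 * n + 3 \<and> c < 3 * n + 3 \<longleftrightarrow>
     (\<exists>y z. x < y \<and> y < z \<and> z < x + 3 * M \<and> pt y = b \<and> pt z = c)"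
proof
  assume c: "cyc (pt x) b c \<and> b < 3 * n + 3 \<and> c < 3 * n + 3"
  hence "b ~= pt x" "c ~= pt x" by (auto simp: cyc_def)
  then obtain y z where yz: "x < y" "y < x + 3 * M" "pt y = b" "x < z" "z < x + 3 * M" "pt z = c"
    using ex_lift[of b x] ex_lift[of c x] c by blast
  have l: "int b < 3 * M" "int c < 3 * M" "int (pt x) < 3 * M" using c pt_lt[of x] n_M(1) by linarith+
  have "y < z" using pt_window[OF yz(1,2)] pt_window[OF yz(4,5)] c l unfolding cyc_def yz(3,6) by linarith
  thus "\<exists>y z. x < y \<and> y < z \<and> z < x + 3 * M \<and> pt y = b \<and> pt z = c" using yz by blast
next
  assume "\<exists>y z. x < y \<and> y < z \<and> z < x + 3 * M \<and> pt y = b \<and> pt z = c"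
  then obtain y z where yz: "x < y" "y < z" "z < x + 3 * M" "pt y = b" "pt z = c" by blast
  have "x < z" "y < x + 3 * M" "z < y + 3 * M" using yz by linarith+
  hence "cyc (pt x) (pt y) (pt z)"
    using pt_window[of x y] pt_window[of x z] pt_window[of y z] yz unfolding cyc_def by linarith
  thus "cyc (pt x) b c \<and> b < 3 * n + 3 \<and> c < 3 * n + 3" using yz pt_lt by blast
qed

lemma pt_eq_window:
  assumes "pt x = pt y" "x < y" "y < x + 6 * M"
  shows "y = x + 3 * M"
proof -
  obtain k where k: "y = x + k * (3 * M)" using assms(1) pt_eq_iff by blast
  have N: "3 * M > 0" using M3 by simp
  have "k <= 1" by (rule multiple_window(3)[OF N]) (use k assms in linarith)
  moreover have "k \<ge> 1" by (rule multiple_window(4)[OF N]) (use k assms in linarith)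
  ultimately have "k = 1" by linarith
  thus ?thesis using k by simp
qed

definition dg :: "int => int => nat set" where "dg x y = {pt x, pt y}"

lemma dg_flip: "dg y (x + 3 * M) = dg x y" using pt_shift[of x 1] by (auto simp: dg_def)

lemma dg_shift: "dg (x + k * (3 * M)) (y + k * (3 * M)) = dg x y" by (simp add: dg_def pt_shift)

lemma crosses_cyc:
  assumes "q < 3 * n + 3" "s < 3 * n + 3"
  shows "crosses {p, r} {q, s} \<longleftrightarrow> cyc p q r \<and> cyc r s p \<or> cyc p s r \<and> cyc r q p"
proof
  assume "crosses {p, r} {q, s}"
  then obtain a b c e where abce: "a < b" "b < c" "c < e"
      "{p, r} = {a, c} \<and> {q, s} = {b, e} \<or> {p, r} = {b, e} \<and> {q, s} = {a, c}"
    unfolding crosses_def by blast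
  have "(p = a \<and> r = c \<or> p = c \<and> r = a) \<and> (q = b \<and> s = e \<or> q = e \<and> s = b) \<or>
      (p = b \<and> r = e \<or> p = e \<and> r = b) \<and> (q = a \<and> s = c \<or> q = c \<and> s = a)"
    using abce(4) unfolding doubleton_eq_iff by blast
  thus "cyc p q r \<and> cyc r s p \<or> cyc p s r \<and> cyc r q p"
    by (elim disjE conjE) (use abce(1-3) in \<open>simp_all add: cyc_def\<close>)
next
  have *: "crosses {p, r} {q, s}" if "cyc p q r" "cyc r s p" for p q r s
  proof -
    have "p < q \<and> q < r \<or> q < r \<and> r < p \<or> r < p \<and> p < q" using that(1) unfolding cyc_def .
    moreover have "r < s \<or> s < p" "r < p ==> r < s \<and> s < p" using that(2) unfolding cyc_def by auto
    ultimately consider "p < q" "q < r" "r < s" | "s < p" "p < q" "q < r" | "r < s" "s < p" "p < q" | "q < r" "r < s" "s < p"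
      by blast
    thus ?thesis
    proof cases
      case 1
      thus ?thesis unfolding crosses_def by blast
    next
      case 2
      thus ?thesis unfolding crosses_def by (intro exI[of _ s] exI[of _ p] exI[of _ q] exI[of _ r]) auto
    next
      case 3
      thus ?thesis unfolding crosses_def by (intro exI[of _ r] exI[of _ s] exI[of _ p] exI[of _ q]) auto
    next
      case 4
      thus ?thesis unfolding crosses_def by (intro exI[of _ q] exI[of _ r] exI[of _ s] exI[of _ p]) auto
    qed
  qed
  assume "cyc p q r \<and> cyc r s p \<or> cyc p s r \<and> cyc r q p"
  thus "crosses {p, r} {q, s}" using *[of p q r s] *[of p s r q] by (auto simp: insert_commute)
qed

lemma cyc_cyc_lift:
  assumes xy: "x < y" "y < x + 3 * M"
  shows "cyc (pt x) q (pt y) \<and> cyc (pt y) s (pt x) \<and> q < 3 * n + 3 \<and> s < 3 * n + 3 \<longleftrightarrow>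
    (\<exists>b a. x < b \<and> b < y \<and> y < a \<and> a < x + 3 * M \<and> pt b = q \<and> pt a = s)"
proof
  assume c: "cyc (pt x) q (pt y) \<and> cyc (pt y) s (pt x) \<and> q < 3 * n + 3 \<and> s < 3 * n + 3"
  obtain b y' where b: "x < b" "b < y'" "y' < x + 3 * M" "pt b = q" "pt y' = pt y"
    using cyc_lift[of x q "pt y"] c pt_lt by blast
  have "y' = y"
  proof (rule ccontr)
    assume "y' ~= y"
    then consider "y' < y" | "y < y'" by linarith
    thus False
    proof cases
      case 1
      hence "y = y' + 3 * M" by (intro pt_eq_window) (use b xy M3 in auto)
      thus False using b xy by linarith
    next
      case 2
      hence "y' = y + 3 * M" by (intro pt_eq_window) (use b xy M3 in auto)
      thus False using b xy by linarith
    qed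
  qed
  obtain a x' where a: "y < a" "a < x'" "x' < y + 3 * M" "pt a = s" "pt x' = pt x"
    using cyc_lift[of y s "pt x"] c pt_lt by blast
  have "x' = x + 3 * M" by (intro pt_eq_window) (use a xy in auto)
  thus "\<exists>b a. x < b \<and> b < y \<and> y < a \<and> a < x + 3 * M \<and> pt b = q \<and> pt a = s"
    using b a \<open>y' = y\<close> by blast
next
  assume "\<exists>b a. x < b \<and> b < y \<and> y < a \<and> a < x + 3 * M \<and> pt b = q \<and> pt a = s"
  then obtain b a where ba: "x < b" "b < y" "y < a" "a < x + 3 * M" "pt b = q" "pt a = s" by blast
  have "cyc (pt x) q (pt y)" using cyc_lift[of x q "pt y"] ba xy by blast
  moreover have "cyc (pt y) s (pt x)"
  proof -
    have "y < a \<and> a < x + 3 * M \<and> x + 3 * M < y + 3 * M \<and> pt a = s \<and> pt (x + 3 * M) = pt x"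
      using ba xy pt_shift[of x 1] by simp
    thus ?thesis using cyc_lift[of y s "pt x"] by blast
  qed
  ultimately show "cyc (pt x) q (pt y) \<and> cyc (pt y) s (pt x) \<and> q < 3 * n + 3 \<and> s < 3 * n + 3"
    using ba pt_lt by blast
qed

lemma crosses_dg:
  assumes xy: "x < y" "y < x + 3 * M" and t: "t = {q, s}" "q < 3 * n + 3" "s < 3 * n + 3"
  shows "crosses (dg x y) t \<longleftrightarrow> (\<exists>b a. x < b \<and> b < y \<and> y < a \<and> a < x + 3 * M \<and> t = dg b a)"
proof -
  have "crosses (dg x y) t \<longleftrightarrow> (\<exists>b a. x < b \<and> b < y \<and> y < a \<and> a < x + 3 * M \<and>
      (pt b = q \<and> pt a = s \<or> pt b = s \<and> pt a = q))"
    unfolding dg_def t(1) crosses_cyc[OF t(2,3)]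
    using cyc_cyc_lift[OF xy, of q s] cyc_cyc_lift[OF xy, of s q] t(2,3) by blast
  also have "\<dots> \<longleftrightarrow> (\<exists>b a. x < b \<and> b < y \<and> y < a \<and> a < x + 3 * M \<and> t = dg b a)"
    unfolding dg_def t(1) doubleton_eq_iff by (intro iff_exI) auto
  finally show ?thesis .
qed

lemma crosses_dg_dg:
  assumes "x < y" "y < x + 3 * M"
  shows "crosses (dg x y) (dg c d) \<longleftrightarrow> (\<exists>b a. x < b \<and> b < y \<and> y < a \<and> a < x + 3 * M \<and> dg c d = dg b a)"
  by (rule crosses_dg[OF assms, of _ "pt c" "pt d"]) (simp_all add: dg_def pt_lt)

lemma dg_eq_iff:
  assumes "x < y" "y < x + 3 * M" "x' < y'" "y' < x' + 3 * M"
  shows "dg x y = dg x' y' \<longleftrightarrow> (\<exists>k. x' = x + k * (3 * M) \<and> y' = y + k * (3 * M) \<or>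
      x' = y + k * (3 * M) \<and> y' = x + (k + 1) * (3 * M))"
proof
  assume "dg x y = dg x' y'"
  hence "pt x = pt x' \<and> pt y = pt y' \<or> pt x = pt y' \<and> pt y = pt x'"
    by (auto simp: dg_def doubleton_eq_iff)
  thus "\<exists>k. x' = x + k * (3 * M) \<and> y' = y + k * (3 * M) \<or>
      x' = y + k * (3 * M) \<and> y' = x + (k + 1) * (3 * M)"
  proof
    assume "pt x = pt x' \<and> pt y = pt y'"
    then obtain k where k: "x' = x + k * (3 * M)" using pt_eq_iff by blast
    have p: "pt (y + k * (3 * M)) = pt y'" using pt_shift \<open>pt x = pt x' \<and> pt y = pt y'\<close> by simp
    have "y' = y + k * (3 * M)"
    proof (rule ccontr)
      assume "y' ~= y + k * (3 * M)"
      then consider "y' < y + k * (3 * M)" | "y + k * (3 * M) < y'" by linarith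
      thus False
      proof cases
        case 1
        hence "y + k * (3 * M) = y' + 3 * M" by (intro pt_eq_window) (use p k assms M3 in auto)
        thus False using k assms by linarith
      next
        case 2
        hence "y' = y + k * (3 * M) + 3 * M" by (intro pt_eq_window) (use p k assms M3 in auto)
        thus False using k assms by linarith
      qed
    qed
    with k show ?thesis by blast
  next
    assume *: "pt x = pt y' \<and> pt y = pt x'"
    then obtain k where k: "x' = y + k * (3 * M)" using pt_eq_iff by blast
    have p: "pt (x + k * (3 * M)) = pt y'" using pt_shift * by simp
    have "y' = x + k * (3 * M) + 3 * M"
      by (intro pt_eq_window p) (use k assms in linarith)+
    hence "y' = x + (k + 1) * (3 * M)" by (simp add: distrib_right)
    with k show ?thesis by blast
  qed
next
  assume "\<exists>k. x' = x + k * (3 * M) \<and> y' = y + k * (3 * M) \<or>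
      x' = y + k * (3 * M) \<and> y' = x + (k + 1) * (3 * M)"
  thus "dg x y = dg x' y'" by (auto simp: dg_def pt_shift)
qed

lemma rot_pt: "rot n k (pt x) = pt (x + int k * M)"
proof -
  have "int (rot n k (pt x)) = (x mod (3 * M) + int k * M) mod (3 * M)"
    unfolding rot_def zmod_int n_M of_nat_add of_nat_mult int_pt by (simp add: M_def)
  also have "\<dots> = int (pt (x + int k * M))" unfolding int_pt by (simp only: mod_add_left_eq)
  finally show ?thesis by linarith
qed

lemma rot_dg: "rot n k ` dg x y = dg (x + int k * M) (y + int k * M)"
  by (simp add: dg_def rot_pt)

lemma shift_mod3: "\<exists>j<3. \<exists>i. k = int j + i * 3"
  by (rule exI[of _ "nat (k mod 3)"]) (use div_mult_mod_eq[of k 3] in \<open>auto intro!: exI[of _ "k div 3"]\<close>)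

definition arc :: "int => int => arc" where "arc x y = orbit n (dg x y)"

lemma arc_eq_set: "arc x y = {dg (x + k * M) (y + k * M) | k. True}"
proof (intro equalityI subsetI)
  fix s assume "s \<in> arc x y"
  thus "s \<in> {dg (x + k * M) (y + k * M) | k. True}"
    unfolding arc_def orbit_def rot_dg by blast
next
  fix s assume "s \<in> {dg (x + k * M) (y + k * M) | k. True}"
  then obtain k where k: "s = dg (x + k * M) (y + k * M)" by blast
  obtain j i where ji: "j < 3" "k = int j + i * 3" using shift_mod3 by blast
  have e: "x + k * M = x + int j * M + i * (3 * M)" "y + k * M = y + int j * M + i * (3 * M)"
    using ji(2) by (simp_all add: algebra_simps)
  have "s = dg (x + int j * M) (y + int j * M)" unfolding k e by (rule dg_shift)
  thus "s \<in> arc x y" unfolding arc_def orbit_def rot_dg using ji(1) by blast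
qed

lemma dg_in_arc: "dg (x + k * M) (y + k * M) \<in> arc x y" unfolding arc_eq_set by blast

lemma dg_self_in_arc: "dg x y \<in> arc x y" using dg_in_arc[of x 0 y] by simp

lemma arc_shift: "arc (x + k * M) (y + k * M) = arc x y"
proof -
  have "{dg (x + k * M + j * M) (y + k * M + j * M) | j. True} = {dg (x + j * M) (y + j * M) | j. True}"
  proof (intro equalityI subsetI)
    fix s assume "s \<in> {dg (x + k * M + j * M) (y + k * M + j * M) | j. True}"
    then obtain j where "s = dg (x + (k + j) * M) (y + (k + j) * M)" by (auto simp: distrib_right add.assoc)
    thus "s \<in> {dg (x + j * M) (y + j * M) | j. True}" by blast
  next
    fix s assume "s \<in> {dg (x + j * M) (y + j * M) | j. True}"
    then obtain j where j: "s = dg (x + j * M) (y + j * M)" by blast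
    hence "s = dg (x + k * M + (j - k) * M) (y + k * M + (j - k) * M)" by (simp add: algebra_simps)
    thus "s \<in> {dg (x + k * M + j * M) (y + k * M + j * M) | j. True}" by blast
  qed
  thus ?thesis unfolding arc_eq_set .
qed

lemma arc_flip: "arc y (x + 3 * M) = arc x y" by (simp add: arc_def dg_flip)

lemma arc_of_member:
  assumes "dg x y \<in> arc x' y'"
  shows "arc x y = arc x' y'"
proof -
  obtain k where "dg x y = dg (x' + k * M) (y' + k * M)" using assms unfolding arc_eq_set by blast
  hence "arc x y = arc (x' + k * M) (y' + k * M)" by (simp add: arc_def)
  thus ?thesis using arc_shift by simp
qed

definition short :: "int => int => bool" where "short x y \<longleftrightarrow> x < y \<and> y <= x + M"

lemma shortD: "short x y ==> x < y \<and> y < x + 3 * M" using M3 by (simp add: short_def)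

lemma crosses_short:
  assumes "short x y" "short c d"
  shows "crosses (dg x y) (dg c d) \<longleftrightarrow> (\<exists>k. let c' = c + k * (3 * M); d' = d + k * (3 * M)
     in x < c' \<and> c' < y \<and> y < d' \<or> c' < x \<and> x < d' \<and> d' < y)"
proof -
  have cd: "c < d" "d < c + 3 * M" "x < y" "y < x + 3 * M" using shortD[OF assms(1)] shortD[OF assms(2)] by auto
  show ?thesis
  proof
    assume "crosses (dg x y) (dg c d)"
    then obtain b a where ba: "x < b" "b < y" "y < a" "a < x + 3 * M" "dg c d = dg b a"
      using crosses_dg_dg[OF cd(3,4)] by blast
    then obtain k where k: "b = c + k * (3 * M) \<and> a = d + k * (3 * M) \<or>
        b = d + k * (3 * M) \<and> a = c + (k + 1) * (3 * M)"
      using dg_eq_iff[of c d b a] cd by auto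
    from k show "\<exists>k. let c' = c + k * (3 * M); d' = d + k * (3 * M)
        in x < c' \<and> c' < y \<and> y < d' \<or> c' < x \<and> x < d' \<and> d' < y"
    proof
      assume "b = c + k * (3 * M) \<and> a = d + k * (3 * M)"
      thus ?thesis using ba by (intro exI[of _ k]) (simp add: Let_def)
    next
      assume *: "b = d + k * (3 * M) \<and> a = c + (k + 1) * (3 * M)"
      hence "a = c + k * (3 * M) + 3 * M" by (simp add: algebra_simps)
      thus ?thesis using ba * by (intro exI[of _ k]) (simp add: Let_def)
    qed
  next
    assume "\<exists>k. let c' = c + k * (3 * M); d' = d + k * (3 * M)
        in x < c' \<and> c' < y \<and> y < d' \<or> c' < x \<and> x < d' \<and> d' < y"
    then obtain k where k: "x < c + k * (3 * M) \<and> c + k * (3 * M) < y \<and> y < d + k * (3 * M) \<or>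
        c + k * (3 * M) < x \<and> x < d + k * (3 * M) \<and> d + k * (3 * M) < y" by (auto simp: Let_def)
    have len: "d <= c + M" "y <= x + M" using assms by (auto simp: short_def)
    from k have "\<exists>b a. x < b \<and> b < y \<and> y < a \<and> a < x + 3 * M \<and> dg c d = dg b a"
    proof
      assume "x < c + k * (3 * M) \<and> c + k * (3 * M) < y \<and> y < d + k * (3 * M)"
      thus ?thesis using len M3 dg_shift[of c k d]
        by (intro exI[of _ "c + k * (3 * M)"] exI[of _ "d + k * (3 * M)"]) auto
    next
      assume "c + k * (3 * M) < x \<and> x < d + k * (3 * M) \<and> d + k * (3 * M) < y"
      thus ?thesis using len M3 dg_shift[of c k d] dg_flip[of "d + k * (3 * M)" "c + k * (3 * M)"]
        by (intro exI[of _ "d + k * (3 * M)"] exI[of _ "c + k * (3 * M) + 3 * M"]) auto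
    qed
    thus "crosses (dg x y) (dg c d)" using crosses_dg_dg[OF cd(3,4)] by blast
  qed
qed

definition interlaced :: "int => int => int => int => bool" where
  "interlaced x y c d \<longleftrightarrow> x < c \<and> c < y \<and> y < d \<or> c < x \<and> x < d \<and> d < y"

text \<open>The rotations shift both arcs by multiples of \<open>M\<close>, and full turns add
  multiples of \<open>3 * M\<close>. Only the relative shift matters, and it runs through all
  multiples of \<open>M\<close>.\<close>

lemma compatible_iff:
  assumes "short x y" "short c d"
  shows "compatible (arc x y) (arc c d) \<longleftrightarrow> (\<forall>k. \<not> interlaced x y (c + k * M) (d + k * M))"
proof -
  have s: "short (u + k * M) (v + k * M)" if "short u v" for u v k using that by (simp add: short_def)
  have "compatible (arc x y) (arc c d) \<longleftrightarrow>
      (\<forall>i j. \<not> crosses (dg (x + i * M) (y + i * M)) (dg (c + j * M) (d + j * M)))"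
    unfolding compatible_def arc_eq_set by blast
  also have "\<dots> \<longleftrightarrow> (\<forall>i j k. \<not> interlaced (x + i * M) (y + i * M) (c + j * M + k * (3 * M)) (d + j * M + k * (3 * M)))"
    unfolding crosses_short[OF s[OF assms(1)] s[OF assms(2)]] Let_def interlaced_def by blast
  also have "\<dots> \<longleftrightarrow> (\<forall>k. \<not> interlaced x y (c + k * M) (d + k * M))"
  proof
    assume A: "\<forall>i j k. \<not> interlaced (x + i * M) (y + i * M) (c + j * M + k * (3 * M)) (d + j * M + k * (3 * M))"
    show "\<forall>k. \<not> interlaced x y (c + k * M) (d + k * M)"
    proof
      fix k show "\<not> interlaced x y (c + k * M) (d + k * M)" using A[rule_format, of 0 k 0] by simp
    qed
  next
    assume A: "\<forall>k. \<not> interlaced x y (c + k * M) (d + k * M)"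
    show "\<forall>i j k. \<not> interlaced (x + i * M) (y + i * M) (c + j * M + k * (3 * M)) (d + j * M + k * (3 * M))"
    proof (intro allI)
      fix i j k
      have e: "c + j * M + k * (3 * M) = c + (j + k * 3 - i) * M + i * M"
        "d + j * M + k * (3 * M) = d + (j + k * 3 - i) * M + i * M" by (simp_all add: algebra_simps)
      have 1: "interlaced (x + i * M) (y + i * M) (c' + i * M) (d' + i * M) \<longleftrightarrow> interlaced x y c' d'" for c' d'
        by (simp add: interlaced_def)
      show "\<not> interlaced (x + i * M) (y + i * M) (c + j * M + k * (3 * M)) (d + j * M + k * (3 * M))"
        unfolding e 1 by (rule A[rule_format])
    qed
  qed
  finally show ?thesis .
qed

end

section \<open>Arcs and triangulations in the periodic model\<close>

context orbifold
begin

lemma sides_iff: "s \<in> sides n \<longleftrightarrow> (\<exists>x. s = dg x (x + 1))"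
proof -
  have p: "pt (x + 1) = (pt x + 1) mod (3 * n + 3)" for x
  proof -
    have "int ((pt x + 1) mod (3 * n + 3)) = (x mod (3 * M) + 1) mod (3 * M)"
      unfolding zmod_int n_M(1) unfolding of_nat_add int_pt by simp
    also have "\<dots> = int (pt (x + 1))" unfolding int_pt by (simp only: mod_add_left_eq)
    finally show ?thesis by linarith
  qed
  show ?thesis
  proof
    assume "s \<in> sides n"
    then obtain a where a: "s = {a, (a + 1) mod (3 * n + 3)}" "a < 3 * n + 3" unfolding sides_def by blast
    hence "s = dg (int a) (int a + 1)" unfolding dg_def p by (simp add: pt_of_nat)
    thus "\<exists>x. s = dg x (x + 1)" ..
  next
    assume "\<exists>x. s = dg x (x + 1)"
    thus "s \<in> sides n" unfolding sides_def dg_def p using pt_lt by blast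
  qed
qed

lemma dg_side_iff:
  assumes "x < y" "y < x + 3 * M"
  shows "dg x y \<in> sides n \<longleftrightarrow> y = x + 1 \<or> y = x + 3 * M - 1"
proof
  assume "dg x y \<in> sides n"
  then obtain z where "dg x y = dg z (z + 1)" unfolding sides_iff by blast
  then obtain k where "z = x + k * (3 * M) \<and> z + 1 = y + k * (3 * M) \<or>
      z = y + k * (3 * M) \<and> z + 1 = x + (k + 1) * (3 * M)"
    using dg_eq_iff[OF assms, of z "z + 1"] M3 by auto
  thus "y = x + 1 \<or> y = x + 3 * M - 1" by (auto simp: distrib_right)
next
  assume "y = x + 1 \<or> y = x + 3 * M - 1"
  moreover have "dg (x + 3 * M - 1) (x + 3 * M - 1 + 1) = dg x (x + 3 * M - 1)"
    using dg_flip[of "x + 3 * M - 1" x] by simp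
  ultimately show "dg x y \<in> sides n" unfolding sides_iff by metis
qed

lemma diagonal_iff:
  assumes "x < y" "y < x + 3 * M"
  shows "dg x y \<in> diagonals n \<longleftrightarrow> x + 2 <= y \<and> y <= x + 3 * M - 2"
proof -
  have "pt x ~= pt y" using pt_window[OF assms] by auto
  hence "dg x y \<subseteq> {..<3 * n + 3} \<and> card (dg x y) = 2" using pt_lt by (simp add: dg_def)
  hence "dg x y \<in> diagonals n \<longleftrightarrow> dg x y \<notin> sides n" unfolding diagonals_def by blast
  also have "\<dots> \<longleftrightarrow> x + 2 <= y \<and> y <= x + 3 * M - 2"
    unfolding dg_side_iff[OF assms] using assms by linarith
  finally show ?thesis .
qed

lemma ex_short:
  assumes "x < y" "y < x + 3 * M" "y <= x + M \<or> x + 2 * M <= y"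
  shows "\<exists>x' y'. short x' y' \<and> dg x' y' = dg x y"
proof (cases "y <= x + M")
  case True
  thus ?thesis using assms by (auto simp: short_def)
next
  case False
  thus ?thesis using assms dg_flip[of y x] by (intro exI[of _ y] exI[of _ "x + 3 * M"]) (auto simp: short_def)
qed

lemma arcs_iff: "i \<in> arcs n \<longleftrightarrow> (\<exists>x y. short x y \<and> x + 2 <= y \<and> i = arc x y)"
proof
  assume "i \<in> arcs n"
  then obtain d where d: "i = orbit n d" "d \<in> diagonals n" "\<forall>s \<in> orbit n d. \<forall>t \<in> orbit n d. \<not> crosses s t"
    unfolding arcs_def by blast
  hence "card d = 2" "d \<subseteq> {..<3 * n + 3}" unfolding diagonals_def by auto
  then obtain p q where pq: "d = {p, q}" "p < q" "q < 3 * n + 3"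
    unfolding card_2_iff by (metis insert_commute insert_subset lessThan_iff linorder_neqE_nat)
  define x y where "x = int p" and "y = int q"
  have xy: "x < y" "y < x + 3 * M" using pq n_M(1) by (simp_all add: x_def y_def)
  have dxy: "d = dg x y" using pq by (simp add: dg_def x_def y_def pt_of_nat)
  have l: "x + 2 <= y" "y <= x + 3 * M - 2" using d(2) unfolding dxy diagonal_iff[OF xy] by auto
  have "y <= x + M \<or> x + 2 * M <= y"
  proof (rule ccontr)
    assume "\<not> ?thesis"
    hence "x < x + M \<and> x + M < y \<and> y < y + M \<and> y + M < x + 3 * M" using M3 by linarith
    hence "crosses (dg x y) (dg (x + M) (y + M))" unfolding crosses_dg_dg[OF xy] by blast
    moreover have "dg x y \<in> orbit n d" "dg (x + M) (y + M) \<in> orbit n d"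
      using dg_self_in_arc[of x y] dg_in_arc[of x 1 y] unfolding arc_def dxy by simp_all
    ultimately show False using d(3) by blast
  qed
  then obtain x' y' where "short x' y'" "dg x' y' = dg x y" using ex_short[OF xy] by blast
  moreover from this have "x' + 2 <= y'"
    using d(2) diagonal_iff[of x' y'] shortD[of x' y'] dxy by simp
  ultimately show "\<exists>x y. short x y \<and> x + 2 <= y \<and> i = arc x y" using d(1) dxy unfolding arc_def by metis
next
  assume "\<exists>x y. short x y \<and> x + 2 <= y \<and> i = arc x y"
  then obtain x y where xy: "short x y" "x + 2 <= y" "i = arc x y" by blast
  have "dg x y \<in> diagonals n" using xy shortD[OF xy(1)] M3 by (simp add: diagonal_iff short_def)
  moreover have "compatible i i"
    unfolding xy(3) compatible_iff[OF xy(1) xy(1)]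
  proof
    fix k
    have "\<not> (0 < k * M \<and> k * M < M)" "\<not> (k * M < 0 \<and> - M < k * M)"
      using multiple_window(2,4)[of M k] multiple_window(1)[of M k] multiple_window(4)[of M "- k"] M3 by auto
    thus "\<not> interlaced x y (x + k * M) (y + k * M)"
      using xy(1) unfolding interlaced_def short_def by linarith
  qed
  ultimately show "i \<in> arcs n" unfolding arcs_def compatible_def xy(3) arc_def by blast
qed

lemma short_shift: "short (x + k * M) (y + k * M) \<longleftrightarrow> short x y" by (simp add: short_def)

lemma arc_eq_iff_flip:
  assumes "x < y" "y < x + 3 * M" "x' < y'" "y' < x' + 3 * M"
  shows "arc x y = arc x' y' \<longleftrightarrow> (\<exists>k. x' = x + k * M \<and> y' = y + k * M \<or>
      x' = y + k * M \<and> y' = x + (k + 3) * M)"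
proof
  assume "arc x y = arc x' y'"
  hence "dg x' y' \<in> arc x y" using dg_self_in_arc by simp
  then obtain k where k: "dg (x + k * M) (y + k * M) = dg x' y'" unfolding arc_eq_set by auto
  obtain i where i: "x' = x + k * M + i * (3 * M) \<and> y' = y + k * M + i * (3 * M) \<or>
      x' = y + k * M + i * (3 * M) \<and> y' = x + k * M + (i + 1) * (3 * M)"
    using k dg_eq_iff[of "x + k * M" "y + k * M" x' y'] assms by auto
  thus "\<exists>k. x' = x + k * M \<and> y' = y + k * M \<or> x' = y + k * M \<and> y' = x + (k + 3) * M"
    by (intro exI[of _ "k + 3 * i"]) (auto simp: algebra_simps)
next
  assume "\<exists>k. x' = x + k * M \<and> y' = y + k * M \<or> x' = y + k * M \<and> y' = x + (k + 3) * M"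
  then obtain k where "x' = x + k * M \<and> y' = y + k * M \<or> x' = y + k * M \<and> y' = x + (k + 3) * M" ..
  moreover have "x + (k + 3) * M = (x + 3 * M) + k * M" by (simp add: algebra_simps)
  ultimately show "arc x y = arc x' y'" using arc_shift arc_flip by metis
qed

definition edge :: "arc set => int => int => bool" where
  "edge \<tau> x y \<longleftrightarrow> short x y \<and> (y = x + 1 \<or> arc x y \<in> \<tau>)"

lemma periodic_triangulation_edge:
  assumes "is_triangulation n \<tau>"
  shows "periodic_triangulation M (edge \<tau>)"
proof
  show "M \<ge> 3" by (rule M3)
  show "x < y \<and> y <= x + M" if "edge \<tau> x y" for x y using that by (simp add: edge_def short_def)
  show "edge \<tau> x (x + 1)" for x using M3 by (simp add: edge_def short_def)
  show "edge \<tau> (x + k * M) (y + k * M)" if "edge \<tau> x y" for x y k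
    using that by (simp add: edge_def short_shift arc_shift)
  fix x y x' y'
  assume e: "edge \<tau> x y" "edge \<tau> x' y'"
  show "\<not> (x < x' \<and> x' < y \<and> y < y')"
  proof
    assume *: "x < x' \<and> x' < y \<and> y < y'"
    have 1: "short x y" "short x' y'" "arc x y \<in> \<tau>" "arc x' y' \<in> \<tau>" using e * by (auto simp: edge_def)
    hence "compatible (arc x y) (arc x' y')" using assms unfolding is_triangulation_def by blast
    hence "\<not> interlaced x y (x' + 0 * M) (y' + 0 * M)" unfolding compatible_iff[OF 1(1,2)] ..
    thus False using * by (simp add: interlaced_def)
  qed
next
  fix x y
  assume xy: "x + 2 <= y" "y <= x + M"
    and no: "\<And>c d. edge \<tau> c d ==> \<not> (x < c \<and> c < y \<and> y < d) \<and> \<not> (c < x \<and> x < d \<and> d < y)"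
  have s: "short x y" using xy by (simp add: short_def)
  have i: "arc x y \<in> arcs n" unfolding arcs_iff using s xy by blast
  have "compatible (arc x y) j" if j: "j \<in> \<tau>" for j
  proof -
    have "j \<in> arcs n" using j assms unfolding is_triangulation_def by blast
    then obtain c d where cd: "short c d" "j = arc c d" unfolding arcs_iff by blast
    have "edge \<tau> (c + k * M) (d + k * M)" for k
      using j cd by (simp add: edge_def short_shift arc_shift)
    thus ?thesis unfolding cd(2) compatible_iff[OF s cd(1)] interlaced_def using no by blast
  qed
  hence "arc x y \<in> \<tau>" using i assms unfolding is_triangulation_def by blast
  thus "edge \<tau> x y" using s by (simp add: edge_def)
qed

end

section \<open>Chords, triangles and arrows of the lifted triangulation\<close>

locale orbifold_triangulation = orbifold +
  fixes \<tau> :: "arc set"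
  assumes triangulation: "is_triangulation n \<tau>"
begin

sublocale periodic_triangulation M "edge \<tau>"
  by (rule periodic_triangulation_edge[OF triangulation])

lemma finite_triangulation: "finite \<tau>"
proof (rule finite_subset)
  show "\<tau> \<subseteq> Pow (Pow {..<3 * n + 3})"
  proof
    fix i assume "i \<in> \<tau>"
    hence "i \<in> arcs n" using triangulation unfolding is_triangulation_def by blast
    then obtain x y where i: "i = arc x y" unfolding arcs_iff by blast
    show "i \<in> Pow (Pow {..<3 * n + 3})" unfolding i arc_eq_set dg_def using pt_lt by auto
  qed
qed simp

lemma D_short: "D x y ==> y <= x + M \<or> x + 2 * M <= y"
  using E_len[of x y] E_len[of y "x + 3 * M"] unfolding D_def by linarith

lemma arc_mem_iff:
  assumes "x < y" "y < x + 3 * M"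
  shows "arc x y \<in> \<tau> \<longleftrightarrow> D x y \<and> x + 2 <= y \<and> y <= x + 3 * M - 2"
proof
  assume t: "arc x y \<in> \<tau>"
  hence "arc x y \<in> arcs n" using triangulation unfolding is_triangulation_def by blast
  then obtain c d where cd: "short c d" "c + 2 <= d" "arc x y = arc c d" unfolding arcs_iff by blast
  obtain k where "c = x + k * M \<and> d = y + k * M \<or> c = y + k * M \<and> d = x + (k + 3) * M"
    using arc_eq_iff_flip[OF assms, of c d] cd shortD[OF cd(1)] by blast
  thus "D x y \<and> x + 2 <= y \<and> y <= x + 3 * M - 2"
  proof
    assume *: "c = x + k * M \<and> d = y + k * M"
    hence "edge \<tau> x y" using cd t by (simp add: edge_def short_shift)
    thus ?thesis using * cd M3 by (auto simp: D_def short_def)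
  next
    assume *: "c = y + k * M \<and> d = x + (k + 3) * M"
    hence **: "d = (x + 3 * M) + k * M" by (simp add: algebra_simps)
    have "short (y + k * M) (x + 3 * M + k * M)" using cd(1) unfolding conjunct1[OF *] ** .
    hence "edge \<tau> y (x + 3 * M)" unfolding short_shift using t arc_flip[of y x] by (simp add: edge_def)
    thus ?thesis using * ** cd M3 by (auto simp: D_def short_def)
  qed
next
  assume "D x y \<and> x + 2 <= y \<and> y <= x + 3 * M - 2"
  thus "arc x y \<in> \<tau>" using arc_flip[of y x] unfolding D_def edge_def by auto
qed

lemma dg_mem_iff:
  assumes "x < y" "y < x + 3 * M"
  shows "dg x y \<in> \<Union>\<tau> \<longleftrightarrow> arc x y \<in> \<tau>"
proof
  assume "dg x y \<in> \<Union>\<tau>"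
  then obtain i where i: "i \<in> \<tau>" "dg x y \<in> i" by blast
  hence "i \<in> arcs n" using triangulation unfolding is_triangulation_def by blast
  then obtain c d where "i = arc c d" unfolding arcs_iff by blast
  thus "arc x y \<in> \<tau>" using i arc_of_member by metis
next
  assume "arc x y \<in> \<tau>"
  thus "dg x y \<in> \<Union>\<tau>" using dg_self_in_arc by blast
qed

lemma ex_dg: "s \<in> \<Union>\<tau> \<union> sides n ==> \<exists>x y. x < y \<and> y < x + 3 * M \<and> s = dg x y"
proof -
  assume "s \<in> \<Union>\<tau> \<union> sides n"
  thus ?thesis
  proof
    assume "s \<in> \<Union>\<tau>"
    then obtain i where i: "i \<in> \<tau>" "s \<in> i" by blast
    hence "i \<in> arcs n" using triangulation unfolding is_triangulation_def by blast
    then obtain c d where cd: "short c d" "i = arc c d" unfolding arcs_iff by blast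
    then obtain k where "s = dg (c + k * M) (d + k * M)" using i unfolding arc_eq_set by blast
    thus ?thesis using shortD[OF cd(1)] by (intro exI[of _ "c + k * M"] exI[of _ "d + k * M"]) auto
  next
    assume "s \<in> sides n"
    then obtain x where "s = dg x (x + 1)" unfolding sides_iff by blast
    thus ?thesis using M3 by (intro exI[of _ x] exI[of _ "x + 1"]) simp
  qed
qed

lemma dg_D_iff:
  assumes "x < y" "y < x + 3 * M"
  shows "dg x y \<in> \<Union>\<tau> \<union> sides n \<longleftrightarrow> D x y"
proof -
  have s: "D x (x + 1)" "D x (x + 3 * M - 1)"
    using D_side[of x] D_flip[of "x + 3 * M - 1" x] D_side[of "x + 3 * M - 1"] by auto
  show ?thesis
    using dg_side_iff s dg_mem_iff arc_mem_iff assms by auto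
qed

abbreviation proper :: "int => int => bool" where
  "proper x y \<equiv> x + 2 <= y \<and> y <= x + 3 * M - 2"

lemma dg_mem: "x < y ==> y < x + 3 * M ==> dg x y \<in> \<Union>\<tau> \<longleftrightarrow> D x y \<and> proper x y"
  using dg_mem_iff arc_mem_iff by blast

lemma ccw_triangle_iff:
  "ccw_triangle n \<tau> a b c \<longleftrightarrow> (\<exists>x y z. x < y \<and> y < z \<and> z < x + 3 * M \<and> a = pt x \<and> b = pt y \<and> c = pt z \<and>
     D x y \<and> D y z \<and> D x z)"
proof
  assume t: "ccw_triangle n \<tau> a b c"
  hence s: "{a, b} \<in> \<Union>\<tau> \<union> sides n" "{b, c} \<in> \<Union>\<tau> \<union> sides n" "{c, a} \<in> \<Union>\<tau> \<union> sides n"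
    unfolding ccw_triangle_def by auto
  have lt: "p < 3 * n + 3" if "s \<in> \<Union>\<tau> \<union> sides n" "p \<in> s" for p s
    using ex_dg[OF that(1)] that(2) pt_lt by (auto simp: dg_def)
  have l: "a < 3 * n + 3" "b < 3 * n + 3" "c < 3 * n + 3" using lt[OF s(1)] lt[OF s(2)] by auto
  have a: "a = pt (int a)" using l pt_of_nat by simp
  have "cyc (pt (int a)) b c" using t a unfolding ccw_triangle_def cyc_def by simp
  then obtain y z where yz: "int a < y" "y < z" "z < int a + 3 * M" "pt y = b" "pt z = c"
    using cyc_lift[of "int a" b c] l by blast
  have "dg (int a) y \<in> \<Union>\<tau> \<union> sides n" "dg y z \<in> \<Union>\<tau> \<union> sides n" "dg (int a) z \<in> \<Union>\<tau> \<union> sides n"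
    using s yz a by (simp_all add: dg_def insert_commute)
  hence "D (int a) y" "D y z" "D (int a) z" using dg_D_iff yz by simp_all
  thus "\<exists>x y z. x < y \<and> y < z \<and> z < x + 3 * M \<and> a = pt x \<and> b = pt y \<and> c = pt z \<and> D x y \<and> D y z \<and> D x z"
    using yz a by blast
next
  assume "\<exists>x y z. x < y \<and> y < z \<and> z < x + 3 * M \<and> a = pt x \<and> b = pt y \<and> c = pt z \<and> D x y \<and> D y z \<and> D x z"
  then obtain x y z where xyz: "x < y" "y < z" "z < x + 3 * M" "a = pt x" "b = pt y" "c = pt z" "D x y" "D y z" "D x z"
    by blast
  have "cyc a b c" using cyc_lift[of x b c] xyz by blast
  moreover have "dg x y \<in> \<Union>\<tau> \<union> sides n" "dg y z \<in> \<Union>\<tau> \<union> sides n" "dg x z \<in> \<Union>\<tau> \<union> sides n"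
    using dg_D_iff[of x y] dg_D_iff[of y z] dg_D_iff[of x z] xyz by simp_all
  ultimately show "ccw_triangle n \<tau> a b c"
    unfolding ccw_triangle_def cyc_def xyz dg_def by (simp add: insert_commute)
qed

text \<open>Orienting the source so that the triangle of the arrow lies on its inner side makes the
  third vertex a function of the chord; source and target share the endpoint
  \<open>a\<close>.\<close>

lemma lifted_arrows_iff:
  "(s, t) \<in> lifted_arrows n \<tau> \<longleftrightarrow> (\<exists>b a. D b a \<and> proper b a \<and> apx b a + 2 <= a \<and>
     s = dg b a \<and> t = dg (apx b a) a)"
proof
  assume "(s, t) \<in> lifted_arrows n \<tau>"
  then obtain p q r where pqr: "s = {q, r}" "t = {p, q}" "ccw_triangle n \<tau> p q r" "{q, r} \<in> \<Union>\<tau>" "{p, q} \<in> \<Union>\<tau>"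
    unfolding lifted_arrows_def by blast
  then obtain x y z where xyz: "x < y" "y < z" "z < x + 3 * M" "p = pt x" "q = pt y" "r = pt z" "D x y" "D y z" "D x z"
    unfolding ccw_triangle_iff by blast
  \<comment> \<open>Starting at \<open>z\<close> puts the triangle on the inner side of the source
    chord, whose other end then becomes \<open>y + 3 * M\<close>.\<close>
  have D: "D z (y + 3 * M)" "D z (x + 3 * M)" "D (x + 3 * M) (y + 3 * M)"
    using D_flip D_shift[of x 3 y] xyz by auto
  have ap: "apx z (y + 3 * M) = x + 3 * M" by (rule apx_eq) (use D xyz in auto)
  have "dg y z \<in> \<Union>\<tau>" "dg x y \<in> \<Union>\<tau>" using pqr xyz by (simp_all add: dg_def)
  hence pr: "proper y z" "proper x y" using dg_mem[of y z] dg_mem[of x y] xyz by auto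
  have "s = dg z (y + 3 * M)" "t = dg (x + 3 * M) (y + 3 * M)"
    using pqr xyz dg_flip[of z y] dg_shift[of x 1 y] by (simp_all add: dg_def)
  thus "\<exists>b a. D b a \<and> proper b a \<and> apx b a + 2 <= a \<and> s = dg b a \<and> t = dg (apx b a) a"
    using pr D(1) ap by (intro exI[of _ z] exI[of _ "y + 3 * M"]) auto
next
  assume "\<exists>b a. D b a \<and> proper b a \<and> apx b a + 2 <= a \<and> s = dg b a \<and> t = dg (apx b a) a"
  then obtain b a where ba: "D b a" "proper b a" "apx b a + 2 <= a" "s = dg b a" "t = dg (apx b a) a" by blast
  define z where "z = apx b a"
  have z: "b < z" "z < a" "D b z" "D z a" using apx[OF ba(1)] ba(2) by (auto simp: z_def)
  have D: "D z a" "D a (b + 3 * M)" "D z (b + 3 * M)" using z ba(1) D_flip by auto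
  have "ccw_triangle n \<tau> (pt z) (pt a) (pt (b + 3 * M))"
    unfolding ccw_triangle_iff using D z D_len[OF ba(1)] by (intro exI[of _ z] exI[of _ a] exI[of _ "b + 3 * M"]) auto
  moreover have "dg a (b + 3 * M) \<in> \<Union>\<tau>" "dg z a \<in> \<Union>\<tau>"
    using ba D z dg_mem[of a "b + 3 * M"] dg_mem[of z a] D_len[OF ba(1)] by (auto simp: z_def)
  ultimately show "(s, t) \<in> lifted_arrows n \<tau>"
    unfolding lifted_arrows_def ba(4,5) z_def[symmetric] dg_flip[of a b, symmetric]
    unfolding dg_def by blast
qed

end

context orbifold
begin

lemma pt_neq: "x < y ==> y < x + 3 * M ==> pt x ~= pt y"
  using pt_window by fastforce

lemma pt_3: "pt (x + 3 * M) = pt x" "pt (x + 6 * M) = pt x"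
  using pt_shift[of x 1] pt_shift[of x 2] by simp_all

lemma arrow_orbit_dg: "arrow_orbit n (dg x y) (dg x' y') =
    {(dg (x + k * M) (y + k * M), dg (x' + k * M) (y' + k * M)) | k. True}"
proof (intro equalityI subsetI)
  fix p assume "p \<in> arrow_orbit n (dg x y) (dg x' y')"
  thus "p \<in> {(dg (x + k * M) (y + k * M), dg (x' + k * M) (y' + k * M)) | k. True}"
    unfolding arrow_orbit_def rot_dg by blast
next
  fix p assume "p \<in> {(dg (x + k * M) (y + k * M), dg (x' + k * M) (y' + k * M)) | k. True}"
  then obtain k where k: "p = (dg (x + k * M) (y + k * M), dg (x' + k * M) (y' + k * M))" by blast
  obtain j i where ji: "j < 3" "k = int j + i * 3" using shift_mod3 by blast
  have e: "v + k * M = v + int j * M + i * (3 * M)" for v using ji(2) by (simp add: algebra_simps)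
  have "p = (dg (x + int j * M) (y + int j * M), dg (x' + int j * M) (y' + int j * M))"
    unfolding k e dg_shift ..
  thus "p \<in> arrow_orbit n (dg x y) (dg x' y')" unfolding arrow_orbit_def rot_dg using ji(1) by blast
qed

text \<open>A rotation that maps a chord to itself with its endpoints exchanged would be a half
  turn, and rotations by multiples of a third of a turn contain none.\<close>

lemma dg_rot_free:
  assumes "x < y" "y < x + 3 * M" "dg (x + k * M) (y + k * M) = dg (x + l * M) (y + l * M)"
  shows "\<exists>i. l = k + 3 * i"
proof -
  have "\<exists>i. x + l * M = x + k * M + i * (3 * M) \<and> y + l * M = y + k * M + i * (3 * M) \<or>
      x + l * M = y + k * M + i * (3 * M) \<and> y + l * M = x + k * M + (i + 1) * (3 * M)"
    using dg_eq_iff[of "x + k * M" "y + k * M" "x + l * M" "y + l * M"] assms by simp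
  then obtain i where i: "x + l * M = x + k * M + i * (3 * M) \<and> y + l * M = y + k * M + i * (3 * M) \<or>
      x + l * M = y + k * M + i * (3 * M) \<and> y + l * M = x + k * M + (i + 1) * (3 * M)" by blast
  have M0: "M ~= 0" using M3 by simp
  from i show ?thesis
  proof
    assume "x + l * M = x + k * M + i * (3 * M) \<and> y + l * M = y + k * M + i * (3 * M)"
    hence "l * M = (k + 3 * i) * M" by (simp add: algebra_simps)
    thus ?thesis using M0 by auto
  next
    assume *: "x + l * M = y + k * M + i * (3 * M) \<and> y + l * M = x + k * M + (i + 1) * (3 * M)"
    \<comment> \<open>Adding the two equations eliminates x and y and leaves a contradiction modulo
      2.\<close>
    have "(2 * l) * M = (x + l * M) + (y + l * M) - x - y" by (simp add: algebra_simps)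
    also have "\<dots> = (2 * k + 6 * i + 3) * M" unfolding conjunct1[OF *] conjunct2[OF *] by (simp add: algebra_simps)
    finally have "2 * l = 2 * k + 6 * i + 3" using M0 by simp
    thus ?thesis by presburger
  qed
qed

lemma dg_rot_mult:
  assumes "l = k + 3 * i" 
  shows "dg (x + l * M) (y + l * M) = dg (x + k * M) (y + k * M)"
proof -
  have e: "v + l * M = v + k * M + i * (3 * M)" for v using assms by (simp add: algebra_simps)
  show ?thesis unfolding e dg_shift ..
qed

end

context orbifold_triangulation
begin

definition arw :: "int => int => arrow" where
  "arw b a = arrow_orbit n (dg b a) (dg (apx b a) a)"

text \<open>The oriented edges that are sources of an arrow inside the triangle on their inner side.\<close>
definition half :: "int => int => bool" where
  "half b a \<longleftrightarrow> D b a \<and> proper b a \<and> apx b a + 2 <= a"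

lemma halfD:
  assumes "half b a"
  shows "D b a" "b < a" "a < b + 3 * M" "proper b a" "b < apx b a" "apx b a + 2 <= a" "D b (apx b a)" "D (apx b a) a"
  using assms apx[of b a] M3 unfolding half_def by auto

lemma half_shift: "half b a ==> half (b + k * M) (a + k * M)"
  using D_shift[of b k a] apx_shift[of b a k] unfolding half_def by simp

lemma arw_set: "arw b a = {(dg (b + k * M) (a + k * M), dg (apx b a + k * M) (a + k * M)) | k. True}"
  unfolding arw_def by (rule arrow_orbit_dg)

lemma arw_shift: "half b a ==> arw (b + k * M) (a + k * M) = arw b a"
proof -
  assume h: "half b a"
  have a: "apx (b + k * M) (a + k * M) = apx b a + k * M" by (rule apx_shift) (use halfD[OF h] in auto)
  have s: "v + k * M + l * M = v + (k + l) * M" for v l by (simp add: algebra_simps)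
  show ?thesis unfolding arw_set a s
  proof (intro equalityI subsetI)
    fix p assume "p \<in> {(dg (b + k * M) (a + k * M), dg (apx b a + k * M) (a + k * M)) | k. True}"
    then obtain l where "p = (dg (b + l * M) (a + l * M), dg (apx b a + l * M) (a + l * M))" by blast
    hence "p = (dg (b + (k + (l - k)) * M) (a + (k + (l - k)) * M), dg (apx b a + (k + (l - k)) * M) (a + (k + (l - k)) * M))"
      by simp
    thus "p \<in> {(dg (b + (k + l) * M) (a + (k + l) * M), dg (apx b a + (k + l) * M) (a + (k + l) * M)) | l. True}"
      by blast
  qed blast
qed

lemma arrs_eq: "quiver_arrows n \<tau> = {arw b a | b a. half b a}"
  unfolding quiver_arrows_def lifted_arrows_iff half_def arw_def by blast

lemma src_arw: "fst ` arw b a = arc b a" and tgt_arw: "snd ` arw b a = arc (apx b a) a"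
  unfolding arw_set arc_eq_set by (auto simp: image_iff)

lemma arw_functional:
  assumes h: "half b a" and "(s, t) \<in> arw b a" "(s', t') \<in> arw b a"
  shows "s = s' \<longleftrightarrow> t = t'"
proof -
  obtain k where k: "s = dg (b + k * M) (a + k * M)" "t = dg (apx b a + k * M) (a + k * M)"
    using assms(2) unfolding arw_set by blast
  obtain l where l: "s' = dg (b + l * M) (a + l * M)" "t' = dg (apx b a + l * M) (a + l * M)"
    using assms(3) unfolding arw_set by blast
  have z: "apx b a < a" "a < apx b a + 3 * M" using halfD[OF h] by auto
  show ?thesis
  by (metis dg_rot_free halfD k l dg_rot_mult z assms)
qed

lemma half_unique:
  assumes h: "half b a" "half b' a'" and e: "dg b a = dg b' a'" "dg (apx b a) a = dg (apx b' a') a'"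
  shows "\<exists>k. b' = b + k * M \<and> a' = a + k * M"
proof -
  obtain k where k: "b' = b + k * (3 * M) \<and> a' = a + k * (3 * M) \<or>
      b' = a + k * (3 * M) \<and> a' = b + (k + 1) * (3 * M)"
    using dg_eq_iff[OF halfD(2,3)[OF h(1)] halfD(2,3)[OF h(2)]] e(1) by blast
  thus ?thesis
  proof
    assume "b' = b + k * (3 * M) \<and> a' = a + k * (3 * M)"
    hence "b' = b + (3 * k) * M \<and> a' = a + (3 * k) * M" by (simp add: algebra_simps)
    thus ?thesis by blast
  next
    assume "b' = a + k * (3 * M) \<and> a' = b + (k + 1) * (3 * M)"
    hence "pt a' = pt b" by (simp only: pt_shift)
    hence "pt b \<in> dg (apx b a) a" unfolding e(2) by (simp add: dg_def)
    moreover have "pt b ~= pt a" "pt b ~= pt (apx b a)" using pt_neq halfD[OF h(1)] by auto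
    ultimately show ?thesis by (simp add: dg_def)
  qed
qed

lemma arw_eq:
  assumes h: "half b a" "half b' a'" and e: "arw b a = arw b' a'"
  shows "\<exists>k. b' = b + k * M \<and> a' = a + k * M"
proof -
  have "(dg (b' + 0 * M) (a' + 0 * M), dg (apx b' a' + 0 * M) (a' + 0 * M)) \<in> arw b' a'" unfolding arw_set by blast
  hence "(dg b' a', dg (apx b' a') a') \<in> arw b a" using e by simp
  then obtain k where k: "dg b' a' = dg (b + k * M) (a + k * M)" "dg (apx b' a') a' = dg (apx b a + k * M) (a + k * M)"
    unfolding arw_set by blast
  have "apx (b + k * M) (a + k * M) = apx b a + k * M" by (rule apx_shift) (use halfD[OF h(1)] in auto)
  then obtain l where "b' = b + k * M + l * M \<and> a' = a + k * M + l * M"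
    using half_unique[OF half_shift[OF h(1), of k] h(2)] k by auto
  hence "b' = b + (k + l) * M \<and> a' = a + (k + l) * M" by (simp add: algebra_simps)
  thus ?thesis by blast
qed

text \<open>All three sides of the triangle are arcs; the central triangle is included.\<close>

definition full :: "int => int => bool" where "full b a \<longleftrightarrow> half b a \<and> b + 2 <= apx b a"

lemma full_next:
  assumes "full b a"
  shows "full a (apx b a + 3 * M)" "apx a (apx b a + 3 * M) = b + 3 * M"
proof -
  have h: "half b a" "b + 2 <= apx b a" using assms by (auto simp: full_def)
  have D: "D a (apx b a + 3 * M)" "D a (b + 3 * M)" "D (b + 3 * M) (apx b a + 3 * M)"
    using halfD[OF h(1)] D_flip D_shift[of b 3 "apx b a"] by auto
  show ap: "apx a (apx b a + 3 * M) = b + 3 * M"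
    by (rule apx_eq) (use D halfD[OF h(1)] in auto)
  show "full a (apx b a + 3 * M)" unfolding full_def half_def ap
    using D halfD[OF h(1)] h(2) by auto
qed

text \<open>The following arrow in the same internal triangle. An arrow is an orbit, so a
  representative has to be chosen; \<open>arw_eq\<close> and invariance under shifts make the result
  independent of it.\<close>

definition nxt :: "arrow => arrow option" where
  "nxt A = (let p = (SOME p. half (fst p) (snd p) \<and> arw (fst p) (snd p) = A) in
     if full (fst p) (snd p) then Some (arw (snd p) (apx (fst p) (snd p) + 3 * M)) else None)"

lemma nxt_arw:
  assumes h: "half b a"
  shows "nxt (arw b a) = (if full b a then Some (arw a (apx b a + 3 * M)) else None)"
proof -
  define p where "p = (SOME p. half (fst p) (snd p) \<and> arw (fst p) (snd p) = arw b a)"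
  have "half (fst (b, a)) (snd (b, a)) \<and> arw (fst (b, a)) (snd (b, a)) = arw b a" using h by simp
  hence p: "half (fst p) (snd p)" "arw b a = arw (fst p) (snd p)"
    unfolding p_def by (metis (mono_tags, lifting) someI)+
  obtain k where k: "fst p = b + k * M" "snd p = a + k * M" using arw_eq[OF h p] by blast
  have ap: "apx (b + k * M) (a + k * M) = apx b a + k * M" by (rule apx_shift) (use halfD[OF h] in auto)
  have "full (fst p) (snd p) \<longleftrightarrow> full b a" using p(1) h unfolding full_def k ap by auto
  moreover have "arw (a + k * M) (apx b a + k * M + 3 * M) = arw a (apx b a + 3 * M)" if "full b a"
  proof -
    have e: "apx b a + k * M + 3 * M = apx b a + 3 * M + k * M" by simp
    show ?thesis unfolding e by (rule arw_shift) (use full_next[OF that] full_def in blast)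
  qed
  ultimately show ?thesis unfolding nxt_def p_def[symmetric] Let_def k ap by simp
qed

lemma nxt_SomeD:
  assumes "A \<in> quiver_arrows n \<tau>" "nxt A = Some B"
  shows "\<exists>b a. full b a \<and> A = arw b a \<and> B = arw a (apx b a + 3 * M)"
proof -
  obtain b a where ba: "half b a" "A = arw b a" using assms(1) unfolding arrs_eq by blast
  thus ?thesis using assms(2) nxt_arw[OF ba(1)] by (intro exI[of _ b] exI[of _ a]) (auto split: if_splits)
qed

lemma nxt_full: "full b a ==> nxt (arw b a) = Some (arw a (apx b a + 3 * M))"
  using nxt_arw full_def by simp

lemma full_arrs: "full b a ==> arw b a \<in> quiver_arrows n \<tau>"
  unfolding arrs_eq full_def by blast

lemma full_cycle:
  assumes f: "full b a"
  shows "nxt (arw a (apx b a + 3 * M)) = Some (arw (apx b a + 3 * M) (b + 6 * M))"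
    "full (apx b a + 3 * M) (b + 6 * M)" "nxt (arw (apx b a + 3 * M) (b + 6 * M)) = Some (arw b a)"
proof -
  have f1: "full a (apx b a + 3 * M)" and a1: "apx a (apx b a + 3 * M) = b + 3 * M" using full_next[OF f] by auto
  have 6: "b + 3 * M + 3 * M = b + 6 * M" by simp
  show "nxt (arw a (apx b a + 3 * M)) = Some (arw (apx b a + 3 * M) (b + 6 * M))"
    using nxt_full[OF f1] a1 6 by simp
  have f2: "full (apx b a + 3 * M) (b + 6 * M)" and a2: "apx (apx b a + 3 * M) (b + 6 * M) = a + 3 * M"
    using full_next[OF f1] unfolding a1 6 by auto
  from f2 show "full (apx b a + 3 * M) (b + 6 * M)" .
  have "arw (b + 6 * M) (a + 6 * M) = arw b a" using arw_shift[of b a 6] f by (simp add: full_def)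
  thus "nxt (arw (apx b a + 3 * M) (b + 6 * M)) = Some (arw b a)"
    using nxt_full[OF f2] a2 by (simp add: add.assoc)
qed

text \<open>If two sides of a triangle lie in one orbit, the triangle is central: the inequalities
  between its vertices leave only the shift k = -1.\<close>

lemma loop_half:
  assumes h: "half b a" and e: "arc b a = arc (apx b a) a"
  shows "apx b a = b + M" "a = b + 2 * M"
proof -
  define z where "z = apx b a"
  have z: "b < z" "z < a" "a < z + 3 * M" using halfD[OF h] by (auto simp: z_def)
  obtain k where k: "z = b + k * M \<and> a = a + k * M \<or> z = a + k * M \<and> a = b + (k + 3) * M"
    using arc_eq_iff_flip[OF halfD(2,3)[OF h] z(2,3)] e unfolding z_def by blast
  have *: "z = a + k * M" "a = b + (k + 3) * M" using k z by auto
  have "k * M < 0" using * z by linarith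
  hence "k < 0" using M3 by (simp add: mult_less_0_iff)
  moreover have "z = b + (2 * k + 3) * M" using * by (simp add: algebra_simps)
  hence "0 < (2 * k + 3) * M" using z by linarith
  hence "0 < 2 * k + 3" using M3 by (simp add: zero_less_mult_iff)
  ultimately have "k = -1" by linarith
  thus "apx b a = b + M" "a = b + 2 * M" using * unfolding z_def[symmetric] by simp_all
qed

lemma loop_full:
  assumes h: "half b a" and e: "arc b a = arc (apx b a) a"
  shows "full b a" "nxt (arw b a) = Some (arw b a)"
proof -
  show f: "full b a" using h loop_half[OF h e] M3 by (simp add: full_def)
  have "arw (b + 2 * M) (a + 2 * M) = arw b a" by (rule arw_shift[OF h])
  moreover have "a = b + 2 * M" "apx b a + 3 * M = a + 2 * M" using loop_half[OF h e] by auto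
  ultimately show "nxt (arw b a) = Some (arw b a)" using nxt_full[OF f] by simp
qed

text \<open>The common shape of all words of the potential. The cube of the loop is the case in
  which the three arrows coincide.\<close>

definition chain3 :: "arrow list => bool" where
  "chain3 w \<longleftrightarrow> (\<exists>A B C. w = [A, B, C] \<and> {A, B, C} \<subseteq> quiver_arrows n \<tau> \<and>
     nxt A = Some B \<and> nxt B = Some C \<and> nxt C = Some A)"

lemma chain3_rotate: "chain3 w ==> chain3 (rotate k w)"
proof (induction k)
  case (Suc k)
  then obtain A B C where "rotate k w = [A, B, C] \<and> {A, B, C} \<subseteq> quiver_arrows n \<tau> \<and>
     nxt A = Some B \<and> nxt B = Some C \<and> nxt C = Some A" unfolding chain3_def by blast
  thus ?case unfolding chain3_def by (intro exI[of _ B] exI[of _ C] exI[of _ A]) simp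
qed simp

lemma chain3_triangle_cycle: "w \<in> triangle_cycles n \<tau> ==> chain3 w"
proof -
  assume "w \<in> triangle_cycles n \<tau>"
  then obtain p q r where w: "w = [arrow_orbit n {q, r} {p, q}, arrow_orbit n {p, q} {r, p}, arrow_orbit n {r, p} {q, r}]"
    "ccw_triangle n \<tau> p q r" "{{p, q}, {q, r}, {r, p}} \<subseteq> \<Union>\<tau>" unfolding triangle_cycles_def by blast
  obtain x y z where xyz: "x < y" "y < z" "z < x + 3 * M" "p = pt x" "q = pt y" "r = pt z" "D x y" "D y z" "D x z"
    using w(2) unfolding ccw_triangle_iff by blast
  have "dg x y \<in> \<Union>\<tau>" "dg y z \<in> \<Union>\<tau>" "dg x z \<in> \<Union>\<tau>"
    using w(3) unfolding xyz dg_def by (simp_all add: insert_commute)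
  hence pr: "proper x y" "proper y z" "proper x z" using dg_mem xyz by auto
  have D: "D z (y + 3 * M)" "D z (x + 3 * M)" "D (x + 3 * M) (y + 3 * M)"
    using D_flip D_shift[of x 3 y] xyz by auto
  have ap: "apx z (y + 3 * M) = x + 3 * M" by (rule apx_eq) (use D xyz in auto)
  have f: "full z (y + 3 * M)" unfolding full_def half_def ap using D pr by auto
  have f1: "full (y + 3 * M) (x + 6 * M)" "apx (y + 3 * M) (x + 6 * M) = z + 3 * M"
    using full_next[OF f] unfolding ap by (simp_all add: add.assoc)
  have f2: "full (x + 6 * M) (z + 6 * M)" "apx (x + 6 * M) (z + 6 * M) = y + 6 * M"
    using full_next[OF f1(1)] unfolding f1(2) by (simp_all add: add.assoc)
  have "arw z (y + 3 * M) = arrow_orbit n {q, r} {p, q}" "arw (y + 3 * M) (x + 6 * M) = arrow_orbit n {p, q} {r, p}"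
    "arw (x + 6 * M) (z + 6 * M) = arrow_orbit n {r, p} {q, r}"
    unfolding arw_def ap f1(2) f2(2) dg_def pt_3 xyz by (simp_all add: insert_commute)
  hence w': "w = [arw z (y + 3 * M), arw (y + 3 * M) (x + 6 * M), arw (x + 6 * M) (z + 6 * M)]" unfolding w(1) by simp
  have "x + 3 * M + 3 * M = x + 6 * M" by simp
  thus "chain3 w" unfolding chain3_def w'
    using full_arrs[OF f] full_arrs[OF f1(1)] full_arrs[OF f2(1)] nxt_full[OF f] full_cycle[OF f]
    unfolding ap \<open>x + 3 * M + 3 * M = x + 6 * M\<close> by simp
qed

lemma chain3_potential:
  assumes "w \<in> potential n \<tau>"
  shows "chain3 w"
proof -
  from assms consider w0 where "w0 \<in> triangle_cycles n \<tau>" "w = (SOME w. w \<in> {rotate k w0 | k. True})"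
    | \<epsilon> where "w = [\<epsilon>, \<epsilon>, \<epsilon>]" "\<epsilon> \<in> quiver_arrows n \<tau>" "fst ` \<epsilon> = snd ` \<epsilon>"
    unfolding potential_def by blast
  thus ?thesis
  proof cases
    case 1
    have "rotate 0 w0 \<in> {rotate k w0 | k. True}" by blast
    hence "w \<in> {rotate k w0 | k. True}" unfolding 1(2) by (rule someI)
    thus ?thesis using chain3_rotate[OF chain3_triangle_cycle[OF 1(1)]] by blast
  next
    case 2
    obtain b a where ba: "half b a" "\<epsilon> = arw b a" using 2(2) unfolding arrs_eq by blast
    have "nxt \<epsilon> = Some \<epsilon>" using loop_full(2)[OF ba(1)] 2(3) unfolding ba(2) src_arw tgt_arw .
    thus ?thesis using 2 unfolding chain3_def by simp
  qed
qed

text \<open>If a rotation preserved the triangle, the two nontrivial rotations of one side would be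
  sides too. They differ from it and from each other, and the side opposite \<open>b\<close> is
  excluded because it lies in another orbit; so one remaining side would have to serve for
  both.\<close>

lemma triangle_not_invariant:
  assumes h: "half b a" and ne: "arc b a ~= arc (apx b a) a"
  shows "rot n 1 ` {pt (apx b a), pt a, pt b} ~= {pt (apx b a), pt a, pt b}"
proof
  let ?S = "{pt (apx b a), pt a, pt b}" and ?d = "\<lambda>k. dg (b + k * M) (a + k * M)"
  assume inv: "rot n 1 ` ?S = ?S"
  have step: "?d (k + 1) \<subseteq> ?S" if "?d k \<subseteq> ?S" for k
  proof -
    have "?d (k + 1) = rot n 1 ` ?d k" unfolding rot_dg by (simp add: algebra_simps)
    thus ?thesis using image_mono[OF that, of "rot n 1"] inv by simp
  qed
  have "?d 0 \<subseteq> ?S" by (simp add: dg_def)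
  hence "?d 1 \<subseteq> ?S" "?d 2 \<subseteq> ?S" using step[of 0] step[of 1] by simp_all
  moreover have "pt (b + k * M) ~= pt (a + k * M)" for k using pt_neq halfD[OF h] by simp
  moreover have "?d k ~= dg (apx b a) a" for k
  proof
    assume "?d k = dg (apx b a) a"
    hence "dg (apx b a) a \<in> arc b a" using dg_in_arc[of b k a] by simp
    thus False using arc_of_member ne by metis
  qed
  moreover have "{p, q} = {x3, x2} \<or> {p, q} = {x3, x1}"
    if "{p, q} \<subseteq> {x1, x2, x3}" "p ~= q" "{p, q} ~= {x1, x2}" for p q x1 x2 x3 :: nat
    using that by auto
  ultimately have "?d k = dg b a \<or> ?d k = dg b (apx b a)" if "k = 1 \<or> k = 2" for k
    using that unfolding dg_def by metis
  moreover have free: "?d k ~= ?d l" if "\<not> 3 dvd l - k" for k l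
    using dg_rot_free[OF halfD(2,3)[OF h], of k l] that by auto
  have "?d 1 ~= ?d 2" "?d 1 ~= dg b a" "?d 2 ~= dg b a" using free[of 2 1] free[of 0 1] free[of 0 2] by auto
  ultimately show False by metis
qed

lemma full_in_potential:
  assumes f: "full b a"
  shows "\<exists>w\<in>potential n \<tau>. arw b a \<in> set w"
proof (cases "arc b a = arc (apx b a) a")
  case True
  hence "[arw b a, arw b a, arw b a] \<in> potential n \<tau>"
    unfolding potential_def using full_arrs[OF f] by (auto simp: src_arw tgt_arw)
  thus ?thesis by (intro bexI) simp_all
next
  case False
  have h: "half b a" using f by (simp add: full_def)
  define z where "z = apx b a"
  have z: "b < z" "z < a" "a < b + 3 * M" "D b z" "D z a" "D b a" "proper b a" "b + 2 <= z" "z + 2 <= a"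
    using halfD[OF h] f by (auto simp: z_def full_def)
  have D: "D a (b + 3 * M)" "D z (b + 3 * M)" using z D_flip by auto
  have t: "ccw_triangle n \<tau> (pt z) (pt a) (pt b)"
    unfolding ccw_triangle_iff using D z pt_3 by (intro exI[of _ z] exI[of _ a] exI[of _ "b + 3 * M"]) auto
  have "dg b a \<in> \<Union>\<tau>" "dg z a \<in> \<Union>\<tau>" "dg b z \<in> \<Union>\<tau>" using dg_mem z by auto
  hence s: "{{pt z, pt a}, {pt a, pt b}, {pt b, pt z}} \<subseteq> \<Union>\<tau>" by (simp add: dg_def insert_commute)
  define w where "w = [arrow_orbit n {pt a, pt b} {pt z, pt a}, arrow_orbit n {pt z, pt a} {pt b, pt z},
      arrow_orbit n {pt b, pt z} {pt a, pt b}]"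
  have "w \<in> triangle_cycles n \<tau>"
    unfolding w_def triangle_cycles_def using t s triangle_not_invariant[OF h False, folded z_def] by blast
  moreover have "arw b a \<in> set w" unfolding w_def arw_def z_def[symmetric] dg_def by (simp add: insert_commute)
  moreover define w' where "w' = (SOME v. v \<in> {rotate k w | k. True})"
  have "rotate 0 w \<in> {rotate k w | k. True}" by blast
  hence "w' \<in> {rotate k w | k. True}" unfolding w'_def by (rule someI)
  hence "set w' = set w" by auto
  moreover have "w' \<in> potential n \<tau>" if "w \<in> triangle_cycles n \<tau>" unfolding potential_def w'_def using that by blast
  ultimately show ?thesis by blast
qed

lemma finite_arrs: "finite (quiver_arrows n \<tau>)"
proof (rule finite_subset)
  show "quiver_arrows n \<tau> \<subseteq> Pow (Pow {..<3 * n + 3} \<times> Pow {..<3 * n + 3})"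
    unfolding arrs_eq arw_set dg_def using pt_lt by auto
qed simp

lemma finite_potential: "finite (potential n \<tau>)"
proof (rule finite_subset)
  show "potential n \<tau> \<subseteq> {w. set w \<subseteq> quiver_arrows n \<tau> \<and> length w = 3}"
    using chain3_potential unfolding chain3_def by fastforce
qed (rule finite_lists_length_eq[OF finite_arrs])

abbreviation Qv :: "(arc, arrow) qp" where "Qv \<equiv> surface_qp n \<tau>"

lemma Qv_simps: "verts Qv = \<tau>" "arrs Qv = quiver_arrows n \<tau>" "src Qv A = fst ` A" "tgt Qv A = snd ` A"
  "pot Qv = potential n \<tau>"
  by (simp_all add: surface_qp_def)

lemma nxt_arrs:
  assumes "A \<in> quiver_arrows n \<tau>" "nxt A = Some B"
  shows "B \<in> quiver_arrows n \<tau>" "fst ` B = snd ` A"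
  by (metis nxt_SomeD full_arrs full_next src_arw tgt_arw arc_flip assms)+

lemma nxt_cycle:
  assumes "A \<in> quiver_arrows n \<tau>" "nxt A = Some B"
  shows "\<exists>C\<in>quiver_arrows n \<tau>. nxt B = Some C \<and> nxt C = Some A"
  using nxt_SomeD[OF assms] full_cycle full_arrs by blast

text \<open>Every occurrence of \<open>C\<close> in the potential is followed cyclically by the same
  two arrows, so the derivative is the number of occurrences times one path. For the loop the three
  positions in its cube all count. Over the complex numbers this nonzero factor does not change the
  relation.\<close>

lemma cyclic_deriv_nxt:
  fixes N :: "(arc, arrow) rep"
  assumes C: "C \<in> quiver_arrows n \<tau>" and i: "i < rdim N"
  shows "nxt C = None ==> cyclic_deriv_ent Qv N C i k = 0"
    and "nxt C = Some A ==> nxt A = Some B ==> \<exists>c. c ~= 0 \<and>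
      cyclic_deriv_ent Qv N C i k = c * (\<Sum>m<rdim N. ent N B i m * ent N A m k)"
proof -
  let ?P = "{(w, m). w \<in> potential n \<tau> \<and> m < length w \<and> w ! m = C}"
  have cd: "cyclic_deriv_ent Qv N C i k = (\<Sum>(w, m)\<in>?P. path_ent N (drop (Suc m) w @ take m w) i k)"
    by (simp only: cyclic_deriv_ent_def Qv_simps)
  have P: "\<exists>A B. nxt C = Some A \<and> nxt A = Some B \<and> m < 3 \<and> drop (Suc m) w @ take m w = [A, B]"
    if "(w, m) \<in> ?P" for w m
  proof -
    have "chain3 w" "m < length w" "w ! m = C" using that chain3_potential by auto
    then obtain X Y Z where w: "w = [X, Y, Z]" "nxt X = Some Y" "nxt Y = Some Z" "nxt Z = Some X"
      unfolding chain3_def by blast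
    hence "m = 0 \<or> m = 1 \<or> m = 2" using \<open>m < length w\<close> by auto
    thus ?thesis using w \<open>w ! m = C\<close> by auto
  qed
  show "cyclic_deriv_ent Qv N C i k = 0" if "nxt C = None"
  proof -
    have "?P = {}" using P that by fastforce
    thus ?thesis unfolding cd by (simp only: sum.empty)
  qed
  show "\<exists>c. c ~= 0 \<and> cyclic_deriv_ent Qv N C i k = c * (\<Sum>m<rdim N. ent N B i m * ent N A m k)"
    if nC: "nxt C = Some A" and nA: "nxt A = Some B"
  proof -
    have p: "path_ent N [A, B] i k = (\<Sum>m<rdim N. ent N B i m * ent N A m k)"
    proof -
      have "(\<Sum>l<rdim N. (if i = l then 1 else 0) * ent N B l m) = ent N B i m" for m
      proof -
        have "(\<Sum>l<rdim N. (if i = l then 1 else 0) * ent N B l m) = (\<Sum>l<rdim N. if i = l then ent N B l m else 0)"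
          by (rule sum.cong) auto
        thus ?thesis using i by simp
      qed
      thus ?thesis by simp
    qed
    have "cyclic_deriv_ent Qv N C i k = (\<Sum>(w, m)\<in>?P. path_ent N [A, B] i k)"
      unfolding cd by (rule sum.cong) (use P nC nA in fastforce)+
    also have "\<dots> = of_nat (card ?P) * path_ent N [A, B] i k" by (simp add: case_prod_unfold)
    finally have e: "cyclic_deriv_ent Qv N C i k = of_nat (card ?P) * (\<Sum>m<rdim N. ent N B i m * ent N A m k)"
      unfolding p .
    obtain b a where ba: "full b a" "C = arw b a" using nxt_SomeD[OF C nC] by blast
    obtain w m where "w \<in> potential n \<tau>" "m < length w" "w ! m = C"
      using full_in_potential[OF ba(1)] unfolding ba(2)[symmetric] in_set_conv_nth by blast
    hence "(w, m) \<in> ?P" by simp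
    moreover have "finite ?P"
      by (rule finite_subset[of _ "potential n \<tau> \<times> {..<3}"]) (use P finite_potential in fastforce)+
    ultimately have "card ?P ~= 0" by auto
    thus ?thesis using e by (intro exI[of _ "of_nat (card ?P)"]) simp
  qed
qed

lemma relations_nxt:
  fixes N :: "(arc, arrow) rep"
  shows "(\<forall>C\<in>arrs Qv. \<forall>i<rdim N. \<forall>k<rdim N. cyclic_deriv_ent Qv N C i k = 0) \<longleftrightarrow>
    (\<forall>A\<in>arrs Qv. \<forall>B. nxt A = Some B -->
       (\<forall>i<rdim N. \<forall>k<rdim N. (\<Sum>m<rdim N. ent N B i m * ent N A m k) = 0))"
  unfolding Qv_simps
proof (intro iffI ballI allI impI)
  fix A B i k
  assume 0: "\<forall>C\<in>quiver_arrows n \<tau>. \<forall>i<rdim N. \<forall>k<rdim N. cyclic_deriv_ent Qv N C i k = 0"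
    and A: "A \<in> quiver_arrows n \<tau>" "nxt A = Some B" and ik: "i < rdim N" "k < rdim N"
  obtain C where C: "C \<in> quiver_arrows n \<tau>" "nxt C = Some A" using nxt_cycle[OF A] by blast
  obtain c where "c ~= 0" "cyclic_deriv_ent Qv N C i k = c * (\<Sum>m<rdim N. ent N B i m * ent N A m k)"
    using cyclic_deriv_nxt(2)[OF C(1) ik(1) C(2) A(2)] by blast
  thus "(\<Sum>m<rdim N. ent N B i m * ent N A m k) = 0" using 0 C(1) ik by simp
next
  fix C i k
  assume 0: "\<forall>A\<in>quiver_arrows n \<tau>. \<forall>B. nxt A = Some B -->
       (\<forall>i<rdim N. \<forall>k<rdim N. (\<Sum>m<rdim N. ent N B i m * ent N A m k) = 0)"
    and C: "C \<in> quiver_arrows n \<tau>" and ik: "i < rdim N" "k < rdim N"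
  show "cyclic_deriv_ent Qv N C i k = 0"
  proof (cases "nxt C")
    case None
    thus ?thesis by (rule cyclic_deriv_nxt(1)[OF C ik(1)])
  next
    case (Some A)
    obtain B where B: "nxt A = Some B" using nxt_cycle[OF C Some] by blast
    have "A \<in> quiver_arrows n \<tau>" using nxt_arrs[OF C Some] by simp
    thus ?thesis using cyclic_deriv_nxt(2)[OF C ik(1) Some B, of k] 0 B ik by auto
  qed
qed

end

section \<open>Arc representations\<close>

lemma sorted_wrt_unique:
  assumes "\<And>x y. x \<in> set xs ==> y \<in> set xs ==> P x y ==> P y x ==> x = y"
    and "sorted_wrt P xs" "sorted_wrt P ys" "distinct xs" "distinct ys" "set xs = set ys"
  shows "xs = ys"
  using assms
proof (induction xs arbitrary: ys)
  case (Cons x xs)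
  obtain y ys' where ys: "ys = y # ys'" using Cons.prems(6) by (cases ys) auto
  have "x = y"
  proof (rule ccontr)
    assume "x ~= y"
    hence "y \<in> set xs" "x \<in> set ys'" using Cons.prems(6) unfolding ys by auto
    hence "P x y" "P y x" using Cons.prems(2,3) unfolding ys by auto
    thus False using Cons.prems(1)[of x y] \<open>y \<in> set xs\<close> \<open>x ~= y\<close> by simp
  qed
  moreover from this have "set xs = set ys'" using Cons.prems(4,5,6) unfolding ys by auto
  hence "xs = ys'" using Cons.prems unfolding ys by (intro Cons.IH) auto
  ultimately show ?case unfolding ys by simp
qed simp

lemma prod_two:
  fixes G :: "'x => 'r::comm_monoid_mult"
  assumes "S = (if c1 then {x} else {}) \<union> (if c2 then {y} else {})" "c1 ==> c2 ==> x ~= y"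
  shows "(\<Prod>A | A \<in> S \<and> P A. G A) = (if c1 \<and> P x then G x else 1) * (if c2 \<and> P y then G y else 1)"
proof -
  have "{A. A \<in> S \<and> P A} = (if c1 \<and> P x then {x} else {}) \<union> (if c2 \<and> P y then {y} else {})"
    unfolding assms(1) by (auto split: if_splits)
  thus ?thesis using assms(2) by (cases "c1 \<and> P x"; cases "c2 \<and> P y") (auto simp: mult.commute)
qed

context orbifold_triangulation
begin

lemma half_turn_neq: "(b :: int) + 3 * M = a + k * M ==> a = b + k * M ==> False"
proof -
  assume "b + 3 * M = a + k * M" "a = b + k * M"
  hence "(2 * k) * M = 3 * M" by (simp add: algebra_simps)
  moreover have "M ~= 0" using M3 by simp
  ultimately have "2 * k = 3" unfolding mult_cancel_right by blast
  thus False by presburger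
qed

text \<open>The triangle on each side of the chord holds at most one arrow leaving the arc. The two
  are distinct, since identifying them would again require a half turn.\<close>

lemma out_arrows:
  assumes D: "D b a" "proper b a"
  shows "{A. A \<in> quiver_arrows n \<tau> \<and> fst ` A = arc b a} =
      (if apx b a + 2 <= a then {arw b a} else {}) \<union> (if apx a (b + 3 * M) + 2 <= b + 3 * M then {arw a (b + 3 * M)} else {})"
    (is "?L = ?R")
    and "apx b a + 2 <= a ==> apx a (b + 3 * M) + 2 <= b + 3 * M ==> arw b a ~= arw a (b + 3 * M)"
proof -
  have D': "D a (b + 3 * M)" "proper a (b + 3 * M)" using D D_flip by auto
  have ba: "b < a" "a < b + 3 * M" using D_len[OF D(1)] by auto
  show "?L = ?R"
  proof (intro equalityI subsetI)
    fix A assume "A \<in> ?L"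
    then obtain b' a' where h: "half b' a'" "A = arw b' a'" "arc b' a' = arc b a" unfolding arrs_eq using src_arw by auto
    obtain k where k: "b = b' + k * M \<and> a = a' + k * M \<or> b = a' + k * M \<and> a = b' + (k + 3) * M"
      using arc_eq_iff_flip[OF halfD(2,3)[OF h(1)] ba] h(3) by blast
    from k show "A \<in> ?R"
    proof
      assume k: "b = b' + k * M \<and> a = a' + k * M"
      hence "half b a" "arw b a = A" using half_shift[OF h(1), of k] arw_shift[OF h(1), of k] h(2) by auto
      thus ?thesis using halfD by auto
    next
      assume k: "b = a' + k * M \<and> a = b' + (k + 3) * M"
      hence "a = b' + (k + 3) * M" "b + 3 * M = a' + (k + 3) * M" by (simp_all add: algebra_simps)
      hence "half a (b + 3 * M)" "arw a (b + 3 * M) = A"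
        using half_shift[OF h(1), of "k + 3"] arw_shift[OF h(1), of "k + 3"] h(2) by auto
      thus ?thesis using halfD by auto
    qed
  next
    fix A assume A: "A \<in> ?R"
    have "A \<in> ?L" if "apx b a + 2 <= a" "A = arw b a"
    proof -
      have "half b a" using that D by (simp add: half_def)
      thus ?thesis unfolding that(2) mem_Collect_eq src_arw arrs_eq by blast
    qed
    moreover have "A \<in> ?L" if "apx a (b + 3 * M) + 2 <= b + 3 * M" "A = arw a (b + 3 * M)"
    proof -
      have "half a (b + 3 * M)" using that D' by (simp add: half_def)
      thus ?thesis unfolding that(2) mem_Collect_eq src_arw arrs_eq using arc_flip[of a b] by blast
    qed
    ultimately show "A \<in> ?L" using A by (auto split: if_splits)
  qed
  show "arw b a ~= arw a (b + 3 * M)" if c: "apx b a + 2 <= a" "apx a (b + 3 * M) + 2 <= b + 3 * M"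
    using arw_eq c D' half_def half_turn_neq assms by blast
qed

lemma in_half:
  assumes D: "D b a" "proper b a" and z: "b + 2 <= apx b a"
  shows "half (apx b a) (b + 3 * M)" "apx (apx b a) (b + 3 * M) = a"
    "fst ` arw (apx b a) (b + 3 * M) = arc b (apx b a)" "snd ` arw (apx b a) (b + 3 * M) = arc b a"
    "nxt (arw (apx b a) (b + 3 * M)) = (if apx b a + 2 <= a then Some (arw b a) else None)"
proof -
  have t: "b < apx b a" "apx b a < a" "D b (apx b a)" "D (apx b a) a" using apx[OF D(1)] D(2) by auto
  have D': "D (apx b a) (b + 3 * M)" "D a (b + 3 * M)" using t D D_flip by auto
  show ap: "apx (apx b a) (b + 3 * M) = a" by (rule apx_eq) (use D' t D_len[OF D(1)] in auto)
  show h: "half (apx b a) (b + 3 * M)" unfolding half_def ap using D D' t z by auto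
  show "fst ` arw (apx b a) (b + 3 * M) = arc b (apx b a)" unfolding src_arw by (rule arc_flip)
  show "snd ` arw (apx b a) (b + 3 * M) = arc b a" unfolding tgt_arw ap by (rule arc_flip)
  show "nxt (arw (apx b a) (b + 3 * M)) = (if apx b a + 2 <= a then Some (arw b a) else None)"
    using half_def arw_shift nxt_arw h ap full_def assms by simp
qed

lemma in_arrows:
  assumes D: "D b a" "proper b a"
  shows "{A. A \<in> quiver_arrows n \<tau> \<and> snd ` A = arc b a} =
      (if b + 2 <= apx b a then {arw (apx b a) (b + 3 * M)} else {}) \<union>
      (if a + 2 <= apx a (b + 3 * M) then {arw (apx a (b + 3 * M)) (a + 3 * M)} else {})"
    (is "?L = ?R")
    and "b + 2 <= apx b a ==> a + 2 <= apx a (b + 3 * M) ==>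
      arw (apx b a) (b + 3 * M) ~= arw (apx a (b + 3 * M)) (a + 3 * M)"
proof -
  have D': "D a (b + 3 * M)" "proper a (b + 3 * M)" using D D_flip by auto
  have ba: "b < a" "a < b + 3 * M" using D_len[OF D(1)] by auto
  show "?L = ?R"
  proof (intro equalityI subsetI)
    fix A assume "A \<in> ?L"
    then obtain b' a' where h: "half b' a'" "A = arw b' a'" "arc (apx b' a') a' = arc b a"
      unfolding arrs_eq using tgt_arw by auto
    define z where "z = apx b' a'"
    have z: "b' < z" "z + 2 <= a'" "a' < b' + 3 * M" "D b' z" "D z a'" "D b' a'" "proper b' a'"
      using halfD[OF h(1)] by (auto simp: z_def)
    have za: "z < a'" "a' < z + 3 * M" using z by auto
    obtain k where k: "b = z + k * M \<and> a = a' + k * M \<or> b = a' + k * M \<and> a = z + (k + 3) * M"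
      using arc_eq_iff_flip[OF za ba] h(3) unfolding z_def by blast
    have Ds: "D (p + k * M) (q + k * M)" if "D p q" for p q using that D_shift by simp
    from k show "A \<in> ?R"
    proof
      assume k: "b = z + k * M \<and> a = a' + k * M"
      have "apx a (b + 3 * M) = b' + k * M + 3 * M"
        by (rule apx_eq[OF D'(1)]) (use k z Ds[OF z(4)] Ds[OF z(6)] D_flip D_shift[of "b' + k * M" 3 "z + k * M"] in auto)
      moreover have "arw (b' + k * M + 3 * M) (a + 3 * M) = arw (b' + (k + 3) * M) (a' + (k + 3) * M)"
        using k by (simp add: algebra_simps)
      moreover have "\<dots> = A" using arw_shift[OF h(1), of "k + 3"] h(2) by simp
      ultimately show ?thesis using k z by auto
    next
      assume k: "b = a' + k * M \<and> a = z + (k + 3) * M"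
      hence a: "a = z + k * M + 3 * M" by (simp add: algebra_simps)
      have "apx b a = b' + k * M + 3 * M"
        by (rule apx_eq[OF D(1)]) (use k a z Ds[OF z(4)] Ds[OF z(6)] D_flip D_shift[of "b' + k * M" 3 "z + k * M"] in auto)
      moreover have "arw (b' + k * M + 3 * M) (b + 3 * M) = arw (b' + (k + 3) * M) (a' + (k + 3) * M)"
        using k by (simp add: algebra_simps)
      moreover have "\<dots> = A" using arw_shift[OF h(1), of "k + 3"] h(2) by simp
      ultimately show ?thesis using k z by auto
    qed
  next
    fix A assume A: "A \<in> ?R"
    have "A \<in> ?L" if "b + 2 <= apx b a" "A = arw (apx b a) (b + 3 * M)"
      using in_half[OF D that(1)] that(2) unfolding arrs_eq by blast
    moreover have "A \<in> ?L" if "a + 2 <= apx a (b + 3 * M)" "A = arw (apx a (b + 3 * M)) (a + 3 * M)"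
      using in_half[OF D' that(1)] that(2) arc_flip[of a b] unfolding arrs_eq by auto
    ultimately show "A \<in> ?L" using A by (auto split: if_splits)
  qed
  show "arw (apx b a) (b + 3 * M) ~= arw (apx a (b + 3 * M)) (a + 3 * M)"
    if c: "b + 2 <= apx b a" "a + 2 <= apx a (b + 3 * M)"
  proof
    assume e: "arw (apx b a) (b + 3 * M) = arw (apx a (b + 3 * M)) (a + 3 * M)"
    note h = in_half[OF D c(1)] in_half[OF D' c(2)]
    obtain k where k: "apx a (b + 3 * M) = apx b a + k * M \<and> a + 3 * M = b + 3 * M + k * M"
      using arw_eq[OF h(1,6) e] by blast
    have "apx (apx b a + k * M) (b + 3 * M + k * M) = a + k * M"
      using apx_shift[of "apx b a" "b + 3 * M" k] h(2) halfD[OF h(1)] by simp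
    hence "b + 3 * M = a + k * M" using h(7) k by simp
    thus False using half_turn_neq k by auto
  qed
qed

lemma arrow_mem:
  assumes "A \<in> quiver_arrows n \<tau>"
  shows "(s, t) \<in> A \<longleftrightarrow> (s, t) \<in> lifted_arrows n \<tau> \<and> A = arrow_orbit n s t"
proof
  assume "(s, t) \<in> A"
  obtain b a where h: "half b a" "A = arw b a" using assms unfolding arrs_eq by blast
  then obtain k where k: "s = dg (b + k * M) (a + k * M)" "t = dg (apx b a + k * M) (a + k * M)"
    using \<open>(s, t) \<in> A\<close> unfolding arw_set by blast
  have ap: "apx (b + k * M) (a + k * M) = apx b a + k * M" by (rule apx_shift) (use halfD[OF h(1)] in auto)
  have "(s, t) \<in> lifted_arrows n \<tau>" unfolding lifted_arrows_iff k ap[symmetric]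
    using half_shift[OF h(1), of k] unfolding half_def by blast
  moreover have "A = arrow_orbit n s t" using arw_shift[OF h(1), of k] h(2) unfolding arw_def ap k by simp
  ultimately show "(s, t) \<in> lifted_arrows n \<tau> \<and> A = arrow_orbit n s t" ..
next
  assume *: "(s, t) \<in> lifted_arrows n \<tau> \<and> A = arrow_orbit n s t"
  then obtain b a where "s = dg b a" "t = dg (apx b a) a" unfolding lifted_arrows_iff by blast
  hence "A = arw b a" using * by (simp add: arw_def)
  have "(dg (b + 0 * M) (a + 0 * M), dg (apx b a + 0 * M) (a + 0 * M)) \<in> arw b a" unfolding arw_set by blast
  thus "(s, t) \<in> A" unfolding \<open>A = arw b a\<close> \<open>s = dg b a\<close> \<open>t = dg (apx b a) a\<close> by simp
qed

lemma arw_mem: "(dg (b + k * M) (a + k * M), dg (apx b a + k * M) (a + k * M)) \<in> arw b a"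
  unfolding arw_set by blast

lemma arw_mem0: "(dg b a, dg (apx b a) a) \<in> arw b a"
  using arw_mem[of b 0 a] by simp

lemma arrow_shift_mem:
  assumes "A \<in> quiver_arrows n \<tau>" "(dg x y, dg x' y') \<in> A"
  shows "(dg (x + k * M) (y + k * M), dg (x' + k * M) (y' + k * M)) \<in> A"
  using arrow_mem arrow_orbit_dg assms by auto

abbreviation dgp :: "int \<times> int => nat set" where "dgp s \<equiv> dg (fst s) (snd s)"

definition nested :: "int \<times> int => int \<times> int => bool" where
  "nested s t \<longleftrightarrow> fst s <= fst t \<and> snd t <= snd s"

lemma dg_window_inj:
  assumes "dg x y = dg x' y'" "u < x" "x < y" "y < u + 3 * M" "u < x'" "x' < y'" "y' < u + 3 * M"
  shows "x = x' \<and> y = y'"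
proof -
  have inj: "p = q" if "pt p = pt q" "u < p" "p < u + 3 * M" "u < q" "q < u + 3 * M" for p q
    using that pt_neq[of p q] pt_neq[of q p] by (cases p q rule: linorder_cases) auto
  have "pt x = pt x' \<and> pt y = pt y' \<or> pt x = pt y' \<and> pt y = pt x'"
    using assms(1) by (auto simp: dg_def doubleton_eq_iff)
  thus ?thesis
  proof
    assume "pt x = pt x' \<and> pt y = pt y'"
    thus ?thesis using inj[of x x'] inj[of y y'] assms by auto
  next
    assume "pt x = pt y' \<and> pt y = pt x'"
    hence "x = y'" "y = x'" using inj[of x y'] inj[of y x'] assms by auto
    thus ?thesis using assms by auto
  qed
qed

lemma ex_crossing_list: "\<exists>L. distinct L \<and> set L = Cr u w \<and> sorted_wrt nested L"
proof -
  obtain xs where xs: "set xs = Cr u w" "distinct xs" using finite_distinct_list[OF finite_Cr] by blast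
  \<comment> \<open>Crossings are nested, so sorting them by decreasing width puts them in the order
    in which they are met.\<close>
  define L where "L = sort_key (\<lambda>s. fst s - snd s) xs"
  have L: "set L = Cr u w" "distinct L" using xs by (simp_all add: L_def)
  have "sorted_wrt (\<lambda>s t. fst s - snd s <= fst t - snd t) L"
    using sorted_sort_key[of "\<lambda>s. fst s - snd s" xs] unfolding L_def[symmetric] sorted_map .
  hence "sorted_wrt nested L"
  proof (rule sorted_wrt_mono_rel[rotated])
    fix s t assume st: "s \<in> set L" "t \<in> set L" "fst s - snd s <= fst t - snd t"
    have "(fst s, snd s) \<in> Cr u w" "(fst t, snd t) \<in> Cr u w" using st L by auto
    note n = Cr_nested[OF this] Cr_nested[OF this(2,1)]
    show "nested s t" using n st(3) unfolding nested_def by linarith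
  qed
  thus ?thesis using L by blast
qed

lemma offset_pt:
  assumes "u < x" "x < u + 3 * M"
  shows "offset n (pt u) (pt x) = nat (x - u)"
proof -
  have l: "pt u < 3 * n + 3" "pt x < 3 * n + 3" using pt_lt by auto
  show ?thesis using pt_window[OF assms]
  proof
    assume *: "pt u < pt x \<and> x - u = int (pt x) - int (pt u)"
    hence "pt x + (3 * n + 3) - pt u = (pt x - pt u) + (3 * n + 3)" using l by linarith
    hence "offset n (pt u) (pt x) = (pt x - pt u) mod (3 * n + 3)" unfolding offset_def by (simp only: mod_add_self2)
    also have "\<dots> = pt x - pt u" by (rule mod_less) (use l in linarith)
    also have "\<dots> = nat (x - u)" using * by linarith
    finally show ?thesis .
  next
    assume *: "pt x < pt u \<and> x - u = int (pt x) - int (pt u) + 3 * M"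
    have "pt x + (3 * n + 3) - pt u < 3 * n + 3" using * l by linarith
    hence "offset n (pt u) (pt x) = pt x + (3 * n + 3) - pt u" unfolding offset_def by (rule mod_less)
    also have "\<dots> = nat (x - u)" using * l n_M(1) by linarith
    finally show ?thesis .
  qed
qed

lemma beyond_iff:
  assumes "s \<in> Cr u w" "t \<in> Cr u w"
  shows "beyond n (pt u) (dgp s) (dgp t) \<longleftrightarrow> nested s t"
proof -
  obtain b a b' a' where s: "s = (b, a)" and t: "t = (b', a')" by (cases s, cases t)
  have c: "u < b" "b < w" "w < a" "a < u + 3 * M" "u < b'" "b' < w" "w < a'" "a' < u + 3 * M"
    using CrD[OF assms(1)[unfolded s]] CrD[OF assms(2)[unfolded t]] by auto
  have "offset n (pt u) ` dgp s = {nat (b - u), nat (a - u)}" "offset n (pt u) ` dgp t = {nat (b' - u), nat (a' - u)}"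
    using c offset_pt by (simp_all add: dg_def s t)
  moreover have "Min {nat (b - u), nat (a - u)} = nat (b - u)" "Max {nat (b - u), nat (a - u)} = nat (a - u)"
    using c by auto
  ultimately show ?thesis using c unfolding beyond_def nested_def s t by auto
qed

lemma crosses_commute: "crosses s t \<longleftrightarrow> crosses t s" unfolding crosses_def by blast

lemma crossed_set:
  assumes "u < w" "w < u + 3 * M"
  shows "{s \<in> \<Union>\<tau>. crosses s {pt u, pt w}} = dgp ` Cr u w"
proof (intro equalityI subsetI)
  fix s assume "s \<in> {s \<in> \<Union>\<tau>. crosses s {pt u, pt w}}"
  hence s: "s \<in> \<Union>\<tau>" "crosses (dg u w) s" using crosses_commute by (auto simp: dg_def)
  obtain x y where xy: "s = dg x y" using ex_dg[of s] s(1) by auto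
  obtain b a where ba: "u < b" "b < w" "w < a" "a < u + 3 * M" "s = dg b a"
    using s(2) crosses_dg_dg[OF assms] unfolding xy by blast
  have "b < a" "a < b + 3 * M" using ba by linarith+
  hence "D b a" using s(1) dg_mem unfolding ba(5) by blast
  thus "s \<in> dgp ` Cr u w" using ba by (intro image_eqI[of _ _ "(b, a)"]) (auto simp: Cr_def)
next
  fix s assume "s \<in> dgp ` Cr u w"
  then obtain b a where ba: "(b, a) \<in> Cr u w" "s = dg b a" by auto
  note c = CrD[OF ba(1)]
  have "b < a" "a < b + 3 * M" "proper b a" using c by linarith+
  hence "s \<in> \<Union>\<tau>" using dg_mem c unfolding ba(2) by blast
  moreover have "crosses (dg u w) s" unfolding ba(2) crosses_dg_dg[OF assms] using c by blast
  ultimately show "s \<in> {s \<in> \<Union>\<tau>. crosses s {pt u, pt w}}" using crosses_commute by (auto simp: dg_def)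
qed

lemma dgp_inj: "inj_on dgp (Cr u w)"
proof (rule inj_onI)
  fix s t assume st: "s \<in> Cr u w" "t \<in> Cr u w" "dgp s = dgp t"
  obtain b a b' a' where e: "s = (b, a)" "t = (b', a')" by (cases s, cases t)
  show "s = t" using dg_window_inj[of b a b' a' u] CrD[of b a u w] CrD[of b' a' u w] st unfolding e by auto
qed

lemma crossed_eq:
  assumes uw: "u < w" "w < u + 3 * M" and L: "distinct L" "set L = Cr u w" "sorted_wrt nested L"
  shows "crossed n \<tau> (pt u) (pt w) = map dgp L"
  unfolding crossed_def crossed_set[OF uw]
proof (rule the_equality)
  have anti: "s = t" if "s \<in> Cr u w" "t \<in> Cr u w" "nested s t" "nested t s" for s t
    using that by (auto simp: nested_def prod_eq_iff)
  have dist: "distinct (map dgp L)" using L dgp_inj by (simp add: distinct_map)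
  have sor: "sorted_wrt (beyond n (pt u)) (map dgp L)"
    unfolding sorted_wrt_map
    by (rule sorted_wrt_mono_rel[OF _ L(3)]) (use beyond_iff L(2) in auto)
  show *: "distinct (map dgp L) \<and> set (map dgp L) = dgp ` Cr u w \<and> sorted_wrt (beyond n (pt u)) (map dgp L)"
    using dist sor L(2) by simp
  fix ss assume ss: "distinct ss \<and> set ss = dgp ` Cr u w \<and> sorted_wrt (beyond n (pt u)) ss"
  have "map dgp L = ss"
  proof (rule sorted_wrt_unique)
    fix x y assume "x \<in> set (map dgp L)" "y \<in> set (map dgp L)" and b: "beyond n (pt u) x y" "beyond n (pt u) y x"
    then obtain s t where st: "s \<in> Cr u w" "t \<in> Cr u w" "x = dgp s" "y = dgp t" using L(2) by auto
    thus "x = y" using anti[OF st(1,2)] b beyond_iff by blast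
  qed (use ss * in auto)
  thus "ss = map dgp L" ..
qed

end

section \<open>The string module of a crossing sequence\<close>

locale crossing_list = orbifold_triangulation +
  fixes u w :: int and L :: "(int \<times> int) list"
  assumes uw: "u < w" "w < u + 3 * M" and uw_len: "w <= u + M \<or> u + 2 * M <= w"
    and L_distinct: "distinct L" and L_set: "set L = Cr u w" and L_sorted: "sorted_wrt nested L"
begin

definition Rp :: "(arc, arrow) rep" where
  "Rp = string_rep (map (orbit n) (map dgp L)) (map2 (arc_letter n \<tau>) (map dgp L) (tl (map dgp L)))"

lemma L_Cr: "k < length L ==> L ! k \<in> Cr u w" using L_set nth_mem by blast

lemma L_CrD: "k < length L ==> L ! k = (b, a) ==> u < b \<and> b < w \<and> w < a \<and> a < u + 3 * M \<and> D b a"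
  using L_Cr CrD by metis

lemma L_proper: "k < length L ==> L ! k = (b, a) ==> D b a \<and> proper b a"
  using L_CrD by fastforce

lemma L_surj: "s \<in> Cr u w ==> \<exists>k<length L. L ! k = s"
  using L_set by (metis in_set_conv_nth)

lemma L_inj: "i < length L ==> k < length L ==> L ! i = L ! k ==> i = k"
  using L_distinct nth_eq_iff_index_eq by blast

lemma dgp_L_inj: "i < length L ==> k < length L ==> dgp (L ! i) = dgp (L ! k) ==> i = k"
proof -
  assume ik: "i < length L" "k < length L" and e: "dgp (L ! i) = dgp (L ! k)"
  have "L ! i = L ! k" by (rule inj_onD[OF dgp_inj e L_Cr[OF ik(1)] L_Cr[OF ik(2)]])
  thus "i = k" by (rule L_inj[OF ik])
qed

lemma L_nested: "i <= j ==> j < length L ==> nested (L ! i) (L ! j)"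
  using sorted_wrt_nth_less[OF L_sorted, of i j] by (cases "i = j") (auto simp: nested_def)

text \<open>The next entry of the list is enclosed by \<open>nx w (L ! k)\<close> because of
  \<open>nx_contains\<close>, and it encloses it because the list is sorted by nesting.\<close>

lemma nx_L:
  assumes "k < length L" "nx w (L ! k) \<in> Cr u w"
  shows "Suc k < length L" "L ! Suc k = nx w (L ! k)"
proof -
  obtain j where j: "j < length L" "L ! j = nx w (L ! k)" using L_surj[OF assms(2)] by blast
  have Ck: "(fst (L ! k), snd (L ! k)) \<in> Cr u w" using L_Cr[OF assms(1)] by simp
  have n: "nested (L ! k) (L ! j)" "L ! j ~= L ! k" using nx_nested[OF Ck] j(2) by (auto simp: nested_def)
  have "k < j"
  proof (rule ccontr)
    assume "\<not> k < j"
    hence "nested (L ! j) (L ! k)" using L_nested[of j k] assms(1) by simp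
    thus False using n by (auto simp: nested_def prod_eq_iff)
  qed
  thus l: "Suc k < length L" using j by simp
  have "nested (L ! k) (L ! Suc k)" "L ! Suc k ~= L ! k" using L_nested[of k "Suc k"] L_inj[of "Suc k" k] l by auto
  hence "nested (nx w (L ! k)) (L ! Suc k)"
    using nx_contains[OF L_Cr[OF assms(1)] L_Cr[OF l]] by (auto simp: nested_def)
  moreover have "nested (L ! Suc k) (L ! j)" using L_nested[of "Suc k" j] \<open>k < j\<close> j by simp
  ultimately show "L ! Suc k = nx w (L ! k)" using j(2) by (auto simp: nested_def prod_eq_iff)
qed

lemma nx_in:
  assumes "Suc k < length L"
  shows "nx w (L ! k) \<in> Cr u w"
proof -
  obtain b a where ba: "L ! k = (b, a)" by (cases "L ! k")
  have k: "k < length L" using assms by simp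
  have C: "(b, a) \<in> Cr u w" using L_Cr[OF k] ba by simp
  note c = CrD[OF C] and z = inn[OF C]
  have "apx b a ~= w"
  proof
    assume "apx b a = w"
    hence "nx w (L ! k) = (b, w)" by (simp add: nx_def ba)
    moreover have "nested (L ! k) (L ! Suc k)" "L ! Suc k ~= L ! k"
      using L_nested[of k "Suc k"] L_inj[of "Suc k" k] assms by auto
    hence "snd (L ! Suc k) <= snd (nx w (L ! k))"
      using nx_contains[OF L_Cr[OF k] L_Cr[OF assms]] by (auto simp: nested_def)
    moreover have "w < snd (L ! Suc k)" using L_CrD[OF assms, of "fst (L ! Suc k)" "snd (L ! Suc k)"] by simp
    ultimately show False by simp
  qed
  thus ?thesis using z c by (auto simp: nx_def ba Cr_def)
qed

definition dir :: "nat => bool" where "dir k \<longleftrightarrow> inn (L ! k) < w"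

lemma arrow_fwd:
  assumes "k < length L" "L ! k = (b, a)" "apx b a < w"
  shows "dir k" "Suc k < length L" "L ! Suc k = (apx b a, a)" "half b a"
proof -
  have C: "(b, a) \<in> Cr u w" using L_Cr[OF assms(1)] assms(2) by simp
  note c = CrD[OF C] and z = inn[OF C]
  show "dir k" using assms by (simp add: dir_def)
  have nx: "nx w (L ! k) = (apx b a, a)" using assms by (simp add: nx_def)
  have "nx w (L ! k) \<in> Cr u w" unfolding nx using z c assms(3) by (auto simp: Cr_def)
  from nx_L[OF assms(1) this] show "Suc k < length L" "L ! Suc k = (apx b a, a)" unfolding nx by auto
  show "half b a" unfolding half_def using c assms(3) L_proper[OF assms(1,2)] by linarith
qed

lemma arrow_bwd:
  assumes "k < length L" "L ! k = (b, a)" "w < apx b a"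
  shows "\<not> dir k" "Suc k < length L" "L ! Suc k = (b, apx b a)" "half (apx b a) (b + 3 * M)" "apx (apx b a) (b + 3 * M) = a"
proof -
  have C: "(b, a) \<in> Cr u w" using L_Cr[OF assms(1)] assms(2) by simp
  note c = CrD[OF C] and z = inn[OF C]
  show "\<not> dir k" using assms by (simp add: dir_def)
  have nx: "nx w (L ! k) = (b, apx b a)" using assms by (simp add: nx_def)
  have "nx w (L ! k) \<in> Cr u w" unfolding nx using z c assms(3) by (auto simp: Cr_def)
  from nx_L[OF assms(1) this] show "Suc k < length L" "L ! Suc k = (b, apx b a)" unfolding nx by auto
  have D: "D b a" "proper b a" "b + 2 <= apx b a" using L_proper[OF assms(1,2)] c assms(3) by auto
  show "half (apx b a) (b + 3 * M)" "apx (apx b a) (b + 3 * M) = a" using in_half[OF D] by auto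
qed

lemma consecutive_cases:
  assumes "Suc k < length L" "L ! k = (b, a)"
  obtains "dir k" "apx b a < w" "L ! Suc k = (apx b a, a)" "half b a"
  | "\<not> dir k" "w < apx b a" "L ! Suc k = (b, apx b a)" "half (apx b a) (b + 3 * M)" "apx (apx b a) (b + 3 * M) = a"
proof -
  have k: "k < length L" using assms(1) by simp
  consider "apx b a < w" | "w < apx b a" | "apx b a = w" by linarith
  thus ?thesis
  proof cases
    case 1
    thus ?thesis using that(1) arrow_fwd[OF k assms(2)] by blast
  next
    case 2
    thus ?thesis using that(2) arrow_bwd[OF k assms(2)] by blast
  next
    case 3
    hence "(b, w) \<in> Cr u w" using nx_in[OF assms(1)] by (simp add: nx_def assms(2))
    thus ?thesis using CrD by blast
  qed
qed

text \<open>An arrow between two crossed chords lies in a triangle that the diagonal traverses, so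
  the two crossings are consecutive.\<close>

lemma lifted_cases:
  assumes k: "k < length L" and i: "i < length L" and l: "(dgp (L ! k), dgp (L ! i)) \<in> lifted_arrows n \<tau>"
  shows "i = Suc k \<and> dir k \<or> k = Suc i \<and> \<not> dir i"
proof -
  obtain b' a' where h: "half b' a'" and e: "dgp (L ! k) = dg b' a'" "dgp (L ! i) = dg (apx b' a') a'"
    using l unfolding lifted_arrows_iff half_def by blast
  obtain b a where ba: "L ! k = (b, a)" by (cases "L ! k")
  obtain c d where cd: "L ! i = (c, d)" by (cases "L ! i")
  have C: "(b, a) \<in> Cr u w" "(c, d) \<in> Cr u w" using L_Cr k i ba cd by metis+
  note D = CrD[OF C(1)] and D' = CrD[OF C(2)]
  have ba': "b < a" "a < b + 3 * M" using D by auto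
  have e': "dg b a = dg b' a'" "dg c d = dg (apx b' a') a'" using e ba cd by auto
  obtain j where "b' = b + j * (3 * M) \<and> a' = a + j * (3 * M) \<or>
      b' = a + j * (3 * M) \<and> a' = b + (j + 1) * (3 * M)"
    using dg_eq_iff[OF ba' halfD(2,3)[OF h]] e'(1) by blast
  thus ?thesis
  proof
    assume j: "b' = b + j * (3 * M) \<and> a' = a + j * (3 * M)"
    have z: "b < apx b a" "apx b a < a" using inn[OF C(1)] by auto
    have "apx (b + (3 * j) * M) (a + (3 * j) * M) = apx b a + (3 * j) * M"
      by (rule apx_shift) (use D in auto)
    hence "apx b' a' = apx b a + j * (3 * M)" using j by (simp add: algebra_simps)
    hence "dg c d = dg (apx b a) a" using e'(2) j dg_shift by simp
    hence "c = apx b a \<and> d = a" using dg_window_inj[of c d "apx b a" a u] D D' z by auto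
    hence "apx b a < w" "L ! i = (apx b a, a)" using D' cd by auto
    thus ?thesis using arrow_fwd[OF k ba] L_inj[OF i, of "Suc k"] by auto
  next
    assume j: "b' = a + j * (3 * M) \<and> a' = b + (j + 1) * (3 * M)"
    define z where "z = apx a (b + 3 * M)"
    have z: "a < z" "z < b + 3 * M" "D a z" "D z (b + 3 * M)" using out[OF C(1)] by (auto simp: z_def)
    have a': "a' = b + 3 * M + j * (3 * M)" using j by (simp add: algebra_simps)
    have "apx (a + (3 * j) * M) (b + 3 * M + (3 * j) * M) = z + (3 * j) * M"
      unfolding z_def by (rule apx_shift) (use D D_flip in auto)
    hence "apx b' a' = z + j * (3 * M)" using j a' by (simp add: algebra_simps)
    hence e2: "dg c d = dg z (b + 3 * M)" using e'(2) unfolding a' using dg_shift by simp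
    \<comment> \<open>Here the arrow lies in the outer triangle. Only the first position of the apex
      is possible: in the second the target ends at \<open>u\<close>, and in the third both its ends
      lie before \<open>w\<close>.\<close>
    consider "z < u + 3 * M" | "z = u + 3 * M" | "u + 3 * M < z" by linarith
    thus ?thesis
    proof cases
      case 1
      have "dg c d = dg b z" using e2 dg_flip[of z b] by simp
      hence cd': "c = b \<and> d = z" using dg_window_inj[of c d b z u] D D' z 1 by auto
      hence ap: "apx c d = a" using apx_eq[of b z a] D D' z by auto
      hence nd: "w < apx c d" using D by simp
      have "L ! Suc i = (b, a)" "Suc i < length L" "\<not> dir i" using arrow_bwd[OF i cd nd] cd' ap by auto
      thus ?thesis using L_inj[OF k, of "Suc i"] ba by auto
    next
      case 2
      hence "pt u \<in> dg c d" unfolding e2 by (simp add: dg_def pt_3)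
      thus ?thesis using pt_neq[of u c] pt_neq[of u d] D' by (auto simp: dg_def)
    next
      case 3
      have "dg c d = dg (z - 3 * M) b" using e2 dg_shift[of "z - 3 * M" 1 b] by simp
      hence "d = b" using dg_window_inj[of c d "z - 3 * M" b u] D D' z 3 by auto
      thus ?thesis using D D' by auto
    qed
  qed
qed

lemma Rp_simps: "rdim Rp = length L" "k < length L ==> vtx Rp k = arc (fst (L ! k)) (snd (L ! k))"
  by (simp_all add: Rp_def string_rep_def arc_def)

lemma Rp_ent_01: "ent Rp A i k = 0 \<or> ent Rp A i k = 1" by (simp add: Rp_def string_rep_def)

lemma lifted_fwd: "Suc k < length L ==> dir k ==> (dgp (L ! k), dgp (L ! Suc k)) \<in> lifted_arrows n \<tau>"
proof -
  assume k: "Suc k < length L" "dir k"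
  obtain b a where ba: "L ! k = (b, a)" by (cases "L ! k")
  from k(1) ba show ?thesis
  proof (cases rule: consecutive_cases)
    case 1
    thus ?thesis unfolding lifted_arrows_iff half_def ba by auto
  next
    case 2
    thus ?thesis using k by simp
  qed
qed

lemma lifted_bwd: "Suc k < length L ==> \<not> dir k ==> (dgp (L ! Suc k), dgp (L ! k)) \<in> lifted_arrows n \<tau>"
proof -
  assume k: "Suc k < length L" "\<not> dir k"
  obtain b a where ba: "L ! k = (b, a)" by (cases "L ! k")
  from k(1) ba show ?thesis
  proof (cases rule: consecutive_cases)
    case 1
    thus ?thesis using k by simp
  next
    case 2
    have "dgp (L ! Suc k) = dg (apx b a) (b + 3 * M)" "dgp (L ! k) = dg a (b + 3 * M)"
      using 2 ba dg_flip[of _ b] by simp_all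
    thus ?thesis unfolding lifted_arrows_iff
      by (intro exI[of _ "apx b a"] exI[of _ "b + 3 * M"]) (use 2(4,5) in \<open>simp add: half_def\<close>)
  qed
qed

lemma letter:
  assumes "Suc k < length L"
  shows "map2 (arc_letter n \<tau>) (map dgp L) (tl (map dgp L)) ! k =
    (if dir k then Direct (arrow_orbit n (dgp (L ! k)) (dgp (L ! Suc k)))
     else Inverse (arrow_orbit n (dgp (L ! Suc k)) (dgp (L ! k))))"
proof -
  have "map2 (arc_letter n \<tau>) (map dgp L) (tl (map dgp L)) ! k = arc_letter n \<tau> (dgp (L ! k)) (dgp (L ! Suc k))"
    using assms by (simp add: nth_tl)
  moreover have "(dgp (L ! k), dgp (L ! Suc k)) \<in> lifted_arrows n \<tau> \<longleftrightarrow> dir k"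
    using lifted_cases[of k "Suc k"] lifted_fwd[OF assms] assms by auto
  ultimately show ?thesis by (simp add: arc_letter_def)
qed

lemma Rp_ent:
  assumes A: "A \<in> quiver_arrows n \<tau>"
  shows "ent Rp A i k = 1 \<longleftrightarrow> i < length L \<and> k < length L \<and> (dgp (L ! k), dgp (L ! i)) \<in> A"
proof -
  have "ent Rp A i k = 1 \<longleftrightarrow>
      i = Suc k \<and> i < length L \<and> dir k \<and> A = arrow_orbit n (dgp (L ! k)) (dgp (L ! i)) \<or>
      k = Suc i \<and> k < length L \<and> \<not> dir i \<and> A = arrow_orbit n (dgp (L ! k)) (dgp (L ! i))"
    using letter[of k] letter[of i] by (auto simp: Rp_def string_rep_def)
  also have "\<dots> \<longleftrightarrow> i < length L \<and> k < length L \<and> (dgp (L ! k), dgp (L ! i)) \<in> A"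
    unfolding arrow_mem[OF A] using lifted_cases[of k i] lifted_fwd[of k] lifted_bwd[of i] by auto
  finally show ?thesis .
qed

lemma Rp_ent_dir:
  assumes "A \<in> quiver_arrows n \<tau>" "ent Rp A i k = 1"
  shows "i = Suc k \<and> dir k \<or> k = Suc i \<and> \<not> dir i"
  using Rp_ent lifted_cases arrow_mem assms by simp

text \<open>A nonzero path moves along the string in one direction only, since the letter just used
  cannot be traversed backwards by an arrow. Its length is therefore bounded by that of the
  string.\<close>

lemma Rp_path:
  assumes "set p \<subseteq> quiver_arrows n \<tau>" "p ~= []" "path_ent Rp p i k ~= 0"
  shows "i = k + length p \<and> dir k \<or> k = i + length p \<and> \<not> dir (k - 1)"
  using assms
proof (induction p arbitrary: k)
  case (Cons A p)
  obtain m where m: "path_ent Rp p i m ~= 0" "ent Rp A m k ~= 0"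
  proof -
    have "(\<Sum>m<rdim Rp. path_ent Rp p i m * ent Rp A m k) ~= 0" using Cons.prems(3) by simp
    then obtain m where "path_ent Rp p i m * ent Rp A m k ~= 0" by (rule sum.not_neutral_contains_not_neutral)
    thus ?thesis using that[of m] by simp
  qed
  have A: "A \<in> quiver_arrows n \<tau>" using Cons.prems(1) by simp
  have "ent Rp A m k = 1" using m(2) Rp_ent_01[of A m k] by blast
  hence d: "m = Suc k \<and> dir k \<or> k = Suc m \<and> \<not> dir m" by (rule Rp_ent_dir[OF A])
  show ?case
  proof (cases "p = []")
    case True
    hence "i = m" using m(1) by (auto split: if_splits)
    thus ?thesis using d True by auto
  next
    case False
    hence "i = m + length p \<and> dir m \<or> m = i + length p \<and> \<not> dir (m - 1)"
      using Cons.IH[of m] Cons.prems(1) m(1) by auto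
    thus ?thesis using d False by auto
  qed
qed simp

lemma Rp_nilpotent:
  "\<exists>l. \<forall>p. set p \<subseteq> arrs Qv \<and> length p \<ge> l --> (\<forall>i<rdim Rp. \<forall>k<rdim Rp. path_ent Rp p i k = 0)"
proof (intro exI[of _ "Suc (length L)"] allI impI)
  fix p i k assume p: "set p \<subseteq> arrs Qv \<and> Suc (length L) <= length p" and ik: "i < rdim Rp" "k < rdim Rp"
  show "path_ent Rp p i k = 0"
    using p Rp_path Qv_simps ik Rp_simps by fastforce
qed

text \<open>Two successive arrows of one internal triangle would make the diagonal cross all three
  sides. The third arrow would then make \<open>i\<close> and \<open>k\<close> consecutive in the
  list, although both are neighbours of \<open>m\<close>.\<close>

lemma Rp_relations:
  assumes A: "A \<in> quiver_arrows n \<tau>" "nxt A = Some B" and e: "ent Rp A m k = 1" "ent Rp B i m = 1"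
  shows False
proof -
  have B: "B \<in> quiver_arrows n \<tau>" using nxt_arrs[OF A] by blast
  have ik: "i < length L" "k < length L" "m < length L" using e Rp_ent A(1) B by blast+
  obtain b' a' where f': "full b' a'" "A = arw b' a'" "B = arw a' (apx b' a' + 3 * M)" using nxt_SomeD[OF A] by blast
  have h': "half b' a'" using f' by (simp add: full_def)
  obtain j where j: "dgp (L ! k) = dg (b' + j * M) (a' + j * M)" "dgp (L ! m) = dg (apx b' a' + j * M) (a' + j * M)"
    using e(1) Rp_ent[OF A(1)] unfolding f'(2) arw_set by blast
  define b a where "b = b' + j * M" and "a = a' + j * M"
  define z where "z = apx b a"
  have z': "z = apx b' a' + j * M" unfolding z_def b_def a_def by (rule apx_shift) (use halfD[OF h'] in auto)
  have f: "full b a" using f'(1) half_shift[OF h', of j] z' unfolding full_def z_def b_def a_def by simp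
  have n2: "full a (z + 3 * M)" "apx a (z + 3 * M) = b + 3 * M" using full_next[OF f] by (auto simp: z_def)
  have Be: "B = arw a (z + 3 * M)"
  proof -
    have "half a' (apx b' a' + 3 * M)" using full_next(1)[OF f'(1)] by (simp add: full_def)
    from arw_shift[OF this, of j] show ?thesis using f'(3) z' by (simp add: a_def add_ac)
  qed
  have k: "dgp (L ! k) = dg b a" and m: "dgp (L ! m) = dg z a" using j z' by (simp_all add: a_def b_def)
  have "(dg a (z + 3 * M), dg (b + 3 * M) (z + 3 * M)) \<in> B" unfolding Be using arw_mem0[of a "z + 3 * M"] n2(2) by simp
  hence "(dg z a, dg b z) \<in> B" using dg_flip[of a z] dg_shift[of b 1 z] by simp
  moreover have "(dgp (L ! m), dgp (L ! i)) \<in> B" using e(2) Rp_ent[OF B] by blast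
  ultimately have i: "dgp (L ! i) = dg b z"
    using arw_functional[of a "z + 3 * M" "dg z a" "dg b z" "dgp (L ! m)" "dgp (L ! i)"] n2(1) m unfolding Be full_def by auto
  have Db: "D b a" "proper b a" "b + 2 <= apx b a" using f halfD by (auto simp: full_def)
  have "(dg z (b + 3 * M), dg a (b + 3 * M)) \<in> lifted_arrows n \<tau>"
    unfolding lifted_arrows_iff using in_half[OF Db] unfolding z_def half_def by (intro exI[of _ "apx b a"] exI[of _ "b + 3 * M"]) auto
  hence "(dgp (L ! i), dgp (L ! k)) \<in> lifted_arrows n \<tau>" unfolding i k using dg_flip[of _ b] by simp
  from lifted_cases[OF ik(1,2) this] Rp_ent_dir[OF A(1) e(1)] Rp_ent_dir[OF B e(2)]
  show False by auto
qed

text \<open>Two crossings by lifts of one arc are told apart by whether the chord or its complement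
  is the one of length at most \<open>M\<close>.\<close>

definition lbl :: "nat => bool" where "lbl k \<longleftrightarrow> snd (L ! k) <= fst (L ! k) + M"

text \<open>Copies differing by a translation alone would be closer than \<open>M\<close> and hence
  equal. So the second copy also has its endpoints exchanged, which changes the label; the bounds on
  the crossings then leave a single rotation, determined by the label and by which side of the
  diagonal is short.\<close>

lemma copies:
  assumes k: "k < length L" and l: "l < length L" and e: "vtx Rp k = vtx Rp l" "k ~= l"
    and ba: "L ! k = (b, a)"
  defines "j \<equiv> (if lbl k = (w <= u + M) then -1 else -2)"
  shows "lbl k ~= lbl l" "L ! l = (a + j * M, b + (j + 3) * M)"
proof -
  obtain c d where cd: "L ! l = (c, d)" by (cases "L ! l")
  note C = L_CrD[OF k ba] and C' = L_CrD[OF l cd]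
  have w1: "b < a" "a < b + 3 * M" and w2: "c < d" "d < c + 3 * M" using C C' by auto
  have "arc b a = arc c d" using e(1) Rp_simps(2) k l ba cd by simp
  then obtain i where i: "c = b + i * M \<and> d = a + i * M \<or> c = a + i * M \<and> d = b + (i + 3) * M"
    using arc_eq_iff_flip[OF w1 w2] by blast
  have lk: "lbl k \<longleftrightarrow> a <= b + M" and ll: "lbl l \<longleftrightarrow> d <= c + M" using ba cd by (simp_all add: lbl_def)
  have M0: "0 < M" using M3 by simp
  have "\<not> (c = b + i * M \<and> d = a + i * M)"
  proof
    assume *: "c = b + i * M \<and> d = a + i * M"
    have "- M < i * M" "i * M < M" using uw_len C C' * by linarith+
    hence "i = 0" using multiple_window(1,2)[OF M0, of i] by linarith
    thus False using * ba cd e(2) L_inj[OF k l] by simp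
  qed
  with i have *: "c = a + i * M" "d = b + (i + 3) * M" by auto
  have d: "d = b + i * M + 3 * M" using * by (simp add: algebra_simps)
  show "lbl k ~= lbl l" using *(1) d D_short[of b a] D_short[of c d] C C' M0 unfolding lk ll by linarith
  have win: "i = -1" if "- M < (i + 1) * M" "(i + 1) * M < M"
    using multiple_window(1,2)[OF M0, of "i + 1"] that by linarith
  have win2: "i = -2" if "- M < (i + 2) * M" "(i + 2) * M < M"
    using multiple_window(1,2)[OF M0, of "i + 2"] that by linarith
  have s: "(i + 1) * M = i * M + M" "(i + 2) * M = i * M + 2 * M" by (simp_all add: algebra_simps)
  have "i = j"
  proof (cases "w <= u + M")
    case True
    show ?thesis
    proof (cases "lbl k")
      case l: True
      have "- M < (i + 1) * M" "(i + 1) * M < M" using C C' *(1) True l lk unfolding s by linarith+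
      thus ?thesis using win l True by (simp add: j_def)
    next
      case l: False
      hence "b + 2 * M <= a" using D_short[of b a] C lk by auto
      hence "- M < (i + 2) * M" "(i + 2) * M < M" using C C' *(1) True unfolding s by linarith+
      thus ?thesis using win2 l True by (simp add: j_def)
    qed
  next
    case False
    hence uw2: "u + 2 * M <= w" using uw_len by simp
    show ?thesis
    proof (cases "lbl k")
      case l: True
      have "- M < (i + 2) * M" "(i + 2) * M < M" using C C' *(1) d uw2 l lk unfolding s by linarith+
      thus ?thesis using win2 l False by (simp add: j_def)
    next
      case l: False
      hence "b + 2 * M <= a" using D_short[of b a] C lk by auto
      hence "- M < (i + 1) * M" "(i + 1) * M < M" using C C' *(1) d uw2 unfolding s by linarith+
      thus ?thesis using win l False by (simp add: j_def)
    qed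
  qed
  thus "L ! l = (a + j * M, b + (j + 3) * M)" using * cd by simp
qed

lemma copy_dg:
  assumes k: "k < length L" and l: "l < length L" and e: "vtx Rp k = vtx Rp l" "k ~= l"
  defines "j \<equiv> (if lbl k = (w <= u + M) then -1 else -2)"
  shows "dgp (L ! l) = dg (fst (L ! k) + j * M) (snd (L ! k) + j * M)"
proof -
  obtain b a where ba: "L ! k = (b, a)" by (cases "L ! k")
  have "L ! l = (a + j * M, b + (j + 3) * M)" unfolding j_def by (rule copies(2)[OF k l e ba])
  moreover have "b + (j + 3) * M = b + j * M + 3 * M" by (simp add: algebra_simps)
  ultimately show ?thesis using dg_flip[of "a + j * M" "b + j * M"] ba by simp
qed

text \<open>Widths decrease along the sequence, so a change of label means passing from width at
  least \<open>2 * M\<close> to width at most \<open>M\<close>. The positions of the second copies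
  then leave only the central triangle, whose sides all belong to one arc.\<close>

lemma consecutive_label:
  assumes m: "Suc m < length L" and ne: "vtx Rp m ~= vtx Rp (Suc m)"
    and k: "k < length L" "vtx Rp m = vtx Rp k" "m ~= k"
    and l: "l < length L" "vtx Rp (Suc m) = vtx Rp l" "Suc m ~= l"
  shows "lbl m = lbl (Suc m)"
proof (rule ccontr)
  assume neq: "lbl m ~= lbl (Suc m)"
  obtain b a where ba: "L ! m = (b, a)" by (cases "L ! m")
  obtain c d where cd: "L ! Suc m = (c, d)" by (cases "L ! Suc m")
  have m': "m < length L" using m by simp
  note C = L_CrD[OF m' ba] and C' = L_CrD[OF m cd]
  have M0: "0 < M" using M3 by simp
  have "nested (b, a) (c, d)" using L_nested[of m "Suc m"] m ba cd by simp
  hence lb: "\<not> lbl m" "lbl (Suc m)" using neq ba cd by (auto simp: lbl_def nested_def)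
  hence ab: "b + 2 * M <= a" and dc: "d <= c + M" using D_short[of b a] C ba cd by (auto simp: lbl_def)
  have C1: "if w <= u + M then u < a - 2 * M \<and> a - 2 * M < w else w < b + 2 * M \<and> b + 2 * M < u + 3 * M"
    using L_CrD[OF k(1) copies(2)[OF m' k ba]] lb by (auto split: if_splits)
  have C2: "if w <= u + M then u < d - M \<and> d - M < w else w < c + M \<and> c + M < u + 3 * M"
    using L_CrD[OF l(1) copies(2)[OF m l cd]] lb by (auto split: if_splits)
  define z where "z = apx b a"
  have z: "b < z" "z < a" "D b z" "D z a" using inn[of b a u w] L_Cr[OF m'] ba by (simp_all add: z_def)
  have sz: "z <= b + M \<or> b + 2 * M <= z" "a <= z + M \<or> z + 2 * M <= a" using z D_short by auto
  have central: "\<not> (z = b + M \<and> a = b + 2 * M)"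
  proof
    assume *: "z = b + M \<and> a = b + 2 * M"
    have e: "b + 2 * M = (b + M) + 1 * M" "b + M = b + 1 * M" by simp_all
    have "arc (b + M) (b + 2 * M) = arc b (b + M)" using arc_shift[of b 1 "b + M"] by (simp add: algebra_simps)
    moreover have "arc b (b + 2 * M) = arc (b + 2 * M) (b + 3 * M)" by (rule arc_flip[symmetric])
    moreover have "arc (b + 2 * M) (b + 3 * M) = arc b (b + M)" using arc_shift[of b 2 "b + M"] by (simp add: algebra_simps)
    ultimately have "arc b z = arc b a" "arc z a = arc b a" using * by simp_all
    moreover have "(c, d) = (z, a) \<or> (c, d) = (b, z)"
      using m ba by (cases rule: consecutive_cases) (simp_all add: cd z_def)
    ultimately have "arc c d = arc b a" by auto
    thus False using ne Rp_simps(2) m m' ba cd by simp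
  qed
  from m ba show False
  proof (cases rule: consecutive_cases)
    case 1
    hence "c = z" "d = a" "z < w" using cd by (simp_all add: z_def)
    thus False using C1 C2 sz central ab dc C C' uw_len M0 by (auto split: if_splits)
  next
    case 2
    hence "c = b" "d = z" "w < z" using cd by (simp_all add: z_def)
    thus False using C1 C2 sz central ab dc C C' uw_len M0 by (auto split: if_splits)
  qed
qed

lemma arrow_label:
  assumes A: "A \<in> quiver_arrows n \<tau>" "fst ` A ~= snd ` A" and e: "ent Rp A i k = 1"
    and k: "k' < length L" "vtx Rp k = vtx Rp k'" "k ~= k'"
    and i: "i' < length L" "vtx Rp i = vtx Rp i'" "i ~= i'"
    and v: "vtx Rp k = fst ` A" "vtx Rp i = snd ` A"
  shows "lbl i = lbl k"
  by (metis Rp_ent Rp_ent_dir consecutive_label assms)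

lemma Rp_graded:
  assumes A: "A \<in> quiver_arrows n \<tau>" and e: "ent Rp A i k = 1"
  shows "i < length L" "k < length L" "vtx Rp k = fst ` A" "vtx Rp i = snd ` A"
proof -
  show ik: "i < length L" "k < length L" using e Rp_ent[OF A] by blast+
  have m: "(dgp (L ! k), dgp (L ! i)) \<in> A" using e Rp_ent[OF A] by blast
  obtain b a where h: "half b a" "A = arw b a" using A unfolding arrs_eq by blast
  have "dgp (L ! k) \<in> fst ` A" "dgp (L ! i) \<in> snd ` A" using m by force+
  thus "vtx Rp k = fst ` A" "vtx Rp i = snd ` A"
    using arc_of_member Rp_simps(2) ik unfolding h(2) src_arw tgt_arw by auto
qed

lemma Rp_functional:
  assumes A: "A \<in> quiver_arrows n \<tau>" and e: "ent Rp A i k = 1" "ent Rp A i' k' = 1"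
  shows "i = i' \<longleftrightarrow> k = k'"
proof -
  have ik: "i < length L" "k < length L" "i' < length L" "k' < length L" using e Rp_ent[OF A] by blast+
  have m: "(dgp (L ! k), dgp (L ! i)) \<in> A" "(dgp (L ! k'), dgp (L ! i')) \<in> A" using e Rp_ent[OF A] by blast+
  obtain b a where h: "half b a" "A = arw b a" using A unfolding arrs_eq by blast
  have "dgp (L ! k) = dgp (L ! k') \<longleftrightarrow> dgp (L ! i) = dgp (L ! i')"
    using arw_functional[OF h(1)] m unfolding h(2) by blast
  thus ?thesis using dgp_L_inj ik by metis
qed

text \<open>The ends of the arrow have equal labels, so by \<open>copy_dg\<close> the same rotation
  carries both crossings to their second copies. Arrows are rotation-invariant, hence they also join
  these copies.\<close>

lemma Rp_planes:
  assumes A: "A \<in> quiver_arrows n \<tau>" "fst ` A ~= snd ` A" and e: "ent Rp A i k = 1"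
    and d: "dimv Rp (fst ` A) = 2" "dimv Rp (snd ` A) = 2"
    and k': "k' < length L" "vtx Rp k' = fst ` A" and i': "i' < length L" "vtx Rp i' = snd ` A"
  shows "ent Rp A i' k' = 1 \<longleftrightarrow> lbl i' = lbl k'"
proof -
  note g = Rp_graded[OF A(1) e]
  have other: "\<exists>k'<length L. k' ~= k \<and> vtx Rp k' = v" if "dimv Rp v = 2" "vtx Rp k = v" "k < length L" for v k
  proof (rule ccontr)
    assume "\<not> ?thesis"
    hence "{k. k < rdim Rp \<and> vtx Rp k = v} = {k}" using that by (auto simp: Rp_simps)
    thus False using that(1) by (simp add: dimv_def)
  qed
  obtain k2 where k2: "k2 < length L" "k2 ~= k" "vtx Rp k2 = fst ` A" using other[OF d(1) g(3,2)] by blast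
  obtain i2 where i2: "i2 < length L" "i2 ~= i" "vtx Rp i2 = snd ` A" using other[OF d(2) g(4,1)] by blast
  have lab: "lbl i = lbl k" using arrow_label[OF A e k2(1) _ _ i2(1)] g k2 i2 by auto
  show ?thesis
  proof (cases "k' = k")
    case True
    show ?thesis
    proof (cases "i' = i")
      case False
      hence "lbl i' ~= lbl i" using copies(1)[OF g(1) i'(1)] g i' by (cases "L ! i") auto
      moreover have "ent Rp A i' k' ~= 1" using Rp_functional[OF A(1) e, of i' k'] True False by auto
      ultimately show ?thesis using lab True by simp
    qed (use True e lab in simp)
  next
    case False
    have lk: "lbl k ~= lbl k'" using copies(1)[OF g(2) k'(1)] g k' False by (cases "L ! k") auto
    show ?thesis
    proof (cases "i' = i")
      case True
      moreover have "ent Rp A i' k' ~= 1" using Rp_functional[OF A(1) e, of i' k'] True False by auto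
      ultimately show ?thesis using lab lk by simp
    next
      case ii: False
      have "lbl i ~= lbl i'" using copies(1)[OF g(1) i'(1)] g i' ii by (cases "L ! i") auto
      moreover have "(dgp (L ! k'), dgp (L ! i')) \<in> A"
        using e Rp_ent arrow_shift_mem copy_dg g False ii lab assms by simp
      hence "ent Rp A i' k' = 1" using Rp_ent[OF A(1)] k' i' by blast
      ultimately show ?thesis using lab lk by auto
    qed
  qed
qed

lemma Rp_label_inj: "k < length L ==> k' < length L ==> vtx Rp k = vtx Rp k' ==> lbl k = lbl k' ==> k = k'"
  using copies(1)[of k k'] by (cases "L ! k") auto

text \<open>A loop joins the two crossings at its vertex. Another nonzero entry could only be the
  reversed one, and one letter does not act in both directions.\<close>

lemma Rp_loop:
  assumes A: "A \<in> quiver_arrows n \<tau>" "fst ` A = snd ` A" and e: "ent Rp A i k = 1"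
  shows "i ~= k \<and> (\<forall>i' k'. ent Rp A i' k' = 1 --> i' = i \<and> k' = k)"
proof (intro conjI allI impI)
  have ad: "i ~= k \<and> ent Rp A k i ~= 1" if "ent Rp A i k = 1" for i k
    using Rp_ent_dir[OF A(1) that] Rp_ent_dir[OF A(1), of k i] by auto
  show "i ~= k" using ad[OF e] by simp
  fix i' k' assume e': "ent Rp A i' k' = 1"
  note g = Rp_graded[OF A(1) e] and g' = Rp_graded[OF A(1) e']
  have "lbl i ~= lbl k" "lbl i' ~= lbl k'"
    using Rp_label_inj[of i k] Rp_label_inj[of i' k'] g g' A(2) ad[OF e] ad[OF e'] by auto
  hence "i' = i \<and> k' = k \<or> i' = k \<and> k' = i"
    using Rp_label_inj[of i i'] Rp_label_inj[of k k'] Rp_label_inj[of i k'] Rp_label_inj[of k i'] g g' A(2) by auto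
  thus "i' = i" "k' = k" using ad[OF e] e' by auto
qed

end

section \<open>Edge weights given by the variables\<close>

context orbifold_triangulation
begin

definition xwt :: "int => int => arc laurent" where
  "xwt x y = (if dg x y \<in> \<Union>\<tau> then xvar (arc x y) else 1)"

definition xwi :: "int => int => arc laurent" where
  "xwi x y = (if dg x y \<in> \<Union>\<tau> then xinv (arc x y) else 1)"

lemma dg_mem_shift: "dg (x + k * M) (y + k * M) \<in> \<Union>\<tau> \<longleftrightarrow> dg x y \<in> \<Union>\<tau>"
proof -
  have *: "dg (x + k * M) (y + k * M) \<in> \<Union>\<tau>" if m: "dg x y \<in> \<Union>\<tau>" for x y k
  proof -
    obtain i where i: "i \<in> \<tau>" "dg x y \<in> i" using m by blast
    hence "i \<in> arcs n" using triangulation unfolding is_triangulation_def by blast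
    then obtain c d where "i = arc c d" unfolding arcs_iff by blast
    hence "dg (x + k * M) (y + k * M) \<in> i" using i(2) arc_of_member dg_in_arc[of x k y] by blast
    thus ?thesis using i(1) by blast
  qed
  have e: "x + k * M + - k * M = x" "y + k * M + - k * M = y" by simp_all
  from *[of x y k] *[of "x + k * M" "y + k * M" "- k"] show ?thesis unfolding e by blast
qed

sublocale weighted_triangulation M "edge \<tau>" xwt xwi
proof
  show "xwt x (x + 1) = 1" for x
    using dg_mem[of x "x + 1"] M3 by (simp add: xwt_def)
  show "xwt x y * xwi x y = 1" for x y
    using xpow_inverse(1)[of "arc x y" 1] by (simp add: xwt_def xwi_def)
  show "xwt (x + k * M) (y + k * M) = xwt x y" "xwi (x + k * M) (y + k * M) = xwi x y" for x y k
    unfolding xwt_def xwi_def dg_mem_shift arc_shift by (rule refl)+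
  show "xwt y (x + 3 * M) = xwt x y" "xwi y (x + 3 * M) = xwi x y" for x y
    by (simp_all add: xwt_def xwi_def dg_flip arc_flip)
qed

lemma xwt_D: "D x y ==> xwt x y = (if proper x y then xvar (arc x y) else 1)"
  and xwi_D: "D x y ==> xwi x y = (if proper x y then xinv (arc x y) else 1)"
  using dg_mem[of x y] D_len[of x y] by (auto simp: xwt_def xwi_def)

lemma arrow_ends:
  assumes "A \<in> quiver_arrows n \<tau>"
  shows "fst ` A \<in> \<tau> \<and> snd ` A \<in> \<tau>"
proof -
  obtain b a where h: "half b a" "A = arw b a" using assms unfolding arrs_eq by blast
  have "arc b a \<in> \<tau>" "arc (apx b a) a \<in> \<tau>"
    using halfD[OF h(1)] arc_mem_iff[of b a] arc_mem_iff[of "apx b a" a] by auto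
  thus ?thesis unfolding h(2) src_arw tgt_arw by simp
qed

text \<open>Arrows leaving the arc lead to two opposite sides of the quadrilateral around it, and
  arrows entering it come from the other two. Boundary sides have weight 1.\<close>

lemma y_monom_eq:
  assumes D: "D b a" "proper b a"
  shows "y_monom Qv (arc b a) = y_wt (b, a)"
proof -
  define z z' where "z = apx b a" and "z' = apx a (b + 3 * M)"
  have D': "D a (b + 3 * M)" "proper a (b + 3 * M)" using D D_flip by auto
  have z: "b < z" "z < a" "D b z" "D z a" using apx[OF D(1)] D(2) by (auto simp: z_def)
  have z': "a < z'" "z' < b + 3 * M" "D a z'" "D z' (b + 3 * M)" using apx[OF D'(1)] D'(2) by (auto simp: z'_def)
  have 1: "(\<Prod>A | A \<in> {A. A \<in> quiver_arrows n \<tau> \<and> fst ` A = arc b a} \<and> True. xvar (snd ` A)) =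
      (if z + 2 <= a then xvar (arc z a) else 1) * (if z' + 2 <= b + 3 * M then xvar (arc z' (b + 3 * M)) else 1)"
    using prod_two[OF out_arrows[OF D], where P = "\<lambda>_. True" and G = "\<lambda>A. xvar (snd ` A)"]
    by (simp add: tgt_arw z_def[symmetric] z'_def[symmetric])
  have 2: "(\<Prod>A | A \<in> {A. A \<in> quiver_arrows n \<tau> \<and> snd ` A = arc b a} \<and> True. xinv (fst ` A)) =
      (if b + 2 <= z then xinv (arc b z) else 1) * (if a + 2 <= z' then xinv (arc a z') else 1)"
    using prod_two[OF in_arrows[OF D], where P = "\<lambda>_. True" and G = "\<lambda>A. xinv (fst ` A)"] in_half(3)[OF D] in_half(3)[OF D']
    by (simp add: z_def[symmetric] z'_def[symmetric])
  have "xwt z a = (if z + 2 <= a then xvar (arc z a) else 1)"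
    "xwt z' (b + 3 * M) = (if z' + 2 <= b + 3 * M then xvar (arc z' (b + 3 * M)) else 1)"
    "xwi b z = (if b + 2 <= z then xinv (arc b z) else 1)"
    "xwi a z' = (if a + 2 <= z' then xinv (arc a z') else 1)"
    using z z' D xwt_D[of z a] xwt_D[of z' "b + 3 * M"] xwi_D[of b z] xwi_D[of a z'] by auto
  hence "y_monom Qv (arc b a) = (xwt z a * xwt z' (b + 3 * M)) * (xwi b z * xwi a z')"
    using 1 2 unfolding y_monom_def Qv_simps by simp
  moreover have ac: "(p * q) * (r * s) = (p * r) * (q * s)" for p q r s :: "arc laurent"
    by (simp only: mult.assoc mult.left_commute)
  ultimately show ?thesis unfolding y_wt_def z_def z'_def fst_conv snd_conv ac by simp
qed

end

context crossing_list
begin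

sublocale R: thin_module Qv Rp lbl nxt
proof
  show "finite (verts Qv)" by (simp add: Qv_simps finite_triangulation)
  show "finite (arrs Qv)" by (simp add: Qv_simps finite_arrs)
  show "vtx Rp k \<in> verts Qv" if "k < rdim Rp" for k
  proof -
    obtain b a where ba: "L ! k = (b, a)" by (cases "L ! k")
    have "k < length L" using that by (simp add: Rp_simps)
    thus ?thesis using L_proper[OF _ ba] D_len[of b a] arc_mem_iff[of b a] ba by (simp add: Rp_simps Qv_simps)
  qed
  show "src Qv A \<in> verts Qv \<and> tgt Qv A \<in> verts Qv" if "A \<in> arrs Qv" for A
    using that arrow_ends unfolding Qv_simps by blast
  show "ent Rp A i k = 0 \<or> ent Rp A i k = 1" for A i k by (rule Rp_ent_01)
  show "i < rdim Rp \<and> k < rdim Rp \<and> vtx Rp k = src Qv A \<and> vtx Rp i = tgt Qv A"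
    if "A \<in> arrs Qv" "ent Rp A i k = 1" for A i k
    using Rp_graded[of A i k] that unfolding Qv_simps Rp_simps by blast
  show "i = i'" if "A \<in> arrs Qv" "ent Rp A i k = 1" "ent Rp A i' k = 1" for A i i' k
    using Rp_functional[of A i k i' k] that unfolding Qv_simps by blast
  show "k = k'" if "A \<in> arrs Qv" "ent Rp A i k = 1" "ent Rp A i k' = 1" for A i k k'
    using Rp_functional[of A i k i k'] that unfolding Qv_simps by blast
  show "k = k'" if "k < rdim Rp" "k' < rdim Rp" "vtx Rp k = vtx Rp k'" "lbl k = lbl k'" for k k'
    using Rp_label_inj that unfolding Rp_simps by blast
  show "ent Rp A i' k' = 1 \<longleftrightarrow> lbl i' = lbl k'"
    if "A \<in> arrs Qv" "src Qv A ~= tgt Qv A" "ent Rp A i k = 1"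
      "dimv Rp (src Qv A) = 2" "dimv Rp (tgt Qv A) = 2" "k' < rdim Rp" "i' < rdim Rp"
      "vtx Rp k' = src Qv A" "vtx Rp i' = tgt Qv A" for A i k i' k'
    by (rule Rp_planes) (use that in \<open>auto simp: Qv_simps Rp_simps\<close>)
  show "i ~= k \<and> (\<forall>i' k'. ent Rp A i' k' = 1 --> i' = i \<and> k' = k)"
    if "A \<in> arrs Qv" "src Qv A = tgt Qv A" "ent Rp A i k = 1" for A i k
    by (rule Rp_loop) (use that in \<open>auto simp: Qv_simps\<close>)
  show "B \<in> arrs Qv \<and> src Qv B = tgt Qv A" if "A \<in> arrs Qv" "nxt A = Some B" for A B
    using nxt_arrs that unfolding Qv_simps by blast
  show "(\<forall>c\<in>arrs Qv. \<forall>i<rdim N. \<forall>k<rdim N. cyclic_deriv_ent Qv N c i k = 0) \<longleftrightarrow>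
    (\<forall>a\<in>arrs Qv. \<forall>b. nxt a = Some b --> (\<forall>i<rdim N. \<forall>k<rdim N. (\<Sum>m<rdim N. ent N b i m * ent N a m k) = 0))"
    for N :: "(arc, arrow) rep"
    by (rule relations_nxt)
  show "\<exists>l. \<forall>p. set p \<subseteq> arrs Qv \<and> length p \<ge> l --> (\<forall>i<rdim Rp. \<forall>k<rdim Rp. path_ent Rp p i k = 0)"
    by (rule Rp_nilpotent)
  show "ent Rp B i m ~= 1" if "A \<in> arrs Qv" "nxt A = Some B" "ent Rp A m k = 1" for A B i m k
    using Rp_relations that unfolding Qv_simps by blast
qed

lemma ent_inner:
  assumes p: "p < length L" "L ! p = (b, a)" and h: "half b a"
  shows "(\<exists>j. ent Rp (arw b a) j p = 1) \<longleftrightarrow> apx b a < w"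
proof
  have A: "arw b a \<in> quiver_arrows n \<tau>" unfolding arrs_eq using h by blast
  note m = arw_mem0[of b a]
  show "apx b a < w" if ex: "\<exists>j. ent Rp (arw b a) j p = 1"
  proof -
    obtain j where "ent Rp (arw b a) j p = 1" using ex by blast
    hence jl: "j < length L" "(dgp (L ! p), dgp (L ! j)) \<in> arw b a" using Rp_ent[OF A] by blast+
    obtain c d where cd: "L ! j = (c, d)" by (cases "L ! j")
    have "dg c d = dg (apx b a) a"
      using arw_functional[OF h m, of "dgp (L ! p)" "dgp (L ! j)"] jl p cd by simp
    thus ?thesis using dg_window_inj[of c d "apx b a" a u] L_CrD[OF jl(1) cd] L_CrD[OF p] halfD[OF h] by auto
  qed
  show "\<exists>j. ent Rp (arw b a) j p = 1" if "apx b a < w"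
    using arrow_fwd[OF p that] m p Rp_ent[OF A, of "Suc p" p] by auto
qed

lemma ent_outer:
  assumes p: "p < length L" "L ! p = (b, a)" and h: "half a (b + 3 * M)"
  shows "(\<exists>j. ent Rp (arw a (b + 3 * M)) j p = 1) \<longleftrightarrow> apx a (b + 3 * M) < u + 3 * M"
proof
  define z where "z = apx a (b + 3 * M)"
  have A: "arw a (b + 3 * M) \<in> quiver_arrows n \<tau>" unfolding arrs_eq using h by blast
  have m: "(dg b a, dg z (b + 3 * M)) \<in> arw a (b + 3 * M)"
    using arw_mem0[of a "b + 3 * M"] dg_flip[of a b] by (simp add: z_def)
  note C = L_CrD[OF p]
  have z: "a < z" "z < b + 3 * M" "D a z" "D z (b + 3 * M)" using halfD[OF h] by (auto simp: z_def)
  show "apx a (b + 3 * M) < u + 3 * M" if ex: "\<exists>j. ent Rp (arw a (b + 3 * M)) j p = 1"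
  proof (rule ccontr)
    obtain j where "ent Rp (arw a (b + 3 * M)) j p = 1" using ex by blast
    hence jl: "j < length L" "(dgp (L ! p), dgp (L ! j)) \<in> arw a (b + 3 * M)" using Rp_ent[OF A] by blast+
    obtain c d where cd: "L ! j = (c, d)" by (cases "L ! j")
    note C' = L_CrD[OF jl(1) cd]
    have e: "dg c d = dg z (b + 3 * M)"
      using arw_functional[OF h m, of "dgp (L ! p)" "dgp (L ! j)"] jl p cd by simp
    assume "\<not> apx a (b + 3 * M) < u + 3 * M"
    then consider "z = u + 3 * M" | "u < z - 3 * M" unfolding z_def by linarith
    thus False
    proof cases
      case 1
      hence "pt u \<in> dg c d" unfolding e by (simp add: dg_def pt_3)
      thus ?thesis using pt_neq[of u c] pt_neq[of u d] C' by (auto simp: dg_def)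
    next
      case 2
      have "dg c d = dg (z - 3 * M) b" using e dg_shift[of "z - 3 * M" 1 b] by simp
      thus ?thesis using dg_window_inj[of c d "z - 3 * M" b u] C C' z 2 by auto
    qed
  qed
  show "\<exists>j. ent Rp (arw a (b + 3 * M)) j p = 1" if zu: "apx a (b + 3 * M) < u + 3 * M"
  proof -
    have Db: "D b z" using D_flip[of z b] z by simp
    have "(b, z) \<in> Cr u w" using zu z C Db unfolding z_def[symmetric] by (auto simp: Cr_def)
    then obtain i where i: "i < length L" "L ! i = (b, z)" using L_surj by blast
    have ap: "apx b z = a" by (rule apx_eq) (use Db z C in auto)
    hence "w < apx b z" using C by simp
    note s = arrow_bwd[OF i this]
    have "p = Suc i" using s(2,3) ap p L_inj[of p "Suc i"] by simp
    moreover have "dgp (L ! i) = dg z (b + 3 * M)" using i dg_flip[of z b] by simp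
    ultimately have "ent Rp (arw a (b + 3 * M)) i p = 1" using Rp_ent[OF A, of i p] i p m by simp
    thus ?thesis ..
  qed
qed

text \<open>An arrow entering the arc counts exactly when the next arrow in its triangle annihilates
  \<open>z\<^sub>p\<close>, i.e. when the string does not continue from \<open>p\<close> along that
  arrow. These are the case distinctions in \<open>in_wt\<close> and \<open>out_wt\<close>.\<close>

lemma kill_monom:
  assumes p: "p < length L"
  shows "xinv (vtx Rp p) * (\<Prod>A | A \<in> arrs Qv \<and> tgt Qv A = vtx Rp p \<and> R.kills A p. xvar (src Qv A)) =
    g_wt u w (L ! p)"
proof -
  obtain b a where ba: "L ! p = (b, a)" by (cases "L ! p")
  note C = L_CrD[OF p ba]
  have D: "D b a" "proper b a" using L_proper[OF p ba] by auto
  have D': "D a (b + 3 * M)" "proper a (b + 3 * M)" using D D_flip by auto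
  define z z' where "z = apx b a" and "z' = apx a (b + 3 * M)"
  have z: "b < z" "z < a" "D b z" "D z a" using apx[OF D(1)] D(2) by (auto simp: z_def)
  have z': "a < z'" "z' < b + 3 * M" "D a z'" "D z' (b + 3 * M)" using apx[OF D'(1)] D'(2) by (auto simp: z'_def)
  have v: "vtx Rp p = arc b a" using p ba by (simp add: Rp_simps)
  have k1: "R.kills (arw z (b + 3 * M)) p \<longleftrightarrow> \<not> z < w" if c: "b + 2 <= z"
  proof (cases "z + 2 <= a")
    case True
    hence "half b a" using D by (simp add: half_def z_def)
    thus ?thesis using ent_inner[OF p ba] in_half(5)[OF D] c True by (auto simp: R.kills_def z_def)
  next
    case False
    thus ?thesis using in_half(5)[OF D] c C by (auto simp: R.kills_def z_def)
  qed
  have k2: "R.kills (arw z' (a + 3 * M)) p \<longleftrightarrow> \<not> z' < u + 3 * M" if c: "a + 2 <= z'"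
  proof (cases "z' + 2 <= b + 3 * M")
    case True
    hence "half a (b + 3 * M)" using D' by (simp add: half_def z'_def)
    thus ?thesis using ent_outer[OF p ba] in_half(5)[OF D'] c True by (auto simp: R.kills_def z'_def)
  next
    case False
    thus ?thesis using in_half(5)[OF D'] c C by (auto simp: R.kills_def z'_def)
  qed
  have "(\<Prod>A | A \<in> {A. A \<in> quiver_arrows n \<tau> \<and> snd ` A = arc b a} \<and> R.kills A p. xvar (fst ` A)) =
      (if b + 2 <= z \<and> R.kills (arw z (b + 3 * M)) p then xvar (fst ` arw z (b + 3 * M)) else 1) *
      (if a + 2 <= z' \<and> R.kills (arw z' (a + 3 * M)) p then xvar (fst ` arw z' (a + 3 * M)) else 1)"
    unfolding z_def z'_def by (rule prod_two[OF in_arrows[OF D]])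
  also have "\<dots> = (if b + 2 <= z \<and> \<not> z < w then xvar (arc b z) else 1) *
      (if a + 2 <= z' \<and> \<not> z' < u + 3 * M then xvar (arc a z') else 1)"
    using k1 k2 in_half(3)[OF D] in_half(3)[OF D'] by (auto simp: z_def z'_def)
  also have "\<dots> = in_wt w (b, a) * out_wt u (b, a)"
    using xwt_D[of b z] xwt_D[of a z'] z z' D D' by (auto simp: in_wt_def out_wt_def z_def z'_def)
  finally have "(\<Prod>A | A \<in> arrs Qv \<and> tgt Qv A = vtx Rp p \<and> R.kills A p. xvar (src Qv A)) =
      in_wt w (b, a) * out_wt u (b, a)"
    by (simp add: v Qv_simps conj_assoc)
  moreover have "xwi b a = xinv (arc b a)" using xwi_D D by simp
  ultimately show ?thesis by (simp add: v g_wt_def ba mult.assoc)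
qed

lemma closed_set_iff:
  "R.closed_set S \<longleftrightarrow> S \<subseteq> {..<length L} \<and>
     (\<forall>k. Suc k < length L --> (if dir k then k \<in> S --> Suc k \<in> S else Suc k \<in> S --> k \<in> S))"
proof -
  have ex: "\<exists>A\<in>quiver_arrows n \<tau>. (s, t) \<in> A" if l: "(s, t) \<in> lifted_arrows n \<tau>" for s t
  proof -
    have "arrow_orbit n s t \<in> quiver_arrows n \<tau>" unfolding quiver_arrows_def using l by blast
    thus ?thesis using arrow_mem l by blast
  qed
  show ?thesis
  proof
    assume c: "R.closed_set S"
    have "if dir k then k \<in> S --> Suc k \<in> S else Suc k \<in> S --> k \<in> S" if k: "Suc k < length L" for k
    proof (cases "dir k")
      case True
      obtain A where A: "A \<in> quiver_arrows n \<tau>" "(dgp (L ! k), dgp (L ! Suc k)) \<in> A" using ex[OF lifted_fwd[OF k True]] by blast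
      hence "ent Rp A (Suc k) k = 1" using Rp_ent k by simp
      thus ?thesis using c A(1) True unfolding R.closed_set_def Qv_simps by auto
    next
      case False
      obtain A where A: "A \<in> quiver_arrows n \<tau>" "(dgp (L ! Suc k), dgp (L ! k)) \<in> A" using ex[OF lifted_bwd[OF k False]] by blast
      hence "ent Rp A k (Suc k) = 1" using Rp_ent k by simp
      thus ?thesis using c A(1) False unfolding R.closed_set_def Qv_simps by auto
    qed
    thus "S \<subseteq> {..<length L} \<and>
     (\<forall>k. Suc k < length L --> (if dir k then k \<in> S --> Suc k \<in> S else Suc k \<in> S --> k \<in> S))"
      using c unfolding R.closed_set_def Rp_simps by blast
  next
    assume c: "S \<subseteq> {..<length L} \<and>
     (\<forall>k. Suc k < length L --> (if dir k then k \<in> S --> Suc k \<in> S else Suc k \<in> S --> k \<in> S))"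
    have "i \<in> S" if A: "A \<in> quiver_arrows n \<tau>" "ent Rp A i k = 1" "k \<in> S" for A i k
      by (metis A Rp_ent Rp_ent_dir c)
    thus "R.closed_set S" unfolding R.closed_set_def Qv_simps Rp_simps using c by blast
  qed
qed

lemma closed_set_image: "S \<subseteq> {..<length L} ==> closedOn w (Cr u w) ((!) L ` S) \<longleftrightarrow> R.closed_set S"
proof -
  assume S: "S \<subseteq> {..<length L}"
  have mem: "L ! k \<in> (!) L ` S \<longleftrightarrow> k \<in> S" if "k < length L" for k using that S L_inj by (auto simp: image_iff)
  have "closedOn w (Cr u w) ((!) L ` S) \<longleftrightarrow> (!) L ` S \<subseteq> Cr u w \<and> (\<forall>k<length L. nx w (L ! k) \<in> Cr u w -->
     (if dir k then L ! k \<in> (!) L ` S --> nx w (L ! k) \<in> (!) L ` S else nx w (L ! k) \<in> (!) L ` S --> L ! k \<in> (!) L ` S))"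
    unfolding closedOn_def dir_def all_set_conv_all_nth[of L, unfolded L_set] ..
  also have "\<dots> \<longleftrightarrow> (\<forall>k. Suc k < length L --> (if dir k then k \<in> S --> Suc k \<in> S else Suc k \<in> S --> k \<in> S))"
    (is "?l \<and> (\<forall>k<length L. ?c k --> ?p k) \<longleftrightarrow> (\<forall>k. Suc k < length L --> ?q k)")
  proof -
    have l: ?l using S L_Cr by auto
    have c: "?c k \<longleftrightarrow> Suc k < length L" if "k < length L" for k using nx_L(1)[OF that] nx_in by blast
    have p: "?p k \<longleftrightarrow> ?q k" if k: "Suc k < length L" for k
    proof -
      have "nx w (L ! k) = L ! Suc k" using nx_L(2)[OF _ nx_in[OF k]] k by simp
      thus ?thesis using mem[OF k] mem[of k] k by simp
    qed
    have "k < length L" if "Suc k < length L" for k using that by simp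
    thus ?thesis using l c p by blast
  qed
  finally show ?thesis using closed_set_iff S by simp
qed

lemma CC_crossing:
  assumes f: "is_frieze f" and nD: "\<not> D u w"
  shows "CC Qv (Rp, \<lambda>_. 0) = f u w"
proof -
  obtain b a where "u < b \<and> b < w \<and> w < a \<and> a < u + 3 * M \<and> D b a" using ex_crossing[OF uw nD uw_len] by blast
  hence ne: "Cr u w ~= {}" by (auto simp: Cr_def)
  have bij: "bij_betw ((!) L) {..<length L} (Cr u w)" using L_distinct L_set by (intro bij_betw_nth) auto
  have inj: "inj_on ((!) L) {..<length L}" using bij by (rule bij_betw_imp_inj_on)
  have "CC Qv (Rp, \<lambda>_. 0) = (\<Prod>p<length L. g_wt u w (L ! p)) * (\<Sum>S | R.closed_set S. \<Prod>p\<in>S. y_wt (L ! p))"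
  proof -
    have 1: "(\<Prod>p<rdim Rp. xinv (vtx Rp p) * (\<Prod>A | A \<in> arrs Qv \<and> tgt Qv A = vtx Rp p \<and> R.kills A p. xvar (src Qv A))) =
        (\<Prod>p<length L. g_wt u w (L ! p))"
      using kill_monom Rp_simps by simp
    have 2: "(\<Sum>S | R.closed_set S. \<Prod>p\<in>S. y_monom Qv (vtx Rp p)) = (\<Sum>S | R.closed_set S. \<Prod>p\<in>S. y_wt (L ! p))"
    proof (rule sum.cong[OF refl], rule prod.cong[OF refl])
      fix S p assume "S \<in> {S. R.closed_set S}" "p \<in> S"
      hence p: "p < length L" using closed_set_iff by auto
      obtain b a where ba: "L ! p = (b, a)" by (cases "L ! p")
      show "y_monom Qv (vtx Rp p) = y_wt (L ! p)"
        using y_monom_eq L_proper[OF p ba] p ba by (simp add: Rp_simps)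
    qed
    show ?thesis unfolding R.CC_thin 1 2 ..
  qed
  also have "(\<Prod>p<length L. g_wt u w (L ! p)) = (\<Prod>s\<in>Cr u w. g_wt u w s)"
    by (rule prod.reindex_bij_betw[OF bij])
  also have "(\<Sum>S | R.closed_set S. \<Prod>p\<in>S. y_wt (L ! p)) = (\<Sum>T | closedOn w (Cr u w) T. prod y_wt T)"
  proof (rule sum.reindex_cong[symmetric])
    show "inj_on ((`) ((!) L)) {S. R.closed_set S}"
      using inj_on_image_eq_iff[OF inj] closed_set_iff by (intro inj_onI) blast
    show "{T. closedOn w (Cr u w) T} = (`) ((!) L) ` {S. R.closed_set S}"
    proof (intro equalityI subsetI)
      fix T assume T: "T \<in> {T. closedOn w (Cr u w) T}"
      hence "T \<subseteq> (!) L ` {..<length L}" using bij_betw_imp_surj_on[OF bij] by (simp add: closedOn_def)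
      then obtain S where "S \<subseteq> {..<length L}" "T = (!) L ` S" using subset_imageE by metis
      thus "T \<in> (`) ((!) L) ` {S. R.closed_set S}" using T closed_set_image by blast
    next
      fix T assume "T \<in> (`) ((!) L) ` {S. R.closed_set S}"
      then obtain S where "R.closed_set S" "T = (!) L ` S" by blast
      thus "T \<in> {T. closedOn w (Cr u w) T}" using closed_set_image closed_set_iff by blast
    qed
    fix S assume "S \<in> {S. R.closed_set S}"
    hence "inj_on ((!) L) S" using inj closed_set_iff inj_on_subset by blast
    thus "prod y_wt ((!) L ` S) = (\<Prod>p\<in>S. y_wt (L ! p))" by (simp add: prod.reindex)
  qed
  also have "(\<Prod>s\<in>Cr u w. g_wt u w s) * \<dots> = f u w"
    using frieze_expansion[OF f uw ne] by simp
  finally show ?thesis .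
qed

end

lemma CC_decoration:
  assumes "finite (verts Q)"
  shows "CC Q (N, V) = lmonom (verts Q) (\<lambda>i. int (V i)) * CC Q (N, \<lambda>_. 0)"
proof -
  have g: "g_vec Q (N, V) = (\<lambda>i. int (V i) + g_vec Q (N, \<lambda>_. 0) i)" by (auto simp: g_vec_def)
  show ?thesis unfolding CC_def g lmonom_add[OF assms] fst_conv by (simp only: mult.assoc)
qed

section \<open>Caldero-Chapoton functions of arcs as frieze values\<close>

context orbifold_triangulation
begin

text \<open>The zero module has only the empty closed set, so the whole function comes from the
  decoration.\<close>

lemma CC_neg_simple:
  assumes v: "v \<in> \<tau>"
  shows "CC Qv (neg_simple v) = xvar v"
proof -
  interpret Z: thin_module Qv "zero_rep :: (arc, arrow) rep" "\<lambda>_. True" nxt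
  proof
    show "finite (verts Qv)" by (simp add: Qv_simps finite_triangulation)
    show "finite (arrs Qv)" by (simp add: Qv_simps finite_arrs)
    show "src Qv A \<in> verts Qv \<and> tgt Qv A \<in> verts Qv" if "A \<in> arrs Qv" for A
      using that arrow_ends unfolding Qv_simps by blast
    show "B \<in> arrs Qv \<and> src Qv B = tgt Qv A" if "A \<in> arrs Qv" "nxt A = Some B" for A B
      using nxt_arrs that unfolding Qv_simps by blast
    show "(\<forall>c\<in>arrs Qv. \<forall>i<rdim N. \<forall>k<rdim N. cyclic_deriv_ent Qv N c i k = 0) \<longleftrightarrow>
      (\<forall>a\<in>arrs Qv. \<forall>b. nxt a = Some b --> (\<forall>i<rdim N. \<forall>k<rdim N. (\<Sum>m<rdim N. ent N b i m * ent N a m k) = 0))"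
      for N :: "(arc, arrow) rep"
      by (rule relations_nxt)
  qed (simp_all add: zero_rep_def)
  have "Z.closed_set S \<longleftrightarrow> S = {}" for S unfolding Z.closed_set_def by (auto simp: zero_rep_def)
  hence "{S. Z.closed_set S} = {{}}" by auto
  moreover have "rdim (zero_rep :: (arc, arrow) rep) = 0" by (simp add: zero_rep_def)
  ultimately have 1: "CC Qv (zero_rep, \<lambda>_. 0) = 1" unfolding Z.CC_thin by simp
  have fin: "finite (verts Qv)" and vv: "v \<in> verts Qv" using v finite_triangulation by (simp_all add: Qv_simps)
  have "(\<lambda>i. int (if i = v then 1 else 0)) = (\<lambda>i. if i = v then 1 else 0)" by auto
  thus ?thesis unfolding neg_simple_def CC_decoration[OF fin, of _ "\<lambda>u. if u = v then 1 else 0"] 1 using lmonom_single[OF fin vv, of 1] by simp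
qed

theorem CC_arc_rep:
  assumes f: "is_frieze f" and \<alpha>: "\<forall>i \<in> arcs n. {fst (\<alpha> i), snd (\<alpha> i)} \<in> i"
    and xy: "short x y" "x + 2 <= y"
  shows "CC Qv (arc_rep n \<tau> \<alpha> (arc x y)) = f x y"
proof (cases "arc x y \<in> \<tau>")
  case True
  have D: "D x y" using True arc_mem_iff shortD[OF xy(1)] by blast
  moreover have "proper x y" using xy M3 by (simp add: short_def)
  ultimately have "f x y = xvar (arc x y)" using friezeD(7)[OF f D] xwt_D by simp
  thus ?thesis using True CC_neg_simple by (simp add: arc_rep_def)
next
  case False
  let ?i = "arc x y"
  have "?i \<in> arcs n" unfolding arcs_iff using xy by blast
  hence "{fst (\<alpha> ?i), snd (\<alpha> ?i)} \<in> ?i" using \<alpha> by blast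
  then obtain k where k: "{fst (\<alpha> ?i), snd (\<alpha> ?i)} = dg (x + k * M) (y + k * M)" unfolding arc_eq_set by blast
  have "\<exists>u w. fst (\<alpha> ?i) = pt u \<and> snd (\<alpha> ?i) = pt w \<and> u < w \<and> w < u + 3 * M \<and>
      (w <= u + M \<or> u + 2 * M <= w) \<and> arc u w = ?i \<and> f u w = f x y"
  proof -
    from k consider "fst (\<alpha> ?i) = pt (x + k * M)" "snd (\<alpha> ?i) = pt (y + k * M)"
      | "fst (\<alpha> ?i) = pt (y + k * M)" "snd (\<alpha> ?i) = pt (x + k * M)"
      unfolding dg_def doubleton_eq_iff by blast
    thus ?thesis
    proof cases
      case 1
      thus ?thesis using arc_shift friezeD(4)[OF f] shortD[OF xy(1)] xy(1)
        by (intro exI[of _ "x + k * M"] exI[of _ "y + k * M"]) (auto simp: short_def)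
    next
      case 2
      \<comment> \<open>A lift chosen with the opposite orientation is the complementary pair of
        length at least \<open>2 * M\<close>; the frieze has the same value on it.\<close>
      have "arc (y + k * M) (x + k * M + 3 * M) = ?i" using arc_flip arc_shift by simp
      moreover have "f (y + k * M) (x + k * M + 3 * M) = f x y" using friezeD(5)[OF f] friezeD(4)[OF f] by simp
      ultimately show ?thesis using 2 shortD[OF xy(1)] xy(1) pt_3(1)
        by (intro exI[of _ "y + k * M"] exI[of _ "x + k * M + 3 * M"]) (auto simp: short_def)
    qed
  qed
  then obtain u w where UW: "fst (\<alpha> ?i) = pt u" "snd (\<alpha> ?i) = pt w" "u < w" "w < u + 3 * M"
      "w <= u + M \<or> u + 2 * M <= w" "arc u w = ?i" "f u w = f x y" by blast
  obtain l where "x = u + l * M \<and> y = w + l * M \<or> x = w + l * M \<and> y = u + (l + 3) * M"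
    using arc_eq_iff_flip[OF UW(3,4)] shortD[OF xy(1)] UW(6) by metis
  hence "proper u w" using xy M3 by (auto simp: short_def distrib_right)
  hence nD: "\<not> D u w" using False arc_mem_iff[OF UW(3,4)] UW(6) by simp
  obtain L where L: "distinct L" "set L = Cr u w" "sorted_wrt nested L" using ex_crossing_list by blast
  interpret crossing_list n \<tau> u w L by unfold_locales (use UW L in auto)
  have "arc_rep n \<tau> \<alpha> ?i = (Rp, \<lambda>_. 0)"
    using False crossed_eq[OF UW(3,4) L] UW(1,2) by (simp add: arc_rep_def Rp_def Let_def)
  thus ?thesis using CC_crossing[OF f nD] UW(7) by simp
qed

end

section \<open>Flips\<close>

context orbifold_triangulation
begin

lemma compatible_Cr:
  assumes i: "i \<in> \<tau>" and uw: "u < w" "w < u + 3 * M"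
  shows "compatible (arc u w) i \<longleftrightarrow> \<not> (\<exists>b a. (b, a) \<in> Cr u w \<and> arc b a = i)"
proof -
  have "i \<in> arcs n" using i triangulation unfolding is_triangulation_def by blast
  then obtain c d where cd: "i = arc c d" unfolding arcs_iff by blast
  show ?thesis
  proof
    assume co: "compatible (arc u w) i"
    show "\<not> (\<exists>b a. (b, a) \<in> Cr u w \<and> arc b a = i)"
      by (metis CrD crosses_dg_dg dg_self_in_arc co compatible_def assms)
  next
    assume no: "\<not> (\<exists>b a. (b, a) \<in> Cr u w \<and> arc b a = i)"
    show "compatible (arc u w) i" unfolding compatible_def
    proof (intro ballI notI)
      fix s t assume st: "s \<in> arc u w" "t \<in> i" "crosses s t"
      obtain k where k: "s = dg (u + k * M) (w + k * M)" using st(1) unfolding arc_eq_set by blast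
      obtain x y where xy: "t = dg x y" using st(2) unfolding cd arc_eq_set by blast
      have uwk: "u + k * M < w + k * M" "w + k * M < u + k * M + 3 * M" using uw by auto
      obtain b a where ba: "u + k * M < b" "b < w + k * M" "w + k * M < a" "a < u + k * M + 3 * M" "t = dg b a"
        using st(3) unfolding k xy crosses_dg_dg[OF uwk] by blast
      have "dg b a \<in> \<Union>\<tau>" using st(2) i ba(5) by blast
      hence "D b a" using dg_mem[of b a] ba by auto
      hence "D (b - k * M) (a - k * M)" using D_shift[of "b - k * M" k "a - k * M"] by simp
      hence "(b - k * M, a - k * M) \<in> Cr u w" using ba by (auto simp: Cr_def)
      moreover have "arc b a = i" using arc_of_member[of b a c d] st(2) ba(5) cd by simp
      hence "arc (b - k * M) (a - k * M) = i" using arc_shift[of "b - k * M" k "a - k * M"] by simp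
      ultimately show False using no by blast
    qed
  qed
qed

text \<open>Two sides of a triangle are in the same orbit only for the central triangle.\<close>
lemma pred_cases_arc:
  assumes s: "(b, a) \<in> Cr x y" and all: "\<And>c d. (c, d) \<in> Cr x y ==> arc c d = j"
  obtains "apx a (b + 3 * M) = x + 3 * M" "Pre x y (b, a) = {(b, a)}"
  | "a = b + M" "(b - M, a) \<in> Cr x y" "Pre x y (b, a) = insert (b, a) (Pre x y (b - M, a))"
  | "a = b + M" "(b, b + 2 * M) \<in> Cr x y" "Pre x y (b, a) = insert (b, a) (Pre x y (b, b + 2 * M))"
proof -
  note C = CrD[OF s]
  from s show ?thesis
  proof (cases rule: pred_cases)
    case 1
    thus ?thesis using that(1) by blast
  next
    case 2
    have "\<exists>c. c = apx a (b + 3 * M) - 3 * M" by blast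
    then obtain c where c: "apx a (b + 3 * M) - 3 * M = c" by blast
    note 2 = 2[unfolded c]
    note C2 = CrD[OF 2(2)]
    have h: "half c a" using C2 C 2(3,5) unfolding half_def by auto
    have "arc c a = arc (apx c a) a" using all[OF 2(2)] all[OF s] unfolding 2(5) by simp
    from loop_half[OF h this] have e: "c = b - M" "a = b + M" unfolding 2(5) by linarith+
    show ?thesis by (rule that(2)[OF e(2)]) (use 2(2,7) in \<open>simp_all only: e(1)\<close>)
  next
    case 3
    have "\<exists>z. z = apx a (b + 3 * M)" by blast
    then obtain z where z: "apx a (b + 3 * M) = z" by blast
    note 3 = 3[unfolded z]
    note C3 = CrD[OF 3(2)]
    have D: "D b z" "proper b z" "b + 2 <= apx b z" using C3 C 3(3,5) by auto
    note h = in_half[OF D, unfolded 3(5)]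
    have "arc b a = arc b z" using all[OF 3(2)] all[OF s] by simp
    hence "arc a (b + 3 * M) = arc (apx a (b + 3 * M)) (b + 3 * M)" unfolding h(2) arc_flip .
    from loop_half[OF h(1) this] have e: "a = b + M" "z = b + 2 * M" unfolding z by linarith+
    show ?thesis by (rule that(3)[OF e(1)]) (use 3(2,7) in \<open>simp_all only: e(2)\<close>)
  qed
qed

text \<open>Such an arc crosses only lifts of \<open>j\<close>, so it can be reconstructed backwards
  from its last crossing.\<close>

lemma new_arc:
  assumes i: "i \<in> arcs n" "i \<notin> \<tau>" and co: "\<And>i'. i' \<in> \<tau> ==> i' ~= j ==> compatible i i'"
  obtains x y b a where "i = arc x y" "short x y" "(b, a) \<in> Cr x y" "apx b a = y"
    "Pre x y (b, a) = Cr x y" "\<And>c d. (c, d) \<in> Cr x y ==> arc c d = j"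
proof -
  obtain x y where xy: "short x y" "x + 2 <= y" "i = arc x y" using i(1) unfolding arcs_iff by blast
  have l: "x < y" "y < x + 3 * M" using shortD[OF xy(1)] by auto
  have p: "proper x y" using xy M3 by (simp add: short_def)
  have nD: "\<not> D x y" using i(2) arc_mem_iff[OF l] xy(3) p by blast
  have all: "arc c d = j" if c: "(c, d) \<in> Cr x y" for c d
  proof (rule ccontr)
    assume "arc c d ~= j"
    have "arc c d \<in> \<tau>" using arc_mem_iff[of c d] CrD[OF c] by auto
    thus False using co[OF _ \<open>arc c d ~= j\<close>] compatible_Cr[OF _ l] c xy(3) by blast
  qed
  have "y <= x + M \<or> x + 2 * M <= y" using xy(1) by (simp add: short_def)
  then obtain b a where "x < b \<and> b < y \<and> y < a \<and> a < x + 3 * M \<and> D b a" using ex_crossing[OF l nD] by blast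
  hence "Cr x y ~= {}" by (auto simp: Cr_def)
  then obtain s where "s \<in> Cr x y" "inn s = y" "Pre x y s = Cr x y" by (rule ex_last_crossing)
  thus ?thesis using that[of x y "fst s" "snd s"] xy all by simp
qed

text \<open>The definite description in \<open>flip\<close> is settled once \<open>j'\<close> is the
  only arc outside the triangulation that is compatible with everything except possibly
  \<open>j\<close>.\<close>

lemma flip_unique:
  assumes j: "j \<in> \<tau>" and j': "j' \<in> arcs n" "\<not> compatible j' j" "\<And>i. i \<in> \<tau> ==> i ~= j ==> compatible j' i"
    and new: "\<And>i. i \<in> arcs n ==> i \<notin> \<tau> ==> (\<And>i'. i' \<in> \<tau> ==> i' ~= j ==> compatible i i') ==> i = j'"
  shows "flip n \<tau> j = j'"
proof -
  have sym: "compatible i i' \<longleftrightarrow> compatible i' i" for i i' unfolding compatible_def using crosses_commute by blast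
  have tri: "\<tau> \<subseteq> arcs n" "\<And>i i'. i \<in> \<tau> ==> i' \<in> \<tau> ==> compatible i i'"
    using triangulation unfolding is_triangulation_def by blast+
  have self: "compatible i i" if "i \<in> arcs n" for i using that unfolding arcs_def compatible_def by blast
  show ?thesis unfolding flip_def
  proof (rule the_equality)
    show "j' ~= j \<and> is_triangulation n (\<tau> - {j} \<union> {j'})"
    proof
      show "j' ~= j" using j'(2) self[OF j'(1)] by blast
      show "is_triangulation n (\<tau> - {j} \<union> {j'})"
        unfolding is_triangulation_def
      proof (intro conjI ballI impI)
        show "\<tau> - {j} \<union> {j'} \<subseteq> arcs n" using tri(1) j'(1) by blast
        show "compatible i i'" if "i \<in> \<tau> - {j} \<union> {j'}" "i' \<in> \<tau> - {j} \<union> {j'}" for i i'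
          using that tri(2) j'(3) self[OF j'(1)] sym by blast
        fix i assume i: "i \<in> arcs n" "\<forall>i' \<in> \<tau> - {j} \<union> {j'}. compatible i i'"
        show "i \<in> \<tau> - {j} \<union> {j'}"
        proof (cases "i \<in> \<tau>")
          case True
          thus ?thesis using i(2) j'(2) sym by blast
        next
          case False
          thus ?thesis using new[OF i(1)] i(2) by blast
        qed
      qed
    qed
    fix i assume i: "i ~= j \<and> is_triangulation n (\<tau> - {j} \<union> {i})"
    hence i': "i \<in> arcs n" "\<And>i'. i' \<in> \<tau> ==> i' ~= j ==> compatible i i'"
      unfolding is_triangulation_def by blast+
    have "i \<notin> \<tau>"
    proof
      assume "i \<in> \<tau>"
      hence "\<forall>i' \<in> \<tau> - {j} \<union> {i}. compatible j i'" using tri(2)[OF j] i by blast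
      moreover have "j \<in> arcs n" using tri(1) j by blast
      ultimately have "j \<in> \<tau> - {j} \<union> {i}" using i unfolding is_triangulation_def by blast
      thus False using i by blast
    qed
    thus "i = j'" using new[OF i'(1)] i'(2) by blast
  qed
qed

text \<open>The replacement is the other diagonal of the quadrilateral around \<open>j\<close>. For
  uniqueness, two consecutive crossings with lifts of \<open>j\<close> would be sides of the central
  triangle and \<open>j\<close> would be pending. So a new arc has a single crossing, and both its
  ends are apexes over it.\<close>

lemma flip_nonpending:
  assumes D: "D b a" "b + 2 <= a" "a < b + M"
  defines "z \<equiv> apx b a" and "z' \<equiv> apx a (b + 3 * M)"
  shows "flip n \<tau> (arc b a) = arc z z'" "z + 2 <= z'" "z' <= z + M \<or> z + 2 * M <= z'" "z' < z + 3 * M"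
proof -
  have p: "proper b a" using D M3 by linarith
  have D': "D a (b + 3 * M)" "a + 2 <= b + 3 * M" using D D_flip p by auto
  have t: "b < z" "z < a" "D b z" "D z a" using apx[OF D(1,2)] by (auto simp: z_def)
  have t': "a < z'" "z' < b + 3 * M" "D a z'" "D z' (b + 3 * M)" using apx[OF D'] by (auto simp: z'_def)
  show zz: "z + 2 <= z'" "z' < z + 3 * M" using t t' by auto
  show len: "z' <= z + M \<or> z + 2 * M <= z'" using D_short[OF t'(3)] D_short[OF t'(4)] t t' D by linarith
  have z: "z < z'" using zz by simp
  have Cr_zz: "c = a \<and> d = b + 3 * M" if c: "(c, d) \<in> Cr z z'" for c d
  proof -
    note C = CrD[OF c]
    have Dz: "D (b + 3 * M) (z + 3 * M)" using t(3) D_shift[of b 3 z] by simp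
    have "c = a"
      using D_noncross[OF t(4), of c d] D_noncross[OF t'(3), of c d] C t t' by (cases c a rule: linorder_cases) auto
    moreover have "d = b + 3 * M"
    proof (cases d "b + 3 * M" rule: linorder_cases)
      case less
      thus ?thesis using D_noncross[of c d z' "b + 3 * M"] C t' D' \<open>c = a\<close> D by auto
    next
      case greater
      thus ?thesis using D_noncross[of c d "b + 3 * M" "z + 3 * M"] C t' Dz \<open>c = a\<close> t D by auto
    qed simp
    ultimately show ?thesis ..
  qed
  show "flip n \<tau> (arc b a) = arc z z'"
  proof (rule flip_unique)
    show j: "arc b a \<in> \<tau>" using arc_mem_iff[of b a] D p by auto
    obtain x y where xy: "short x y" "dg x y = dg z z'" using ex_short[OF z zz(2) len] by blast
    have "dg x y \<in> diagonals n" unfolding xy(2) diagonal_iff[OF z zz(2)] using zz(1) t t' by auto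
    hence "x + 2 <= y" using diagonal_iff[of x y] shortD[OF xy(1)] by blast
    thus "arc z z' \<in> arcs n" unfolding arcs_iff using xy by (intro exI[of _ x] exI[of _ y]) (simp add: arc_def)
    have "(a, b + 3 * M) \<in> Cr z z'" using t t' D' by (auto simp: Cr_def)
    moreover have fl: "arc a (b + 3 * M) = arc b a" by (rule arc_flip)
    ultimately show "\<not> compatible (arc z z') (arc b a)" using compatible_Cr[OF j z zz(2)] by blast
    show "compatible (arc z z') i" if "i \<in> \<tau>" "i ~= arc b a" for i
      using compatible_Cr[OF that(1) z zz(2)] Cr_zz that(2) fl by blast
    fix i assume i: "i \<in> arcs n" "i \<notin> \<tau>" "\<And>i'. i' \<in> \<tau> ==> i' ~= arc b a ==> compatible i i'"
    from i obtain x y c d where xy: "i = arc x y" "short x y" "(c, d) \<in> Cr x y" "apx c d = y"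
      "Pre x y (c, d) = Cr x y" "\<And>c d. (c, d) \<in> Cr x y ==> arc c d = arc b a" by (rule new_arc) blast+
    note C = CrD[OF xy(3)]
    have cd: "c < d" "d < c + 3 * M" using C by auto
    have ba: "b < a" "a < b + 3 * M" using D p by auto
    \<comment> \<open>This excludes a preceding crossing, because \<open>j\<close> is not
      pending.\<close>
    have "d ~= c + M"
    proof
      assume d: "d = c + M"
      obtain k where "c = b + k * M \<and> d = a + k * M \<or> c = a + k * M \<and> d = b + (k + 3) * M"
        using arc_eq_iff_flip[OF ba cd] xy(6)[OF xy(3)] by metis
      hence "a = b + M \<or> a = b + 2 * M" using d by (auto simp: algebra_simps)
      thus False using D M3 by auto
    qed
    from xy(3) xy(6) have o: "apx d (c + 3 * M) = x + 3 * M"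
      by (rule pred_cases_arc) (use \<open>d ~= c + M\<close> in auto)
    have e: "i = arc (apx c d) (apx d (c + 3 * M))" unfolding o xy(4) using xy(1) arc_flip by simp
    obtain k where "c = b + k * M \<and> d = a + k * M \<or> c = a + k * M \<and> d = b + (k + 3) * M"
      using arc_eq_iff_flip[OF ba cd] xy(6)[OF xy(3)] by metis
    thus "i = arc z z'"
    proof
      assume k: "c = b + k * M \<and> d = a + k * M"
      hence "apx c d = z + k * M" using apx_shift[OF D(1,2)] by (simp add: z_def)
      moreover have c3: "c + 3 * M = b + 3 * M + k * M" using k by simp
      have "apx d (c + 3 * M) = z' + k * M" unfolding c3 conjunct2[OF k] z'_def by (rule apx_shift[OF D'])
      ultimately show ?thesis unfolding e by (simp add: arc_shift)
    next
      assume k: "c = a + k * M \<and> d = b + (k + 3) * M"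
      hence d: "d = b + 3 * M + k * M" by (simp add: algebra_simps)
      have "apx c d = z' + k * M" unfolding d conjunct1[OF k] z'_def by (rule apx_shift[OF D'])
      moreover have c3: "c + 3 * M = a + (k + 3) * M" using k by (simp add: algebra_simps)
      have "apx d (c + 3 * M) = z + (k + 3) * M" unfolding c3 conjunct2[OF k] z_def by (rule apx_shift[OF D(1,2)])
      moreover have "z + (k + 3) * M = z + 3 * M + k * M" by (simp add: algebra_simps)
      ultimately show ?thesis unfolding e by (simp add: arc_shift arc_flip)
    qed
  qed
qed

text \<open>The new arc is the loop at the third vertex \<open>z\<close> of the triangle adjoining
  the monogon. Its lift from \<open>z\<close> to \<open>z + M\<close> enters the central triangle
  and crosses two lifts of \<open>j\<close>.\<close>

lemma flip_pending:
  assumes E: "D v (v + M)"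
  defines "z \<equiv> apx v (v + M)"
  shows "flip n \<tau> (arc v (v + M)) = arc z (z + M)"
proof -
  have M: "0 < M" "3 <= M" using M3 by auto
  have E2: "v + 2 <= v + M" using M3 by simp
  have t: "v < z" "z < v + M" "D v z" "D z (v + M)" using apx[OF E E2] by (auto simp: z_def)
  have sh: "D (p + k * M) (q + k * M)" if "D p q" for p q k using that D_shift by simp
  have s1: "D (v + M) (z + M)" "D (z + M) (v + 2 * M)" "D (v + M) (v + 2 * M)"
    using sh[OF t(3), of 1] sh[OF t(4), of 1] sh[OF E, of 1] by (simp_all add: algebra_simps)
  have s3: "D (v + 2 * M) (v + 3 * M)" "D (v + 3 * M) (z + 3 * M)" 
    using sh[OF E, of 2] sh[OF t(3), of 3] by (simp_all add: algebra_simps)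
  have arc_v: "arc (v + M) (v + 2 * M) = arc v (v + M)" "arc (v + M) (v + 3 * M) = arc v (v + M)"
    using arc_shift[of v 1 "v + M"] arc_flip[of "v + M" v] by (simp_all add: algebra_simps)
  have Cr_zz: "arc c d = arc v (v + M)" if c: "(c, d) \<in> Cr z (z + M)" for c d
  proof -
    note C = CrD[OF c]
    have Dcd: "D c d" using C by blast
    have c': "c = v + M"
      using D_noncross[OF t(4) Dcd] D_noncross[OF s1(1) Dcd] C t by (cases c "v + M" rule: linorder_cases) auto
    have "\<not> (z + M < d \<and> d < v + 2 * M)" using D_noncross[OF Dcd s1(2)] C c' t by auto
    moreover have "\<not> (v + 2 * M < d \<and> d < v + 3 * M)" using D_noncross[OF Dcd s3(1)] C c' t M by auto
    moreover have "\<not> (v + 3 * M < d)" using D_noncross[OF Dcd s3(2)] C c' t M by auto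
    ultimately have "d = v + 2 * M \<or> d = v + 3 * M" using C by linarith
    thus ?thesis using c' arc_v by auto
  qed
  have zl: "z < z + M" "z + M < z + 3 * M" using M by auto
  show ?thesis
  proof (rule flip_unique)
    show j: "arc v (v + M) \<in> \<tau>" using arc_mem_iff[of v "v + M"] E M by auto
    show "arc z (z + M) \<in> arcs n" unfolding arcs_iff using M by (intro exI[of _ z] exI[of _ "z + M"]) (simp add: short_def)
    have "(v + M, v + 2 * M) \<in> Cr z (z + M)" using t s1 M by (auto simp: Cr_def)
    thus "\<not> compatible (arc z (z + M)) (arc v (v + M))" using compatible_Cr[OF j zl] arc_v by blast
    show "compatible (arc z (z + M)) i" if "i \<in> \<tau>" "i ~= arc v (v + M)" for i
      using compatible_Cr[OF that(1) zl] Cr_zz that(2) by blast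
    fix i assume i: "i \<in> arcs n" "i \<notin> \<tau>" "\<And>i'. i' \<in> \<tau> ==> i' ~= arc v (v + M) ==> compatible i i'"
    from i obtain x y c d where xy: "i = arc x y" "short x y" "(c, d) \<in> Cr x y" "apx c d = y"
      "Pre x y (c, d) = Cr x y" "\<And>c d. (c, d) \<in> Cr x y ==> arc c d = arc v (v + M)" by (rule new_arc) blast+
    note C = CrD[OF xy(3)]
    have xyM: "x < y" "y <= x + M" using xy(2) by (auto simp: short_def)
    have ap: "apx (v + k * M) (v + k * M + M) = z + k * M" for k
      using apx_shift[OF E E2, of k] by (simp add: z_def add_ac)
    have cd: "c < d" "d < c + 3 * M" and vl: "v < v + M" "v + M < v + 3 * M" using C M by auto
    obtain k where k: "c = v + k * M \<and> d = v + M + k * M \<or> c = v + M + k * M \<and> d = v + (k + 3) * M"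
      using arc_eq_iff_flip[OF vl cd] xy(6)[OF xy(3)] by metis
    have o_cases: thesis
      if "apx d (c + 3 * M) = x + 3 * M ==> thesis"
        "d = c + M ==> (c - M, d) \<in> Cr x y ==> thesis"
        "d = c + M ==> (c, c + 2 * M) \<in> Cr x y ==> thesis" for thesis
      using xy(3) xy(6) by (rule pred_cases_arc) (use that in blast)+
    from k show "i = arc z (z + M)"
    proof
      assume *: "c = v + k * M \<and> d = v + M + k * M"
      have d: "d = c + M" using * by simp
      have y: "y = z + k * M" using xy(4) ap[of k] * by (simp add: add_ac)
      \<comment> \<open>Before its last crossing the arc traverses the central triangle. If it
        started at the opposite vertex or entered through the other side, it would be longer than
        \<open>M\<close>.\<close>
      have "(c, c + 2 * M) \<in> Cr x y"
      proof (rule o_cases)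
        assume o: "apx d (c + 3 * M) = x + 3 * M"
        have "apx (c + M) (c + 3 * M) = c + 2 * M"
          by (rule apx_eq) (use * sh[OF s1(3), of k] sh[OF s3(1), of k] sh[OF E, of k] D_flip[of "c + M" c] M in \<open>auto simp: algebra_simps\<close>)
        hence "x = c - M" using o d by simp
        thus ?thesis using xyM y t * by simp
      next
        assume "(c - M, d) \<in> Cr x y"
        thus ?thesis using CrD xyM y t * by fastforce
      qed
      hence c2: "(c, c + 2 * M) \<in> Cr x y" .
      from c2 xy(6) have "apx (c + 2 * M) (c + 3 * M) = x + 3 * M"
        by (rule pred_cases_arc) (use M in auto)
      moreover have "apx (c + 2 * M) (c + 3 * M) = z + (k + 2) * M"
        using ap[of "k + 2"] * by (simp add: algebra_simps)
      ultimately have x: "x = z + (k - 1) * M" by (simp add: algebra_simps)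
      moreover have "y = z + M + (k - 1) * M" using y by (simp add: algebra_simps)
      ultimately show ?thesis unfolding xy(1) by (simp only: arc_shift)
    next
      \<comment> \<open>In this orientation the arc would end at a vertex of the central triangle
        and again be longer than \<open>M\<close>.\<close>
      assume *: "c = v + M + k * M \<and> d = v + (k + 3) * M"
      have d: "d = c + 2 * M" using * by (simp add: algebra_simps)
      have "apx c (c + 2 * M) = c + M"
        by (rule apx_eq) (use C d sh[OF s1(3), of k] sh[OF s3(1), of k] * M in \<open>auto simp: algebra_simps\<close>)
      hence y: "y = c + M" using xy(4) d by simp
      have "apx d (c + 3 * M) = x + 3 * M" by (rule o_cases) (use d M in auto)
      moreover have "apx d (c + 3 * M) = z + (k + 3) * M"
        using ap[of "k + 3"] * by (simp add: algebra_simps)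
      ultimately have "x = z + k * M" by (simp add: algebra_simps)
      thus ?thesis using xyM y t * by simp
    qed
  qed
qed

end

section \<open>Exchange polynomials\<close>

context orbifold
begin

lemma pending_arc:
  assumes "short x y" "x + 2 <= y"
  shows "pending n (arc x y) \<longleftrightarrow> y = x + M"
proof -
  have r: "pt x mod (n + 1) = pt y mod (n + 1) \<longleftrightarrow> x mod M = y mod M" for x y
  proof -
    have "int (pt x mod (n + 1)) = x mod M" for x
      unfolding zmod_int n_M(2) int_pt by (simp add: mod_mod_cancel)
    thus ?thesis by (metis of_nat_eq_iff)
  qed
  have "pending n (arc x y) \<longleftrightarrow> x mod M = y mod M"
  proof
    assume "pending n (arc x y)"
    hence "pt x mod (n + 1) = pt y mod (n + 1)"
      using dg_self_in_arc[of x y] unfolding pending_def by (auto simp: dg_def)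
    thus "x mod M = y mod M" unfolding r .
  next
    assume "x mod M = y mod M"
    hence "pt (x + k * M) mod (n + 1) = pt (y + k * M) mod (n + 1)" for k
      unfolding r by simp
    thus "pending n (arc x y)" unfolding pending_def arc_eq_set dg_def by auto
  qed
  also have "\<dots> \<longleftrightarrow> y = x + M"
  proof
    assume "x mod M = y mod M"
    hence "M dvd y - x" by (metis mod_eq_dvd_iff)
    then obtain k where k: "y - x = k * M" by (metis dvdE mult.commute)
    have M0: "0 < M" using M3 by simp
    have "y <= x + M" using assms(1) by (simp add: short_def)
    hence "0 < k * M" "k * M < 2 * M" using k assms(2) M0 by linarith+
    hence "k = 1" using multiple_window(3,4)[OF M0, of k] by simp
    thus "y = x + M" using k by simp
  qed simp
  finally show ?thesis .
qed

text \<open>For pairs starting less than one full turn apart only these shifts can occur. With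
  explicit shifts, inequality of arcs is decided by linear arithmetic.\<close>

lemma arc_eq_cases:
  assumes "x < y" "y < x + 3 * M" "x' < y'" "y' < x' + 3 * M" "x < x' + 3 * M" "x' < x + 3 * M" "arc x y = arc x' y'"
  shows "(\<exists>k\<in>{-2,-1,0,1,2}. x' = x + k * M \<and> y' = y + k * M) \<or>
    (\<exists>k\<in>{-5,-4,-3,-2,-1,0,1,2}. x' = y + k * M \<and> y' = x + (k + 3) * M)"
proof -
  have M: "0 < M" using M3 by simp
  have c: "a < k" if "a * M < k * M" for a k using that mult_less_cancel_right_pos[OF M] by simp
  obtain k where k: "x' = x + k * M \<and> y' = y + k * M \<or> x' = y + k * M \<and> y' = x + (k + 3) * M"
    using arc_eq_iff_flip[OF assms(1-4)] assms(7) by blast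
  thus ?thesis
  proof
    assume *: "x' = x + k * M \<and> y' = y + k * M"
    have "-3 < k" "k < 3" using c[of "-3" k] c[of k 3] * assms by linarith+
    thus ?thesis using * by (intro disjI1 bexI[of _ k]) auto
  next
    assume *: "x' = y + k * M \<and> y' = x + (k + 3) * M"
    have "-6 < k" "k < 3" using c[of "-6" k] c[of k 3] * assms by linarith+
    thus ?thesis using * by (intro disjI2 bexI[of _ k]) auto
  qed
qed

lemma arc_neq:
  assumes "x < y" "y < x + 3 * M" "x' < y'" "y' < x' + 3 * M" "x < x' + 3 * M" "x' < x + 3 * M"
    and "\<And>k. k \<in> {-2,-1,0,1,2} ==> \<not> (x' = x + k * M \<and> y' = y + k * M)"
    and "\<And>k. k \<in> {-5,-4,-3,-2,-1,0,1,2} ==> \<not> (x' = y + k * M \<and> y' = x + (k + 3) * M)"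
  shows "arc x y ~= arc x' y'"
  using arc_eq_cases[OF assms(1-6)] assms(7,8) by blast

end

context orbifold_triangulation
begin

text \<open>After a translation the two edges of length \<open>M\<close> start less than
  \<open>M\<close> apart, and they would cross unless they coincide.\<close>

lemma pending_unique:
  assumes "i \<in> \<tau>" "k \<in> \<tau>" "pending n i" "pending n k"
  shows "i = k"
proof -
  have ex: "\<exists>p. i = arc p (p + M) \<and> edge \<tau> p (p + M)" if i: "i \<in> \<tau>" "pending n i" for i
  proof -
    have "i \<in> arcs n" using i triangulation unfolding is_triangulation_def by blast
    then obtain x y where xy: "short x y" "x + 2 <= y" "i = arc x y" unfolding arcs_iff by blast
    hence "y = x + M" using pending_arc i(2) by blast
    thus ?thesis using xy i(1) by (auto simp: edge_def)
  qed
  obtain p q where p: "i = arc p (p + M)" "edge \<tau> p (p + M)" and q: "k = arc q (q + M)" "edge \<tau> q (q + M)"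
    using ex assms by meson
  define l where "l = (p - q) div M"
  have M0: "0 < M" using M3 by simp
  have l: "q + l * M <= p" "p < q + l * M + M"
    using M0 pos_mod_bound[of M "p - q"] pos_mod_sign[of M "p - q"] div_mult_mod_eq[of "p - q" M]
    unfolding l_def by linarith+
  have e: "edge \<tau> (q + l * M) (q + l * M + M)" using E_shift[OF q(2), of l] by (simp add: add_ac)
  have "p = q + l * M" using noncross[OF e p(2)] l by linarith
  thus ?thesis using p(1) q(1) arc_shift[of q l "q + M"] by (simp add: add_ac)
qed

definition outs :: "arc => arrow set" where "outs k = {A \<in> quiver_arrows n \<tau>. fst ` A = k}"
definition ins :: "arc => arrow set" where "ins k = {A \<in> quiver_arrows n \<tau>. snd ` A = k}"

lemma finite_outs: "finite (outs k)" "finite (ins k)"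
  using finite_arrs by (simp_all add: outs_def ins_def)

lemma c_mat_eq: "c_mat Qv l k = int (card {A \<in> outs k. snd ` A = l}) - int (card {A \<in> ins k. fst ` A = l})"
  unfolding c_mat_def Qv_simps outs_def ins_def by (simp add: conj_ac Collect_conj_eq Int_ac)

lemma c_mat_self: "c_mat Qv k k = 0" unfolding c_mat_def by simp

text \<open>Two distinct arcs of a triangulation are not both pending, so the gcd of their weights
  is 1; on the diagonal the entry is 0. Dividing by the weight therefore gives back
  \<open>c_mat\<close>.\<close>

lemma b_mat_eq:
  assumes "l \<in> \<tau>" "k \<in> \<tau>"
  shows "b_mat n \<tau> l k div int (weight n k) = c_mat Qv l k" "b_mat n \<tau> l k > 0 \<longleftrightarrow> c_mat Qv l k > 0"
    "b_mat n \<tau> l k < 0 \<longleftrightarrow> c_mat Qv l k < 0" "- b_mat n \<tau> l k div int (weight n k) = - c_mat Qv l k"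
proof -
  have "b_mat n \<tau> l k = int (weight n k) * c_mat Qv l k"
    using pending_unique b_mat_def c_mat_self weight_def assms by fastforce
  thus "b_mat n \<tau> l k div int (weight n k) = c_mat Qv l k" "b_mat n \<tau> l k > 0 \<longleftrightarrow> c_mat Qv l k > 0"
    "b_mat n \<tau> l k < 0 \<longleftrightarrow> c_mat Qv l k < 0" "- b_mat n \<tau> l k div int (weight n k) = - c_mat Qv l k"
    by (auto simp: weight_def)
qed

lemma prod_positive:
  fixes x :: "arc => 'r::comm_ring_1"
  assumes "finite B" "g ` B \<subseteq> \<tau>" and c: "\<And>l. nat (c l) = card {A \<in> B. g A = l}"
  shows "(\<Prod>l | l \<in> \<tau> \<and> c l > 0. x l ^ nat (c l)) = (\<Prod>A\<in>B. x (g A))"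
proof -
  have pw: "\<not> 0 < c l ==> x l ^ nat (c l) = 1" for l by simp
  have "(\<Prod>l | l \<in> \<tau> \<and> c l > 0. x l ^ nat (c l)) = (\<Prod>l\<in>\<tau>. x l ^ nat (c l))"
    by (rule prod.mono_neutral_left) (use finite_triangulation pw in blast)+
  also have "\<dots> = (\<Prod>l\<in>\<tau>. \<Prod>A\<in>{A \<in> B. g A = l}. x (g A))"
    by (rule prod.cong) (simp_all add: c)
  also have "\<dots> = (\<Prod>A\<in>B. x (g A))" by (rule prod.group) (use assms finite_triangulation in auto)
  finally show ?thesis .
qed

text \<open>The hypothesis \<open>no2\<close> excludes cancellation between arrows in opposite
  directions, so the positive and negative parts of a column of \<open>c_mat\<close> count outgoing
  and incoming arrows separately. Loops are left out.\<close>

lemma v_eq: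
  fixes x :: "arc => 'r::comm_ring_1"
  assumes k: "k \<in> \<tau>" and no2: "\<And>A B. A \<in> outs k ==> B \<in> ins k ==> snd ` A = fst ` B ==> snd ` A = k"
  shows "v_plus n \<tau> x k = (\<Prod>A | A \<in> outs k \<and> snd ` A ~= k. x (snd ` A))"
    and "v_minus n \<tau> x k = (\<Prod>A | A \<in> ins k \<and> fst ` A ~= k. x (fst ` A))"
proof -
  let ?O = "{A \<in> outs k. snd ` A ~= k}" and ?I = "{A \<in> ins k. fst ` A ~= k}"
  have c: "nat (c_mat Qv l k) = card {A \<in> ?O. snd ` A = l}" "nat (- c_mat Qv l k) = card {A \<in> ?I. fst ` A = l}" for l
  proof -
    have "nat (c_mat Qv l k) = card {A \<in> ?O. snd ` A = l} \<and> nat (- c_mat Qv l k) = card {A \<in> ?I. fst ` A = l}"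
    proof (cases "l = k")
      case True
      hence "{A \<in> ?O. snd ` A = l} = {}" "{A \<in> ?I. fst ` A = l} = {}" by auto
      thus ?thesis using True c_mat_self by (simp only: card.empty) simp
    next
      case False
      hence s: "{A \<in> ?O. snd ` A = l} = {A \<in> outs k. snd ` A = l}" "{A \<in> ?I. fst ` A = l} = {A \<in> ins k. fst ` A = l}"
        by auto
      have "{A \<in> outs k. snd ` A = l} = {} \<or> {A \<in> ins k. fst ` A = l} = {}"
      proof (rule ccontr)
        assume "\<not> ?thesis"
        then obtain A B where "A \<in> outs k" "snd ` A = l" "B \<in> ins k" "fst ` B = l" by auto
        thus False using no2[of A B] False by simp
      qed
      hence "card {A \<in> outs k. snd ` A = l} = 0 \<or> card {A \<in> ins k. fst ` A = l} = 0"
        by (elim disjE) (simp_all only: card.empty simp_thms)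
      thus ?thesis unfolding s c_mat_eq by auto
    qed
    thus "nat (c_mat Qv l k) = card {A \<in> ?O. snd ` A = l}" "nat (- c_mat Qv l k) = card {A \<in> ?I. fst ` A = l}" by blast+
  qed
  have mem: "snd ` A \<in> \<tau> \<and> fst ` A \<in> \<tau>" if "A \<in> outs k \<or> A \<in> ins k" for A
    using arrow_ends[of A] that by (auto simp: outs_def ins_def)
  have "v_plus n \<tau> x k = (\<Prod>l | l \<in> \<tau> \<and> c_mat Qv l k > 0. x l ^ nat (c_mat Qv l k))"
    unfolding v_plus_def by (rule prod.cong) (use b_mat_eq k in auto)
  also have "\<dots> = (\<Prod>A\<in>?O. x (snd ` A))" by (rule prod_positive) (use mem finite_outs c in auto)
  finally show "v_plus n \<tau> x k = (\<Prod>A | A \<in> outs k \<and> snd ` A ~= k. x (snd ` A))" .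
  have "v_minus n \<tau> x k = (\<Prod>l | l \<in> \<tau> \<and> - c_mat Qv l k > 0. x l ^ nat (- c_mat Qv l k))"
    unfolding v_minus_def by (rule prod.cong) (use b_mat_eq k in auto)
  also have "\<dots> = (\<Prod>A\<in>?I. x (fst ` A))" by (rule prod_positive) (use mem finite_outs c in auto)
  finally show "v_minus n \<tau> x k = (\<Prod>A | A \<in> ins k \<and> fst ` A ~= k. x (fst ` A))" .
qed

end

text \<open>The function \<open>f\<close> is related to \<open>\<tau>\<close> only through its
  values on arcs and sides, so it may come from a different triangulation.\<close>

locale exchange = orbifold_triangulation n \<tau> for n \<tau> +
  fixes X :: "arc => 'r::comm_ring_1" and f :: "int => int => 'r"
  assumes f_self: "f x x = 0" and f_swap: "f y x = - f x y"
    and f_plucker: "f a c * f b d = f a b * f c d + f b c * f a d"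
    and f_shift: "f (x + k * M) (y + k * M) = f x y"
    and f_flip: "f y (x + 3 * M) = f x y"
    and f_trace: "f x (y + 2 * M) = f x (y + M) - f x y"
    and f_side: "f x (x + 1) = 1"
    and f_arc: "short x y ==> x + 2 <= y ==> X (arc x y) = f x y"
begin

lemma X_arc:
  assumes "proper x y" "y <= x + M \<or> x + 2 * M <= y"
  shows "X (arc x y) = f x y"
proof (cases "y <= x + M")
  case True
  thus ?thesis using f_arc[of x y] assms by (simp add: short_def)
next
  case False
  hence "X (arc y (x + 3 * M)) = f y (x + 3 * M)" using f_arc[of y "x + 3 * M"] assms by (simp add: short_def)
  thus ?thesis by (simp add: arc_flip f_flip)
qed

lemma f_D:
  assumes "D x y"
  shows "(if proper x y then X (arc x y) else 1) = f x y"
proof (cases "proper x y")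
  case True
  thus ?thesis using X_arc[OF True] D_short[OF assms] by simp
next
  case False
  hence "y = x + 1 \<or> y = x + 3 * M - 1" using D_len[OF assms] by linarith
  hence 1: "f x y = 1"
  proof
    assume "y = x + 3 * M - 1"
    hence "x + 3 * M = y + 1" by simp
    hence "f y (x + 3 * M) = 1" using f_side by simp
    thus ?thesis by (simp add: f_flip)
  qed (simp add: f_side)
  show ?thesis unfolding if_not_P[OF False] 1 ..
qed

theorem exchange_relation:
  assumes j: "j \<in> \<tau>"
  shows "X j * X (flip n \<tau> j) = exchange_poly n \<tau> X j"
proof -
  have "j \<in> arcs n" using j triangulation unfolding is_triangulation_def by blast
  then obtain b a where ba: "short b a" "b + 2 <= a" "j = arc b a" unfolding arcs_iff by blast
  have len: "b < a" "a < b + 3 * M" "a <= b + M" using shortD[OF ba(1)] ba(1) by (auto simp: short_def)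
  have M: "0 < M" "3 <= M" using M3 by auto
  have D: "D b a" "proper b a" using arc_mem_iff[OF len(1,2)] j ba(3) by auto
  have D': "D a (b + 3 * M)" "proper a (b + 3 * M)" using D D_flip by auto
  define z z' where "z = apx b a" and "z' = apx a (b + 3 * M)"
  have t: "b < z" "z < a" "D b z" "D z a" using apx[OF D(1)] D(2) by (auto simp: z_def)
  have t': "a < z'" "z' < b + 3 * M" "D a z'" "D z' (b + 3 * M)" using apx[OF D'(1)] D'(2) by (auto simp: z'_def)
  have Xj: "X j = f b a" using f_arc[OF ba(1,2)] ba(3) by simp
  have outs: "outs j = (if z + 2 <= a then {arw b a} else {}) \<union> (if z' + 2 <= b + 3 * M then {arw a (b + 3 * M)} else {})"
    and outs_ne: "z + 2 <= a ==> z' + 2 <= b + 3 * M ==> arw b a ~= arw a (b + 3 * M)"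
    using out_arrows[OF D] by (simp_all add: outs_def ba(3) z_def z'_def)
  have ins: "ins j = (if b + 2 <= z then {arw z (b + 3 * M)} else {}) \<union> (if a + 2 <= z' then {arw z' (a + 3 * M)} else {})"
    and ins_ne: "b + 2 <= z ==> a + 2 <= z' ==> arw z (b + 3 * M) ~= arw z' (a + 3 * M)"
    using in_arrows[OF D] by (simp_all add: ins_def ba(3) z_def z'_def)
  have tg: "snd ` arw b a = arc z a" "snd ` arw a (b + 3 * M) = arc z' (b + 3 * M)"
    by (simp_all add: tgt_arw z_def z'_def)
  have sc: "b + 2 <= z ==> fst ` arw z (b + 3 * M) = arc b z" "a + 2 <= z' ==> fst ` arw z' (a + 3 * M) = arc a z'"
    using in_half(3)[OF D] in_half(3)[OF D'] by (simp_all add: z_def z'_def)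
  have tA: "snd ` A = arc z a \<or> snd ` A = arc z' (b + 3 * M)" if "A \<in> outs j" for A
  proof -
    have "A = arw b a \<or> A = arw a (b + 3 * M)" using that unfolding outs by (auto split: if_splits)
    thus ?thesis using tg by blast
  qed
  have fB: "fst ` B = arc b z \<or> fst ` B = arc a z'" if "B \<in> ins j" for B
  proof -
    have "b + 2 <= z \<and> B = arw z (b + 3 * M) \<or> a + 2 <= z' \<and> B = arw z' (a + 3 * M)"
      using that unfolding ins by (auto split: if_splits)
    thus ?thesis using sc by blast
  qed
  have n: "arc z a ~= j" "arc b z ~= j" "arc z a ~= arc b z"
    unfolding ba(3) by (rule arc_neq; use t len M in auto)+
  have eP: "f b a * f z z' = f b z * f a z' + f z a * f b z'" by (rule f_plucker)
  show ?thesis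
  proof (cases "a = b + M")
    case False
    hence aM: "a < b + M" using len by simp
    have np: "\<not> pending n j" using pending_arc[OF ba(1,2)] ba(3) False by simp
    note fl = flip_nonpending[OF D(1) ba(2) aM, folded z_def z'_def]
    have "proper z z'" using fl(2) t t' by auto
    hence Xf: "X (flip n \<tau> j) = f z z'" using X_arc fl(1,3) ba(3) by simp
    have "arc z' (b + 3 * M) ~= arc a (b + 3 * M)" "arc a z' ~= arc a (b + 3 * M)"
      by (rule arc_neq; use t' len aM M D' in auto)+
    hence n': "arc z' (b + 3 * M) ~= j" "arc a z' ~= j" by (simp_all add: arc_flip ba(3))
    have n'': "arc z a ~= arc a z'" "arc z' (b + 3 * M) ~= arc b z" "arc z' (b + 3 * M) ~= arc a z'"
      by (rule arc_neq; use t t' len aM M D' in auto)+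
    have no2: "snd ` A = j" if "A \<in> outs j" "B \<in> ins j" "snd ` A = fst ` B" for A B
      using tA[OF that(1)] fB[OF that(2)] that(3) n(3) n'' by auto
    have veq: "v_plus n \<tau> X j = (\<Prod>A | A \<in> outs j \<and> snd ` A ~= j. X (snd ` A))"
      "v_minus n \<tau> X j = (\<Prod>A | A \<in> ins j \<and> fst ` A ~= j. X (fst ` A))"
      by (rule v_eq(1)[OF j], rule no2, assumption+, rule v_eq(2)[OF j], rule no2, assumption+)
    have "v_plus n \<tau> X j = (if z + 2 <= a \<and> snd ` arw b a ~= j then X (snd ` arw b a) else 1) *
        (if z' + 2 <= b + 3 * M \<and> snd ` arw a (b + 3 * M) ~= j then X (snd ` arw a (b + 3 * M)) else 1)"
      unfolding veq(1) by (rule prod_two[OF outs outs_ne])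
    also have "\<dots> = f z a * f z' (b + 3 * M)"
      unfolding tg f_D[OF t(4), symmetric] f_D[OF t'(4), symmetric] using n(1) n'(1) t t' len D' by auto
    finally have vp: "v_plus n \<tau> X j = f z a * f b z'" by (simp add: f_flip)
    have "v_minus n \<tau> X j = (if b + 2 <= z \<and> fst ` arw z (b + 3 * M) ~= j then X (fst ` arw z (b + 3 * M)) else 1) *
        (if a + 2 <= z' \<and> fst ` arw z' (a + 3 * M) ~= j then X (fst ` arw z' (a + 3 * M)) else 1)"
      unfolding veq(2) by (rule prod_two[OF ins ins_ne])
    also have "\<dots> = f b z * f a z'"
    proof -
      have "proper b z \<longleftrightarrow> b + 2 <= z" "proper a z' \<longleftrightarrow> a + 2 <= z'" using t t' D(2) D'(2) by auto
      thus ?thesis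
        unfolding f_D[OF t(3), symmetric] f_D[OF t'(3), symmetric] using sc n(2) n'(2) by simp
    qed
    finally have vm: "v_minus n \<tau> X j = f b z * f a z'" .
    show ?thesis unfolding Xj Xf exchange_poly_def using np eP vp vm by (simp add: weight_def)
  next
    case True
    have pe: "pending n j" using pending_arc[OF ba(1,2)] ba(3) True by simp
    have Db: "D b (b + M)" using D True by simp
    have Xf: "X (flip n \<tau> j) = f z (z + M)"
      using flip_pending[OF Db] X_arc[of z "z + M"] M ba(3) True by (simp add: z_def)
    \<comment> \<open>Behind a pending arc lies the central triangle, whose arrow is the loop and
      does not enter \<open>v_plus\<close> or \<open>v_minus\<close>. The flipped arc is therefore
      not found at this apex, and the quadrilateral used below is b, z, a, z + M.\<close>
    have z': "z' = b + 2 * M"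
    proof -
      have "D a (b + 2 * M)" "D (b + 2 * M) (b + 3 * M)"
        using D_shift[of b 1 "b + M"] D_shift[of b 2 "b + M"] Db True by (simp_all add: algebra_simps)
      thus ?thesis unfolding z'_def using M True by (intro apx_eq[OF D'(1)]) auto
    qed
    have e1: "arc z' (b + 3 * M) = j" "arc a z' = j"
      using arc_shift[of b 2 "b + M"] arc_shift[of b 1 "b + M"] ba(3) True z' by (simp_all add: algebra_simps)
    have no2: "snd ` A = j" if "A \<in> outs j" "B \<in> ins j" "snd ` A = fst ` B" for A B
    proof (cases "snd ` A = arc z a")
      case True
      hence "fst ` B ~= arc b z" using that(3) n(3) by simp
      hence "fst ` B = j" using fB[OF that(2)] e1(2) by simp
      thus ?thesis using that(3) by simp
    next
      case False
      thus ?thesis using tA[OF that(1)] e1(1) by simp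
    qed
    have veq: "v_plus n \<tau> X j = (\<Prod>A | A \<in> outs j \<and> snd ` A ~= j. X (snd ` A))"
      "v_minus n \<tau> X j = (\<Prod>A | A \<in> ins j \<and> fst ` A ~= j. X (fst ` A))"
      by (rule v_eq(1)[OF j], rule no2, assumption+, rule v_eq(2)[OF j], rule no2, assumption+)
    have "v_plus n \<tau> X j = (if z + 2 <= a \<and> snd ` arw b a ~= j then X (snd ` arw b a) else 1) *
        (if z' + 2 <= b + 3 * M \<and> snd ` arw a (b + 3 * M) ~= j then X (snd ` arw a (b + 3 * M)) else 1)"
      unfolding veq(1) by (rule prod_two[OF outs outs_ne])
    also have "\<dots> = f z a"
      unfolding tg e1 f_D[OF t(4), symmetric] using n(1) t t' len D' by auto
    finally have vp: "v_plus n \<tau> X j = f z a" .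
    have "v_minus n \<tau> X j = (if b + 2 <= z \<and> fst ` arw z (b + 3 * M) ~= j then X (fst ` arw z (b + 3 * M)) else 1) *
        (if a + 2 <= z' \<and> fst ` arw z' (a + 3 * M) ~= j then X (fst ` arw z' (a + 3 * M)) else 1)"
      unfolding veq(2) by (rule prod_two[OF ins ins_ne])
    also have "\<dots> = f b z"
    proof -
      have "proper b z \<longleftrightarrow> b + 2 <= z" using t D(2) by auto
      moreover have o: "\<not> (a + 2 <= z' \<and> fst ` arw z' (a + 3 * M) ~= j)" using sc(2) e1(2) by auto
      ultimately show ?thesis unfolding if_not_P[OF o] f_D[OF t(3), symmetric] using sc(1) n(2) by simp
    qed
    finally have vm: "v_minus n \<tau> X j = f b z" .
    \<comment> \<open>The side from a to z + M is a rotation of the one from b to z. The value at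
      (b, z + M) belongs to no side of a triangle and is computed by the three-term recurrence; its
      two summands produce the middle term of the exchange polynomial.\<close>
    have s: "f a (z + M) = f b z" using f_shift[of b 1 z] True by simp
    have "f b (z + 2 * M) = f z a"
    proof -
      have "f (z + 2 * M) (b + 3 * M) = f z a" using f_shift[of z 2 "b + M"] True by (simp add: algebra_simps)
      thus ?thesis by (simp add: f_flip)
    qed
    hence r: "f b (z + M) = f z a + f b z" using f_trace[of b z] by (simp add: algebra_simps)
    have "f b a * f z (z + M) = f b z * f a (z + M) + f z a * f b (z + M)" by (rule f_plucker)
    also have "\<dots> = f b z * f b z + f z a * f z a + f z a * f b z" unfolding s r by (simp add: distrib_left add.assoc)
    finally have eq: "f b a * f z (z + M) = f b z * f b z + f z a * f z a + f z a * f b z" .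
    have "exchange_poly n \<tau> X j = (\<Sum>l = 0..2. f z a ^ l * f b z ^ (2 - l))"
      unfolding exchange_poly_def vp vm using pe by (simp add: weight_def)
    also have "\<dots> = f b z * f b z + f z a * f b z + f z a * f z a"
      by (simp add: numeral_2_eq_2)
    finally show ?thesis unfolding Xj Xf eq by (simp add: ac_simps)
  qed
qed

end

theorem mainTheorem3:
  fixes n :: nat and \<sigma> \<tau> :: "arc set" and j :: arc and \<alpha> :: "arc \<Rightarrow> nat \<times> nat"
  assumes "n \<ge> 2"
    and "is_triangulation n \<sigma>"
    and "\<forall>i \<in> arcs n. {fst (\<alpha> i), snd (\<alpha> i)} \<in> i"
    and "is_triangulation n \<tau>"
    and "j \<in> \<tau>"
  shows "(let X = (\<lambda>i. CC (surface_qp n \<sigma>) (arc_rep n \<sigma> \<alpha> i))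
          in X j * X (flip n \<tau> j) = exchange_poly n \<tau> X j)"
proof -
  interpret S: orbifold_triangulation n \<sigma> by unfold_locales (use assms in auto)
  interpret T: orbifold_triangulation n \<tau> by unfold_locales (use assms in auto)
  \<comment> \<open>The frieze is built from \<open>\<sigma>\<close>, while the exchange relation is
    applied in \<open>\<tau>\<close>.\<close>
  obtain f :: "int => int => arc laurent" where f: "S.is_frieze f" using S.ex_frieze by blast
  interpret X: exchange n \<tau> "\<lambda>i. CC (surface_qp n \<sigma>) (arc_rep n \<sigma> \<alpha> i)" f
  proof
    show "f x x = 0" "f y x = - f x y" "f a c * f b d = f a b * f c d + f b c * f a d"
      "f x (y + 2 * S.M) = f x (y + S.M) - f x y" for x y a b c d
      using S.friezeD[OF f] by blast+
    show "f (x + k * S.M) (y + k * S.M) = f x y" for x y k by (rule S.friezeD(4)[OF f])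
    show "f y (x + 3 * S.M) = f x y" for x y by (rule S.friezeD(5)[OF f])
    show "f x (x + 1) = 1" for x using S.friezeD(7)[OF f S.D_side] S.wt_side by simp
    show "CC (surface_qp n \<sigma>) (arc_rep n \<sigma> \<alpha> (S.arc x y)) = f x y" if "S.short x y" "x + 2 <= y" for x y
      by (rule S.CC_arc_rep[OF f assms(3) that])
  qed
  show ?thesis unfolding Let_def by (rule X.exchange_relation[OF assms(5)])
qed

end
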